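(* Let $H$ be a quasitriangular quasi-Hopf algebra, let $(A,\mathrm{d})$ be a differential calculus in ${}^{H}\mathscr{M}$ and let $V,W$ be two objects in ${}^{H}_{A}\mathscr{M}^{\mathrm{sym}}_{A}$. Then $\boxplus$ induces an ${}^{H}\mathscr{M}$-morphism $$\boxplus:\ \mathrm{con}(V)\times_{I[1]}\mathrm{con}(W)\longrightarrow \mathrm{con}(V\otimes_A W),$$ i.e. for every $((L,c),(L',c))\in \mathrm{con}(V)\times_{I[1]}\mathrm{con}(W)$ the $k$-linear map $L\circledast 1+1\circledast L'$ on $V\otimes W$ descends to the quotient $V\otimes_A W$, the descended map together with $c$ is an element of $\mathrm{con}(V\otimes_A W)$, and the resulting assignment is an ${}^{H}\mathscr{M}$-morphism.
   Context: BASIC SETTING. $k$ is a commutative associative ring with unit. $H$ is a quasitriangular quasi-Hopf algebra over $k$, placed in degree $0$, with coproduct $\Delta(h)=h_{(1)}\otimes h_{(2)}$, counit $\epsilon$, invertible associator $\phi=\phi^{(1)}\otimes\phi^{(2)}\otimes\phi^{(3)}$ with inverse $\phi^{-1}=\phi^{(-1)}\otimes\phi^{(-2)}\otimes\phi^{(-3)}$, quasi-antipode $(S,\alpha,\beta)$ and universal $R$-matrix $R=R^{(1)}\otimes R^{(2)}$ (summations understood). Conventions: $(\mathrm{id}\otimes\Delta)\Delta(h)=\phi\,(\Delta\otimes\mathrm{id})\Delta(h)\,\phi^{-1}$; $S(h_{(1)})\alpha h_{(2)}=\epsilon(h)\alpha$; $h_{(1)}\beta S(h_{(2)})=\epsilon(h)\beta$;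 $\phi^{(1)}\beta S(\phi^{(2)})\alpha\phi^{(3)}=1=S(\phi^{(-1)})\alpha\phi^{(-2)}\beta S(\phi^{(-3)})$; $\Delta^{\mathrm{op}}(h)=R\,\Delta(h)\,R^{-1}$; the remaining axioms (pentagon, counit normalization, hexagons) are the ones making the following a braided monoidal category. ${}^{H}\mathscr{M}$: objects are bounded $\mathbb{Z}$-graded left $H$-modules $V=\bigoplus_n V_n$ ($V_n=0$ for all but finitely many $n$; action $\triangleright$ degree-preserving); morphisms are degree-preserving $H$-equivariant $k$-linear maps. $V\otimes W$ is the graded tensor product over $k$ with $h\triangleright(v\otimes w)=(h_{(1)}\triangleright v)\otimes(h_{(2)}\triangleright w)$; unit $I=k$ (degree $0$, action by $\epsilon$); associator $\Phi((v\otimes w)\otimes x)=(\phi^{(1)}\triangleright v)\otimes((\phi^{(2)}\triangleright w)\otimes(\phi^{(3)}\triangleright x))$; braiding $\tau(v\otimes w)=(-1)^{|v||w|}(R^{(2)}\triangleright w)\otimes(R^{(1)}\triangleright v)$. Internal hom: $\hom(V,W)=\bigoplus_n\bigoplus_{l-m=n}\mathrm{Hom}_k(V_m,W_l)$ with $h\triangleright L=(h_{(1)}\triangleright\cdot)\circ L\circ(S(h_{(2)})\triangleright\cdot)$. Currying bijection: for $f:V\otimes W\to X$, $\zeta(f)(v)=f((\phi^{(-1)}\triangleright v)\otimes((\phi^{(-2)}\beta S(\phi^{(-3)}))\triangleright(\cdot)))$; inverse: for $g:V\to\hom(W,X)$, $\zeta^{-1}(g)(v\otimes w)=\phi^{(1)}\triangleright(g(v)((S(\phi^{(2)})\alpha\phi^{(3)})\triangleright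 w))$. Evaluation $\mathrm{ev}=\zeta^{-1}(\mathrm{id}):\hom(V,W)\otimes V\to W$; internal composition $\bullet=\zeta(\mathrm{ev}\circ(\mathrm{id}\otimes\mathrm{ev})\circ\Phi):\hom(W,X)\otimes\hom(V,W)\to\hom(V,X)$. $\mathrm{end}(V)=\hom(V,V)$, unit $1=(\beta\triangleright\cdot)$. Commutator on $\mathrm{end}(V)$: $[L,L']=L\bullet L'-(-1)^{|L||L'|}(R^{(2)}\triangleright L')\bullet(R^{(1)}\triangleright L)$. INTERNAL TENSOR PRODUCT. $\circledast:\hom(V,W)\otimes\hom(X,Y)\to\hom(V\otimes X,W\otimes Y)$ is $\zeta$ of $(\mathrm{ev}\otimes\mathrm{ev})$ composed with the canonical isomorphism $(\hom(V,W)\otimes\hom(X,Y))\otimes(V\otimes X)\to(\hom(V,W)\otimes V)\otimes(\hom(X,Y)\otimes X)$ built from associators and the braiding $\tau:\hom(X,Y)\otimes V\to V\otimes\hom(X,Y)$. ALGEBRAS AND BIMODULES. An algebra in ${}^{H}\mathscr{M}$ is an object $A$ with ${}^{H}\mathscr{M}$-morphisms product $\mu:A\otimes A\to A$ and unit $I\to A$, with $(aa')a''=(\phi^{(1)}\triangleright a)((\phi^{(2)}\triangleright a')(\phi^{(3)}\triangleright a''))$ and $1a=a=a1$; it is braided commutative (an object of ${}^{H}\mathscr{A}^{\mathrm{com}}$) if $\mu\circ\tau=\mu$. An $A$-bimodule $V$ in ${}^{H}\mathscr{M}$ has ${}^{H}\mathscr{M}$-morphisms $l:A\otimes V\to V$,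 $r:V\otimes A\to V$ (written by juxtaposition) that are unital and satisfy the module and bimodule axioms with brackets changed by $\Phi$; it is symmetric if $r\circ\tau=l$ and $l\circ\tau=r$. ${}^{H}_{A}\mathscr{M}^{\mathrm{sym}}_{A}$ is the category of symmetric $A$-bimodules. $\hat l=\zeta(l):A\to\mathrm{end}(V)$, and $[L,a]:=[L,\hat l(a)]$ for $L\in\mathrm{end}(V)$, $a\in A$. TENSOR PRODUCT OVER $A$. $V\otimes_A W=(V\otimes W)/\mathrm{Im}(r\otimes\mathrm{id}-(\mathrm{id}\otimes l)\circ\Phi)$, with actions $a(v\otimes_A w)=((\phi^{(-1)}\triangleright a)(\phi^{(-2)}\triangleright v))\otimes_A(\phi^{(-3)}\triangleright w)$ and $(v\otimes_A w)a=(\phi^{(1)}\triangleright v)\otimes_A((\phi^{(2)}\triangleright w)(\phi^{(3)}\triangleright a))$; it is an object of ${}^{H}_{A}\mathscr{M}^{\mathrm{sym}}_{A}$. DIFFERENTIAL CALCULUS AND CONNECTIONS. $I[1]$ is $k$ placed in degree $1$ with $H$ acting by $\epsilon$. Derivations: $\mathrm{der}(A)=\mathrm{Ker}\,\zeta([\cdot,\cdot]-\hat l\circ\mathrm{ev})\subseteq\mathrm{end}(A)$, where $[\cdot,\cdot]-\hat l\circ\mathrm{ev}:\mathrm{end}(A)\otimes A\to\mathrm{end}(A)$, $L\otimes a\mapsto[L,a]-\hat l(\mathrm{ev}(L\otimes a))$. A differential calculus $(A,\mathrm{d})$ in ${}^{H}\mathscr{M}$ is an object $A$ of ${}^{H}\mathscr{A}^{\mathrm{com}}$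 with an ${}^{H}\mathscr{M}$-morphism $\mathrm{d}:I[1]\to\mathrm{der}(A)$ such that $\mathrm{d}(c)\bullet\mathrm{d}(c')=0$ for all $c,c'$. With $\times$ the categorical product in ${}^{H}\mathscr{M}$, $\mathrm{con}(V)=\mathrm{Ker}\,\zeta(f)\subseteq\mathrm{end}(V)\times I[1]$, where $f:(\mathrm{end}(V)\times I[1])\otimes A\to\mathrm{end}(V)$, $f((L,c)\otimes a)=[L,a]-\hat l(\mathrm{ev}(\mathrm{d}(c)\otimes a))$. SUM. $\boxplus:(\mathrm{end}(V)\times I[1])\times(\mathrm{end}(W)\times I[1])\to\mathrm{end}(V\otimes W)\times I[1]$, $((L,c),(L',c'))\mapsto(L\circledast1+1\circledast L',c)$. $\mathrm{con}(V)\times_{I[1]}\mathrm{con}(W)$ is the fibred product in ${}^{H}\mathscr{M}$ over the projections to $I[1]$: pairs $((L,c),(L',c'))$ with $c=c'$. *)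

theory Defs
  imports "HOL-Algebra.Module" "HOL-Algebra.AbelCoset" "HOL-Algebra.RingHom"
begin

section \<open>Modules over a commutative ring: quotients and tensor products\<close>

(* An element of V \<otimes> W is a coset in the free k-module on carrier V \<times> carrier W. *)
type_synonym ('k, 'v, 'w) tens = "('v \<times> 'w \<Rightarrow> 'k) set"

context
  fixes k :: "'k ring"
begin

definition linear_on ::
  "('k, 'v, 'm) module_scheme \<Rightarrow> ('k, 'w, 'n) module_scheme \<Rightarrow> ('v \<Rightarrow> 'w) \<Rightarrow> bool" where
  "linear_on V W f \<longleftrightarrow>
     f \<in> carrier V \<rightarrow> carrier W \<and>
     (\<forall>x\<in>carrier V. \<forall>y\<in>carrier V. f (x \<oplus>\<^bsub>V\<^esub> y) = f x \<oplus>\<^bsub>W\<^esub> f y) \<and>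
     (\<forall>c\<in>carrier k. \<forall>x\<in>carrier V. f (c \<odot>\<^bsub>V\<^esub> x) = c \<odot>\<^bsub>W\<^esub> f x)"

(* Hom_k(V,W); extensionality outside carrier V makes equality of maps the HOL equality. *)
definition Lin ::
  "('k, 'v, 'm) module_scheme \<Rightarrow> ('k, 'w, 'n) module_scheme \<Rightarrow> ('v \<Rightarrow> 'w) set" where
  "Lin V W = {f \<in> extensional (carrier V). linear_on V W f}"

definition submodule_gen :: "('k, 'v, 'm) module_scheme \<Rightarrow> 'v set \<Rightarrow> 'v set" where
  "submodule_gen M X = \<Inter>{N. submodule N k M \<and> X \<subseteq> N}"

definition quot_map ::
  "('k, 'v, 'm) module_scheme \<Rightarrow> 'v set \<Rightarrow> ('v \<Rightarrow> 'y) \<Rightarrow> 'v set \<Rightarrow> 'y" where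
  "quot_map M N g = (\<lambda>C\<in>a_rcosets\<^bsub>M\<^esub> N. THE y. \<forall>x\<in>C. g x = y)"

(* The ring multiplication and unit fields of the record are irrelevant for modules. *)
definition quot_mod ::
  "('k, 'v, 'm) module_scheme \<Rightarrow> 'v set \<Rightarrow> ('k, 'v set) module" where
  "quot_mod M N =
     \<lparr>carrier = a_rcosets\<^bsub>M\<^esub> N, mult = undefined, one = undefined,
      zero = N, add = set_add M,
      smult = (\<lambda>c. quot_map M N (\<lambda>x. N +>\<^bsub>M\<^esub> (c \<odot>\<^bsub>M\<^esub> x)))\<rparr>"

definition free_mod :: "'x set \<Rightarrow> ('k, 'x \<Rightarrow> 'k) module" where
  "free_mod X =
     \<lparr>carrier = {f. f \<in> UNIV \<rightarrow> carrier k \<and> finite {x. f x \<noteq> \<zero>\<^bsub>k\<^esub>} \<and> {x. f x \<noteq> \<zero>\<^bsub>k\<^esub>} \<subseteq> X},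
      mult = undefined, one = undefined,
      zero = (\<lambda>_. \<zero>\<^bsub>k\<^esub>), add = (\<lambda>f g x. f x \<oplus>\<^bsub>k\<^esub> g x), smult = (\<lambda>c f x. c \<otimes>\<^bsub>k\<^esub> f x)\<rparr>"

definition free_gen :: "'x \<Rightarrow> 'x \<Rightarrow> 'k" where
  "free_gen x = (\<lambda>y. if y = x then \<one>\<^bsub>k\<^esub> else \<zero>\<^bsub>k\<^esub>)"

definition tensor_rel ::
  "('k, 'v, 'm) module_scheme \<Rightarrow> ('k, 'w, 'n) module_scheme \<Rightarrow> ('v \<times> 'w \<Rightarrow> 'k) set" where
  "tensor_rel V W = (let F = free_mod (carrier V \<times> carrier W) in
     submodule_gen F
      ({free_gen (v \<oplus>\<^bsub>V\<^esub> v', w) \<ominus>\<^bsub>F\<^esub> (free_gen (v, w) \<oplus>\<^bsub>F\<^esub> free_gen (v', w)) | v v' w.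
           v \<in> carrier V \<and> v' \<in> carrier V \<and> w \<in> carrier W} \<union>
       {free_gen (v, w \<oplus>\<^bsub>W\<^esub> w') \<ominus>\<^bsub>F\<^esub> (free_gen (v, w) \<oplus>\<^bsub>F\<^esub> free_gen (v, w')) | v w w'.
           v \<in> carrier V \<and> w \<in> carrier W \<and> w' \<in> carrier W} \<union>
       {free_gen (c \<odot>\<^bsub>V\<^esub> v, w) \<ominus>\<^bsub>F\<^esub> c \<odot>\<^bsub>F\<^esub> free_gen (v, w) | c v w.
           c \<in> carrier k \<and> v \<in> carrier V \<and> w \<in> carrier W} \<union>
       {free_gen (v, c \<odot>\<^bsub>W\<^esub> w) \<ominus>\<^bsub>F\<^esub> c \<odot>\<^bsub>F\<^esub> free_gen (v, w) | c v w.
           c \<in> carrier k \<and> v \<in> carrier V \<and> w \<in> carrier W}))"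

definition tensor_mod ::
  "('k, 'v, 'm) module_scheme \<Rightarrow> ('k, 'w, 'n) module_scheme \<Rightarrow>
   ('k, ('k, 'v, 'w) tens) module" where
  "tensor_mod V W = quot_mod (free_mod (carrier V \<times> carrier W)) (tensor_rel V W)"

(* v \<otimes> w *)
definition pt ::
  "('k, 'v, 'm) module_scheme \<Rightarrow> ('k, 'w, 'n) module_scheme \<Rightarrow> 'v \<Rightarrow> 'w \<Rightarrow> ('k, 'v, 'w) tens" where
  "pt V W v w = tensor_rel V W +>\<^bsub>free_mod (carrier V \<times> carrier W)\<^esub> free_gen (v, w)"

(* The linear map V \<otimes> W \<rightarrow> X given by v \<otimes> w \<mapsto> b v w, for b bilinear. For t in V \<otimes> W,
   bilift V W X b t is "the sum over t = t1 \<otimes> t2 of b t1 t2" in Sweedler-like notation. *)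
definition bilift ::
  "('k, 'v, 'm) module_scheme \<Rightarrow> ('k, 'w, 'n) module_scheme \<Rightarrow> ('k, 'x, 'p) module_scheme \<Rightarrow>
   ('v \<Rightarrow> 'w \<Rightarrow> 'x) \<Rightarrow> ('k, 'v, 'w) tens \<Rightarrow> 'x" where
  "bilift V W X b = (THE g. g \<in> Lin (tensor_mod V W) X \<and>
     (\<forall>v\<in>carrier V. \<forall>w\<in>carrier W. g (pt V W v w) = b v w))"

(* Likewise on (U \<otimes> V) \<otimes> W. *)
definition trilift ::
  "('k, 'u, 'l) module_scheme \<Rightarrow> ('k, 'v, 'm) module_scheme \<Rightarrow> ('k, 'w, 'n) module_scheme \<Rightarrow>
   ('k, 'x, 'p) module_scheme \<Rightarrow> ('u \<Rightarrow> 'v \<Rightarrow> 'w \<Rightarrow> 'x) \<Rightarrow>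
   ('k, ('k, 'u, 'v) tens, 'w) tens \<Rightarrow> 'x" where
  "trilift U V W X b =
     bilift (tensor_mod U V) W X (\<lambda>t w. bilift U V X (\<lambda>u v. b u v w) t)"

definition tensor_map ::
  "('k, 'v, 'm) module_scheme \<Rightarrow> ('k, 'w, 'n) module_scheme \<Rightarrow>
   ('k, 'x, 'p) module_scheme \<Rightarrow> ('k, 'y, 'q) module_scheme \<Rightarrow>
   ('v \<Rightarrow> 'x) \<Rightarrow> ('w \<Rightarrow> 'y) \<Rightarrow> ('k, 'v, 'w) tens \<Rightarrow> ('k, 'x, 'y) tens" where
  "tensor_map V W X Y f g = bilift V W (tensor_mod X Y) (\<lambda>v w. pt X Y (f v) (g w))"

definition assoc_alg :: "('k, 'a, 'm) module_scheme \<Rightarrow> bool" where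
  "assoc_alg A \<longleftrightarrow> module k A \<and> ring A \<and>
     (\<forall>c\<in>carrier k. \<forall>x\<in>carrier A. \<forall>y\<in>carrier A.
        (c \<odot>\<^bsub>A\<^esub> x) \<otimes>\<^bsub>A\<^esub> y = c \<odot>\<^bsub>A\<^esub> (x \<otimes>\<^bsub>A\<^esub> y) \<and>
        x \<otimes>\<^bsub>A\<^esub> (c \<odot>\<^bsub>A\<^esub> y) = c \<odot>\<^bsub>A\<^esub> (x \<otimes>\<^bsub>A\<^esub> y))"

(* The ungraded tensor product of algebras, (a \<otimes> b)(a' \<otimes> b') = aa' \<otimes> bb'. *)
definition tensor_alg ::
  "('k, 'a, 'm) module_scheme \<Rightarrow> ('k, 'b, 'n) module_scheme \<Rightarrow>
   ('k, ('k, 'a, 'b) tens) module" where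
  "tensor_alg A B = (tensor_mod A B)
     \<lparr>mult := (\<lambda>s t. bilift A B (tensor_mod A B) (\<lambda>a b.
                 bilift A B (tensor_mod A B) (\<lambda>a' b'.
                   pt A B (a \<otimes>\<^bsub>A\<^esub> a') (b \<otimes>\<^bsub>B\<^esub> b')) t) s),
      one := pt A B \<one>\<^bsub>A\<^esub> \<one>\<^bsub>B\<^esub>\<rparr>"

end


section \<open>Quasitriangular quasi-Hopf algebras\<close>

(* The associator lives in (H \<otimes> H) \<otimes> H. *)
record ('k, 'h) qqha = "('k, 'h) module" +
  comul :: "'h \<Rightarrow> ('k, 'h, 'h) tens"
  counit :: "'h \<Rightarrow> 'k"
  phi :: "('k, ('k, 'h, 'h) tens, 'h) tens"
  antip :: "'h \<Rightarrow> 'h"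
  alpha :: "'h"
  beta :: "'h"
  rmat :: "('k, 'h, 'h) tens"

context
  fixes k :: "'k ring" and H :: "('k, 'h) qqha"
begin

abbreviation H2 :: "('k, ('k, 'h, 'h) tens) module" where
  "H2 \<equiv> tensor_alg k H H"

abbreviation H3 :: "('k, ('k, ('k, 'h, 'h) tens, 'h) tens) module" where
  "H3 \<equiv> tensor_alg k H2 H"

abbreviation H4 :: "('k, ('k, ('k, ('k, 'h, 'h) tens, 'h) tens, 'h) tens) module" where
  "H4 \<equiv> tensor_alg k H3 H"

abbreviation p2 :: "'h \<Rightarrow> 'h \<Rightarrow> ('k, 'h, 'h) tens" where
  "p2 a b \<equiv> pt k H H a b"

abbreviation p3 :: "'h \<Rightarrow> 'h \<Rightarrow> 'h \<Rightarrow> ('k, ('k, 'h, 'h) tens, 'h) tens" where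
  "p3 a b c \<equiv> pt k H2 H (p2 a b) c"

abbreviation p4 ::
  "'h \<Rightarrow> 'h \<Rightarrow> 'h \<Rightarrow> 'h \<Rightarrow> ('k, ('k, ('k, 'h, 'h) tens, 'h) tens, 'h) tens" where
  "p4 a b c d \<equiv> pt k H3 H (p3 a b c) d"

definition phi_inv :: "('k, ('k, 'h, 'h) tens, 'h) tens" where
  "phi_inv = inv\<^bsub>H3\<^esub> (phi H)"

definition quasi_bialgebra :: bool where
  "quasi_bialgebra \<longleftrightarrow>
     cring k \<and> assoc_alg k H \<and>
     comul H \<in> ring_hom H H2 \<and> linear_on k H H2 (comul H) \<and>
     counit H \<in> ring_hom H k \<and>
     (\<forall>c\<in>carrier k. \<forall>x\<in>carrier H. counit H (c \<odot>\<^bsub>H\<^esub> x) = c \<otimes>\<^bsub>k\<^esub> counit H x) \<and>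
     phi H \<in> Units H3 \<and>
     (\<forall>h\<in>carrier H.
        bilift k H H H (\<lambda>a b. counit H a \<odot>\<^bsub>H\<^esub> b) (comul H h) = h \<and>
        bilift k H H H (\<lambda>a b. counit H b \<odot>\<^bsub>H\<^esub> a) (comul H h) = h) \<and>
     (\<forall>h\<in>carrier H.
        bilift k H H H3 (\<lambda>a b. bilift k H H H3 (\<lambda>b1 b2. p3 a b1 b2) (comul H b)) (comul H h) =
        phi H \<otimes>\<^bsub>H3\<^esub> bilift k H H H3 (\<lambda>a b. pt k H2 H (comul H a) b) (comul H h)
              \<otimes>\<^bsub>H3\<^esub> phi_inv) \<and>
     \<comment> \<open>pentagon: (id id \<open>\<Delta>\<close>)(\<open>\<phi>\<close>) (\<open>\<Delta>\<close> id id)(\<open>\<phi>\<close>) = (1 \<open>\<otimes>\<close> \<open>\<phi>\<close>) (id \<open>\<Delta>\<close> id)(\<open>\<phi>\<close>) (\<open>\<phi>\<close> \<open>\<otimes>\<close> 1)\<close>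
     trilift k H H H H4 (\<lambda>a b c. bilift k H H H4 (\<lambda>c1 c2. p4 a b c1 c2) (comul H c)) (phi H)
       \<otimes>\<^bsub>H4\<^esub>
     trilift k H H H H4 (\<lambda>a b c. bilift k H H H4 (\<lambda>a1 a2. p4 a1 a2 b c) (comul H a)) (phi H) =
     trilift k H H H H4 (\<lambda>a b c. p4 \<one>\<^bsub>H\<^esub> a b c) (phi H)
       \<otimes>\<^bsub>H4\<^esub>
     trilift k H H H H4 (\<lambda>a b c. bilift k H H H4 (\<lambda>b1 b2. p4 a b1 b2 c) (comul H b)) (phi H)
       \<otimes>\<^bsub>H4\<^esub>
     trilift k H H H H4 (\<lambda>a b c. p4 a b c \<one>\<^bsub>H\<^esub>) (phi H) \<and>
     trilift k H H H H2 (\<lambda>a b c. counit H b \<odot>\<^bsub>H2\<^esub> p2 a c) (phi H) = \<one>\<^bsub>H2\<^esub>"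

(* As in Drinfeld's definition, the quasi-antipode S is an algebra anti-automorphism. *)
definition quasi_antipode :: bool where
  "quasi_antipode \<longleftrightarrow>
     linear_on k H H (antip H) \<and> bij_betw (antip H) (carrier H) (carrier H) \<and>
     antip H \<one>\<^bsub>H\<^esub> = \<one>\<^bsub>H\<^esub> \<and>
     (\<forall>x\<in>carrier H. \<forall>y\<in>carrier H. antip H (x \<otimes>\<^bsub>H\<^esub> y) = antip H y \<otimes>\<^bsub>H\<^esub> antip H x) \<and>
     alpha H \<in> carrier H \<and> beta H \<in> carrier H \<and>
     (\<forall>h\<in>carrier H.
        bilift k H H H (\<lambda>a b. antip H a \<otimes>\<^bsub>H\<^esub> alpha H \<otimes>\<^bsub>H\<^esub> b) (comul H h) =
          counit H h \<odot>\<^bsub>H\<^esub> alpha H \<and>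
        bilift k H H H (\<lambda>a b. a \<otimes>\<^bsub>H\<^esub> beta H \<otimes>\<^bsub>H\<^esub> antip H b) (comul H h) =
          counit H h \<odot>\<^bsub>H\<^esub> beta H) \<and>
     trilift k H H H H (\<lambda>a b c. a \<otimes>\<^bsub>H\<^esub> beta H \<otimes>\<^bsub>H\<^esub> antip H b \<otimes>\<^bsub>H\<^esub> alpha H \<otimes>\<^bsub>H\<^esub> c) (phi H) =
       \<one>\<^bsub>H\<^esub> \<and>
     trilift k H H H H
       (\<lambda>a b c. antip H a \<otimes>\<^bsub>H\<^esub> alpha H \<otimes>\<^bsub>H\<^esub> b \<otimes>\<^bsub>H\<^esub> beta H \<otimes>\<^bsub>H\<^esub> antip H c) phi_inv =
       \<one>\<^bsub>H\<^esub>"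

(* The hexagons are those of the braiding v \<otimes> w \<mapsto> R2 w \<otimes> R1 v and the associator phi. With
   (v, w, x) in positions 1, 2, 3, expanding the braiding of V \<otimes> W past X gives
     (Delta \<otimes> id)(R) = (phi2 \<otimes> phi3 \<otimes> phi1) R13 (phi'1 \<otimes> phi'3 \<otimes> phi'2) R23 phi,
   and expanding the braiding of V past W \<otimes> X gives
     (id \<otimes> Delta)(R) = (phi'3 \<otimes> phi'1 \<otimes> phi'2) R13 (phi2 \<otimes> phi1 \<otimes> phi3) R12 phi',
   where phi' is the inverse of phi. *)
definition universal_R :: bool where
  "universal_R \<longleftrightarrow>
     rmat H \<in> Units H2 \<and>
     (\<forall>h\<in>carrier H.
        bilift k H H H2 (\<lambda>a b. p2 b a) (comul H h) =
        rmat H \<otimes>\<^bsub>H2\<^esub> comul H h \<otimes>\<^bsub>H2\<^esub> inv\<^bsub>H2\<^esub> (rmat H)) \<and>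
     (let R12 = bilift k H H H3 (\<lambda>a b. p3 a b \<one>\<^bsub>H\<^esub>) (rmat H);
          R13 = bilift k H H H3 (\<lambda>a b. p3 a \<one>\<^bsub>H\<^esub> b) (rmat H);
          R23 = bilift k H H H3 (\<lambda>a b. p3 \<one>\<^bsub>H\<^esub> a b) (rmat H) in
        bilift k H H H3 (\<lambda>a b. pt k H2 H (comul H a) b) (rmat H) =
          trilift k H H H H3 (\<lambda>a b c. p3 b c a) (phi H) \<otimes>\<^bsub>H3\<^esub> R13 \<otimes>\<^bsub>H3\<^esub>
          trilift k H H H H3 (\<lambda>a b c. p3 a c b) phi_inv \<otimes>\<^bsub>H3\<^esub> R23 \<otimes>\<^bsub>H3\<^esub> phi H \<and>
        bilift k H H H3 (\<lambda>a b. bilift k H H H3 (\<lambda>b1 b2. p3 a b1 b2) (comul H b)) (rmat H) =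
          trilift k H H H H3 (\<lambda>a b c. p3 c a b) phi_inv \<otimes>\<^bsub>H3\<^esub> R13 \<otimes>\<^bsub>H3\<^esub>
          trilift k H H H H3 (\<lambda>a b c. p3 b a c) (phi H) \<otimes>\<^bsub>H3\<^esub> R12 \<otimes>\<^bsub>H3\<^esub> phi_inv)"

definition quasitriangular_quasi_Hopf :: bool where
  "quasitriangular_quasi_Hopf \<longleftrightarrow> quasi_bialgebra \<and> quasi_antipode \<and> universal_R"

end


section \<open>The braided closed monoidal category of bounded graded left H-modules\<close>

record ('k, 'h, 'v) hmod = "('k, 'v) module" +
  act :: "'h \<Rightarrow> 'v \<Rightarrow> 'v"
  gr :: "int \<Rightarrow> 'v set"

context
  fixes k :: "'k ring" and H :: "('k, 'h) qqha"
begin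

definition gr_support :: "('k, 'h, 'v, 'm) hmod_scheme \<Rightarrow> int set" where
  "gr_support V = {n. gr V n \<noteq> {\<zero>\<^bsub>V\<^esub>}}"

definition hm_object :: "('k, 'h, 'v, 'm) hmod_scheme \<Rightarrow> bool" where
  "hm_object V \<longleftrightarrow>
     module k V \<and>
     (\<forall>h\<in>carrier H. linear_on k V V (act V h)) \<and>
     (\<forall>v\<in>carrier V. linear_on k H V (\<lambda>h. act V h v)) \<and>
     (\<forall>v\<in>carrier V. act V \<one>\<^bsub>H\<^esub> v = v) \<and>
     (\<forall>h\<in>carrier H. \<forall>h'\<in>carrier H. \<forall>v\<in>carrier V. act V (h \<otimes>\<^bsub>H\<^esub> h') v = act V h (act V h' v)) \<and>
     (\<forall>n. submodule (gr V n) k V) \<and>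
     finite (gr_support V) \<and>
     (\<forall>v\<in>carrier V. \<exists>!c. (\<forall>n. c n \<in> gr V n) \<and> v = (\<Oplus>\<^bsub>V\<^esub>n\<in>gr_support V. c n)) \<and>
     (\<forall>h\<in>carrier H. \<forall>n. \<forall>v\<in>gr V n. act V h v \<in> gr V n)"

(* the component of v in degree n *)
definition hcomp :: "('k, 'h, 'v, 'm) hmod_scheme \<Rightarrow> 'v \<Rightarrow> int \<Rightarrow> 'v" where
  "hcomp V v = (THE c. (\<forall>n. c n \<in> gr V n) \<and> v = (\<Oplus>\<^bsub>V\<^esub>n\<in>gr_support V. c n))"

definition hm_morphism ::
  "('k, 'h, 'v, 'm) hmod_scheme \<Rightarrow> ('k, 'h, 'w, 'n) hmod_scheme \<Rightarrow> ('v \<Rightarrow> 'w) \<Rightarrow> bool" where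
  "hm_morphism V W f \<longleftrightarrow>
     hm_object V \<and> hm_object W \<and> f \<in> Lin k V W \<and>
     (\<forall>n. \<forall>v\<in>gr V n. f v \<in> gr W n) \<and>
     (\<forall>h\<in>carrier H. \<forall>v\<in>carrier V. f (act V h v) = act W h (f v))"

definition hmod_of ::
  "('k, 'v, 'm) module_scheme \<Rightarrow> ('h \<Rightarrow> 'v \<Rightarrow> 'v) \<Rightarrow> (int \<Rightarrow> 'v set) \<Rightarrow> ('k, 'h, 'v) hmod" where
  "hmod_of M a g =
     \<lparr>carrier = carrier M, mult = undefined, one = undefined, zero = zero M, add = add M,
      smult = smult M, act = a, gr = g\<rparr>"

(* I[p]; in particular unit_obj 0 is the monoidal unit I and unit_obj 1 is I[1] *)
definition unit_obj :: "int \<Rightarrow> ('k, 'h, 'k) hmod" where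
  "unit_obj p =
     \<lparr>carrier = carrier k, mult = undefined, one = undefined, zero = \<zero>\<^bsub>k\<^esub>, add = add k,
      smult = mult k, act = (\<lambda>h c. counit H h \<otimes>\<^bsub>k\<^esub> c),
      gr = (\<lambda>n. if n = p then carrier k else {\<zero>\<^bsub>k\<^esub>})\<rparr>"

definition sub_obj ::
  "('k, 'h, 'v, 'm) hmod_scheme \<Rightarrow> 'v set \<Rightarrow> ('k, 'h, 'v) hmod" where
  "sub_obj V U = hmod_of (V\<lparr>carrier := U\<rparr>) (act V) (\<lambda>n. gr V n \<inter> U)"

definition prod_obj ::
  "('k, 'h, 'v, 'm) hmod_scheme \<Rightarrow> ('k, 'h, 'w, 'n) hmod_scheme \<Rightarrow> ('k, 'h, 'v \<times> 'w) hmod" where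
  "prod_obj V W =
     \<lparr>carrier = carrier V \<times> carrier W, mult = undefined, one = undefined,
      zero = (\<zero>\<^bsub>V\<^esub>, \<zero>\<^bsub>W\<^esub>),
      add = (\<lambda>(v, w) (v', w'). (v \<oplus>\<^bsub>V\<^esub> v', w \<oplus>\<^bsub>W\<^esub> w')),
      smult = (\<lambda>c (v, w). (c \<odot>\<^bsub>V\<^esub> v, c \<odot>\<^bsub>W\<^esub> w)),
      act = (\<lambda>h (v, w). (act V h v, act W h w)),
      gr = (\<lambda>n. gr V n \<times> gr W n)\<rparr>"

definition tensor_obj (infixr "\<otimes>\<^sub>H" 72) where
  "tensor_obj (V :: ('k, 'h, 'v, 'm) hmod_scheme) (W :: ('k, 'h, 'w, 'n) hmod_scheme) =
     (hmod_of (tensor_mod k V W)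
       (\<lambda>h. bilift k V W (tensor_mod k V W) (\<lambda>v w.
              bilift k H H (tensor_mod k V W) (\<lambda>a b. pt k V W (act V a v) (act W b w)) (comul H h)))
       (\<lambda>n. submodule_gen k (tensor_mod k V W)
              {pt k V W v w | v w p q. v \<in> gr V p \<and> w \<in> gr W q \<and> p + q = n})
      :: ('k, 'h, ('k, 'v, 'w) tens) hmod)"

definition associator ::
  "('k, 'h, 'v, 'm) hmod_scheme \<Rightarrow> ('k, 'h, 'w, 'n) hmod_scheme \<Rightarrow> ('k, 'h, 'x, 'p) hmod_scheme \<Rightarrow>
   ('k, ('k, 'v, 'w) tens, 'x) tens \<Rightarrow> ('k, 'v, ('k, 'w, 'x) tens) tens" where
  "associator V W X = (let T = V \<otimes>\<^sub>H (W \<otimes>\<^sub>H X) in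
     trilift k V W X T (\<lambda>v w x.
       trilift k H H H T (\<lambda>a b c.
         pt k V (W \<otimes>\<^sub>H X) (act V a v) (pt k W X (act W b w) (act X c x))) (phi H)))"

definition associator_inv ::
  "('k, 'h, 'v, 'm) hmod_scheme \<Rightarrow> ('k, 'h, 'w, 'n) hmod_scheme \<Rightarrow> ('k, 'h, 'x, 'p) hmod_scheme \<Rightarrow>
   ('k, 'v, ('k, 'w, 'x) tens) tens \<Rightarrow> ('k, ('k, 'v, 'w) tens, 'x) tens" where
  "associator_inv V W X = (let T = (V \<otimes>\<^sub>H W) \<otimes>\<^sub>H X in
     bilift k V (W \<otimes>\<^sub>H X) T (\<lambda>v t. bilift k W X T (\<lambda>w x.
       trilift k H H H T (\<lambda>a b c.
         pt k (V \<otimes>\<^sub>H W) X (pt k V W (act V a v) (act W b w)) (act X c x)) (phi_inv k H)) t))"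

definition koszul ::
  "('k, 'v, 'm) module_scheme \<Rightarrow> int \<Rightarrow> int \<Rightarrow> 'v \<Rightarrow> 'v" where
  "koszul X m n x = (if even (m * n) then x else \<ominus>\<^bsub>X\<^esub> x)"

definition braiding ::
  "('k, 'h, 'v, 'm) hmod_scheme \<Rightarrow> ('k, 'h, 'w, 'n) hmod_scheme \<Rightarrow>
   ('k, 'v, 'w) tens \<Rightarrow> ('k, 'w, 'v) tens" where
  "braiding V W = (let T = W \<otimes>\<^sub>H V in
     bilift k V W T (\<lambda>v w.
       \<Oplus>\<^bsub>T\<^esub>m\<in>gr_support V. \<Oplus>\<^bsub>T\<^esub>n\<in>gr_support W. koszul T m n
         (bilift k H H T (\<lambda>a b. pt k W V (act W b (hcomp W w n)) (act V a (hcomp V v m))) (rmat H))))"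

(* As gradings are bounded, the direct sum over n and l - m = n of Hom(V_m, W_l) is finite and
   is the module Hom(V, W) of all k-linear maps. *)
definition hom_obj ::
  "('k, 'h, 'v, 'm) hmod_scheme \<Rightarrow> ('k, 'h, 'w, 'n) hmod_scheme \<Rightarrow> ('k, 'h, 'v \<Rightarrow> 'w) hmod" where
  "hom_obj V W =
     \<lparr>carrier = Lin k V W, mult = undefined, one = undefined,
      zero = (\<lambda>v\<in>carrier V. \<zero>\<^bsub>W\<^esub>),
      add = (\<lambda>L L'. \<lambda>v\<in>carrier V. L v \<oplus>\<^bsub>W\<^esub> L' v),
      smult = (\<lambda>c L. \<lambda>v\<in>carrier V. c \<odot>\<^bsub>W\<^esub> L v),
      act = (\<lambda>h L. \<lambda>v\<in>carrier V.
               bilift k H H W (\<lambda>a b. act W a (L (act V (antip H b) v))) (comul H h)),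
      gr = (\<lambda>n. {L \<in> Lin k V W. \<forall>m. \<forall>v\<in>gr V m. L v \<in> gr W (m + n)})\<rparr>"

abbreviation end_obj :: "('k, 'h, 'v, 'm) hmod_scheme \<Rightarrow> ('k, 'h, 'v \<Rightarrow> 'v) hmod" where
  "end_obj V \<equiv> hom_obj V V"

(* currying Hom(V \<otimes> W, X) \<rightarrow> Hom(V, hom(W, X)) *)
definition zeta ::
  "('k, 'h, 'v, 'm) hmod_scheme \<Rightarrow> ('k, 'h, 'w, 'n) hmod_scheme \<Rightarrow> ('k, 'h, 'x, 'p) hmod_scheme \<Rightarrow>
   (('k, 'v, 'w) tens \<Rightarrow> 'x) \<Rightarrow> 'v \<Rightarrow> 'w \<Rightarrow> 'x" where
  "zeta V W X f = (\<lambda>v\<in>carrier V. \<lambda>w\<in>carrier W.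
     trilift k H H H X (\<lambda>a b c.
       f (pt k V W (act V a v) (act W (b \<otimes>\<^bsub>H\<^esub> beta H \<otimes>\<^bsub>H\<^esub> antip H c) w))) (phi_inv k H))"

definition zeta_inv ::
  "('k, 'h, 'v, 'm) hmod_scheme \<Rightarrow> ('k, 'h, 'w, 'n) hmod_scheme \<Rightarrow> ('k, 'h, 'x, 'p) hmod_scheme \<Rightarrow>
   ('v \<Rightarrow> 'w \<Rightarrow> 'x) \<Rightarrow> ('k, 'v, 'w) tens \<Rightarrow> 'x" where
  "zeta_inv V W X g = bilift k V W X (\<lambda>v w.
     trilift k H H H X (\<lambda>a b c.
       act X a (g v (act W (antip H b \<otimes>\<^bsub>H\<^esub> alpha H \<otimes>\<^bsub>H\<^esub> c) w))) (phi H))"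

definition ev ::
  "('k, 'h, 'v, 'm) hmod_scheme \<Rightarrow> ('k, 'h, 'w, 'n) hmod_scheme \<Rightarrow>
   ('k, 'v \<Rightarrow> 'w, 'v) tens \<Rightarrow> 'w" where
  "ev V W = zeta_inv (hom_obj V W) V W (\<lambda>L. L)"

(* internal composition hom(W, X) \<otimes> hom(V, W) \<rightarrow> hom(V, X) *)
definition icomp ::
  "('k, 'h, 'v, 'm) hmod_scheme \<Rightarrow> ('k, 'h, 'w, 'n) hmod_scheme \<Rightarrow> ('k, 'h, 'x, 'p) hmod_scheme \<Rightarrow>
   ('k, 'w \<Rightarrow> 'x, 'v \<Rightarrow> 'w) tens \<Rightarrow> 'v \<Rightarrow> 'x" where
  "icomp V W X = zeta (hom_obj W X \<otimes>\<^sub>H hom_obj V W) V X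
     (\<lambda>t. ev W X
       (tensor_map k (hom_obj W X) (hom_obj V W \<otimes>\<^sub>H V) (hom_obj W X) W (\<lambda>L. L) (ev V W)
         (associator (hom_obj W X) (hom_obj V W) V t)))"

definition iunit :: "('k, 'h, 'v, 'm) hmod_scheme \<Rightarrow> 'v \<Rightarrow> 'v" where
  "iunit V = (\<lambda>v\<in>carrier V. act V (beta H) v)"

definition icommutator ::
  "('k, 'h, 'v, 'm) hmod_scheme \<Rightarrow> ('v \<Rightarrow> 'v) \<Rightarrow> ('v \<Rightarrow> 'v) \<Rightarrow> 'v \<Rightarrow> 'v" where
  "icommutator V L L' = (let t = pt k (end_obj V) (end_obj V) L L' in
     icomp V V V t \<ominus>\<^bsub>end_obj V\<^esub> icomp V V V (braiding (end_obj V) (end_obj V) t))"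

(* The canonical isomorphism (E \<otimes> F) \<otimes> (V \<otimes> X) \<rightarrow> (E \<otimes> V) \<otimes> (F \<otimes> X), as the composite
   (E \<otimes> F) \<otimes> (V \<otimes> X) \<rightarrow> E \<otimes> (F \<otimes> (V \<otimes> X)) \<rightarrow> E \<otimes> ((F \<otimes> V) \<otimes> X) \<rightarrow> E \<otimes> ((V \<otimes> F) \<otimes> X)
   \<rightarrow> E \<otimes> (V \<otimes> (F \<otimes> X)) \<rightarrow> (E \<otimes> V) \<otimes> (F \<otimes> X). *)
definition middle_swap ::
  "('k, 'h, 'e, 'm) hmod_scheme \<Rightarrow> ('k, 'h, 'f, 'n) hmod_scheme \<Rightarrow>
   ('k, 'h, 'v, 'p) hmod_scheme \<Rightarrow> ('k, 'h, 'x, 'q) hmod_scheme \<Rightarrow>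
   ('k, ('k, 'e, 'f) tens, ('k, 'v, 'x) tens) tens \<Rightarrow>
   ('k, ('k, 'e, 'v) tens, ('k, 'f, 'x) tens) tens" where
  "middle_swap E F V X t =
     associator_inv E V (F \<otimes>\<^sub>H X)
      (tensor_map k E (F \<otimes>\<^sub>H (V \<otimes>\<^sub>H X)) E (V \<otimes>\<^sub>H (F \<otimes>\<^sub>H X)) (\<lambda>e. e)
        (\<lambda>s. associator V F X
           (tensor_map k (F \<otimes>\<^sub>H V) X (V \<otimes>\<^sub>H F) X (braiding F V) (\<lambda>x. x)
             (associator_inv F V X s)))
        (associator E F (V \<otimes>\<^sub>H X) t))"

(* the internal tensor product hom(V, W) \<otimes> hom(X, Y) \<rightarrow> hom(V \<otimes> X, W \<otimes> Y) *)
definition itensor ::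
  "('k, 'h, 'v, 'm) hmod_scheme \<Rightarrow> ('k, 'h, 'w, 'n) hmod_scheme \<Rightarrow>
   ('k, 'h, 'x, 'p) hmod_scheme \<Rightarrow> ('k, 'h, 'y, 'q) hmod_scheme \<Rightarrow>
   ('k, 'v \<Rightarrow> 'w, 'x \<Rightarrow> 'y) tens \<Rightarrow> ('k, 'v, 'x) tens \<Rightarrow> ('k, 'w, 'y) tens" where
  "itensor V W X Y = zeta (hom_obj V W \<otimes>\<^sub>H hom_obj X Y) (V \<otimes>\<^sub>H X) (W \<otimes>\<^sub>H Y)
     (\<lambda>t. tensor_map k (hom_obj V W \<otimes>\<^sub>H V) (hom_obj X Y \<otimes>\<^sub>H X) W Y (ev V W) (ev X Y)
       (middle_swap (hom_obj V W) (hom_obj X Y) V X t))"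

end


section \<open>Algebras and symmetric bimodules\<close>

(* prodm is the product A \<otimes> A \<rightarrow> A and unitm the unit I \<rightarrow> A; the ring multiplication and unit
   fields inherited from the module record are not used. *)
record ('k, 'h, 'a) halg = "('k, 'h, 'a) hmod" +
  prodm :: "('k, 'a, 'a) tens \<Rightarrow> 'a"
  unitm :: "'k \<Rightarrow> 'a"

record ('k, 'h, 'a, 'v) hbimod = "('k, 'h, 'v) hmod" +
  lact :: "('k, 'a, 'v) tens \<Rightarrow> 'v"
  ract :: "('k, 'v, 'a) tens \<Rightarrow> 'v"

context
  fixes k :: "'k ring" and H :: "('k, 'h) qqha"
begin

definition algebra_object :: "('k, 'h, 'a) halg \<Rightarrow> bool" where
  "algebra_object A \<longleftrightarrow>
     hm_object k H A \<and>
     hm_morphism k H (tensor_obj k H A A) A (prodm A) \<and>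
     hm_morphism k H (unit_obj k H 0) A (unitm A) \<and>
     (\<forall>t\<in>carrier (tensor_obj k H (tensor_obj k H A A) A).
        prodm A (tensor_map k (tensor_obj k H A A) A A A (prodm A) (\<lambda>a. a) t) =
        prodm A (tensor_map k A (tensor_obj k H A A) A A (\<lambda>a. a) (prodm A)
          (associator k H A A A t))) \<and>
     (\<forall>a\<in>carrier A.
        prodm A (pt k A A (unitm A \<one>\<^bsub>k\<^esub>) a) = a \<and>
        prodm A (pt k A A a (unitm A \<one>\<^bsub>k\<^esub>)) = a)"

definition braided_commutative_algebra :: "('k, 'h, 'a) halg \<Rightarrow> bool" where
  "braided_commutative_algebra A \<longleftrightarrow>
     algebra_object A \<and>
     (\<forall>t\<in>carrier (tensor_obj k H A A). prodm A (braiding k H A A t) = prodm A t)"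

definition bimodule_object ::
  "('k, 'h, 'a) halg \<Rightarrow> ('k, 'h, 'a, 'v) hbimod \<Rightarrow> bool" where
  "bimodule_object A V \<longleftrightarrow>
     hm_object k H V \<and>
     hm_morphism k H (tensor_obj k H A V) V (lact V) \<and>
     hm_morphism k H (tensor_obj k H V A) V (ract V) \<and>
     (\<forall>v\<in>carrier V.
        lact V (pt k A V (unitm A \<one>\<^bsub>k\<^esub>) v) = v \<and>
        ract V (pt k V A v (unitm A \<one>\<^bsub>k\<^esub>)) = v) \<and>
     (\<forall>t\<in>carrier (tensor_obj k H (tensor_obj k H A A) V).
        lact V (tensor_map k (tensor_obj k H A A) V A V (prodm A) (\<lambda>v. v) t) =
        lact V (tensor_map k A (tensor_obj k H A V) A V (\<lambda>a. a) (lact V)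
          (associator k H A A V t))) \<and>
     (\<forall>t\<in>carrier (tensor_obj k H (tensor_obj k H V A) A).
        ract V (tensor_map k (tensor_obj k H V A) A V A (ract V) (\<lambda>a. a) t) =
        ract V (tensor_map k V (tensor_obj k H A A) V A (\<lambda>v. v) (prodm A)
          (associator k H V A A t))) \<and>
     (\<forall>t\<in>carrier (tensor_obj k H (tensor_obj k H A V) A).
        ract V (tensor_map k (tensor_obj k H A V) A V A (lact V) (\<lambda>a. a) t) =
        lact V (tensor_map k A (tensor_obj k H V A) A V (\<lambda>a. a) (ract V)
          (associator k H A V A t)))"

definition symmetric_bimodule ::
  "('k, 'h, 'a) halg \<Rightarrow> ('k, 'h, 'a, 'v) hbimod \<Rightarrow> bool" where
  "symmetric_bimodule A V \<longleftrightarrow>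
     bimodule_object A V \<and>
     (\<forall>t\<in>carrier (tensor_obj k H A V). ract V (braiding k H A V t) = lact V t) \<and>
     (\<forall>t\<in>carrier (tensor_obj k H V A). lact V (braiding k H V A t) = ract V t)"

definition tensor_A_rel ::
  "('k, 'h, 'a) halg \<Rightarrow> ('k, 'h, 'a, 'v) hbimod \<Rightarrow> ('k, 'h, 'a, 'w) hbimod \<Rightarrow>
   ('k, 'v, 'w) tens set" where
  "tensor_A_rel A V W =
     (\<lambda>t. tensor_map k (tensor_obj k H V A) W V W (ract V) (\<lambda>w. w) t
          \<ominus>\<^bsub>tensor_obj k H V W\<^esub>
          tensor_map k V (tensor_obj k H A W) V W (\<lambda>v. v) (lact W) (associator k H V A W t))
     ` carrier (tensor_obj k H (tensor_obj k H V A) W)"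

(* the quotient map V \<otimes> W \<rightarrow> V \<otimes>_A W *)
definition tensor_A_proj ::
  "('k, 'h, 'a) halg \<Rightarrow> ('k, 'h, 'a, 'v) hbimod \<Rightarrow> ('k, 'h, 'a, 'w) hbimod \<Rightarrow>
   ('k, 'v, 'w) tens \<Rightarrow> ('k, 'v, 'w) tens set" where
  "tensor_A_proj A V W t = tensor_A_rel A V W +>\<^bsub>tensor_obj k H V W\<^esub> t"

definition tensor_A_desc ::
  "('k, 'h, 'a) halg \<Rightarrow> ('k, 'h, 'a, 'v) hbimod \<Rightarrow> ('k, 'h, 'a, 'w) hbimod \<Rightarrow>
   (('k, 'v, 'w) tens \<Rightarrow> 'y) \<Rightarrow> ('k, 'v, 'w) tens set \<Rightarrow> 'y" where
  "tensor_A_desc A V W g = quot_map (tensor_obj k H V W) (tensor_A_rel A V W) g"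

definition tensor_A ::
  "('k, 'h, 'a) halg \<Rightarrow> ('k, 'h, 'a, 'v) hbimod \<Rightarrow> ('k, 'h, 'a, 'w) hbimod \<Rightarrow>
   ('k, 'h, 'a, ('k, 'v, 'w) tens set) hbimod" where
  "tensor_A A V W =
     (let T = tensor_obj k H V W;
          Q = quot_mod T (tensor_A_rel A V W);
          proj = tensor_A_proj A V W in
      \<lparr>carrier = carrier Q, mult = undefined, one = undefined, zero = zero Q, add = add Q,
       smult = smult Q,
       act = (\<lambda>h. tensor_A_desc A V W (\<lambda>t. proj (act T h t))),
       gr = (\<lambda>n. proj ` gr T n),
       lact = bilift k A Q Q (\<lambda>a. tensor_A_desc A V W (\<lambda>t. proj
                (tensor_map k (tensor_obj k H A V) W V W (lact V) (\<lambda>w. w)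
                  (associator_inv k H A V W (pt k A T a t))))),
       ract = bilift k Q A Q (\<lambda>C a. tensor_A_desc A V W (\<lambda>t. proj
                (tensor_map k V (tensor_obj k H W A) V W (\<lambda>v. v) (ract W)
                  (associator k H V W A (pt k T A t a)))) C)\<rparr>)"

end


section \<open>Differential calculi and connections\<close>

context
  fixes k :: "'k ring" and H :: "('k, 'h) qqha" and A :: "('k, 'h, 'a) halg"
begin

(* lhat V l for a left A-module structure l : A \<otimes> V \<rightarrow> V *)
definition lhat ::
  "('k, 'h, 'v, 'm) hmod_scheme \<Rightarrow> (('k, 'a, 'v) tens \<Rightarrow> 'v) \<Rightarrow> 'a \<Rightarrow> 'v \<Rightarrow> 'v" where
  "lhat V l = zeta k H A V V l"

definition der :: "('k, 'h, 'a \<Rightarrow> 'a) hmod" where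
  "der = (let E = end_obj k H A in
     sub_obj E
       (a_kernel E (hom_obj k H A E)
         (zeta k H E A E (bilift k E A E (\<lambda>L a.
            icommutator k H A L (lhat A (prodm A) a) \<ominus>\<^bsub>E\<^esub>
            lhat A (prodm A) (ev k H A A (pt k E A L a)))))))"

definition differential_calculus :: "('k \<Rightarrow> 'a \<Rightarrow> 'a) \<Rightarrow> bool" where
  "differential_calculus d \<longleftrightarrow>
     braided_commutative_algebra k H A \<and>
     hm_morphism k H (unit_obj k H 1) der d \<and>
     (\<forall>c\<in>carrier k. \<forall>c'\<in>carrier k.
        icomp k H A A A (pt k (end_obj k H A) (end_obj k H A) (d c) (d c')) =
        \<zero>\<^bsub>end_obj k H A\<^esub>)"

abbreviation end_I1 :: "('k, 'h, 'v, 'm) hmod_scheme \<Rightarrow> ('k, 'h, ('v \<Rightarrow> 'v) \<times> 'k) hmod" where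
  "end_I1 V \<equiv> prod_obj (end_obj k H V) (unit_obj k H 1)"

definition con ::
  "('k \<Rightarrow> 'a \<Rightarrow> 'a) \<Rightarrow> ('k, 'h, 'a, 'v) hbimod \<Rightarrow> ('k, 'h, ('v \<Rightarrow> 'v) \<times> 'k) hmod" where
  "con d V = (let E = end_obj k H V in
     sub_obj (end_I1 V)
       (a_kernel (end_I1 V) (hom_obj k H A E)
         (zeta k H (end_I1 V) A E (bilift k (end_I1 V) A E (\<lambda>(L, c) a.
            icommutator k H V L (lhat V (lact V) a) \<ominus>\<^bsub>E\<^esub>
            lhat V (lact V) (ev k H A A (pt k (end_obj k H A) A (d c) a)))))))"

definition con_fibre_prod ::
  "('k \<Rightarrow> 'a \<Rightarrow> 'a) \<Rightarrow> ('k, 'h, 'a, 'v) hbimod \<Rightarrow> ('k, 'h, 'a, 'w) hbimod \<Rightarrow>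
   ('k, 'h, (('v \<Rightarrow> 'v) \<times> 'k) \<times> (('w \<Rightarrow> 'w) \<times> 'k)) hmod" where
  "con_fibre_prod d V W =
     sub_obj (prod_obj (con d V) (con d W))
       {p \<in> carrier (prod_obj (con d V) (con d W)). snd (fst p) = snd (snd p)}"

definition boxplus ::
  "('k, 'h, 'a, 'v) hbimod \<Rightarrow> ('k, 'h, 'a, 'w) hbimod \<Rightarrow>
   (('v \<Rightarrow> 'v) \<times> 'k) \<times> (('w \<Rightarrow> 'w) \<times> 'k) \<Rightarrow>
   (('k, 'v, 'w) tens \<Rightarrow> ('k, 'v, 'w) tens) \<times> 'k" where
  "boxplus V W = (\<lambda>((L, c), (L', c')).
     (itensor k H V V W W (pt k (end_obj k H V) (end_obj k H W) L (iunit H W))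
        \<oplus>\<^bsub>end_obj k H (tensor_obj k H V W)\<^esub>
      itensor k H V V W W (pt k (end_obj k H V) (end_obj k H W) (iunit H V) L'), c))"

end

end

theory Submission
  imports Defs
begin

text \<open>
  An equivariant map \<open>P \<rightarrow> hom(W, X)\<close> is determined by its evaluation \<open>P \<otimes> W \<rightarrow> X\<close>. Hence
  membership of a pair \<open>(L, c)\<close> in \<open>con(V)\<close> can be tested after evaluation, where it becomes a
  Leibniz rule for morphisms out of \<open>con(V) \<otimes> (A \<otimes> V)\<close>. The operator
  \<open>L \<circledast> 1 + 1 \<circledast> L'\<close> on \<open>V \<otimes> W\<close> evaluates to \<open>(ev \<otimes> id) \<Phi>\<^sup>-\<^sup>1 + (id \<otimes> ev) B\<close>, where \<open>B\<close> braids the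
  operator past \<open>V\<close>; the unit \<open>\<beta>\<close> disappears under evaluation. By the pentagon, the hexagons and
  naturality the Leibniz rule of the first summand passes to the sum. The rule for the left
  action on \<open>V\<close> implies one for the right action: there \<open>d(c)\<close> is moved past \<open>V\<close> and back, which is
  harmless since \<open>d\<close> starts in \<open>I[1]\<close>, against which the braiding is symmetric. Applied to a relation
  of \<open>V \<otimes>\<^sub>A W\<close>, the two factors contribute error terms with the same \<open>d(c)\<close>, and these again form a
  relation, so that the sum descends.
\<close>

text \<open>The Leibniz rule cannot be handled for one operator at a time: the associator and the
  braiding act on the operator through H, so the rule for L involves the translates of L. Hence a
  parameter object P with a morphism from P to pairs (L, c) replaces single elements; in the end P
  is \<open>con_fibre_prod\<close>, which is stable under H. The same point shapes the descent.
  Evaluation at (L, t) is not L t but a sum of translated values, so control over evaluations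
  becomes control over L t only through the inverse formula \<open>zeta_ev\<close>, which again
  ranges over translates of L.

  Computations in tensor powers of H serve to establish the structural facts: equivariance,
  naturality, pentagon, hexagons, currying. The Leibniz rules are then diagram chases. The axioms
  contain a single counit condition on \<phi>, for its middle leg. Those for the outer legs and for
  R, which make 1 in end(V) and the object I[1] transparent to associator and braiding, have to be
  extracted from the pentagon and the hexagons first.\<close>

locale base_ring =
  fixes k :: "'k ring"
  assumes cring_k: "cring k"
begin

section \<open>Modules and linear maps\<close>

lemma m_abelian: "module k V ==> abelian_group V" and m_abelian_monoid: "module k V ==> abelian_monoid V"
  using module.axioms(2)[of k V] by (auto simp: abelian_group_def)

text \<open>The module laws are restated with \<open>module k V\<close> as a premise instead of
  being used through interpreted locales, because single statements below mix many modules, most of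
  them compound terms.\<close>

lemmas m_add [simp] = abelian_monoid.a_closed[OF m_abelian_monoid]
  and m_zero [simp] = abelian_monoid.zero_closed[OF m_abelian_monoid]
  and m_neg [simp] = abelian_group.a_inv_closed[OF m_abelian]
  and m_sub [simp] = abelian_group.minus_closed[OF m_abelian]
  and m_smult [simp] = module.smult_closed[where R = k]
  and m_lzero [simp] = abelian_monoid.l_zero[OF m_abelian_monoid]
  and m_rzero [simp] = abelian_monoid.r_zero[OF m_abelian_monoid]
  and m_lneg [simp] = abelian_group.l_neg[OF m_abelian]
  and m_rneg [simp] = abelian_group.r_neg[OF m_abelian]
  and m_negneg [simp] = abelian_group.minus_minus[OF m_abelian]
  and m_smult_zero [simp] = module.smult_r_null[where R = k]
  and m_zero_smult [simp] = module.smult_l_null[where R = k]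
  and m_one_smult [simp] = module.smult_one[where R = k]
  and m_assoc = abelian_monoid.a_assoc[OF m_abelian_monoid]
  and m_comm = abelian_monoid.a_comm[OF m_abelian_monoid]
  and m_lcomm = abelian_monoid.a_lcomm[OF m_abelian_monoid]
  and m_smult_add = module.smult_r_distr[where R = k]
  and m_add_smult = module.smult_l_distr[where R = k]
  and m_smult_smult = module.smult_assoc1[where R = k, symmetric]
  and m_neg_add = abelian_group.minus_add[OF m_abelian]
  and m_smult_neg = module.smult_r_minus[where R = k]

lemma m_neg_zero [simp]: "module k V ==> \<ominus>\<^bsub>V\<^esub> \<zero>\<^bsub>V\<^esub> = \<zero>\<^bsub>V\<^esub>"
  using m_lneg[of V "\<zero>\<^bsub>V\<^esub>"] by simp

lemma m_sub_eq: "module k V ==> x \<ominus>\<^bsub>V\<^esub> y = x \<oplus>\<^bsub>V\<^esub> \<ominus>\<^bsub>V\<^esub> y"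
  by (simp add: abelian_group.minus_eq[OF m_abelian] a_minus_def)

lemma m_sub_self [simp]: "module k V ==> x \<in> carrier V ==> x \<ominus>\<^bsub>V\<^esub> x = \<zero>\<^bsub>V\<^esub>"
  by (simp add: m_sub_eq)

lemma m_neg_smult: "module k V ==> x \<in> carrier V ==> \<ominus>\<^bsub>V\<^esub> x = (\<ominus>\<^bsub>k\<^esub> \<one>\<^bsub>k\<^esub>) \<odot>\<^bsub>V\<^esub> x"
  using module.smult_l_minus[of k V "\<one>\<^bsub>k\<^esub>" x] cring_k by (simp add: cring.cring_simprules)

lemma m_sub_zero_iff: "module k V ==> x \<in> carrier V ==> y \<in> carrier V ==> x \<ominus>\<^bsub>V\<^esub> y = \<zero>\<^bsub>V\<^esub> \<longleftrightarrow> x = y"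
proof -
  assume "module k V" and xy: "x \<in> carrier V" "y \<in> carrier V"
  then interpret V: module k V by simp
  show ?thesis using xy by (simp add: V.minus_eq V.add.inv_solve_right')
qed

lemmas m_ac = m_assoc m_comm m_lcomm

text \<open>Multiplication by -1 serves as the inverse, so the existential axiom for additive
  inverses becomes an equation that simplification can check.\<close>

lemma moduleI':
  assumes "\<And>x y. x \<in> carrier M ==> y \<in> carrier M ==> x \<oplus>\<^bsub>M\<^esub> y \<in> carrier M"
    and "\<zero>\<^bsub>M\<^esub> \<in> carrier M"
    and "\<And>x y z. x \<in> carrier M ==> y \<in> carrier M ==> z \<in> carrier M ==> x \<oplus>\<^bsub>M\<^esub> y \<oplus>\<^bsub>M\<^esub> z = x \<oplus>\<^bsub>M\<^esub> (y \<oplus>\<^bsub>M\<^esub> z)"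
    and "\<And>x y. x \<in> carrier M ==> y \<in> carrier M ==> x \<oplus>\<^bsub>M\<^esub> y = y \<oplus>\<^bsub>M\<^esub> x"
    and "\<And>x. x \<in> carrier M ==> \<zero>\<^bsub>M\<^esub> \<oplus>\<^bsub>M\<^esub> x = x"
    and "\<And>x. x \<in> carrier M ==> (\<ominus>\<^bsub>k\<^esub> \<one>\<^bsub>k\<^esub>) \<odot>\<^bsub>M\<^esub> x \<oplus>\<^bsub>M\<^esub> x = \<zero>\<^bsub>M\<^esub>"
    and "\<And>c x. c \<in> carrier k ==> x \<in> carrier M ==> c \<odot>\<^bsub>M\<^esub> x \<in> carrier M"
    and "\<And>c d x. c \<in> carrier k ==> d \<in> carrier k ==> x \<in> carrier M ==>
      (c \<oplus>\<^bsub>k\<^esub> d) \<odot>\<^bsub>M\<^esub> x = c \<odot>\<^bsub>M\<^esub> x \<oplus>\<^bsub>M\<^esub> d \<odot>\<^bsub>M\<^esub> x"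
    and "\<And>c x y. c \<in> carrier k ==> x \<in> carrier M ==> y \<in> carrier M ==>
      c \<odot>\<^bsub>M\<^esub> (x \<oplus>\<^bsub>M\<^esub> y) = c \<odot>\<^bsub>M\<^esub> x \<oplus>\<^bsub>M\<^esub> c \<odot>\<^bsub>M\<^esub> y"
    and "\<And>c d x. c \<in> carrier k ==> d \<in> carrier k ==> x \<in> carrier M ==>
      (c \<otimes>\<^bsub>k\<^esub> d) \<odot>\<^bsub>M\<^esub> x = c \<odot>\<^bsub>M\<^esub> (d \<odot>\<^bsub>M\<^esub> x)"
    and "\<And>x. x \<in> carrier M ==> \<one>\<^bsub>k\<^esub> \<odot>\<^bsub>M\<^esub> x = x"
  shows "module k M"
proof (rule moduleI)
  interpret k: cring k by (rule cring_k)
  have m1: "(\<ominus>\<^bsub>k\<^esub> \<one>\<^bsub>k\<^esub>) \<in> carrier k" by simp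
  show "abelian_group M"
  proof (rule abelian_groupI)
    show "\<exists>y\<in>carrier M. y \<oplus>\<^bsub>M\<^esub> x = \<zero>\<^bsub>M\<^esub>" if "x \<in> carrier M" for x
      using assms(6)[OF that] assms(7)[OF m1 that] by (rule bexI)
  qed (fact assms(1-5))+
qed (fact cring_k assms)+

abbreviation lin where "lin V W f \<equiv> linear_on k V W f"

lemma linI:
  assumes "\<And>x. x \<in> carrier V ==> f x \<in> carrier W"
    and "\<And>x y. x \<in> carrier V ==> y \<in> carrier V ==> f (x \<oplus>\<^bsub>V\<^esub> y) = f x \<oplus>\<^bsub>W\<^esub> f y"
    and "\<And>c x. c \<in> carrier k ==> x \<in> carrier V ==> f (c \<odot>\<^bsub>V\<^esub> x) = c \<odot>\<^bsub>W\<^esub> f x"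
  shows "lin V W f"
  using assms by (auto simp: linear_on_def)

lemma lin_closed: "lin V W f ==> x \<in> carrier V ==> f x \<in> carrier W"
  and lin_add: "lin V W f ==> x \<in> carrier V ==> y \<in> carrier V ==> f (x \<oplus>\<^bsub>V\<^esub> y) = f x \<oplus>\<^bsub>W\<^esub> f y"
  and lin_smult: "lin V W f ==> c \<in> carrier k ==> x \<in> carrier V ==> f (c \<odot>\<^bsub>V\<^esub> x) = c \<odot>\<^bsub>W\<^esub> f x"
  by (auto simp: linear_on_def)

lemma lin_zero: "module k V ==> module k W ==> lin V W f ==> f \<zero>\<^bsub>V\<^esub> = \<zero>\<^bsub>W\<^esub>"
proof -
  interpret k: cring k by (rule cring_k)
  assume a: "module k V" "module k W" "lin V W f"
  then have "f (\<zero>\<^bsub>k\<^esub> \<odot>\<^bsub>V\<^esub> \<zero>\<^bsub>V\<^esub>) = \<zero>\<^bsub>k\<^esub> \<odot>\<^bsub>W\<^esub> f \<zero>\<^bsub>V\<^esub>" by (intro lin_smult[OF a(3)]) auto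
  then show ?thesis using a lin_closed[OF a(3)] by simp
qed

lemma lin_neg: "module k V ==> module k W ==> lin V W f ==> x \<in> carrier V ==> f (\<ominus>\<^bsub>V\<^esub> x) = \<ominus>\<^bsub>W\<^esub> f x"
proof -
  interpret k: cring k by (rule cring_k)
  assume a: "module k V" "module k W" "lin V W f" "x \<in> carrier V"
  then show ?thesis using lin_closed[OF a(3)] by (simp add: m_neg_smult lin_smult[OF a(3)])
qed

lemma lin_sub: "module k V ==> module k W ==> lin V W f ==> x \<in> carrier V ==> y \<in> carrier V ==>
  f (x \<ominus>\<^bsub>V\<^esub> y) = f x \<ominus>\<^bsub>W\<^esub> f y"
  by (simp add: m_sub_eq lin_add[of V W f] lin_neg[of V W f])

lemma finsum_closed' [simp]: "module k V ==> f \<in> A \<rightarrow> carrier V ==> finsum V f A \<in> carrier V"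
  using abelian_monoid.finsum_closed m_abelian_monoid by blast

lemma lin_finsum:
  assumes "module k V" "module k W" "lin V W f" and "finite A" "g \<in> A \<rightarrow> carrier V"
  shows "f (finsum V g A) = finsum W (\<lambda>i. f (g i)) A"
  using assms(4,5)
proof (induction A)
  case empty
  then show ?case using assms
    by (simp add: abelian_monoid.finsum_empty[OF m_abelian_monoid] lin_zero)
next
  case (insert x F)
  then have "g \<in> F \<rightarrow> carrier V" "g x \<in> carrier V" by auto
  then show ?case using assms insert lin_closed[OF assms(3)]
    by (auto simp: Pi_def abelian_monoid.finsum_insert[OF m_abelian_monoid] lin_add[OF assms(3)])
qed

lemma lin_cong: "(\<And>x. x \<in> carrier V ==> f x = g x) ==> module k V ==> lin V W f \<longleftrightarrow> lin V W g"
  by (auto simp: linear_on_def Pi_def)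

lemma lin_id: "lin V V (\<lambda>x. x)"
  by (auto simp: linear_on_def)

lemma lin_comp: "lin V W f ==> lin W X g ==> lin V X (\<lambda>x. g (f x))"
  by (auto simp: linear_on_def Pi_def)

lemma lin_addf: "module k W ==> lin V W f ==> lin V W g ==> lin V W (\<lambda>x. f x \<oplus>\<^bsub>W\<^esub> g x)"
  by (auto simp: linear_on_def Pi_def m_ac m_smult_add)

lemma lin_smultf: "module k W ==> lin V W f ==> c \<in> carrier k ==> lin V W (\<lambda>x. c \<odot>\<^bsub>W\<^esub> f x)" (is "PROP ?g1")
proof -
  interpret k: cring k by (rule cring_k)
  show "PROP ?g1"
  by (auto simp: linear_on_def Pi_def m_smult_add m_smult_smult k.m_comm)
qed

lemma lin_negf: "module k W ==> lin V W f ==> lin V W (\<lambda>x. \<ominus>\<^bsub>W\<^esub> f x)"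
  by (auto simp: linear_on_def Pi_def m_neg_add m_smult_neg)

lemma lin_subf: "module k W ==> lin V W f ==> lin V W g ==> lin V W (\<lambda>x. f x \<ominus>\<^bsub>W\<^esub> g x)"
  by (simp add: m_sub_eq lin_addf lin_negf)

lemma lin_zerof: "module k W ==> lin V W (\<lambda>x. \<zero>\<^bsub>W\<^esub>)"
  by (auto simp: linear_on_def)

lemma lin_finsumf:
  assumes "module k W" "finite A" "\<And>i. i \<in> A ==> lin V W (f i)" and V: "module k V"
  shows "lin V W (\<lambda>x. finsum W (\<lambda>i. f i x) A)"
  using assms(2,3)
proof (induction A)
  case empty
  then show ?case using assms(1)
    by (simp add: abelian_monoid.finsum_empty[OF m_abelian_monoid] lin_zerof)
next
  case (insert a F)
  have "lin V W (\<lambda>x. f a x \<oplus>\<^bsub>W\<^esub> finsum W (\<lambda>i. f i x) F)"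
    by (rule lin_addf) (use insert assms in auto)
  moreover have "finsum W (\<lambda>i. f i x) (insert a F) = f a x \<oplus>\<^bsub>W\<^esub> finsum W (\<lambda>i. f i x) F" if "x \<in> carrier V" for x
    using insert that by (intro abelian_monoid.finsum_insert[OF m_abelian_monoid[OF assms(1)]])
      (auto intro: lin_closed)
  ultimately show ?case using V
    by (subst lin_cong) auto
qed

lemma lin_restrict: "module k V ==> lin V W (restrict f (carrier V)) \<longleftrightarrow> lin V W f"
  by (auto simp: linear_on_def Pi_def)

lemma Lin_iff: "f \<in> Lin k V W \<longleftrightarrow> f \<in> extensional (carrier V) \<and> lin V W f"
  by (simp add: Lin_def)

text \<open>Negation is multiplication by -1, so it needs no clause of its own.\<close>

lemma submod_iff: "module k M ==> submodule N k M \<longleftrightarrow> N \<subseteq> carrier M \<and> \<zero>\<^bsub>M\<^esub> \<in> N \<and>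
   (\<forall>x\<in>N. \<forall>y\<in>N. x \<oplus>\<^bsub>M\<^esub> y \<in> N) \<and> (\<forall>c\<in>carrier k. \<forall>x\<in>N. c \<odot>\<^bsub>M\<^esub> x \<in> N)" (is "_ ==> _ \<longleftrightarrow> ?r")
proof -
  assume M: "module k M"
  interpret k: cring k by (rule cring_k)
  interpret M: module k M by (rule M)
  show ?thesis
  proof
    assume s: "submodule N k M"
    show ?r using M.submoduleE[OF s] subgroup.one_closed[OF submodule.axioms(1)[OF s]] by auto
  next
    assume a: ?r
    show "submodule N k M"
    proof (rule M.submoduleI)
      fix x assume x: "x \<in> N"
      have "\<ominus>\<^bsub>k\<^esub> \<one>\<^bsub>k\<^esub> \<in> carrier k" by simp
      then show "\<ominus>\<^bsub>M\<^esub> x \<in> N" using a x m_neg_smult[OF M, of x] by auto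
    qed (use a in auto)
  qed
qed

lemma submod_neg: "module k M ==> submodule N k M ==> x \<in> N ==> \<ominus>\<^bsub>M\<^esub> x \<in> N"
  by (rule module.submoduleE(3))

lemma submod_sub: "module k M ==> submodule N k M ==> x \<in> N ==> y \<in> N ==> x \<ominus>\<^bsub>M\<^esub> y \<in> N"
  by (simp add: m_sub_eq submod_neg submod_iff)

lemma submod_gen:
  assumes "module k M" "X \<subseteq> carrier M"
  shows "submodule (submodule_gen k M X) k M" (is ?g3) "X \<subseteq> submodule_gen k M X" (is ?g2)
    "submodule N k M ==> X \<subseteq> N ==> submodule_gen k M X \<subseteq> N" (is "PROP ?g1")
proof -
  show ?g2 by (auto simp: submodule_gen_def)
  have "submodule (carrier M) k M" by (rule module.carrier_is_submodule[OF assms(1)])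
  then show ?g3
    using assms by (auto simp: submodule_gen_def submod_iff)
  show "PROP ?g1"
    by (auto simp: submodule_gen_def)
qed

lemma submod_vimage:
  assumes "module k V" "module k W" "lin V W f" "submodule N k W"
  shows "submodule {x \<in> carrier V. f x \<in> N} k V"
  using assms lin_closed[OF assms(3)]
  by (auto simp: submod_iff lin_add[OF assms(3)] lin_smult[OF assms(3)] lin_zero)

lemma submod_zero: "module k W ==> submodule {\<zero>\<^bsub>W\<^esub>} k W"
  by (auto simp: submod_iff)

lemma submod_image:
  assumes "module k V" "module k W" "lin V W f"
  shows "submodule (f ` carrier V) k W"
proof -
  have "\<exists>z\<in>carrier V. f x \<oplus>\<^bsub>W\<^esub> f y = f z" if "x \<in> carrier V" "y \<in> carrier V" for x y
    using that assms by (intro bexI[of _ "x \<oplus>\<^bsub>V\<^esub> y"]) (auto simp: lin_add[OF assms(3)])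
  moreover have "\<exists>z\<in>carrier V. c \<odot>\<^bsub>W\<^esub> f x = f z" if "x \<in> carrier V" "c \<in> carrier k" for x c
    using that assms by (intro bexI[of _ "c \<odot>\<^bsub>V\<^esub> x"]) (auto simp: lin_smult[OF assms(3)])
  moreover have "\<exists>z\<in>carrier V. \<zero>\<^bsub>W\<^esub> = f z"
    using assms by (intro bexI[of _ "\<zero>\<^bsub>V\<^esub>"]) (auto simp: lin_zero)
  ultimately show ?thesis using assms lin_closed[OF assms(3)] by (auto simp: submod_iff image_iff)
qed

text \<open>The preimage of a submodule is a submodule, so generators suffice. Both the tensor
  relations and the homogeneous parts of a tensor product are submodules given by generators, and
  they are handled in this way.\<close>

lemma lin_submodule_gen:
  assumes "module k V" "module k W" "lin V W f" "submodule N k W" "X \<subseteq> carrier V"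
    "\<And>x. x \<in> X ==> f x \<in> N" "x \<in> submodule_gen k V X"
  shows "f x \<in> N"
  using submod_gen(3)[OF assms(1,5) submod_vimage[OF assms(1,2,3,4)]] assms(5-7) by auto

section \<open>Quotient modules\<close>

lemma coset_eq_iff:
  assumes "module k M" "submodule N k M" "x \<in> carrier M" "y \<in> carrier M"
  shows "N +>\<^bsub>M\<^esub> x = N +>\<^bsub>M\<^esub> y \<longleftrightarrow> x \<ominus>\<^bsub>M\<^esub> y \<in> N"
proof -
  interpret M: module k M by fact
  interpret N: abelian_subgroup N M
    using assms(2) M.a_comm_group by (intro abelian_subgroupI2) (auto simp: submodule_def)
  have "N +>\<^bsub>M\<^esub> x = N +>\<^bsub>M\<^esub> y \<longleftrightarrow> x \<in> N +>\<^bsub>M\<^esub> y"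
    using assms(3,4) N.a_repr_independence'[of x y] N.a_repr_independenceD[of x y] by metis
  then show ?thesis
    using assms(3,4) N.a_rcos_module[of y x] by (simp add: M.minus_eq)
qed

lemma quot_simps [simp]:
  "carrier (quot_mod M N) = a_rcosets\<^bsub>M\<^esub> N"
  "\<zero>\<^bsub>quot_mod M N\<^esub> = N"
  "add (quot_mod M N) = set_add M"
  by (auto simp: quot_mod_def)

lemma rcosets_image: "a_rcosets\<^bsub>M\<^esub> N = (\<lambda>x. N +>\<^bsub>M\<^esub> x) ` carrier M"
  by (auto simp: A_RCOSETS_def' a_r_coset_def')

text \<open>The definite description in \<open>quot_map\<close> has a value because the coset
  contains x and because g, by the hypothesis on differences, is constant on it.\<close>

lemma quot_map_coset:
  assumes "module k M" "submodule N k M" "x \<in> carrier M"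
    "\<And>x y. x \<in> carrier M ==> y \<in> carrier M ==> x \<ominus>\<^bsub>M\<^esub> y \<in> N ==> g x = g y"
  shows "quot_map M N g (N +>\<^bsub>M\<^esub> x) = g x"
proof -
  interpret M: module k M by fact
  interpret N: abelian_subgroup N M
    using assms(2) M.a_comm_group by (intro abelian_subgroupI2) (auto simp: submodule_def)
  have x: "x \<in> N +>\<^bsub>M\<^esub> x" using assms N.a_rcos_self by simp
  have "g z = g x" if "z \<in> N +>\<^bsub>M\<^esub> x" for z
    using assms(3) that N.a_rcos_module[of x z] N.a_elemrcos_carrier[of x z]
    by (intro assms(4)) (auto simp: M.minus_eq)
  with x have "(THE y. \<forall>z\<in>N +>\<^bsub>M\<^esub> x. g z = y) = g x" by (intro the_equality) (blast, metis)
  moreover have "N +>\<^bsub>M\<^esub> x \<in> a_rcosets\<^bsub>M\<^esub> N" using assms(3) by (simp add: rcosets_image)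
  ultimately show ?thesis by (simp add: quot_map_def)
qed

lemma quot_add:
  assumes "module k M" "submodule N k M" "x \<in> carrier M" "y \<in> carrier M"
  shows "(N +>\<^bsub>M\<^esub> x) <+>\<^bsub>M\<^esub> (N +>\<^bsub>M\<^esub> y) = N +>\<^bsub>M\<^esub> (x \<oplus>\<^bsub>M\<^esub> y)"
proof -
  interpret M: module k M by fact
  interpret N: abelian_subgroup N M
    using assms(2) M.a_comm_group by (intro abelian_subgroupI2) (auto simp: submodule_def)
  show ?thesis using assms N.a_rcos_sum by simp
qed

lemma quot_zero:
  assumes "module k M" "submodule N k M"
  shows "N +>\<^bsub>M\<^esub> \<zero>\<^bsub>M\<^esub> = N"
proof -
  interpret M: module k M by fact
  show ?thesis using assms by (intro M.a_coset_add_zero) (auto simp: submod_iff)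
qed

lemma m_sub_smult: "module k V ==> c \<in> carrier k ==> x \<in> carrier V ==> y \<in> carrier V ==>
    c \<odot>\<^bsub>V\<^esub> x \<ominus>\<^bsub>V\<^esub> c \<odot>\<^bsub>V\<^esub> y = c \<odot>\<^bsub>V\<^esub> (x \<ominus>\<^bsub>V\<^esub> y)"
  by (simp add: m_sub_eq m_smult_add m_smult_neg)

lemma quot_smult:
  assumes "module k M" "submodule N k M" "x \<in> carrier M" "c \<in> carrier k"
  shows "c \<odot>\<^bsub>quot_mod M N\<^esub> (N +>\<^bsub>M\<^esub> x) = N +>\<^bsub>M\<^esub> (c \<odot>\<^bsub>M\<^esub> x)"
proof -
  have "quot_map M N (\<lambda>x. N +>\<^bsub>M\<^esub> (c \<odot>\<^bsub>M\<^esub> x)) (N +>\<^bsub>M\<^esub> x) = N +>\<^bsub>M\<^esub> (c \<odot>\<^bsub>M\<^esub> x)"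
    using assms by (intro quot_map_coset) (auto simp: coset_eq_iff m_sub_smult submod_iff)
  then show ?thesis by (simp add: quot_mod_def)
qed

lemma quot_module:
  assumes "module k M" "submodule N k M"
  shows "module k (quot_mod M N)"
proof -
  interpret k: cring k by (rule cring_k)
  note M = assms(1) and q = quot_add[OF assms] quot_smult[OF assms]
  note z = quot_zero[OF assms, symmetric]
  have m1: "\<ominus>\<^bsub>k\<^esub> \<one>\<^bsub>k\<^esub> \<in> carrier k" by simp
  show ?thesis
  proof (rule moduleI', goal_cases)
    case (2)
    then show ?case using M z by (auto simp: rcosets_image)
  next
    case (4 x y)
    then show ?case using M by (auto simp: rcosets_image q m_comm)
  next
    case (5 x)
    then obtain y where y: "y \<in> carrier M" "x = N +>\<^bsub>M\<^esub> y" by (auto simp: rcosets_image)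
    then have "(N +>\<^bsub>M\<^esub> \<zero>\<^bsub>M\<^esub>) <+>\<^bsub>M\<^esub> (N +>\<^bsub>M\<^esub> y) = N +>\<^bsub>M\<^esub> y" using M by (simp add: q)
    then show ?case using y by (simp add: z[symmetric])
  next
    case (6 x)
    then show ?case using M m1 by (auto simp: rcosets_image q m_neg_smult[symmetric] z[symmetric])
  qed (use M in "auto simp: rcosets_image q m_assoc m_add_smult m_smult_add m_smult_smult")
qed

lemma quot_proj_lin:
  assumes "module k M" "submodule N k M"
  shows "lin M (quot_mod M N) (\<lambda>x. N +>\<^bsub>M\<^esub> x)"
  using assms by (auto intro!: linI simp: rcosets_image quot_smult quot_add)

lemma quot_map_lin:
  assumes "module k M" "submodule N k M" "module k Y" "lin M Y g" "\<And>x. x \<in> N ==> g x = \<zero>\<^bsub>Y\<^esub>"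
  shows "lin (quot_mod M N) Y (quot_map M N g)" (is ?g2)
    "x \<in> carrier M ==> quot_map M N g (N +>\<^bsub>M\<^esub> x) = g x" (is "PROP ?g1")
proof -
  have w: "g x = g y" if "x \<in> carrier M" "y \<in> carrier M" "x \<ominus>\<^bsub>M\<^esub> y \<in> N" for x y
    using assms(5)[OF that(3)] that(1,2) lin_closed[OF assms(4)]
    by (simp add: lin_sub[OF assms(1,3,4)] m_sub_zero_iff[OF assms(3)])
  have q: "quot_map M N g (N +>\<^bsub>M\<^esub> x) = g x" if "x \<in> carrier M" for x
    by (rule quot_map_coset[OF assms(1,2) that w])
  then show "PROP ?g1" .
  show ?g2
    using assms(1) lin_closed[OF assms(4)]
    by (auto intro!: linI simp: rcosets_image quot_add[OF assms(1,2)] quot_smult[OF assms(1,2)] q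
      lin_add[OF assms(4)] lin_smult[OF assms(4)])
qed

section \<open>Tensor products of modules\<close>

lemma free_simps:
  "carrier (free_mod k X) = {f. f \<in> UNIV \<rightarrow> carrier k \<and> finite {x. f x \<noteq> \<zero>\<^bsub>k\<^esub>} \<and> {x. f x \<noteq> \<zero>\<^bsub>k\<^esub>} \<subseteq> X}"
  "\<zero>\<^bsub>free_mod k X\<^esub> = (\<lambda>_. \<zero>\<^bsub>k\<^esub>)"
  "f \<oplus>\<^bsub>free_mod k X\<^esub> g = (\<lambda>x. f x \<oplus>\<^bsub>k\<^esub> g x)"
  "c \<odot>\<^bsub>free_mod k X\<^esub> f = (\<lambda>x. c \<otimes>\<^bsub>k\<^esub> f x)"
  by (auto simp: free_mod_def)

lemma free_module: "module k (free_mod k X)"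
proof -
  interpret k: cring k by (rule cring_k)
  have fin: "finite {x. f x \<oplus>\<^bsub>k\<^esub> g x \<noteq> \<zero>\<^bsub>k\<^esub>}"
    if "finite {x. f x \<noteq> \<zero>\<^bsub>k\<^esub>}" "finite {x. g x \<noteq> \<zero>\<^bsub>k\<^esub>}" for f g :: "'a \<Rightarrow> 'k"
    by (rule finite_subset[of _ "{x. f x \<noteq> \<zero>\<^bsub>k\<^esub>} \<union> {x. g x \<noteq> \<zero>\<^bsub>k\<^esub>}"]) (use that in auto)
  have fin2: "finite {x. c \<otimes>\<^bsub>k\<^esub> g x \<noteq> \<zero>\<^bsub>k\<^esub>}"
    if "finite {x. g x \<noteq> \<zero>\<^bsub>k\<^esub>}" "c \<in> carrier k" for c and g :: "'a \<Rightarrow> 'k"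
    by (rule finite_subset[of _ "{x. g x \<noteq> \<zero>\<^bsub>k\<^esub>}"]) (use that in auto)
  have m1: "\<ominus>\<^bsub>k\<^esub> \<one>\<^bsub>k\<^esub> \<in> carrier k" by simp
  show ?thesis
  proof (rule moduleI', goal_cases)
    case (1 x y)
    have "{z. x z \<oplus>\<^bsub>k\<^esub> y z \<noteq> \<zero>\<^bsub>k\<^esub>} \<subseteq> {z. x z \<noteq> \<zero>\<^bsub>k\<^esub>} \<union> {z. y z \<noteq> \<zero>\<^bsub>k\<^esub>}" by auto
    then have "{z. x z \<oplus>\<^bsub>k\<^esub> y z \<noteq> \<zero>\<^bsub>k\<^esub>} \<subseteq> X" using 1 by (auto simp: free_simps)
    then show ?case using 1 by (auto simp: free_simps Pi_def fin)
  next
    case (7 c x)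
    then have "{z. c \<otimes>\<^bsub>k\<^esub> x z \<noteq> \<zero>\<^bsub>k\<^esub>} \<subseteq> {z. x z \<noteq> \<zero>\<^bsub>k\<^esub>}" by auto
    then have "{z. c \<otimes>\<^bsub>k\<^esub> x z \<noteq> \<zero>\<^bsub>k\<^esub>} \<subseteq> X" using 7 by (auto simp: free_simps)
    then show ?case using 7 by (auto simp: free_simps Pi_def fin2)
  next
    case (6 x)
    then show ?case by (auto simp: free_simps fun_eq_iff Pi_def k.l_minus k.l_neg)
  next
    case (10 c d x)
    then show ?case by (auto simp: free_simps fun_eq_iff Pi_def k.m_assoc)
  qed (auto simp: free_simps fun_eq_iff Pi_def k.a_ac k.l_distr k.r_distr)
qed

lemma free_gen_in: "x \<in> X ==> free_gen k x \<in> carrier (free_mod k X)"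
proof -
  interpret k: cring k by (rule cring_k)
  assume x: "x \<in> X"
  have "finite {y. (if y = x then \<one>\<^bsub>k\<^esub> else \<zero>\<^bsub>k\<^esub>) \<noteq> \<zero>\<^bsub>k\<^esub>}"
    by (rule finite_subset[of _ "{x}"]) auto
  then show ?thesis using x
    by (auto simp: free_simps free_gen_def)
qed

text \<open>Induction on the finite support: one point is erased and its value put back as a
  multiple of a generator.\<close>

lemma free_induct:
  assumes f: "f \<in> carrier (free_mod k X)"
    and z: "P \<zero>\<^bsub>free_mod k X\<^esub>"
    and s: "\<And>f c x. f \<in> carrier (free_mod k X) ==> c \<in> carrier k ==> x \<in> X ==> P f ==>
      P (f \<oplus>\<^bsub>free_mod k X\<^esub> c \<odot>\<^bsub>free_mod k X\<^esub> free_gen k x)"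
  shows "P f"
proof -
  interpret k: cring k by (rule cring_k)
  have "finite A ==> f \<in> carrier (free_mod k X) ==> {x. f x \<noteq> \<zero>\<^bsub>k\<^esub>} = A ==> P f" for A f
  proof (induction A arbitrary: f rule: finite_induct)
    case empty
    then have "f = \<zero>\<^bsub>free_mod k X\<^esub>" by (auto simp: free_simps fun_eq_iff)
    then show ?case using z by simp
  next
    case (insert a A)
    let ?g = "f(a := \<zero>\<^bsub>k\<^esub>)"
    have fz: "c \<in> carrier k ==> c \<otimes>\<^bsub>k\<^esub> \<one>\<^bsub>k\<^esub> = c" "c \<in> carrier k ==> c \<otimes>\<^bsub>k\<^esub> \<zero>\<^bsub>k\<^esub> = \<zero>\<^bsub>k\<^esub>"
      "c \<in> carrier k ==> c \<oplus>\<^bsub>k\<^esub> \<zero>\<^bsub>k\<^esub> = c" "c \<in> carrier k ==> \<zero>\<^bsub>k\<^esub> \<oplus>\<^bsub>k\<^esub> c = c" for c by auto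
    have sg: "{x. ?g x \<noteq> \<zero>\<^bsub>k\<^esub>} = A" using insert by auto
    moreover have g: "?g \<in> carrier (free_mod k X)" using insert sg
      by (auto simp: free_simps Pi_def)
    ultimately have "P ?g" using insert by blast
    moreover have "f a \<in> carrier k" "a \<in> X" using insert by (auto simp: free_simps)
    ultimately have "P (?g \<oplus>\<^bsub>free_mod k X\<^esub> f a \<odot>\<^bsub>free_mod k X\<^esub> free_gen k a)"
      using g by (intro s) auto
    moreover have "?g \<oplus>\<^bsub>free_mod k X\<^esub> f a \<odot>\<^bsub>free_mod k X\<^esub> free_gen k a = f"
      using insert.prems fz by (auto simp: free_simps free_gen_def fun_eq_iff Pi_def)
    ultimately show ?case by simp
  qed
  then show ?thesis using f by (auto simp: free_simps)
qed

lemma free_lift: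
  assumes Y: "module k Y" and b: "\<And>x. x \<in> X ==> b x \<in> carrier Y"
  shows "\<exists>g. lin (free_mod k X) Y g \<and> (\<forall>x\<in>X. g (free_gen k x) = b x)"
proof -
  interpret k: cring k by (rule cring_k)
  interpret Y: module k Y by (rule Y)
  define g where "g f = finsum Y (\<lambda>x. f x \<odot>\<^bsub>Y\<^esub> b x) {x. f x \<noteq> \<zero>\<^bsub>k\<^esub>}" for f
  \<comment> \<open>The sum may run over any finite set that contains the support. This allows the
    sums for f, f' and f + f' to be compared over one index set, although supports can shrink under
    addition.\<close>
  have g: "g f = finsum Y (\<lambda>x. f x \<odot>\<^bsub>Y\<^esub> b x) A"
    if "finite A" "{x. f x \<noteq> \<zero>\<^bsub>k\<^esub>} \<subseteq> A" "A \<subseteq> X" "f \<in> carrier (free_mod k X)" for f A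
    unfolding g_def using that b
    by (intro Y.add.finprod_mono_neutral_cong_left) (auto simp: free_simps Pi_def subset_iff)
  have ad: "g (f \<oplus>\<^bsub>free_mod k X\<^esub> f') = g f \<oplus>\<^bsub>Y\<^esub> g f'"
    if f: "f \<in> carrier (free_mod k X)" and f': "f' \<in> carrier (free_mod k X)" for f f'
  proof -
    let ?A = "{x. f x \<noteq> \<zero>\<^bsub>k\<^esub>} \<union> {x. f' x \<noteq> \<zero>\<^bsub>k\<^esub>}"
    have A: "finite ?A" "?A \<subseteq> X" using that by (auto simp: free_simps)
    have ff': "f \<oplus>\<^bsub>free_mod k X\<^esub> f' \<in> carrier (free_mod k X)"
      using f f' free_module[of X] by simp
    have "g (f \<oplus>\<^bsub>free_mod k X\<^esub> f') = finsum Y (\<lambda>x. (f \<oplus>\<^bsub>free_mod k X\<^esub> f') x \<odot>\<^bsub>Y\<^esub> b x) ?A"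
      using A ff' by (intro g) (auto simp: free_simps)
    also have "... = finsum Y (\<lambda>x. f x \<odot>\<^bsub>Y\<^esub> b x \<oplus>\<^bsub>Y\<^esub> f' x \<odot>\<^bsub>Y\<^esub> b x) ?A"
      using f f' A b by (intro Y.finsum_cong') (auto simp: free_simps Pi_def Y.smult_l_distr)
    also have "... = finsum Y (\<lambda>x. f x \<odot>\<^bsub>Y\<^esub> b x) ?A \<oplus>\<^bsub>Y\<^esub> finsum Y (\<lambda>x. f' x \<odot>\<^bsub>Y\<^esub> b x) ?A"
      using f f' A b by (intro Y.finsum_addf) (auto simp: free_simps Pi_def)
    also have "... = g f \<oplus>\<^bsub>Y\<^esub> g f'" using A f f' by (simp add: g[of ?A])
    finally show ?thesis .
  qed
  have cl: "g f \<in> carrier Y" if "f \<in> carrier (free_mod k X)" for f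
    unfolding g_def using that b by (intro Y.finsum_closed) (auto simp: free_simps Pi_def subset_iff)
  have sm: "g (c \<odot>\<^bsub>free_mod k X\<^esub> f) = c \<odot>\<^bsub>Y\<^esub> g f"
    if f: "f \<in> carrier (free_mod k X)" and c: "c \<in> carrier k" for c f
  proof -
    let ?A = "{x. f x \<noteq> \<zero>\<^bsub>k\<^esub>}"
    have A: "finite ?A" "?A \<subseteq> X" using that by (auto simp: free_simps)
    have ff': "c \<odot>\<^bsub>free_mod k X\<^esub> f \<in> carrier (free_mod k X)"
      using f c free_module[of X] by simp
    have "g (c \<odot>\<^bsub>free_mod k X\<^esub> f) = finsum Y (\<lambda>x. (c \<odot>\<^bsub>free_mod k X\<^esub> f) x \<odot>\<^bsub>Y\<^esub> b x) ?A"
      using A ff' c by (intro g) (auto simp: free_simps)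
    also have "... = finsum Y (\<lambda>x. c \<odot>\<^bsub>Y\<^esub> (f x \<odot>\<^bsub>Y\<^esub> b x)) ?A"
      using f A b c by (intro Y.finsum_cong') (auto simp: free_simps Pi_def Y.smult_assoc1)
    also have "... = c \<odot>\<^bsub>Y\<^esub> g f" unfolding g_def
      using f A b c by (intro Y.finsum_smult_ldistr[symmetric]) (auto simp: free_simps Pi_def)
    finally show ?thesis .
  qed
  have "g (free_gen k x) = b x" if x: "x \<in> X" for x
  proof -
    have "g (free_gen k x) = finsum Y (\<lambda>y. free_gen k x y \<odot>\<^bsub>Y\<^esub> b y) {x}"
      using x free_gen_in[OF x] by (intro g) (auto simp: free_gen_def)
    also have "... = b x" using b[OF x] by (simp add: free_gen_def Y.finsum_insert)
    finally show ?thesis .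
  qed
  then show ?thesis using ad cl sm by (intro exI[of _ g]) (auto intro!: linI)
qed

text \<open>The last clause is the universal property before passing to the quotient: a linear map
  that is bilinear on the generators kills every relation.\<close>

lemma tensor_rel_props:
  assumes V: "module k V" and W: "module k W"
  shows "submodule (tensor_rel k V W) k (free_mod k (carrier V \<times> carrier W))"
    "v \<in> carrier V ==> v' \<in> carrier V ==> w \<in> carrier W ==> free_gen k (v \<oplus>\<^bsub>V\<^esub> v', w)
      \<ominus>\<^bsub>free_mod k (carrier V \<times> carrier W)\<^esub> (free_gen k (v, w) \<oplus>\<^bsub>free_mod k (carrier V \<times> carrier W)\<^esub> free_gen k (v', w))
      \<in> tensor_rel k V W"
    "v \<in> carrier V ==> w \<in> carrier W ==> w' \<in> carrier W ==> free_gen k (v, w \<oplus>\<^bsub>W\<^esub> w')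
      \<ominus>\<^bsub>free_mod k (carrier V \<times> carrier W)\<^esub> (free_gen k (v, w) \<oplus>\<^bsub>free_mod k (carrier V \<times> carrier W)\<^esub> free_gen k (v, w'))
      \<in> tensor_rel k V W"
    "c \<in> carrier k ==> v \<in> carrier V ==> w \<in> carrier W ==> free_gen k (c \<odot>\<^bsub>V\<^esub> v, w)
      \<ominus>\<^bsub>free_mod k (carrier V \<times> carrier W)\<^esub> c \<odot>\<^bsub>free_mod k (carrier V \<times> carrier W)\<^esub> free_gen k (v, w)
      \<in> tensor_rel k V W"
    "c \<in> carrier k ==> v \<in> carrier V ==> w \<in> carrier W ==> free_gen k (v, c \<odot>\<^bsub>W\<^esub> w)
      \<ominus>\<^bsub>free_mod k (carrier V \<times> carrier W)\<^esub> c \<odot>\<^bsub>free_mod k (carrier V \<times> carrier W)\<^esub> free_gen k (v, w)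
      \<in> tensor_rel k V W"
    "\<And>Y g x. module k Y ==> lin (free_mod k (carrier V \<times> carrier W)) Y g ==>
      (\<forall>v\<in>carrier V. \<forall>v'\<in>carrier V. \<forall>w\<in>carrier W. g (free_gen k (v \<oplus>\<^bsub>V\<^esub> v', w)) = g (free_gen k (v,w)) \<oplus>\<^bsub>Y\<^esub> g (free_gen k (v', w))) ==>
      (\<forall>v\<in>carrier V. \<forall>w\<in>carrier W. \<forall>w'\<in>carrier W. g (free_gen k (v, w \<oplus>\<^bsub>W\<^esub> w')) = g (free_gen k (v,w)) \<oplus>\<^bsub>Y\<^esub> g (free_gen k (v, w'))) ==>
      (\<forall>c\<in>carrier k. \<forall>v\<in>carrier V. \<forall>w\<in>carrier W. g (free_gen k (c \<odot>\<^bsub>V\<^esub> v, w)) = c \<odot>\<^bsub>Y\<^esub> g (free_gen k (v,w))) ==>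
      (\<forall>c\<in>carrier k. \<forall>v\<in>carrier V. \<forall>w\<in>carrier W. g (free_gen k (v, c \<odot>\<^bsub>W\<^esub> w)) = c \<odot>\<^bsub>Y\<^esub> g (free_gen k (v,w))) ==>
      x \<in> tensor_rel k V W ==> g x = \<zero>\<^bsub>Y\<^esub>"
proof -
  let ?F = "free_mod k (carrier V \<times> carrier W)"
  let ?X = "{free_gen k (v \<oplus>\<^bsub>V\<^esub> v', w) \<ominus>\<^bsub>?F\<^esub> (free_gen k (v, w) \<oplus>\<^bsub>?F\<^esub> free_gen k (v', w)) | v v' w.
           v \<in> carrier V \<and> v' \<in> carrier V \<and> w \<in> carrier W} \<union>
       {free_gen k (v, w \<oplus>\<^bsub>W\<^esub> w') \<ominus>\<^bsub>?F\<^esub> (free_gen k (v, w) \<oplus>\<^bsub>?F\<^esub> free_gen k (v, w')) | v w w'.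
           v \<in> carrier V \<and> w \<in> carrier W \<and> w' \<in> carrier W} \<union>
       {free_gen k (c \<odot>\<^bsub>V\<^esub> v, w) \<ominus>\<^bsub>?F\<^esub> c \<odot>\<^bsub>?F\<^esub> free_gen k (v, w) | c v w.
           c \<in> carrier k \<and> v \<in> carrier V \<and> w \<in> carrier W} \<union>
       {free_gen k (v, c \<odot>\<^bsub>W\<^esub> w) \<ominus>\<^bsub>?F\<^esub> c \<odot>\<^bsub>?F\<^esub> free_gen k (v, w) | c v w.
           c \<in> carrier k \<and> v \<in> carrier V \<and> w \<in> carrier W}"
  have d: "tensor_rel k V W = submodule_gen k ?F ?X" by (simp add: tensor_rel_def Let_def)
  have F: "module k ?F" by (rule free_module)
  have fg [simp]: "free_gen k (v, w) \<in> carrier ?F" if "v \<in> carrier V" "w \<in> carrier W" for v w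
    using that by (intro free_gen_in) auto
  have X: "?X \<subseteq> carrier ?F" using F V W by (fastforce intro!: m_sub[OF F] m_add[OF F] m_smult[OF F])
  show "submodule (tensor_rel k V W) k ?F" unfolding d by (rule submod_gen(1)[OF F X])
  note X' = submod_gen(2)[OF F X, folded d]
  { assume "v \<in> carrier V" "v' \<in> carrier V" "w \<in> carrier W"
    then show "free_gen k (v \<oplus>\<^bsub>V\<^esub> v', w) \<ominus>\<^bsub>?F\<^esub> (free_gen k (v, w) \<oplus>\<^bsub>?F\<^esub> free_gen k (v', w)) \<in> tensor_rel k V W"
      by (intro subsetD[OF X']) blast }
  { assume "v \<in> carrier V" "w \<in> carrier W" "w' \<in> carrier W"
    then show "free_gen k (v, w \<oplus>\<^bsub>W\<^esub> w') \<ominus>\<^bsub>?F\<^esub> (free_gen k (v, w) \<oplus>\<^bsub>?F\<^esub> free_gen k (v, w')) \<in> tensor_rel k V W"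
      by (intro subsetD[OF X']) blast }
  { assume "c \<in> carrier k" "v \<in> carrier V" "w \<in> carrier W"
    then show "free_gen k (c \<odot>\<^bsub>V\<^esub> v, w) \<ominus>\<^bsub>?F\<^esub> c \<odot>\<^bsub>?F\<^esub> free_gen k (v, w) \<in> tensor_rel k V W"
      by (intro subsetD[OF X']) blast }
  { assume "c \<in> carrier k" "v \<in> carrier V" "w \<in> carrier W"
    then show "free_gen k (v, c \<odot>\<^bsub>W\<^esub> w) \<ominus>\<^bsub>?F\<^esub> c \<odot>\<^bsub>?F\<^esub> free_gen k (v, w) \<in> tensor_rel k V W"
      by (intro subsetD[OF X']) blast }
  fix Y :: "('k, 'z, 'y) module_scheme" and g x
  assume Y: "module k Y" and g: "lin ?F Y g"
    and b1: "\<forall>v\<in>carrier V. \<forall>v'\<in>carrier V. \<forall>w\<in>carrier W. g (free_gen k (v \<oplus>\<^bsub>V\<^esub> v', w)) = g (free_gen k (v,w)) \<oplus>\<^bsub>Y\<^esub> g (free_gen k (v', w))"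
    and b2: "\<forall>v\<in>carrier V. \<forall>w\<in>carrier W. \<forall>w'\<in>carrier W. g (free_gen k (v, w \<oplus>\<^bsub>W\<^esub> w')) = g (free_gen k (v,w)) \<oplus>\<^bsub>Y\<^esub> g (free_gen k (v, w'))"
    and b3: "\<forall>c\<in>carrier k. \<forall>v\<in>carrier V. \<forall>w\<in>carrier W. g (free_gen k (c \<odot>\<^bsub>V\<^esub> v, w)) = c \<odot>\<^bsub>Y\<^esub> g (free_gen k (v,w))"
    and b4: "\<forall>c\<in>carrier k. \<forall>v\<in>carrier V. \<forall>w\<in>carrier W. g (free_gen k (v, c \<odot>\<^bsub>W\<^esub> w)) = c \<odot>\<^bsub>Y\<^esub> g (free_gen k (v,w))"
    and x: "x \<in> tensor_rel k V W"
  note gs = lin_closed[OF g] lin_add[OF g] lin_smult[OF g] lin_sub[OF F Y g] m_sub_zero_iff[OF Y]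
  have gX: "g y \<in> {\<zero>\<^bsub>Y\<^esub>}" if "y \<in> ?X" for y
    using that F V W Y b1 b2 b3 b4 by (elim UnE CollectE exE conjE) (simp_all add: gs)
  show "g x = \<zero>\<^bsub>Y\<^esub>"
    using lin_submodule_gen[OF F Y g submod_zero[OF Y] X gX x[unfolded d]] by simp
qed

lemma tensor_module [simp]: "module k V ==> module k W ==> module k (tensor_mod k V W)"
  unfolding tensor_mod_def by (intro quot_module free_module tensor_rel_props)

lemma pt_in [simp]: "v \<in> carrier V ==> w \<in> carrier W ==> pt k V W v w \<in> carrier (tensor_mod k V W)"
  by (auto simp: pt_def tensor_mod_def rcosets_image intro!: imageI free_gen_in)

lemma pt_bilinear:
  assumes V: "module k V" and W: "module k W"
  shows "w \<in> carrier W ==> lin V (tensor_mod k V W) (\<lambda>v. pt k V W v w)" (is "PROP ?g2")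
    "v \<in> carrier V ==> lin W (tensor_mod k V W) (pt k V W v)" (is "PROP ?g1")
proof -
  note F = free_module[of "carrier V \<times> carrier W"] and R = tensor_rel_props(1)[OF V W]
  have fg [simp]: "free_gen k (v, w) \<in> carrier (free_mod k (carrier V \<times> carrier W))"
    if "v \<in> carrier V" "w \<in> carrier W" for v w
    using that by (intro free_gen_in) auto
  show "PROP ?g2"
    using F V W R
    by (intro linI) (auto simp: pt_def tensor_mod_def rcosets_image quot_add quot_smult coset_eq_iff
      intro!: tensor_rel_props)
  show "PROP ?g1"
    using F V W R
    by (intro linI) (auto simp: pt_def tensor_mod_def rcosets_image quot_add quot_smult coset_eq_iff
      intro!: tensor_rel_props)
qed

text \<open>Scalar multiples need no case: c (v \<otimes> w) is the pure tensor (c v) \<otimes> w,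
  and zero is the pure tensor of zeros.\<close>

lemma tens_induct [consumes 3, case_names pt add]:
  assumes V: "module k V" and W: "module k W" and t: "t \<in> carrier (tensor_mod k V W)"
    and p: "\<And>v w. v \<in> carrier V ==> w \<in> carrier W ==> P (pt k V W v w)"
    and a: "\<And>s t. s \<in> carrier (tensor_mod k V W) ==> t \<in> carrier (tensor_mod k V W) ==>
      P s ==> P t ==> P (s \<oplus>\<^bsub>tensor_mod k V W\<^esub> t)"
  shows "P t"
proof -
  interpret k: cring k by (rule cring_k)
  let ?F = "free_mod k (carrier V \<times> carrier W)" and ?R = "tensor_rel k V W" and ?T = "tensor_mod k V W"
  note F = free_module[of "carrier V \<times> carrier W"] and R = tensor_rel_props(1)[OF V W]
  note pr = quot_proj_lin[OF F R, folded tensor_mod_def]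
  have T: "module k ?T" using V W by simp
  obtain f where f: "f \<in> carrier ?F" "t = ?R +>\<^bsub>?F\<^esub> f"
    using t by (auto simp: tensor_mod_def rcosets_image)
  have z: "P \<zero>\<^bsub>?T\<^esub>"
    using p[of "\<zero>\<^bsub>V\<^esub>" "\<zero>\<^bsub>W\<^esub>"] V W lin_zero[OF V T pt_bilinear(1)[OF V W, of "\<zero>\<^bsub>W\<^esub>"]] by simp
  from f(1) have "P (?R +>\<^bsub>?F\<^esub> f)"
  proof (induction rule: free_induct[consumes 1, case_names 1 2])
    case 1
    then show ?case using z lin_zero[OF F T pr] by simp
  next
    case (2 f c x)
    obtain v w where x: "x = (v, w)" "v \<in> carrier V" "w \<in> carrier W" using 2 by auto
    have g: "free_gen k x \<in> carrier ?F" using 2 by (intro free_gen_in)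
    have "?R +>\<^bsub>?F\<^esub> (c \<odot>\<^bsub>?F\<^esub> free_gen k x) = pt k V W (c \<odot>\<^bsub>V\<^esub> v) w"
      using 2 x g lin_smult[OF pr] lin_smult[OF pt_bilinear(1)[OF V W]] by (simp add: pt_def)
    moreover have "P (pt k V W (c \<odot>\<^bsub>V\<^esub> v) w)" using p x 2 V by auto
    ultimately show ?case using 2 g F V x lin_add[OF pr] a[of "?R +>\<^bsub>?F\<^esub> f" "pt k V W (c \<odot>\<^bsub>V\<^esub> v) w"]
      lin_closed[OF pr] by simp
  qed
  then show ?thesis using f by simp
qed

lemma tens_ext:
  assumes "module k V" "module k W" "lin (tensor_mod k V W) X f" "lin (tensor_mod k V W) X g"
    "\<And>v w. v \<in> carrier V ==> w \<in> carrier W ==> f (pt k V W v w) = g (pt k V W v w)"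
    "t \<in> carrier (tensor_mod k V W)"
  shows "f t = g t"
  using assms(1,2,6)
  by (induction rule: tens_induct) (auto simp: assms(5) lin_add[OF assms(3)] lin_add[OF assms(4)])

section \<open>Bilinear maps and the universal property of the tensor product\<close>

definition bil where
  "bil V W X b \<longleftrightarrow> (\<forall>w\<in>carrier W. lin V X (\<lambda>v. b v w)) \<and> (\<forall>v\<in>carrier V. lin W X (b v))"

lemma bilI: "(\<And>w. w\<in>carrier W ==> lin V X (\<lambda>v. b v w)) ==> (\<And>v. v\<in>carrier V ==> lin W X (\<lambda>w. b v w)) ==> bil V W X b"
  by (auto simp: bil_def)

lemma bilD: "bil V W X b ==> w\<in>carrier W ==> lin V X (\<lambda>v. b v w)" "bil V W X b ==> v\<in>carrier V ==> lin W X (b v)"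
  by (auto simp: bil_def)

text \<open>\<open>bilift\<close> is a definite description, so nothing about it is known until
  existence and uniqueness are. Existence factors the lift from the free module through the
  relations; uniqueness takes extensionality outside the carrier besides agreement on pure
  tensors.\<close>

lemma bilift_props:
  assumes V: "module k V" and W: "module k W" and X: "module k X" and b: "bil V W X b"
  shows bilift_Lin: "bilift k V W X b \<in> Lin k (tensor_mod k V W) X"
    and bilift_pt: "v \<in> carrier V ==> w \<in> carrier W ==> bilift k V W X b (pt k V W v w) = b v w" (is "PROP ?g1")
proof -
  let ?F = "free_mod k (carrier V \<times> carrier W)" and ?R = "tensor_rel k V W" and ?T = "tensor_mod k V W"
  note F = free_module[of "carrier V \<times> carrier W"] and R = tensor_rel_props(1)[OF V W]
  have T: "module k ?T" using V W by simp
  note bD1 = lin_add[OF bilD(1)[OF b]] lin_smult[OF bilD(1)[OF b]] lin_closed[OF bilD(1)[OF b]]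
  note bD2 = lin_add[OF bilD(2)[OF b]] lin_smult[OF bilD(2)[OF b]] lin_closed[OF bilD(2)[OF b]]
  obtain g where g: "lin ?F X g" "\<And>v w. v \<in> carrier V ==> w \<in> carrier W ==> g (free_gen k (v, w)) = b v w"
    using free_lift[OF X, of "carrier V \<times> carrier W" "\<lambda>(v,w). b v w"] bD1(3) by auto
  have 0: "g x = \<zero>\<^bsub>X\<^esub>" if "x \<in> ?R" for x
    by (rule tensor_rel_props(6)[OF V W X g(1) _ _ _ _ that]) (use V W in "auto simp: g(2) bD1 bD2")
  define h where "h = restrict (quot_map ?F ?R g) (carrier ?T)"
  have h: "h \<in> Lin k ?T X"
    using quot_map_lin(1)[OF F R X g(1) 0, folded tensor_mod_def]
    by (auto simp: Lin_iff h_def lin_restrict[OF T])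
  have hp: "h (pt k V W v w) = b v w" if "v \<in> carrier V" "w \<in> carrier W" for v w
  proof -
    have "free_gen k (v,w) \<in> carrier ?F" using that by (intro free_gen_in) auto
    then show ?thesis using quot_map_lin(2)[OF F R X g(1) 0, of "free_gen k (v,w)"] that
      pt_in[OF that] by (simp add: h_def pt_def[symmetric] g(2))
  qed
  have "\<exists>!h. h \<in> Lin k ?T X \<and> (\<forall>v\<in>carrier V. \<forall>w\<in>carrier W. h (pt k V W v w) = b v w)"
  proof (rule ex1I[of _ h])
    show "h \<in> Lin k ?T X \<and> (\<forall>v\<in>carrier V. \<forall>w\<in>carrier W. h (pt k V W v w) = b v w)"
      using h hp by auto
    fix h' assume h': "h' \<in> Lin k ?T X \<and> (\<forall>v\<in>carrier V. \<forall>w\<in>carrier W. h' (pt k V W v w) = b v w)"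
    show "h' = h"
    proof (rule extensionalityI[of _ "carrier ?T"])
      show "h' x = h x" if "x \<in> carrier ?T" for x
        by (rule tens_ext[OF V W _ _ _ that, of X]) (use h h' hp in "auto simp: Lin_iff")
    qed (use h h' in "auto simp: Lin_iff")
  qed
  then have "bilift k V W X b \<in> Lin k ?T X \<and> (\<forall>v\<in>carrier V. \<forall>w\<in>carrier W. bilift k V W X b (pt k V W v w) = b v w)"
    unfolding bilift_def by (rule theI')
  then show "bilift k V W X b \<in> Lin k ?T X"
    "PROP ?g1" by auto
qed

lemma bilift_lin: "module k V ==> module k W ==> module k X ==> bil V W X b ==> lin (tensor_mod k V W) X (bilift k V W X b)"
  using bilift_Lin by (auto simp: Lin_iff)

text \<open>b inherits its bilinearity from the linear map G through the agreement on pure tensors,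
  so a lift can be recognised without analysing b.\<close>

lemma bilift_eq:
  assumes V: "module k V" and W: "module k W" and X: "module k X"
    and G: "lin (tensor_mod k V W) X G"
    and e: "\<And>v w. v \<in> carrier V ==> w \<in> carrier W ==> b v w = G (pt k V W v w)"
    and t: "t \<in> carrier (tensor_mod k V W)"
  shows "bilift k V W X b t = G t"
proof -
  have b: "bil V W X b"
  proof (rule bilI)
    fix w assume "w \<in> carrier W"
    then show "lin V X (\<lambda>v. b v w)"
      by (subst lin_cong[OF e V]) (auto intro: lin_comp[OF pt_bilinear(1)[OF V W] G])
  next
    fix v assume "v \<in> carrier V"
    then show "lin W X (\<lambda>w. b v w)"
      by (subst lin_cong[OF e W]) (auto intro: lin_comp[OF pt_bilinear(2)[OF V W] G])
  qed
  show ?thesis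
    by (rule tens_ext[OF V W bilift_lin[OF V W X b] G _ t]) (simp add: e bilift_pt[OF V W X b])
qed

lemma bilift_cong:
  assumes "\<And>v w. v \<in> carrier V ==> w \<in> carrier W ==> b v w = b' v w"
  shows "bilift k V W X b = bilift k V W X b'"
  unfolding bilift_def using assms by (metis (no_types, lifting))

text \<open>Modules, tensor products, linearity and lifts depend on a record only through carrier,
  addition, zero and scalar multiplication. The congruence rules from here on exchange records that
  share these fields, such as \<open>tensor_mod\<close>, \<open>tensor_alg\<close> and
  \<open>tensor_obj\<close>.\<close>

lemma module_congI:
  assumes "carrier V' = carrier V" "add V' = add V" "zero V' = zero V" "smult V' = smult V"
    and V: "module k V"
  shows "module k V'"
proof -
  interpret k: cring k by (rule cring_k)
  have "\<ominus>\<^bsub>k\<^esub> \<one>\<^bsub>k\<^esub> \<in> carrier k" by simp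
  then show ?thesis
    by (intro moduleI') (simp_all add: assms(1-4) V m_assoc m_add_smult m_smult_add m_smult_smult m_neg_smult[symmetric]
      m_comm[of V])
qed

lemma module_cong:
  "carrier V = carrier V' ==> add V = add V' ==> zero V = zero V' ==> smult V = smult V' ==>
   module k V \<longleftrightarrow> module k V'"
  by (metis module_congI)

lemma tensor_rel_cong:
  "carrier V = carrier V' ==> add V = add V' ==> smult V = smult V' ==>
   carrier W = carrier W' ==> add W = add W' ==> smult W = smult W' ==>
   tensor_rel k V W = tensor_rel k V' W'"
  by (simp add: tensor_rel_def)

lemma tensor_mod_cong:
  "carrier V = carrier V' ==> add V = add V' ==> smult V = smult V' ==>
   carrier W = carrier W' ==> add W = add W' ==> smult W = smult W' ==>
   tensor_mod k V W = tensor_mod k V' W'"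
  using tensor_rel_cong[of V V' W W'] by (simp add: tensor_mod_def)

lemma pt_cong:
  "carrier V = carrier V' ==> add V = add V' ==> smult V = smult V' ==>
   carrier W = carrier W' ==> add W = add W' ==> smult W = smult W' ==>
   pt k V W = pt k V' W'"
  using tensor_rel_cong[of V V' W W'] by (simp add: pt_def fun_eq_iff)

lemma linear_on_cong:
  "carrier V = carrier V' ==> add V = add V' ==> smult V = smult V' ==>
   carrier W = carrier W' ==> add W = add W' ==> smult W = smult W' ==>
   linear_on k V W = linear_on k V' W'"
  by (simp add: linear_on_def fun_eq_iff)

lemma bilift_mod_cong:
  "carrier V = carrier V' ==> add V = add V' ==> smult V = smult V' ==>
   carrier W = carrier W' ==> add W = add W' ==> smult W = smult W' ==>
   carrier X = carrier X' ==> add X = add X' ==> smult X = smult X' ==>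
   bilift k V W X b = bilift k V' W' X' b"
  using tensor_mod_cong[of V V' W W'] pt_cong[of V V' W W']
    linear_on_cong[OF refl refl refl, of X X' "tensor_mod k V W"]
  by (simp add: bilift_def Lin_def)

section \<open>Threefold and fourfold tensor products\<close>

abbreviation pure3 where
  "pure3 U V W u v w \<equiv> pt k (tensor_mod k U V) W (pt k U V u v) w"

abbreviation tens3 where
  "tens3 U V W \<equiv> tensor_mod k (tensor_mod k U V) W"

abbreviation pure4 where
  "pure4 U V W X u v w x \<equiv> pt k (tens3 U V W) X (pure3 U V W u v w) x"

abbreviation tens4 where
  "tens4 U V W X \<equiv> tensor_mod k (tens3 U V W) X"

definition quadlift where
  "quadlift U V W Y X b =
     bilift k (tens3 U V W) Y X (\<lambda>t y. trilift k U V W X (\<lambda>u v w. b u v w y) t)"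

definition tril where
  "tril U V W X b \<longleftrightarrow> (\<forall>v\<in>carrier V. \<forall>w\<in>carrier W. lin U X (\<lambda>u. b u v w)) \<and>
    (\<forall>u\<in>carrier U. \<forall>w\<in>carrier W. lin V X (\<lambda>v. b u v w)) \<and>
    (\<forall>u\<in>carrier U. \<forall>v\<in>carrier V. lin W X (\<lambda>w. b u v w))"

definition quadl where
  "quadl U V W Y X b \<longleftrightarrow>
    (\<forall>v\<in>carrier V. \<forall>w\<in>carrier W. \<forall>y\<in>carrier Y. lin U X (\<lambda>u. b u v w y)) \<and>
    (\<forall>u\<in>carrier U. \<forall>w\<in>carrier W. \<forall>y\<in>carrier Y. lin V X (\<lambda>v. b u v w y)) \<and>
    (\<forall>u\<in>carrier U. \<forall>v\<in>carrier V. \<forall>y\<in>carrier Y. lin W X (\<lambda>w. b u v w y)) \<and>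
    (\<forall>u\<in>carrier U. \<forall>v\<in>carrier V. \<forall>w\<in>carrier W. lin Y X (\<lambda>y. b u v w y))"

lemma trilI:
  "(\<And>v w. v\<in>carrier V ==> w\<in>carrier W ==> lin U X (\<lambda>u. b u v w)) ==>
   (\<And>u w. u\<in>carrier U ==> w\<in>carrier W ==> lin V X (\<lambda>v. b u v w)) ==>
   (\<And>u v. u\<in>carrier U ==> v\<in>carrier V ==> lin W X (\<lambda>w. b u v w)) ==> tril U V W X b"
  by (auto simp: tril_def)

lemma quadlI:
  "(\<And>v w y. v\<in>carrier V ==> w\<in>carrier W ==> y\<in>carrier Y ==> lin U X (\<lambda>u. b u v w y)) ==>
   (\<And>u w y. u\<in>carrier U ==> w\<in>carrier W ==> y\<in>carrier Y ==> lin V X (\<lambda>v. b u v w y)) ==>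
   (\<And>u v y. u\<in>carrier U ==> v\<in>carrier V ==> y\<in>carrier Y ==> lin W X (\<lambda>w. b u v w y)) ==>
   (\<And>u v w. u\<in>carrier U ==> v\<in>carrier V ==> w\<in>carrier W ==> lin Y X (\<lambda>y. b u v w y)) ==> quadl U V W Y X b"
  by (auto simp: quadl_def)

lemma lin_pt1: "module k V ==> module k W ==> lin Y V f ==> w \<in> carrier W ==> lin Y (tensor_mod k V W) (\<lambda>y. pt k V W (f y) w)"
  by (rule lin_comp[OF _ pt_bilinear(1)])

lemma lin_pt2: "module k V ==> module k W ==> lin Y W f ==> v \<in> carrier V ==> lin Y (tensor_mod k V W) (\<lambda>y. pt k V W v (f y))"
  by (rule lin_comp[OF _ pt_bilinear(2)])

lemma lin_bilift_arg: "module k A ==> module k B ==> module k X ==> bil A B X F ==> lin Y (tensor_mod k A B) f ==>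
   lin Y X (\<lambda>y. bilift k A B X F (f y))"
  by (rule lin_comp[OF _ bilift_lin])

text \<open>Linearity in a parameter y on which the bilinear map itself depends. For pure s it is
  the linearity of y \<mapsto> F y a b; sums of linear maps do the rest.\<close>

lemma lin_bilift_par:
  assumes "module k A" "module k B" "module k X" "module k Y"
   "\<And>y. y \<in> carrier Y ==> bil A B X (F y)"
   "\<And>a b. a \<in> carrier A ==> b \<in> carrier B ==> lin Y X (\<lambda>y. F y a b)" "s \<in> carrier (tensor_mod k A B)"
  shows "lin Y X (\<lambda>y. bilift k A B X (F y) s)"
  using assms(1,2,7)
proof (induction rule: tens_induct)
  case (pt a b)
  then show ?case using assms by (subst lin_cong[OF bilift_pt]) auto
next
  case (add s t)
  have "lin Y X (\<lambda>y. bilift k A B X (F y) s \<oplus>\<^bsub>X\<^esub> bilift k A B X (F y) t)"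
    using add assms by (intro lin_addf)
  then show ?case
    by (subst lin_cong[OF lin_add[OF bilift_lin[OF assms(1,2,3,5)]]]) (use add assms in auto)
qed

lemma bilift_push:
  assumes "module k V" "module k W" "module k X" "module k Z" "bil V W X b" "lin X Z f" "t \<in> carrier (tensor_mod k V W)"
  shows "f (bilift k V W X b t) = bilift k V W Z (\<lambda>v w. f (b v w)) t"
  by (rule bilift_eq[OF assms(1,2,4) lin_comp[OF bilift_lin[OF assms(1,2,3,5)] assms(6)] _ assms(7), symmetric])
    (simp add: bilift_pt assms)

lemma bilift_in: "module k V ==> module k W ==> module k X ==> bil V W X b ==> t \<in> carrier (tensor_mod k V W) ==>
   bilift k V W X b t \<in> carrier X"
  by (rule lin_closed[OF bilift_lin])

lemma bilift_pt_id: "module k V ==> module k W ==> t \<in> carrier (tensor_mod k V W) ==>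
   bilift k V W (tensor_mod k V W) (\<lambda>v w. pt k V W v w) t = t"
  by (rule bilift_eq) (auto intro: lin_id)

lemma trilift_props:
  assumes M: "module k U" "module k V" "module k W" "module k X" and b: "tril U V W X b"
  shows trilift_lin: "lin (tens3 U V W) X (trilift k U V W X b)" (is ?g1)
    and trilift_pt: "u \<in> carrier U ==> v \<in> carrier V ==> w \<in> carrier W ==>
       trilift k U V W X b (pure3 U V W u v w) = b u v w"
proof -
  have b1: "bil U V X (\<lambda>u v. b u v w)" if "w \<in> carrier W" for w
    using b that by (auto simp: bil_def tril_def)
  have b2: "bil (tensor_mod k U V) W X (\<lambda>t w. bilift k U V X (\<lambda>u v. b u v w) t)"
  proof (rule bilI)
    show "lin (tensor_mod k U V) X (\<lambda>t. bilift k U V X (\<lambda>u v. b u v w) t)" if "w \<in> carrier W" for w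
      using bilift_lin[OF M(1,2,4) b1[OF that]] .
    show "lin W X (\<lambda>w. bilift k U V X (\<lambda>u v. b u v w) t)" if "t \<in> carrier (tensor_mod k U V)" for t
      using M b1 that b by (intro lin_bilift_par) (auto simp: tril_def)
  qed
  show ?g1
    unfolding trilift_def using M b2 by (intro bilift_lin) auto
  show "trilift k U V W X b (pure3 U V W u v w) = b u v w" if "u \<in> carrier U" "v \<in> carrier V" "w \<in> carrier W"
    unfolding trilift_def using M b2 b1 that by (simp add: bilift_pt)
qed

lemma trilift_eq:
  assumes M: "module k U" "module k V" "module k W" "module k X"
    and G: "lin (tens3 U V W) X G"
    and e: "\<And>u v w. u \<in> carrier U ==> v \<in> carrier V ==> w \<in> carrier W ==> b u v w = G (pure3 U V W u v w)"
    and t: "t \<in> carrier (tens3 U V W)"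
  shows "trilift k U V W X b t = G t"
  unfolding trilift_def
proof (rule bilift_eq[OF _ M(3,4) G _ t])
  show "bilift k U V X (\<lambda>u v. b u v w) s = G (pt k (tensor_mod k U V) W s w)"
    if "s \<in> carrier (tensor_mod k U V)" "w \<in> carrier W" for s w
    by (rule bilift_eq[OF M(1,2,4) lin_comp[OF pt_bilinear(1) G]]) (use that M e in auto)
qed (use M in auto)

lemma trilift_in: "module k U ==> module k V ==> module k W ==> module k X ==> tril U V W X b ==> t \<in> carrier (tens3 U V W) ==>
   trilift k U V W X b t \<in> carrier X"
  by (rule lin_closed[OF trilift_lin])

lemma trilift_cong:
  assumes "\<And>u v w. u \<in> carrier U ==> v \<in> carrier V ==> w \<in> carrier W ==> b u v w = b' u v w"
  shows "trilift k U V W X b = trilift k U V W X b'"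
proof -
  have "bilift k U V X (\<lambda>u v. b u v w) = bilift k U V X (\<lambda>u v. b' u v w)" if "w \<in> carrier W" for w
    using assms that by (intro bilift_cong) auto
  then show ?thesis unfolding trilift_def by (intro bilift_cong) auto
qed

lemma tens3_induct [consumes 4, case_names pt add]:
  assumes M: "module k U" "module k V" "module k W" and t: "t \<in> carrier (tens3 U V W)"
    and p: "\<And>u v w. u \<in> carrier U ==> v \<in> carrier V ==> w \<in> carrier W ==> P (pure3 U V W u v w)"
    and a: "\<And>s t. s \<in> carrier (tens3 U V W) ==> t \<in> carrier (tens3 U V W) ==>
      P s ==> P t ==> P (s \<oplus>\<^bsub>tens3 U V W\<^esub> t)"
  shows "P t"
  using tensor_module[OF M(1,2)] M(3) t
proof (induction rule: tens_induct)
  case (pt s w)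
  have "s \<in> carrier (tensor_mod k U V)" by fact
  with M(1,2) show ?case
  proof (induction rule: tens_induct)
    case (add s t)
    then show ?case using pt M a by (subst lin_add[OF pt_bilinear(1)]) auto
  qed (use p pt in auto)
qed (use a in auto)

lemma tens3_ext:
  assumes "module k U" "module k V" "module k W" "lin (tens3 U V W) X f" "lin (tens3 U V W) X g"
    "\<And>u v w. u \<in> carrier U ==> v \<in> carrier V ==> w \<in> carrier W ==> f (pure3 U V W u v w) = g (pure3 U V W u v w)"
    "t \<in> carrier (tens3 U V W)"
  shows "f t = g t"
  using assms(1,2,3,7)
  by (induction rule: tens3_induct) (auto simp: assms(6) lin_add[OF assms(4)] lin_add[OF assms(5)])

lemma tens4_ext:
  assumes M: "module k U" "module k V" "module k W" "module k Y"
    and f: "lin (tens4 U V W Y) X f" and g: "lin (tens4 U V W Y) X g"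
    and e: "\<And>u v w y. u \<in> carrier U ==> v \<in> carrier V ==> w \<in> carrier W ==> y \<in> carrier Y ==>
       f (pure4 U V W Y u v w y) = g (pure4 U V W Y u v w y)"
    and t: "t \<in> carrier (tens4 U V W Y)"
  shows "f t = g t"
proof (rule tens_ext[OF _ M(4) f g _ t])
  show "f (pt k (tens3 U V W) Y s y) = g (pt k (tens3 U V W) Y s y)"
    if "s \<in> carrier (tens3 U V W)" "y \<in> carrier Y" for s y
    by (rule tens3_ext[OF M(1,2,3) lin_comp[OF pt_bilinear(1) f] lin_comp[OF pt_bilinear(1) g]])
      (use that M e in auto)
qed (use M in auto)

lemma trilift_push:
  assumes "module k U" "module k V" "module k W" "module k X" "module k Z" "tril U V W X b" "lin X Z f" "t \<in> carrier (tens3 U V W)"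
  shows "f (trilift k U V W X b t) = trilift k U V W Z (\<lambda>u v w. f (b u v w)) t"
  by (rule trilift_eq[OF assms(1,2,3,5) lin_comp[OF trilift_lin[OF assms(1,2,3,4,6)] assms(7)] _ assms(8), symmetric])
    (simp add: trilift_pt assms)

lemma trilift_pt_id: "module k U ==> module k V ==> module k W ==> t \<in> carrier (tens3 U V W) ==>
   trilift k U V W (tens3 U V W) (\<lambda>u v w. pure3 U V W u v w) t = t"
  by (rule trilift_eq) (auto intro: lin_id)

lemma lin_trilift_arg: "module k U ==> module k V ==> module k W ==> module k X ==> tril U V W X F ==> lin Y (tens3 U V W) f ==>
   lin Y X (\<lambda>y. trilift k U V W X F (f y))"
  by (rule lin_comp[OF _ trilift_lin])

lemma lin_trilift_par:
  assumes M: "module k U" "module k V" "module k W" "module k X" "module k Y"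
   and F: "\<And>y. y \<in> carrier Y ==> tril U V W X (F y)"
   "\<And>a b c. a \<in> carrier U ==> b \<in> carrier V ==> c \<in> carrier W ==> lin Y X (\<lambda>y. F y a b c)"
   and s: "s \<in> carrier (tens3 U V W)"
  shows "lin Y X (\<lambda>y. trilift k U V W X (F y) s)"
  using M(1,2,3) s
proof (induction rule: tens3_induct)
  case (pt a b c)
  then show ?case using M F by (subst lin_cong[OF trilift_pt]) auto
next
  case (add s t)
  have "lin Y X (\<lambda>y. trilift k U V W X (F y) s \<oplus>\<^bsub>X\<^esub> trilift k U V W X (F y) t)"
    using add M by (intro lin_addf)
  then show ?case
    by (subst lin_cong[OF lin_add[OF trilift_lin[OF M(1-4) F(1)]]]) (use add M in auto)
qed

lemma quadlift_props:
  assumes M: "module k U" "module k V" "module k W" "module k Y" "module k X" and b: "quadl U V W Y X b"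
  shows quadlift_lin: "lin (tens4 U V W Y) X (quadlift U V W Y X b)" (is ?g1)
    and quadlift_pt: "u \<in> carrier U ==> v \<in> carrier V ==> w \<in> carrier W ==> y \<in> carrier Y ==>
       quadlift U V W Y X b (pure4 U V W Y u v w y) = b u v w y"
proof -
  have b1: "tril U V W X (\<lambda>u v w. b u v w y)" if "y \<in> carrier Y" for y
    using b that by (auto simp: quadl_def tril_def)
  have b2: "bil (tens3 U V W) Y X (\<lambda>t y. trilift k U V W X (\<lambda>u v w. b u v w y) t)"
  proof (rule bilI)
    show "lin (tens3 U V W) X (\<lambda>t. trilift k U V W X (\<lambda>u v w. b u v w y) t)" if "y \<in> carrier Y" for y
      using trilift_lin[OF M(1,2,3,5) b1[OF that]] .
    show "lin Y X (\<lambda>y. trilift k U V W X (\<lambda>u v w. b u v w y) t)" if "t \<in> carrier (tens3 U V W)" for t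
      using M b1 that b by (intro lin_trilift_par) (auto simp: quadl_def)
  qed
  show ?g1
    unfolding quadlift_def using M b2 by (intro bilift_lin) auto
  show "quadlift U V W Y X b (pure4 U V W Y u v w y) = b u v w y" if "u \<in> carrier U" "v \<in> carrier V" "w \<in> carrier W" "y \<in> carrier Y"
    unfolding quadlift_def using M b2 b1 that by (simp add: bilift_pt trilift_pt)
qed

section \<open>Maps between tensor products\<close>

lemma tmap_bil:
  assumes "module k V" "module k W" "module k X" "module k Y" "lin V X f" "lin W Y g"
  shows "bil V W (tensor_mod k X Y) (\<lambda>v w. pt k X Y (f v) (g w))"
  by (rule bilI) (use assms in "auto intro: lin_pt1 lin_pt2 lin_closed")

lemma tmap_lin:
  assumes "module k V" "module k W" "module k X" "module k Y" "lin V X f" "lin W Y g"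
  shows "lin (tensor_mod k V W) (tensor_mod k X Y) (tensor_map k V W X Y f g)"
  unfolding tensor_map_def using assms by (intro bilift_lin tmap_bil) auto

lemma tmap_pt:
  assumes "module k V" "module k W" "module k X" "module k Y" "lin V X f" "lin W Y g" "v \<in> carrier V" "w \<in> carrier W"
  shows "tensor_map k V W X Y f g (pt k V W v w) = pt k X Y (f v) (g w)"
  unfolding tensor_map_def using assms by (intro bilift_pt tmap_bil) auto

lemma tmap_cong:
  assumes "\<And>v. v \<in> carrier V ==> f v = f' v" "\<And>w. w \<in> carrier W ==> g w = g' w"
  shows "tensor_map k V W X Y f g = tensor_map k V W X Y f' g'"
  unfolding tensor_map_def using assms by (intro bilift_cong) auto

lemma tmap_comp:
  assumes "module k V" "module k W" "module k X" "module k Y" "module k X'" "module k Y'"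
    "lin V X f" "lin W Y g" "lin X X' f'" "lin Y Y' g'" "t \<in> carrier (tensor_mod k V W)"
  shows "tensor_map k X Y X' Y' f' g' (tensor_map k V W X Y f g t) =
    tensor_map k V W X' Y' (\<lambda>x. f' (f x)) (\<lambda>x. g' (g x)) t"
  by (rule tens_ext[OF assms(1,2) lin_comp[OF tmap_lin tmap_lin] tmap_lin _ assms(11)])
    (use assms in "auto simp: tmap_pt lin_closed[of V X f] lin_closed[of W Y g] lin_comp[of V X f X' f'] lin_comp[of W Y g Y' g']")

lemma tmap_id:
  assumes "module k V" "module k W" "t \<in> carrier (tensor_mod k V W)"
  shows "tensor_map k V W V W (\<lambda>x. x) (\<lambda>x. x) t = t"
  by (rule tens_ext[OF assms(1,2) tmap_lin lin_id _ assms(3)]) (use assms in "auto simp: tmap_pt lin_id")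

lemma lin_tmap_par1:
  assumes M: "module k V" "module k W" "module k X" "module k Y" "module k Z"
    and f: "\<And>z. z \<in> carrier Z ==> lin V X (f z)" "\<And>v. v \<in> carrier V ==> lin Z X (\<lambda>z. f z v)"
    and g: "lin W Y g" and t: "t \<in> carrier (tensor_mod k V W)"
  shows "lin Z (tensor_mod k X Y) (\<lambda>z. tensor_map k V W X Y (f z) g t)"
  unfolding tensor_map_def
  by (intro lin_bilift_par) (use M f g t in "auto intro!: tmap_bil lin_pt1 lin_closed[OF g]")

lemma lin_tmap_par2:
  assumes M: "module k V" "module k W" "module k X" "module k Y" "module k Z"
    and f: "\<And>z. z \<in> carrier Z ==> lin W Y (f z)" "\<And>v. v \<in> carrier W ==> lin Z Y (\<lambda>z. f z v)"
    and g: "lin V X g" and t: "t \<in> carrier (tensor_mod k V W)"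
  shows "lin Z (tensor_mod k X Y) (\<lambda>z. tensor_map k V W X Y g (f z) t)"
  unfolding tensor_map_def
  by (intro lin_bilift_par) (use M f g t in "auto intro!: tmap_bil lin_pt2 lin_closed[OF g]")

section \<open>Tensor products of algebras\<close>

lemma alg_module: "assoc_alg k A ==> module k A"
  and alg_mult_in [simp]: "assoc_alg k A ==> x \<in> carrier A ==> y \<in> carrier A ==> x \<otimes>\<^bsub>A\<^esub> y \<in> carrier A"
  and alg_one_in [simp]: "assoc_alg k A ==> \<one>\<^bsub>A\<^esub> \<in> carrier A"
  and alg_lone [simp]: "assoc_alg k A ==> x \<in> carrier A ==> \<one>\<^bsub>A\<^esub> \<otimes>\<^bsub>A\<^esub> x = x"
  and alg_rone [simp]: "assoc_alg k A ==> x \<in> carrier A ==> x \<otimes>\<^bsub>A\<^esub> \<one>\<^bsub>A\<^esub> = x"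
  and alg_assoc: "assoc_alg k A ==> x \<in> carrier A ==> y \<in> carrier A ==> z \<in> carrier A ==>
     x \<otimes>\<^bsub>A\<^esub> y \<otimes>\<^bsub>A\<^esub> z = x \<otimes>\<^bsub>A\<^esub> (y \<otimes>\<^bsub>A\<^esub> z)"
  by (auto simp: assoc_alg_def ring_def monoid.m_closed monoid.one_closed monoid.m_assoc)

lemma alg_bil: "assoc_alg k A ==> bil A A A (\<lambda>x y. x \<otimes>\<^bsub>A\<^esub> y)"
  by (intro bilI linI) (auto simp: assoc_alg_def ring.ring_simprules(5,13,23))

lemma lin_mult1: "assoc_alg k A ==> lin Y A f ==> a \<in> carrier A ==> lin Y A (\<lambda>y. f y \<otimes>\<^bsub>A\<^esub> a)"
  by (rule lin_comp[OF _ bilD(1)[OF alg_bil]])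

lemma lin_mult2: "assoc_alg k A ==> lin Y A f ==> a \<in> carrier A ==> lin Y A (\<lambda>y. a \<otimes>\<^bsub>A\<^esub> f y)"
  by (rule lin_comp[OF _ bilD(2)[OF alg_bil]])

lemma assoc_algI:
  assumes M: "module k A" and b: "bil A A A (\<lambda>x y. x \<otimes>\<^bsub>A\<^esub> y)" and o: "\<one>\<^bsub>A\<^esub> \<in> carrier A"
    and l: "\<And>x. x \<in> carrier A ==> \<one>\<^bsub>A\<^esub> \<otimes>\<^bsub>A\<^esub> x = x" "\<And>x. x \<in> carrier A ==> x \<otimes>\<^bsub>A\<^esub> \<one>\<^bsub>A\<^esub> = x"
    and a: "\<And>x y z. x \<in> carrier A ==> y \<in> carrier A ==> z \<in> carrier A ==> x \<otimes>\<^bsub>A\<^esub> y \<otimes>\<^bsub>A\<^esub> z = x \<otimes>\<^bsub>A\<^esub> (y \<otimes>\<^bsub>A\<^esub> z)"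
  shows "assoc_alg k A"
proof -
  have "ring A"
  proof (rule ringI)
    show "Group.monoid A"
    proof (rule monoidI)
      show "x \<otimes>\<^bsub>A\<^esub> y \<in> carrier A" if "x \<in> carrier A" "y \<in> carrier A" for x y
        using lin_closed[OF bilD(2)[OF b that(1)] that(2)] .
    qed (fact o l a)+
    show "x \<in> carrier A ==> y \<in> carrier A ==> z \<in> carrier A ==> (x \<oplus>\<^bsub>A\<^esub> y) \<otimes>\<^bsub>A\<^esub> z = x \<otimes>\<^bsub>A\<^esub> z \<oplus>\<^bsub>A\<^esub> y \<otimes>\<^bsub>A\<^esub> z" for x y z
      by (rule lin_add[OF bilD(1)[OF b]])
    show "x \<in> carrier A ==> y \<in> carrier A ==> z \<in> carrier A ==> z \<otimes>\<^bsub>A\<^esub> (x \<oplus>\<^bsub>A\<^esub> y) = z \<otimes>\<^bsub>A\<^esub> x \<oplus>\<^bsub>A\<^esub> z \<otimes>\<^bsub>A\<^esub> y" for x y z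
      by (rule lin_add[OF bilD(2)[OF b]])
  qed (rule m_abelian[OF M])
  then show ?thesis using M lin_smult[OF bilD(1)[OF b]] lin_smult[OF bilD(2)[OF b]] by (auto simp: assoc_alg_def)
qed

lemma tensor_alg_simps [simp]:
  "carrier (tensor_alg k A B) = carrier (tensor_mod k A B)"
  "add (tensor_alg k A B) = add (tensor_mod k A B)"
  "zero (tensor_alg k A B) = zero (tensor_mod k A B)"
  "smult (tensor_alg k A B) = smult (tensor_mod k A B)"
  "one (tensor_alg k A B) = pt k A B \<one>\<^bsub>A\<^esub> \<one>\<^bsub>B\<^esub>"
  by (auto simp: tensor_alg_def)

text \<open>\<open>tensor_alg\<close> only adds a product and a unit to \<open>tensor_mod\<close>.
  Rewriting towards \<open>tensor_mod\<close> gives one normal form for the algebras H \<otimes> H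
  and (H \<otimes> H) \<otimes> H of the axioms and the modules used in computations.\<close>

lemma alg_norm [simp]:
  "tensor_mod k (tensor_alg k A B) W = tensor_mod k (tensor_mod k A B) W"
  "pt k (tensor_alg k A B) W = pt k (tensor_mod k A B) W"
  "linear_on k (tensor_alg k A B) = linear_on k (tensor_mod k A B)"
  "linear_on k Y (tensor_alg k A B) = linear_on k Y (tensor_mod k A B)"
  "bilift k X Y (tensor_alg k A B) = bilift k X Y (tensor_mod k A B)"
  "module k (tensor_alg k A B) = module k (tensor_mod k A B)"
  by (intro tensor_mod_cong pt_cong linear_on_cong module_cong ext bilift_mod_cong; simp)+

lemma alg_norm_trilift [simp]: "trilift k X Y Z (tensor_alg k A B) = trilift k X Y Z (tensor_mod k A B)"
  by (simp add: trilift_def fun_eq_iff)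

lemma tensor_mult_bil:
  assumes A: "assoc_alg k A" and B: "assoc_alg k B"
  shows "bil (tensor_mod k A B) (tensor_mod k A B) (tensor_mod k A B) (\<lambda>s t. s \<otimes>\<^bsub>tensor_alg k A B\<^esub> t)" (is ?g2)
    and "a \<in> carrier A ==> b \<in> carrier B ==> a' \<in> carrier A ==> b' \<in> carrier B ==>
      pt k A B a b \<otimes>\<^bsub>tensor_alg k A B\<^esub> pt k A B a' b' = pt k A B (a \<otimes>\<^bsub>A\<^esub> a') (b \<otimes>\<^bsub>B\<^esub> b')" (is "PROP ?g1")
proof -
  note M = alg_module[OF A] alg_module[OF B]
  \<comment> \<open>The inner lift of the product is the tensor map of two left multiplications,
    whose linearity is already known.\<close>
  have d: "s \<otimes>\<^bsub>tensor_alg k A B\<^esub> t = bilift k A B (tensor_mod k A B) (\<lambda>a b.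
     tensor_map k A B A B (\<lambda>x. a \<otimes>\<^bsub>A\<^esub> x) (\<lambda>x. b \<otimes>\<^bsub>B\<^esub> x) t) s" for s t
    by (simp add: tensor_alg_def tensor_map_def)
  have t: "bil A B (tensor_mod k A B) (\<lambda>a b. tensor_map k A B A B (\<lambda>x. a \<otimes>\<^bsub>A\<^esub> x) (\<lambda>x. b \<otimes>\<^bsub>B\<^esub> x) t)"
    if "t \<in> carrier (tensor_mod k A B)" for t
    using that M A B by (intro bilI lin_tmap_par1 lin_tmap_par2 lin_mult1 lin_mult2 lin_id) auto
  show ?g2
    unfolding d
    by (intro bilI lin_bilift_arg lin_bilift_par t tmap_lin lin_id lin_mult2) (use M A B in auto)
  show "PROP ?g1"
    unfolding d using M A B t
    by (simp add: bilift_pt tmap_pt lin_mult2 lin_id)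
qed

lemmas tensor_mult_pt = tensor_mult_bil(2)

lemma tensor_assoc_alg [simp]:
  assumes A: "assoc_alg k A" and B: "assoc_alg k B"
  shows "assoc_alg k (tensor_alg k A B)"
proof -
  note M = alg_module[OF A] alg_module[OF B] and b = tensor_mult_bil(1)[OF A B] and p = tensor_mult_pt[OF A B]
  note add1 = lin_add[OF bilD(1)[OF b]] and add2 = lin_add[OF bilD(2)[OF b]]
    and cl = lin_closed[OF bilD(1)[OF b]]
  show ?thesis
  proof (rule assoc_algI)
    fix x y z
    assume x: "x \<in> carrier (tensor_alg k A B)" and y: "y \<in> carrier (tensor_alg k A B)" and z: "z \<in> carrier (tensor_alg k A B)"
    from M x[simplified] show "x \<otimes>\<^bsub>tensor_alg k A B\<^esub> y \<otimes>\<^bsub>tensor_alg k A B\<^esub> z =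
      x \<otimes>\<^bsub>tensor_alg k A B\<^esub> (y \<otimes>\<^bsub>tensor_alg k A B\<^esub> z)"
    proof (induction rule: tens_induct)
      case (pt v w)
      from M y[simplified] show ?case
      proof (induction rule: tens_induct)
        case (pt v' w')
        from M z[simplified] show ?case
          by (induction rule: tens_induct) (use pt \<open>v \<in> carrier A\<close> \<open>w \<in> carrier B\<close> A B in "auto simp: p alg_assoc add2 cl")
      qed (use pt z in "auto simp: add1 add2 cl")
    qed (use y z in "auto simp: add1 cl")
  next
    fix x assume "x \<in> carrier (tensor_alg k A B)"
    then have x: "x \<in> carrier (tensor_mod k A B)" by simp
    have o: "pt k A B \<one>\<^bsub>A\<^esub> \<one>\<^bsub>B\<^esub> \<in> carrier (tensor_mod k A B)" using A B by simp
    from M x show "\<one>\<^bsub>tensor_alg k A B\<^esub> \<otimes>\<^bsub>tensor_alg k A B\<^esub> x = x"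
      by (induction rule: tens_induct) (use A B o in "auto simp: p add2")
    from M x show "x \<otimes>\<^bsub>tensor_alg k A B\<^esub> \<one>\<^bsub>tensor_alg k A B\<^esub> = x"
      by (induction rule: tens_induct) (use A B o in "auto simp: p add1")
  qed (use b A B M in "auto simp: bil_def")
qed

lemma lin_tmult1: "assoc_alg k A ==> assoc_alg k B ==> lin Y (tensor_mod k A B) f ==> a \<in> carrier (tensor_mod k A B) ==>
    lin Y (tensor_mod k A B) (\<lambda>y. f y \<otimes>\<^bsub>tensor_alg k A B\<^esub> a)"
  using lin_mult1[of "tensor_alg k A B" Y f a] by simp

lemma lin_tmult2: "assoc_alg k A ==> assoc_alg k B ==> lin Y (tensor_mod k A B) f ==> a \<in> carrier (tensor_mod k A B) ==>
    lin Y (tensor_mod k A B) (\<lambda>y. a \<otimes>\<^bsub>tensor_alg k A B\<^esub> f y)"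
  using lin_mult2[of "tensor_alg k A B" Y f a] by simp

lemma tens_mult_in [simp]:
  "assoc_alg k A ==> assoc_alg k B ==> s \<in> carrier (tensor_mod k A B) ==> t \<in> carrier (tensor_mod k A B) ==>
    s \<otimes>\<^bsub>tensor_alg k A B\<^esub> t \<in> carrier (tensor_mod k A B)"
  using alg_mult_in[OF tensor_assoc_alg[of A B], of s t] by simp

text \<open>Sweedler notation for a product. Here the sum over t is outside;
  \<open>bilift_mult'\<close> below has the sum over s outside. Both nestings occur later.\<close>

lemma bilift_mult:
  assumes A: "assoc_alg k A" "assoc_alg k B" and X: "module k X" and F: "bil A B X F"
    and st: "s \<in> carrier (tensor_mod k A B)" "t \<in> carrier (tensor_mod k A B)"
  shows "bilift k A B X F (s \<otimes>\<^bsub>tensor_alg k A B\<^esub> t) =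
    bilift k A B X (\<lambda>a' b'. bilift k A B X (\<lambda>a b. F (a \<otimes>\<^bsub>A\<^esub> a') (b \<otimes>\<^bsub>B\<^esub> b')) s) t"
proof (rule sym, rule bilift_eq)
  fix a' b' assume a': "a' \<in> carrier A" "b' \<in> carrier B"
  show "bilift k A B X (\<lambda>a b. F (a \<otimes>\<^bsub>A\<^esub> a') (b \<otimes>\<^bsub>B\<^esub> b')) s = bilift k A B X F (s \<otimes>\<^bsub>tensor_alg k A B\<^esub> pt k A B a' b')"
    by (rule bilift_eq) (use assms a' in "auto simp: alg_module bilift_pt tensor_mult_pt
      intro!: lin_bilift_arg lin_tmult1 lin_id")
qed (use assms in "auto intro!: lin_bilift_arg lin_tmult2 lin_id simp: alg_module")

lemma trilift_mult:
  assumes A: "assoc_alg k A" "assoc_alg k B" "assoc_alg k C" and X: "module k X" and F: "tril A B C X F"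
    and st: "s \<in> carrier (tens3 A B C)" "t \<in> carrier (tens3 A B C)"
  shows "trilift k A B C X F (s \<otimes>\<^bsub>tensor_alg k (tensor_alg k A B) C\<^esub> t) =
    trilift k A B C X (\<lambda>a' b' c'. trilift k A B C X (\<lambda>a b c. F (a \<otimes>\<^bsub>A\<^esub> a') (b \<otimes>\<^bsub>B\<^esub> b') (c \<otimes>\<^bsub>C\<^esub> c')) s) t"
proof -
  note M = A[THEN alg_module]
  have AB: "assoc_alg k (tensor_alg k A B)" using A by simp
  note l1 = lin_tmult1[OF AB A(3), simplified] and l2 = lin_tmult2[OF AB A(3), simplified]
  note p = tensor_mult_pt[OF AB A(3), simplified]
  show ?thesis
  proof (rule sym, rule trilift_eq[OF M X _ _ st(2)])
    show "lin (tens3 A B C) X (\<lambda>t. trilift k A B C X F (s \<otimes>\<^bsub>tensor_alg k (tensor_alg k A B) C\<^esub> t))"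
      by (intro lin_trilift_arg M X F l2 lin_id st)
    fix a' b' c' assume a': "a' \<in> carrier A" "b' \<in> carrier B" "c' \<in> carrier C"
    show "trilift k A B C X (\<lambda>a b c. F (a \<otimes>\<^bsub>A\<^esub> a') (b \<otimes>\<^bsub>B\<^esub> b') (c \<otimes>\<^bsub>C\<^esub> c')) s =
      trilift k A B C X F (s \<otimes>\<^bsub>tensor_alg k (tensor_alg k A B) C\<^esub> pure3 A B C a' b' c')"
    proof (rule trilift_eq[OF M X _ _ st(1)])
      show "lin (tens3 A B C) X (\<lambda>s. trilift k A B C X F (s \<otimes>\<^bsub>tensor_alg k (tensor_alg k A B) C\<^esub> pure3 A B C a' b' c'))"
        using a' by (intro lin_trilift_arg M X F l1 lin_id) auto
    qed (use a' A in "simp add: p tensor_mult_pt trilift_pt[OF M X F]")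
  qed
qed

end

section \<open>Graded modules\<close>

context base_ring
begin

lemma bilift_mult':
  assumes A: "assoc_alg k A" "assoc_alg k B" and X: "module k X" and F: "bil A B X F"
    and st: "s \<in> carrier (tensor_mod k A B)" "t \<in> carrier (tensor_mod k A B)"
  shows "bilift k A B X F (s \<otimes>\<^bsub>tensor_alg k A B\<^esub> t) =
    bilift k A B X (\<lambda>a b. bilift k A B X (\<lambda>a' b'. F (a \<otimes>\<^bsub>A\<^esub> a') (b \<otimes>\<^bsub>B\<^esub> b')) t) s"
proof (rule sym, rule bilift_eq)
  fix a' b' assume a': "a' \<in> carrier A" "b' \<in> carrier B"
  show "bilift k A B X (\<lambda>a b. F (a' \<otimes>\<^bsub>A\<^esub> a) (b' \<otimes>\<^bsub>B\<^esub> b)) t = bilift k A B X F (pt k A B a' b' \<otimes>\<^bsub>tensor_alg k A B\<^esub> t)"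
    by (rule bilift_eq) (use assms a' in "auto simp: alg_module bilift_pt tensor_mult_pt
      intro!: lin_bilift_arg lin_tmult2 lin_id")
qed (use assms in "auto intro!: lin_bilift_arg lin_tmult1 lin_id simp: alg_module")

text \<open>This and \<open>trilift_submod\<close> keep Sweedler sums inside a submodule that
  contains all terms; they serve for homogeneous parts and, at the end, for the relations of the
  tensor product over A.\<close>

lemma bilift_submod:
  assumes "module k V" "module k W" "module k X" "bil V W X b" "submodule N k X"
    "\<And>v w. v \<in> carrier V ==> w \<in> carrier W ==> b v w \<in> N" "t \<in> carrier (tensor_mod k V W)"
  shows "bilift k V W X b t \<in> N"
  using assms(1,2,7)
  by (induction rule: tens_induct) (use assms in "auto simp: bilift_pt lin_add[OF bilift_lin] submod_iff")

lemma trilift_submod: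
  assumes M: "module k U" "module k V" "module k W" "module k X" and b: "tril U V W X b" and N: "submodule N k X"
    and c: "\<And>u v w. u \<in> carrier U ==> v \<in> carrier V ==> w \<in> carrier W ==> b u v w \<in> N" and t: "t \<in> carrier (tens3 U V W)"
  shows "trilift k U V W X b t \<in> N"
  using M(1-3) t
  by (induction rule: tens3_induct) (use M b N c in "auto simp: trilift_pt lin_add[OF trilift_lin] submod_iff")

lemma finsum_eq_zero:
  assumes "module k V" "\<And>i. i \<in> A ==> f i = \<zero>\<^bsub>V\<^esub>"
  shows "finsum V f A = \<zero>\<^bsub>V\<^esub>"
proof -
  interpret V: module k V by fact
  show ?thesis using assms(2) by (rule V.add.finprod_one_eqI)
qed

lemma finsum_single:
  assumes V: "module k V" "finite A" "a \<in> A" "f a \<in> carrier V" "\<And>i. i \<in> A ==> i \<noteq> a ==> f i = \<zero>\<^bsub>V\<^esub>"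
  shows "finsum V f A = f a"
proof -
  interpret V: module k V by fact
  have "finsum V f A = finsum V f (insert a (A - {a}))" using assms(3) by (simp add: insert_absorb)
  also have "... = f a \<oplus>\<^bsub>V\<^esub> finsum V f (A - {a})"
  proof (rule V.finsum_insert)
    show "f \<in> A - {a} \<rightarrow> carrier V" using assms(5) by auto
  qed (use assms in auto)
  also have "finsum V f (A - {a}) = \<zero>\<^bsub>V\<^esub>" using assms by (intro finsum_eq_zero) auto
  finally show ?thesis using assms by simp
qed

lemma finsum_mono_neutral:
  assumes V: "module k V" "finite B" "A \<subseteq> B" "\<And>i. i \<in> B - A ==> f i = \<zero>\<^bsub>V\<^esub>" "f \<in> A \<rightarrow> carrier V"
  shows "finsum V f A = finsum V f B"
proof -
  interpret V: module k V by fact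
  show ?thesis using assms by (intro V.add.finprod_mono_neutral_cong_left) auto
qed

lemma finsum_induct:
  assumes V: "module k V" "finite A" and z: "P \<zero>\<^bsub>V\<^esub>"
    and a: "\<And>x y. x \<in> carrier V ==> y \<in> carrier V ==> P x ==> P y ==> P (x \<oplus>\<^bsub>V\<^esub> y)"
    and f: "\<And>i. i \<in> A ==> f i \<in> carrier V \<and> P (f i)"
  shows "P (finsum V f A)"
proof -
  interpret V: module k V by fact
  show ?thesis using assms(2) f
  proof (induction A)
    case (insert x F)
    then show ?case using a by (subst V.finsum_insert) (auto simp: Pi_def)
  qed (use z in auto)
qed

end

section \<open>The quasi-Hopf algebra H and its structure maps\<close>

locale qtqh =
  fixes k :: "'k ring" and H :: "('k, 'h) qqha"
  assumes qtqh: "quasitriangular_quasi_Hopf k H"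
begin

abbreviation hm (infixl "\<cdot>" 70) where "x \<cdot> y \<equiv> x \<otimes>\<^bsub>H\<^esub> y"
abbreviation hone ("\<one>\<^sub>H") where "\<one>\<^sub>H \<equiv> \<one>\<^bsub>H\<^esub>"
abbreviation p2 where "p2 a b \<equiv> pt k H H a b"
abbreviation psi ("\<psi>") where "\<psi> \<equiv> phi_inv k H"

lemma cringk: "cring k"
  using qtqh by (auto simp: quasitriangular_quasi_Hopf_def quasi_bialgebra_def)

sublocale base_ring k
  by (rule base_ring.intro) (rule cringk)

lemma algH [simp]: "assoc_alg k H"
  using qtqh by (auto simp: quasitriangular_quasi_Hopf_def quasi_bialgebra_def)

lemma modH [simp]: "module k H"
  by (rule alg_module[OF algH])

abbreviation HH where "HH \<equiv> tensor_mod k H H"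
abbreviation HHH where "HHH \<equiv> tensor_mod k HH H"
abbreviation HHHH where "HHHH \<equiv> tensor_mod k HHH H"
abbreviation p3 where "p3 a b c \<equiv> pure3 H H H a b c"
abbreviation one2 where "one2 \<equiv> p2 \<one>\<^sub>H \<one>\<^sub>H"
abbreviation one3 where "one3 \<equiv> p3 \<one>\<^sub>H \<one>\<^sub>H \<one>\<^sub>H"

lemma algH2 [simp]: "assoc_alg k (tensor_alg k H H)" and algH3 [simp]: "assoc_alg k (tensor_alg k (tensor_alg k H H) H)"
  by simp_all

lemma comul_lin: "lin H HH (comul H)"
  using qtqh by (auto simp: quasitriangular_quasi_Hopf_def quasi_bialgebra_def)

lemma comul_in [simp]: "h \<in> carrier H ==> comul H h \<in> carrier HH"
  by (rule lin_closed[OF comul_lin])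

lemma comul_mult: "h \<in> carrier H ==> h' \<in> carrier H ==>
    comul H (h \<cdot> h') = comul H h \<otimes>\<^bsub>tensor_alg k H H\<^esub> comul H h'"
  using qtqh by (auto simp: quasitriangular_quasi_Hopf_def quasi_bialgebra_def ring_hom_def)

lemma comul_one: "comul H \<one>\<^sub>H = one2"
proof -
  have "comul H \<one>\<^sub>H = \<one>\<^bsub>tensor_alg k H H\<^esub>"
    using qtqh by (auto simp: quasitriangular_quasi_Hopf_def quasi_bialgebra_def ring_hom_def)
  then show ?thesis by simp
qed

lemma phi_in [simp]: "phi H \<in> carrier HHH"
proof -
  have "phi H \<in> Units (tensor_alg k (tensor_alg k H H) H)"
    using qtqh by (auto simp: quasitriangular_quasi_Hopf_def quasi_bialgebra_def)
  then show ?thesis by (auto simp: Units_def)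
qed

lemma rmat_in [simp]: "rmat H \<in> carrier HH"
proof -
  have "rmat H \<in> Units (tensor_alg k H H)"
    using qtqh by (auto simp: quasitriangular_quasi_Hopf_def universal_R_def)
  then show ?thesis by (auto simp: Units_def)
qed

lemma phi_inv_in [simp]: "\<psi> \<in> carrier HHH" (is ?g3)
  and phi_phi_inv: "phi H \<otimes>\<^bsub>tensor_alg k (tensor_alg k H H) H\<^esub> \<psi> = \<one>\<^bsub>tensor_alg k (tensor_alg k H H) H\<^esub>" (is ?g2)
  and phi_inv_phi: "\<psi> \<otimes>\<^bsub>tensor_alg k (tensor_alg k H H) H\<^esub> phi H = \<one>\<^bsub>tensor_alg k (tensor_alg k H H) H\<^esub>" (is ?g1)
proof -
  have u: "phi H \<in> Units (tensor_alg k (tensor_alg k H H) H)"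
    using qtqh by (auto simp: quasitriangular_quasi_Hopf_def quasi_bialgebra_def)
  have "ring (tensor_alg k (tensor_alg k H H) H)" using algH3 unfolding assoc_alg_def by blast
  then interpret H3: ring "tensor_alg k (tensor_alg k H H) H" .
  show ?g2
   ?g1
    using H3.Units_r_inv[OF u] H3.Units_l_inv[OF u] by (simp_all add: phi_inv_def)
  show ?g3 using H3.Units_inv_closed[OF u] by (simp add: phi_inv_def)
qed

lemma S_lin: "lin H H (antip H)"
  using qtqh by (auto simp: quasitriangular_quasi_Hopf_def quasi_antipode_def)

lemma S_in [simp]: "h \<in> carrier H ==> antip H h \<in> carrier H"
  by (rule lin_closed[OF S_lin])

lemma S_one [simp]: "antip H \<one>\<^sub>H = \<one>\<^sub>H"
  and S_mult: "x \<in> carrier H ==> y \<in> carrier H ==> antip H (x \<cdot> y) = antip H y \<cdot> antip H x"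
  and alpha_in [simp]: "alpha H \<in> carrier H" and beta_in [simp]: "beta H \<in> carrier H"
  using qtqh by (auto simp: quasitriangular_quasi_Hopf_def quasi_antipode_def)

lemma eps_in [simp]: "h \<in> carrier H ==> counit H h \<in> carrier k"
  and eps_mult: "h \<in> carrier H ==> h' \<in> carrier H ==> counit H (h \<cdot> h') = counit H h \<otimes>\<^bsub>k\<^esub> counit H h'"
  and eps_one [simp]: "counit H \<one>\<^sub>H = \<one>\<^bsub>k\<^esub>"
  and eps_add: "h \<in> carrier H ==> h' \<in> carrier H ==> counit H (h \<oplus>\<^bsub>H\<^esub> h') = counit H h \<oplus>\<^bsub>k\<^esub> counit H h'"
  and eps_smult: "c \<in> carrier k ==> h \<in> carrier H ==> counit H (c \<odot>\<^bsub>H\<^esub> h) = c \<otimes>\<^bsub>k\<^esub> counit H h"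
  using qtqh by (auto simp: quasitriangular_quasi_Hopf_def quasi_bialgebra_def ring_hom_def)

lemma k_closed [simp]: "\<one>\<^bsub>k\<^esub> \<in> carrier k" (is ?g6) "\<zero>\<^bsub>k\<^esub> \<in> carrier k" (is ?g5)
  "x \<in> carrier k ==> y \<in> carrier k ==> x \<otimes>\<^bsub>k\<^esub> y \<in> carrier k" (is "PROP ?g4") "x \<in> carrier k ==> y \<in> carrier k ==> x \<oplus>\<^bsub>k\<^esub> y \<in> carrier k" (is "PROP ?g3")
  "x \<in> carrier k ==> \<one>\<^bsub>k\<^esub> \<otimes>\<^bsub>k\<^esub> x = x" (is "PROP ?g2") "x \<in> carrier k ==> x \<otimes>\<^bsub>k\<^esub> \<one>\<^bsub>k\<^esub> = x" (is "PROP ?g1")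
proof -
  interpret k: cring k by (rule cringk)
  show ?g6 ?g5
  "PROP ?g4" "PROP ?g3"
  "PROP ?g2" "PROP ?g1" by simp_all
qed

lemma lin_eps: "module k X ==> lin Y H f ==> x \<in> carrier X ==> lin Y X (\<lambda>y. counit H (f y) \<odot>\<^bsub>X\<^esub> x)"
  by (auto simp: linear_on_def Pi_def eps_add eps_smult m_add_smult m_smult_smult)

lemma lin_S: "lin Y H f ==> lin Y H (\<lambda>y. antip H (f y))"
  by (rule lin_comp[OF _ S_lin])

lemma lin_comul: "lin Y H f ==> lin Y HH (\<lambda>y. comul H (f y))"
  by (rule lin_comp[OF _ comul_lin])

section \<open>Objects\<close>

abbreviation obj where "obj V \<equiv> hm_object k H V"

lemma obj_module [simp]: "obj V ==> module k V"
  and act_lin: "obj V ==> h \<in> carrier H ==> lin V V (act V h)"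
  and act_lin1: "obj V ==> v \<in> carrier V ==> lin H V (\<lambda>h. act V h v)"
  and act_one [simp]: "obj V ==> v \<in> carrier V ==> act V \<one>\<^sub>H v = v"
  and act_mult: "obj V ==> h \<in> carrier H ==> h' \<in> carrier H ==> v \<in> carrier V ==> act V (h \<cdot> h') v = act V h (act V h' v)"
  and gr_submod: "obj V ==> submodule (gr V n) k V"
  and gr_finite: "obj V ==> finite (gr_support V)"
  and gr_ex1: "obj V ==> v \<in> carrier V ==> \<exists>!c. (\<forall>n. c n \<in> gr V n) \<and> v = (\<Oplus>\<^bsub>V\<^esub>n\<in>gr_support V. c n)"
  and act_gr: "obj V ==> h \<in> carrier H ==> v \<in> gr V n ==> act V h v \<in> gr V n"
  by (auto simp: hm_object_def)

lemma act_in [simp]: "obj V ==> h \<in> carrier H ==> v \<in> carrier V ==> act V h v \<in> carrier V"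
  by (rule lin_closed[OF act_lin])

lemma lin_act1: "obj V ==> lin Y H f ==> v \<in> carrier V ==> lin Y V (\<lambda>y. act V (f y) v)"
  by (rule lin_comp[OF _ act_lin1])

lemma lin_act2: "obj V ==> h \<in> carrier H ==> lin Y V f ==> lin Y V (\<lambda>y. act V h (f y))"
  by (rule lin_comp[OF _ act_lin])

lemma gr_in: "obj V ==> v \<in> gr V n ==> v \<in> carrier V"
  using gr_submod[of V n] submod_iff[of V "gr V n"] by auto

lemma gr_zero [simp]: "obj V ==> \<zero>\<^bsub>V\<^esub> \<in> gr V n"
  using gr_submod[of V n] submod_iff[of V "gr V n"] by auto

lemma gr_add: "obj V ==> v \<in> gr V n ==> w \<in> gr V n ==> v \<oplus>\<^bsub>V\<^esub> w \<in> gr V n"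
  using gr_submod[of V n] submod_iff[of V "gr V n"] by auto

lemma gr_smult: "obj V ==> v \<in> gr V n ==> c \<in> carrier k ==> c \<odot>\<^bsub>V\<^esub> v \<in> gr V n"
  using gr_submod[of V n] submod_iff[of V "gr V n"] by auto

lemma gr_nsupport: "v \<in> gr V n ==> n \<notin> gr_support V ==> v = \<zero>\<^bsub>V\<^esub>"
  by (auto simp: gr_support_def)

text \<open>Replaces unique homogeneous decompositions by a family of linear projections that vanish
  on all other degrees and sum to the identity over a finite set S. It is enough that S contains the
  support, which is awkward to determine for tensor products and internal homs.\<close>

lemma objI:
  assumes M: "module k V" and a: "\<And>h. h \<in> carrier H ==> lin V V (act V h)"
    "\<And>v. v \<in> carrier V ==> lin H V (\<lambda>h. act V h v)" "\<And>v. v \<in> carrier V ==> act V \<one>\<^sub>H v = v"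
    "\<And>h h' v. h \<in> carrier H ==> h' \<in> carrier H ==> v \<in> carrier V ==> act V (h \<cdot> h') v = act V h (act V h' v)"
    and g: "\<And>n. submodule (gr V n) k V" "\<And>h n v. h \<in> carrier H ==> v \<in> gr V n ==> act V h v \<in> gr V n"
    and S: "finite S"
    and P: "\<And>n. lin V V (P n)" "\<And>n v. v \<in> carrier V ==> P n v \<in> gr V n"
      "\<And>n v. v \<in> gr V n ==> P n v = v" "\<And>n m v. v \<in> gr V m ==> m \<noteq> n ==> P n v = \<zero>\<^bsub>V\<^esub>"
      "\<And>v. v \<in> carrier V ==> v = finsum V (\<lambda>n. P n v) S"
  shows "obj V"
proof -
  have gc: "v \<in> carrier V" if "v \<in> gr V n" for v n
    using g(1)[of n] submod_iff[OF M, of "gr V n"] that by (metis subsetD)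
  have gz: "\<zero>\<^bsub>V\<^esub> \<in> gr V n" for n using g(1)[of n] submod_iff[OF M, of "gr V n"] by metis
  \<comment> \<open>A vector of a degree outside S is the sum of its components over S, all of which
    vanish.\<close>
  have sup: "gr_support V \<subseteq> S"
  proof
    fix n assume "n \<in> gr_support V"
    then obtain v where v: "v \<in> gr V n" "v \<noteq> \<zero>\<^bsub>V\<^esub>" using gz by (auto simp: gr_support_def)
    show "n \<in> S"
    proof (rule ccontr)
      assume n: "n \<notin> S"
      have "finsum V (\<lambda>m. P m v) S = \<zero>\<^bsub>V\<^esub>"
      proof (rule finsum_eq_zero[OF M])
        show "P m v = \<zero>\<^bsub>V\<^esub>" if "m \<in> S" for m using P(4)[OF v(1)] n that by metis
      qed
      then show False using P(5)[OF gc[OF v(1)]] v(2) by metis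
    qed
  qed
  have fin: "finite (gr_support V)" using sup S finite_subset by blast
  have ex: "v = (\<Oplus>\<^bsub>V\<^esub>n\<in>gr_support V. P n v)" if v: "v \<in> carrier V" for v
  proof -
    have "(\<Oplus>\<^bsub>V\<^esub>n\<in>gr_support V. P n v) = (\<Oplus>\<^bsub>V\<^esub>n\<in>S. P n v)"
    proof (rule finsum_mono_neutral[OF M S sup])
      show "P n v = \<zero>\<^bsub>V\<^esub>" if "n \<in> S - gr_support V" for n
        using that P(2)[OF v, of n] by (auto simp: gr_support_def)
      show "(\<lambda>n. P n v) \<in> gr_support V \<rightarrow> carrier V" using gc[OF P(2)[OF v]] by auto
    qed
    then show ?thesis using P(5)[OF v] by simp
  qed
  \<comment> \<open>Applying P n to any decomposition isolates its term of degree n.\<close>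
  have un: "c = (\<lambda>n. P n v)" if v: "v \<in> carrier V" and c: "\<forall>n. c n \<in> gr V n" "v = (\<Oplus>\<^bsub>V\<^esub>n\<in>gr_support V. c n)" for c v
  proof
    fix n
    have "P n v = (\<Oplus>\<^bsub>V\<^esub>m\<in>gr_support V. P n (c m))"
    proof -
      have "c \<in> gr_support V \<rightarrow> carrier V" using gc c(1) by auto
      then show ?thesis using lin_finsum[OF M M P(1) fin, of c n] c(2) by simp
    qed
    also have "... = c n"
    proof (cases "n \<in> gr_support V")
      case True
      then have "(\<Oplus>\<^bsub>V\<^esub>m\<in>gr_support V. P n (c m)) = P n (c n)"
      proof (intro finsum_single[OF M fin])
        show "P n (c n) \<in> carrier V" using gc[OF P(2)[OF gc]] c(1) by blast
        show "P n (c i) = \<zero>\<^bsub>V\<^esub>" if "i \<noteq> n" for i using P(4)[OF _ that] c(1) by blast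
      qed
      then show ?thesis using c(1) P(3) by simp
    next
      case False
      then have "c n = \<zero>\<^bsub>V\<^esub>" using c(1) gr_nsupport[of "c n" V n] by blast
      moreover have "(\<Oplus>\<^bsub>V\<^esub>m\<in>gr_support V. P n (c m)) = \<zero>\<^bsub>V\<^esub>"
      proof (rule finsum_eq_zero[OF M])
        show "P n (c m) = \<zero>\<^bsub>V\<^esub>" if "m \<in> gr_support V" for m using P(4)[of "c m" m n] c(1) False that by blast
      qed
      ultimately show ?thesis by simp
    qed
    finally show "c n = P n v" by simp
  qed
  show ?thesis unfolding hm_object_def
  proof (intro conjI ballI allI)
    fix v assume v: "v \<in> carrier V"
    show "\<exists>!c. (\<forall>n. c n \<in> gr V n) \<and> v = (\<Oplus>\<^bsub>V\<^esub>n\<in>gr_support V. c n)"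
    proof (rule ex1I[of _ "\<lambda>n. P n v"])
      show "(\<forall>n. P n v \<in> gr V n) \<and> v = (\<Oplus>\<^bsub>V\<^esub>n\<in>gr_support V. P n v)" using P(2)[OF v] ex[OF v] by blast
    qed (use un[OF v] in blast)
  qed (fact M a g fin | rule a g, assumption+)+
qed

lemma hcomp_props:
  assumes V: "obj V" and v: "v \<in> carrier V"
  shows hcomp_gr: "hcomp V v n \<in> gr V n" (is ?g3)
    and hcomp_sum: "v = (\<Oplus>\<^bsub>V\<^esub>n\<in>gr_support V. hcomp V v n)" (is ?g2)
    and hcomp_unique: "(\<And>n. c n \<in> gr V n) ==> v = (\<Oplus>\<^bsub>V\<^esub>n\<in>gr_support V. c n) ==> hcomp V v = c" (is "PROP ?g1")
proof -
  have *: "(\<forall>n. hcomp V v n \<in> gr V n) \<and> v = (\<Oplus>\<^bsub>V\<^esub>n\<in>gr_support V. hcomp V v n)"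
    unfolding hcomp_def by (rule theI'[OF gr_ex1[OF V v]])
  then show ?g3 ?g2 by auto
  show "PROP ?g1"
    using * gr_ex1[OF V v] by metis
qed

lemma hcomp_in [simp]: "obj V ==> v \<in> carrier V ==> hcomp V v n \<in> carrier V"
  by (rule gr_in[OF _ hcomp_gr])

lemma hcomp_hom:
  assumes V: "obj V" and v: "v \<in> gr V n"
  shows "hcomp V v m = (if m = n then v else \<zero>\<^bsub>V\<^esub>)"
proof -
  have "(\<Oplus>\<^bsub>V\<^esub>m\<in>gr_support V. (if m = n then v else \<zero>\<^bsub>V\<^esub>)) = v"
  proof (cases "n \<in> gr_support V")
    case True
    then show ?thesis using V v gr_in
      by (subst finsum_single[where a = n]) (auto simp: gr_finite)
  next
    case False
    then show ?thesis using V gr_nsupport[OF v False]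
      by (subst finsum_eq_zero) auto
  qed
  then have "hcomp V v = (\<lambda>m. if m = n then v else \<zero>\<^bsub>V\<^esub>)"
    using V v gr_in[OF V v] by (intro hcomp_unique) auto
  then show ?thesis by simp
qed

lemma hom_induct [consumes 2, case_names hom add]:
  assumes V: "obj V" and v: "v \<in> carrier V" and h: "\<And>n v. v \<in> gr V n ==> P v"
    and a: "\<And>x y. x \<in> carrier V ==> y \<in> carrier V ==> P x ==> P y ==> P (x \<oplus>\<^bsub>V\<^esub> y)"
  shows "P v"
proof -
  have "P (\<Oplus>\<^bsub>V\<^esub>n\<in>gr_support V. hcomp V v n)"
  proof (rule finsum_induct[OF obj_module[OF V] gr_finite[OF V]])
    show "P \<zero>\<^bsub>V\<^esub>" by (rule h[OF gr_zero[OF V]])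
    show "hcomp V v i \<in> carrier V \<and> P (hcomp V v i)" for i
      using hcomp_gr[OF V v, of i] h gr_in[OF V] by blast
  qed (rule a)
  then show ?thesis using hcomp_sum[OF V v] by simp
qed

lemma hom_ext:
  assumes V: "obj V" and v: "v \<in> carrier V" and f: "lin V X f" and g: "lin V X g"
    and h: "\<And>n v. v \<in> gr V n ==> f v = g v"
  shows "f v = g v"
  using V v by (induction rule: hom_induct) (auto simp: h lin_add[OF f] lin_add[OF g])

lemma hcomp_lin:
  assumes V: "obj V"
  shows "lin V V (\<lambda>v. hcomp V v n)"
proof (rule linI)
  note M = obj_module[OF V]
  interpret V: module k V by (rule M)
  fix x y assume x: "x \<in> carrier V" and y: "y \<in> carrier V"
  have "hcomp V (x \<oplus>\<^bsub>V\<^esub> y) = (\<lambda>n. hcomp V x n \<oplus>\<^bsub>V\<^esub> hcomp V y n)"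
  proof (rule hcomp_unique[OF V])
    have "(\<Oplus>\<^bsub>V\<^esub>n\<in>gr_support V. hcomp V x n \<oplus>\<^bsub>V\<^esub> hcomp V y n) =
      (\<Oplus>\<^bsub>V\<^esub>n\<in>gr_support V. hcomp V x n) \<oplus>\<^bsub>V\<^esub> (\<Oplus>\<^bsub>V\<^esub>n\<in>gr_support V. hcomp V y n)"
      using V x y by (intro V.finsum_addf) auto
    then show "x \<oplus>\<^bsub>V\<^esub> y = (\<Oplus>\<^bsub>V\<^esub>n\<in>gr_support V. hcomp V x n \<oplus>\<^bsub>V\<^esub> hcomp V y n)"
      using hcomp_sum[OF V x] hcomp_sum[OF V y] by simp
  qed (use V x y hcomp_gr in "auto intro!: gr_add")
  then show "hcomp V (x \<oplus>\<^bsub>V\<^esub> y) n = hcomp V x n \<oplus>\<^bsub>V\<^esub> hcomp V y n" by simp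
next
  note M = obj_module[OF V]
  interpret V: module k V by (rule M)
  fix c x assume x: "x \<in> carrier V" and c: "c \<in> carrier k"
  have "hcomp V (c \<odot>\<^bsub>V\<^esub> x) = (\<lambda>n. c \<odot>\<^bsub>V\<^esub> hcomp V x n)"
  proof (rule hcomp_unique[OF V])
    have "c \<odot>\<^bsub>V\<^esub> (\<Oplus>\<^bsub>V\<^esub>n\<in>gr_support V. hcomp V x n) = (\<Oplus>\<^bsub>V\<^esub>n\<in>gr_support V. c \<odot>\<^bsub>V\<^esub> hcomp V x n)"
      using V x c by (intro V.finsum_smult_ldistr) (auto simp: gr_finite)
    then show "c \<odot>\<^bsub>V\<^esub> x = (\<Oplus>\<^bsub>V\<^esub>n\<in>gr_support V. c \<odot>\<^bsub>V\<^esub> hcomp V x n)"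
      using hcomp_sum[OF V x] by simp
  qed (use V x c hcomp_gr in "auto intro!: gr_smult")
  then show "hcomp V (c \<odot>\<^bsub>V\<^esub> x) n = c \<odot>\<^bsub>V\<^esub> hcomp V x n" by simp
qed (use V in auto)

text \<open>\<open>hm_morphism\<close> without extensionality, so that composites are plain lambda
  terms and need no restriction to the carrier. Extensionality is restored only for the final
  statement.\<close>

definition mor where
  "mor V W f \<longleftrightarrow> obj V \<and> obj W \<and> lin V W f \<and> (\<forall>n. \<forall>v\<in>gr V n. f v \<in> gr W n) \<and>
     (\<forall>h\<in>carrier H. \<forall>v\<in>carrier V. f (act V h v) = act W h (f v))"

lemma mor_obj: "mor V W f ==> obj V" "mor V W f ==> obj W"
  and mor_lin: "mor V W f ==> lin V W f"
  and mor_gr: "mor V W f ==> v \<in> gr V n ==> f v \<in> gr W n"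
  and mor_act: "mor V W f ==> h \<in> carrier H ==> v \<in> carrier V ==> f (act V h v) = act W h (f v)"
  by (auto simp: mor_def)

lemma mor_in: "mor V W f ==> v \<in> carrier V ==> f v \<in> carrier W"
  by (rule lin_closed[OF mor_lin])

lemma mor_id: "obj V ==> mor V V (\<lambda>x. x)"
  by (auto simp: mor_def lin_id)

lemma mor_comp: "mor V W f ==> mor W X g ==> mor V X (\<lambda>x. g (f x))"
  by (auto simp: mor_def intro: lin_comp) (metis lin_closed)

lemma mor_cong: "mor V W f ==> (\<And>v. v \<in> carrier V ==> g v = f v) ==> mor V W g"
  unfolding mor_def using lin_cong[of V g f W] obj_module gr_in by (metis act_in)

lemma mor_hcomp:
  assumes f: "mor V W f" and v: "v \<in> carrier V"
  shows "f (hcomp V v n) = hcomp W (f v) n"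
proof (rule hom_ext[OF mor_obj(1)[OF f] v])
  show "lin V W (\<lambda>v. f (hcomp V v n))"
    by (rule lin_comp[OF hcomp_lin[OF mor_obj(1)[OF f]] mor_lin[OF f]])
  show "lin V W (\<lambda>v. hcomp W (f v) n)"
    by (rule lin_comp[OF mor_lin[OF f] hcomp_lin[OF mor_obj(2)[OF f]]])
  show "f (hcomp V v n) = hcomp W (f v) n" if "v \<in> gr V m" for m v
    using that f mor_obj[OF f] lin_zero[OF _ _ mor_lin[OF f]] mor_gr[OF f that]
    by (auto simp: hcomp_hom[OF mor_obj(1)[OF f] that] hcomp_hom[of W "f v" m])
qed

lemma hm_morphism_mor: "hm_morphism k H V W f \<longleftrightarrow> mor V W f \<and> f \<in> extensional (carrier V)"
  by (auto simp: hm_morphism_def mor_def Lin_iff)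

subsection \<open>The unit objects, products, subobjects and quotients\<close>

lemma unit_simps [simp]:
  "carrier (unit_obj k H p) = carrier k" "zero (unit_obj k H p) = \<zero>\<^bsub>k\<^esub>" "add (unit_obj k H p) = add k"
  "smult (unit_obj k H p) = mult k" "act (unit_obj k H p) h c = counit H h \<otimes>\<^bsub>k\<^esub> c"
  "gr (unit_obj k H p) n = (if n = p then carrier k else {\<zero>\<^bsub>k\<^esub>})"
  by (auto simp: unit_obj_def)

lemma unit_module: "module k (unit_obj k H p)"
  using cringk by (intro moduleI') (auto simp: cring.cring_simprules)

lemma unit_obj_obj [simp]: "obj (unit_obj k H p)"
proof (rule objI[where S = "{p}" and P = "\<lambda>n c. if n = p then c else \<zero>\<^bsub>k\<^esub>"])
  note u = unit_module[of p]
  interpret k: cring k by (rule cringk)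
  show "module k (unit_obj k H p)" by (rule u)
  show "submodule (gr (unit_obj k H p) n) k (unit_obj k H p)" for n
    by (auto simp: submod_iff[OF u])
  show "v = finsum (unit_obj k H p) (\<lambda>n. if n = p then v else \<zero>\<^bsub>k\<^esub>) {p}" if "v \<in> carrier (unit_obj k H p)" for v
    using that by (subst finsum_single[OF u, where a = p]) auto
qed (auto intro!: linI simp: eps_mult eps_add eps_smult cringk cring.cring_simprules)

lemma prod_simps [simp]:
  "carrier (prod_obj V W) = carrier V \<times> carrier W" "zero (prod_obj V W) = (\<zero>\<^bsub>V\<^esub>, \<zero>\<^bsub>W\<^esub>)"
  "add (prod_obj V W) p q = (fst p \<oplus>\<^bsub>V\<^esub> fst q, snd p \<oplus>\<^bsub>W\<^esub> snd q)"
  "smult (prod_obj V W) c p = (c \<odot>\<^bsub>V\<^esub> fst p, c \<odot>\<^bsub>W\<^esub> snd p)"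
  "act (prod_obj V W) h p = (act V h (fst p), act W h (snd p))"
  "gr (prod_obj V W) n = gr V n \<times> gr W n"
  by (auto simp: prod_obj_def split: prod.splits)

lemma prod_module: "module k V ==> module k W ==> module k (prod_obj V W)"
  by (intro moduleI') (auto simp: m_ac m_add_smult m_smult_add m_smult_smult m_neg_smult[symmetric])

lemma prod_lin: "lin (prod_obj V W) V fst" "lin (prod_obj V W) W snd"
  by (auto intro!: linI)

lemma prod_obj_obj [simp]:
  assumes V: "obj V" and W: "obj W"
  shows "obj (prod_obj V W)"
proof (rule objI[where S = "gr_support V \<union> gr_support W" and P = "\<lambda>n p. (hcomp V (fst p) n, hcomp W (snd p) n)"])
  note MV = obj_module[OF V] and MW = obj_module[OF W] and M = prod_module[OF MV MW]
  show "module k (prod_obj V W)" by (rule M)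
  show "submodule (gr (prod_obj V W) n) k (prod_obj V W)" for n
    using V W by (auto simp: submod_iff[OF M] gr_in gr_add gr_smult)
  \<comment> \<open>Both decompositions are summed over the union of the two supports, extended by
    zeros, so that they can be paired term by term.\<close>
  let ?S = "gr_support V \<union> gr_support W"
  have S: "finite ?S" using V W by (auto simp: gr_finite)
  show "v = finsum (prod_obj V W) (\<lambda>n. (hcomp V (fst v) n, hcomp W (snd v) n)) ?S" if v: "v \<in> carrier (prod_obj V W)" for v
  proof -
    have v': "fst v \<in> carrier V" "snd v \<in> carrier W" using v by auto
    have c: "(\<lambda>n. (hcomp V (fst v) n, hcomp W (snd v) n)) \<in> ?S \<rightarrow> carrier (prod_obj V W)"
      using v' V W by auto
    have "fst v = finsum V (\<lambda>n. hcomp V (fst v) n) ?S"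
      using hcomp_sum[OF V v'(1)] S V v' gr_nsupport[OF hcomp_gr[OF V v'(1)]]
      by (metis finsum_mono_neutral[OF MV S, of "gr_support V" "hcomp V (fst v)"] DiffD2 Pi_I hcomp_in sup_ge1)
    moreover have "snd v = finsum W (\<lambda>n. hcomp W (snd v) n) ?S"
      using hcomp_sum[OF W v'(2)] S W v' gr_nsupport[OF hcomp_gr[OF W v'(2)]]
      by (metis finsum_mono_neutral[OF MW S, of "gr_support W" "hcomp W (snd v)"] DiffD2 Pi_I hcomp_in sup_ge2)
    ultimately show ?thesis
      using lin_finsum[OF M MV prod_lin(1) S c] lin_finsum[OF M MW prod_lin(2) S c]
      by (simp add: prod_eq_iff)
  qed
  show "lin (prod_obj V W) (prod_obj V W) (\<lambda>p. (hcomp V (fst p) n, hcomp W (snd p) n))" for n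
    using V W by (auto intro!: linI simp: lin_add[OF hcomp_lin] lin_smult[OF hcomp_lin])
  show "lin (prod_obj V W) (prod_obj V W) (act (prod_obj V W) h)" if "h \<in> carrier H" for h
    using V W that by (auto intro!: linI simp: lin_add[OF act_lin] lin_smult[OF act_lin])
  show "lin H (prod_obj V W) (\<lambda>h. act (prod_obj V W) h v)" if "v \<in> carrier (prod_obj V W)" for v
    using V W that by (auto intro!: linI simp: lin_add[OF act_lin1] lin_smult[OF act_lin1])
qed (use V W in "auto simp: gr_finite act_mult act_gr hcomp_gr hcomp_hom")

lemma prod_mor: "obj V ==> obj W ==> mor (prod_obj V W) V fst" "obj V ==> obj W ==> mor (prod_obj V W) W snd"
  by (auto simp: mor_def prod_lin)

lemma sub_simps [simp]:
  "carrier (sub_obj V U) = U" "zero (sub_obj V U) = zero V" "add (sub_obj V U) = add V"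
  "smult (sub_obj V U) = smult V" "act (sub_obj V U) = act V" "gr (sub_obj V U) n = gr V n \<inter> U"
  by (auto simp: sub_obj_def hmod_of_def)

lemma sub_module:
  assumes V: "module k V" and U: "submodule U k V"
  shows "module k (sub_obj V U)"
  using V U submod_iff[OF V, of U]
  by (intro moduleI') (auto simp: m_assoc m_comm[of V] m_add_smult m_smult_add m_smult_smult m_neg_smult[symmetric] subset_iff)

lemma sub_obj_obj:
  assumes V: "obj V" and U: "submodule U k V"
    and a: "\<And>h u. h \<in> carrier H ==> u \<in> U ==> act V h u \<in> U"
    and c: "\<And>n u. u \<in> U ==> hcomp V u n \<in> U"
  shows "obj (sub_obj V U)"
proof (rule objI[where S = "gr_support V" and P = "\<lambda>n v. hcomp V v n"])
  note MV = obj_module[OF V] and M = sub_module[OF obj_module[OF V] U]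
  have UV: "\<And>u. u \<in> U ==> u \<in> carrier V" and U': "\<zero>\<^bsub>V\<^esub> \<in> U" "\<And>x y. x \<in> U ==> y \<in> U ==> x \<oplus>\<^bsub>V\<^esub> y \<in> U"
    "\<And>x c. c \<in> carrier k ==> x \<in> U ==> c \<odot>\<^bsub>V\<^esub> x \<in> U"
    using submod_iff[OF MV, of U] U by (metis subsetD)+
  have i: "lin (sub_obj V U) V (\<lambda>x. x)" using UV by (auto intro!: linI)
  show "module k (sub_obj V U)" by (rule M)
  show "submodule (gr (sub_obj V U) n) k (sub_obj V U)" for n
    using U' by (auto simp: submod_iff[OF M] gr_add gr_smult V)
  show "v = finsum (sub_obj V U) (\<lambda>n. hcomp V v n) (gr_support V)" if "v \<in> carrier (sub_obj V U)" for v
  proof -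
    have "hcomp V v \<in> gr_support V \<rightarrow> carrier (sub_obj V U)" using that c by auto
    from lin_finsum[OF M MV i gr_finite[OF V] this] show ?thesis
      using hcomp_sum[OF V UV, of v] that by simp
  qed
  show "lin (sub_obj V U) (sub_obj V U) (\<lambda>v. hcomp V v n)" for n
    using c UV by (auto intro!: linI simp: lin_add[OF hcomp_lin[OF V]] lin_smult[OF hcomp_lin[OF V]])
  show "lin (sub_obj V U) (sub_obj V U) (act (sub_obj V U) h)" if "h \<in> carrier H" for h
    using that a UV by (auto intro!: linI simp: lin_add[OF act_lin[OF V]] lin_smult[OF act_lin[OF V]])
  show "lin H (sub_obj V U) (\<lambda>h. act (sub_obj V U) h v)" if "v \<in> carrier (sub_obj V U)" for v
    using that a UV by (auto intro!: linI simp: lin_add[OF act_lin1[OF V]] lin_smult[OF act_lin1[OF V]])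
  show "hcomp V v n \<in> gr (sub_obj V U) n" if "v \<in> carrier (sub_obj V U)" for n v
    using that UV c hcomp_gr[OF V] by simp
  show "act (sub_obj V U) h v \<in> gr (sub_obj V U) n" if "h \<in> carrier H" "v \<in> gr (sub_obj V U) n" for h n v
    using that a act_gr[OF V] by simp
  show "act (sub_obj V U) (h \<cdot> h') v = act (sub_obj V U) h (act (sub_obj V U) h' v)"
    if "h \<in> carrier H" "h' \<in> carrier H" "v \<in> carrier (sub_obj V U)" for h h' v
    using that UV by (simp add: act_mult[OF V])
  show "act (sub_obj V U) \<one>\<^sub>H v = v" if "v \<in> carrier (sub_obj V U)" for v
    using that UV by (simp add: V)
qed (auto simp: hcomp_hom[OF V] gr_finite[OF V])

lemma sub_incl_mor: "obj V ==> obj (sub_obj V U) ==> U \<subseteq> carrier V ==> mor (sub_obj V U) V (\<lambda>x. x)"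
  by (auto simp: mor_def intro!: linI)

lemma kernel_eq: "a_kernel V W f = {x \<in> carrier V. f x = \<zero>\<^bsub>W\<^esub>}"
  by (simp add: a_kernel_def')

text \<open>A morphism commutes with the action and with taking components, which are the two
  stability conditions for a subobject.\<close>

lemma kernel_obj:
  assumes f: "mor V W f"
  shows "obj (sub_obj V (a_kernel V W f))"
proof (rule sub_obj_obj)
  note V = mor_obj(1)[OF f] and W = mor_obj(2)[OF f]
  show "submodule (a_kernel V W f) k V"
    using submod_vimage[OF _ _ mor_lin[OF f] submod_zero] V W by (simp add: kernel_eq)
  show "act V h u \<in> a_kernel V W f" if "h \<in> carrier H" "u \<in> a_kernel V W f" for h u
    using that V W f lin_zero[OF _ _ act_lin[OF W]] by (auto simp: kernel_eq mor_act)
  show "hcomp V u n \<in> a_kernel V W f" if "u \<in> a_kernel V W f" for u n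
    using that V W f lin_zero[OF _ _ hcomp_lin[OF W]] by (auto simp: kernel_eq mor_hcomp)
qed (rule mor_obj(1)[OF f])

text \<open>The projections to a degree descend because U contains the components of its elements. Q
  is an arbitrary record with the right fields, so that the result applies to
  \<open>tensor_A\<close>, which carries its bimodule actions in the same record.\<close>

lemma quotient_obj:
  assumes V: "obj V" and U: "submodule U k V"
    and a: "\<And>h u. h \<in> carrier H ==> u \<in> U ==> act V h u \<in> U"
    and c: "\<And>n u. u \<in> U ==> hcomp V u n \<in> U"
    and Q: "carrier Q = carrier (quot_mod V U)" "add Q = add (quot_mod V U)" "zero Q = zero (quot_mod V U)"
      "smult Q = smult (quot_mod V U)"
      "\<And>h v. h \<in> carrier H ==> v \<in> carrier V ==> act Q h (U +>\<^bsub>V\<^esub> v) = U +>\<^bsub>V\<^esub> (act V h v)"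
      "\<And>n. gr Q n = (\<lambda>v. U +>\<^bsub>V\<^esub> v) ` gr V n"
  shows "obj Q" "mor V Q (\<lambda>v. U +>\<^bsub>V\<^esub> v)" (is ?g1)
proof -
  note MV = obj_module[OF V]
  have M: "module k Q" using quot_module[OF MV U] module_cong[OF Q(1-4)] by simp
  have pr: "lin V Q (\<lambda>v. U +>\<^bsub>V\<^esub> v)"
    using quot_proj_lin[OF MV U] Q(1-4) by (simp add: linear_on_def)
  have cQ: "carrier Q = (\<lambda>v. U +>\<^bsub>V\<^esub> v) ` carrier V" by (simp add: Q rcosets_image)
  define P where "P n = quot_map V U (\<lambda>v. U +>\<^bsub>V\<^esub> (hcomp V v n))" for n
  have UQ: "U +>\<^bsub>V\<^esub> u = \<zero>\<^bsub>Q\<^esub>" if "u \<in> U" for u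
  proof -
    have "u \<in> carrier V" using U submod_iff[OF MV, of U] that by (metis subsetD)
    then show ?thesis using coset_eq_iff[OF MV U, of u "\<zero>\<^bsub>V\<^esub>"] that quot_zero[OF MV U] MV by (simp add: Q m_sub_eq)
  qed
  have l: "lin V Q (\<lambda>v. U +>\<^bsub>V\<^esub> (hcomp V v n))" for n
    by (rule lin_comp[OF hcomp_lin[OF V] pr])
  have P1: "lin Q Q (P n)" "\<And>v. v \<in> carrier V ==> P n (U +>\<^bsub>V\<^esub> v) = U +>\<^bsub>V\<^esub> (hcomp V v n)" for n
  proof -
    have "\<And>u. u \<in> U ==> U +>\<^bsub>V\<^esub> hcomp V u n = \<zero>\<^bsub>Q\<^esub>" by (rule UQ[OF c])
    note q = quot_map_lin[OF MV U M l this]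
    show "lin Q Q (P n)" using q(1) linear_on_cong[OF Q(1,2,4) refl refl refl, of Q] by (simp only: P_def)
    show "\<And>v. v \<in> carrier V ==> P n (U +>\<^bsub>V\<^esub> v) = U +>\<^bsub>V\<^esub> (hcomp V v n)"
      unfolding P_def by (rule q(2))
  qed
  have aw: "act Q h (U +>\<^bsub>V\<^esub> v) = U +>\<^bsub>V\<^esub> (act V h v)" if "h \<in> carrier H" "v \<in> carrier V" for h v
    using Q(5) that by simp
  note pa = lin_add[OF pr] lin_smult[OF pr]
  show "obj Q"
  proof (rule objI[where S = "gr_support V" and P = P])
    show "submodule (gr Q n) k Q" for n
      using gr_in[OF V] gr_add[OF V] gr_smult[OF V] lin_zero[OF MV M pr]
      by (auto simp: submod_iff[OF M] Q(6) cQ pa[symmetric] image_iff) (metis gr_zero[OF V])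
    show "v = finsum Q (\<lambda>n. P n v) (gr_support V)" if v: "v \<in> carrier Q" for v
    proof -
      obtain u where u: "u \<in> carrier V" "v = U +>\<^bsub>V\<^esub> u" using v cQ by auto
      have "U +>\<^bsub>V\<^esub> (finsum V (hcomp V u) (gr_support V)) = finsum Q (\<lambda>n. U +>\<^bsub>V\<^esub> (hcomp V u n)) (gr_support V)"
        using u V by (intro lin_finsum[OF MV M pr gr_finite[OF V]]) auto
      then show ?thesis using hcomp_sum[OF V u(1), symmetric] u P1(2)[OF u(1)] by simp
    qed
    show "lin Q Q (act Q h)" if "h \<in> carrier H" for h
      using that V by (auto intro!: linI simp: cQ aw pa[symmetric] lin_add[OF act_lin] lin_smult[OF act_lin])
    show "lin H Q (\<lambda>h. act Q h v)" if "v \<in> carrier Q" for v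
      using that V by (auto intro!: linI simp: cQ aw pa[symmetric] lin_add[OF act_lin1] lin_smult[OF act_lin1])
  qed (use M P1 V in "auto simp: Q(6) cQ aw act_mult gr_in act_gr hcomp_hom hcomp_gr gr_finite lin_zero[OF MV M pr]")
  then show ?g1
    using V pr by (auto simp: mor_def aw Q(6))
qed

section \<open>Tensor products of objects\<close>

abbreviation tens (infixr "\<box>" 72) where "V\<box>W \<equiv> tensor_obj k H V W"
text \<open>Sweedler sums: \<open>L2 X F s\<close> is the sum in X of F s1 s2 over s = s1 \<otimes>
  s2, and likewise for three and four legs. \<open>m2\<close>, \<open>m3\<close>, \<open>m4\<close>
  are the products in the corresponding tensor powers of H.\<close>

abbreviation L2 where "L2 X F \<equiv> bilift k H H X F"
abbreviation L3 where "L3 X F \<equiv> trilift k H H H X F"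
abbreviation L4 where "L4 X F \<equiv> quadlift H H H H X F"
abbreviation m2 where "m2 s t \<equiv> s \<otimes>\<^bsub>tensor_alg k H H\<^esub> t"
abbreviation m3 where "m3 s t \<equiv> s \<otimes>\<^bsub>tensor_alg k (tensor_alg k H H) H\<^esub> t"
abbreviation m4 where "m4 s t \<equiv> s \<otimes>\<^bsub>tensor_alg k (tensor_alg k (tensor_alg k H H) H) H\<^esub> t"

lemma tobj_simps:
  "carrier (V\<box>W) = carrier (tensor_mod k V W)" "add (V\<box>W) = add (tensor_mod k V W)"
  "zero (V\<box>W) = zero (tensor_mod k V W)" "smult (V\<box>W) = smult (tensor_mod k V W)"
  by (auto simp: tensor_obj_def hmod_of_def)

text \<open>A tensor product of objects has the same underlying module as \<open>tensor_mod\<close>;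
  rewriting to the latter makes the lemmas on plain modules applicable to objects.\<close>

lemma tnorm:
  "tensor_mod k (V\<box>W) Y = tensor_mod k (tensor_mod k V W) Y"
  "tensor_mod k Y (V\<box>W) = tensor_mod k Y (tensor_mod k V W)"
  "pt k (V\<box>W) Y = pt k (tensor_mod k V W) Y"
  "pt k Y (V\<box>W) = pt k Y (tensor_mod k V W)"
  "linear_on k (V\<box>W) Y = linear_on k (tensor_mod k V W) Y"
  "linear_on k Y (V\<box>W) = linear_on k Y (tensor_mod k V W)"
  "bilift k X Y (V\<box>W) = bilift k X Y (tensor_mod k V W)"
  "bilift k (V\<box>W) X Y = bilift k (tensor_mod k V W) X Y"
  "bilift k X (V\<box>W) Y = bilift k X (tensor_mod k V W) Y"
  "module k (V\<box>W) = module k (tensor_mod k V W)"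
  by (intro tensor_mod_cong pt_cong linear_on_cong module_cong ext bilift_mod_cong; simp add: tobj_simps)+

lemma module_tobj [simp]: "module k V ==> module k W ==> module k (V\<box>W)"
  by (simp add: tnorm)

lemma pt_in_o [simp]: "v \<in> carrier V ==> w \<in> carrier W ==> pt k V W v w \<in> carrier (V\<box>W)"
  by (simp add: tobj_simps)

lemma lin_pt1_o: "module k V ==> module k W ==> lin Y V f ==> w \<in> carrier W ==> lin Y (V\<box>W) (\<lambda>y. pt k V W (f y) w)"
  and lin_pt2_o: "module k V ==> module k W ==> lin Y W g ==> v \<in> carrier V ==> lin Y (V\<box>W) (\<lambda>y. pt k V W v (g y))"
  by (auto simp: tnorm intro: lin_pt1 lin_pt2)

lemma tens_induct_o [consumes 3, case_names pt add]:
  assumes "module k V" "module k W" "t \<in> carrier (V\<box>W)"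
    "\<And>v w. v \<in> carrier V ==> w \<in> carrier W ==> P (pt k V W v w)"
    "\<And>s t. s \<in> carrier (V\<box>W) ==> t \<in> carrier (V\<box>W) ==> P s ==> P t ==> P (s \<oplus>\<^bsub>V\<box>W\<^esub> t)"
  shows "P t"
  using assms(1-2) assms(3)[unfolded tobj_simps]
  by (induction rule: tens_induct) (use assms(4,5) in "auto simp: tobj_simps")

lemma tens_ext_o:
  assumes "module k V" "module k W" "lin (V\<box>W) X f" "lin (V\<box>W) X g"
    "\<And>v w. v \<in> carrier V ==> w \<in> carrier W ==> f (pt k V W v w) = g (pt k V W v w)"
    "t \<in> carrier (V\<box>W)"
  shows "f t = g t"
  using assms(1,2,6)
  by (induction rule: tens_induct_o) (auto simp: assms(5) lin_add[OF assms(3)] lin_add[OF assms(4)])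

lemma bilift_lin_o: "module k V ==> module k W ==> module k X ==> bil V W X b ==> lin (V\<box>W) X (bilift k V W X b)"
  by (simp add: tnorm bilift_lin)

lemma bilift_eq_o:
  "module k V ==> module k W ==> module k X ==> lin (V\<box>W) X G ==>
    (\<And>v w. v \<in> carrier V ==> w \<in> carrier W ==> b v w = G (pt k V W v w)) ==> t \<in> carrier (V\<box>W) ==>
   bilift k V W X b t = G t"
  by (simp add: tnorm tobj_simps bilift_eq)

lemma trilift_lin_o: "module k U ==> module k V ==> module k W ==> module k X ==> tril U V W X b ==>
    lin ((U\<box>V)\<box>W) X (trilift k U V W X b)"
  and trilift_pt_o: "module k U ==> module k V ==> module k W ==> module k X ==> tril U V W X b ==>
    u \<in> carrier U ==> v \<in> carrier V ==> w \<in> carrier W ==>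
    trilift k U V W X b (pt k (U\<box>V) W (pt k U V u v) w) = b u v w"
  by (auto simp: tnorm trilift_lin trilift_pt)

lemma tmap_lin_o:
  "module k V ==> module k W ==> module k X ==> module k Y ==> lin V X f ==> lin W Y g ==>
   lin (V\<box>W) (X\<box>Y) (tensor_map k V W X Y f g)"
  by (simp add: tnorm tmap_lin)

lemma lin_bil_H1: "module k X ==> module k Y ==> (\<And>y. y \<in> carrier Y ==> bil H H X (F y)) ==>
    (\<And>a b. a \<in> carrier H ==> b \<in> carrier H ==> lin Y X (\<lambda>y. F y a b)) ==> s \<in> carrier HH ==>
    lin Y X (\<lambda>y. L2 X (F y) s)"
  by (rule lin_bilift_par) auto

lemma lin_bil_H2: "module k X ==> bil H H X F ==> lin Y HH f ==> lin Y X (\<lambda>y. L2 X F (f y))"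
  by (rule lin_bilift_arg) auto

lemma lin_tri_H1: "module k X ==> module k Y ==> (\<And>y. y \<in> carrier Y ==> tril H H H X (F y)) ==>
    (\<And>a b c. a \<in> carrier H ==> b \<in> carrier H ==> c \<in> carrier H ==> lin Y X (\<lambda>y. F y a b c)) ==> s \<in> carrier HHH ==>
    lin Y X (\<lambda>y. L3 X (F y) s)"
  by (rule lin_trilift_par) auto

lemma lin_tri_H2: "module k X ==> tril H H H X F ==> lin Y HHH f ==> lin Y X (\<lambda>y. L3 X F (f y))"
  by (rule lin_trilift_arg) auto

lemma L2_in: "module k X ==> bil H H X F ==> s \<in> carrier HH ==> L2 X F s \<in> carrier X"
  and L3_in: "module k X ==> tril H H H X G ==> t \<in> carrier HHH ==> L3 X G t \<in> carrier X"
  by (auto intro: bilift_in trilift_in)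

text \<open>Introduction rules that follow the syntax of nested Sweedler sums of actions; they
  reduce a multilinearity goal to the variables in it.\<close>

lemmas LR = lin_id lin_pt1_o lin_pt2_o lin_pt1 lin_pt2 lin_act1 lin_act2 lin_S lin_comul
  lin_mult1[OF algH] lin_mult2[OF algH] lin_bil_H1 lin_bil_H2 lin_tri_H1 lin_tri_H2
  bilI trilI quadlI L2_in L3_in

lemma L2_cong: "(\<And>a b. a \<in> carrier H ==> b \<in> carrier H ==> F a b = G a b) ==> L2 X F s = L2 X G s"
  using bilift_cong[of H H F G X] by simp

lemma L3_cong: "(\<And>a b c. a \<in> carrier H ==> b \<in> carrier H ==> c \<in> carrier H ==> F a b c = G a b c) ==> L3 X F s = L3 X G s"
  using trilift_cong[of H H H F G X] by simp

lemma L2_pt: "module k X ==> bil H H X F ==> a \<in> carrier H ==> b \<in> carrier H ==> L2 X F (p2 a b) = F a b"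
  and L3_pt: "module k X ==> tril H H H X G ==> a \<in> carrier H ==> b \<in> carrier H ==> c \<in> carrier H ==>
    L3 X G (p3 a b c) = G a b c"
  by (auto intro: bilift_pt trilift_pt)

lemma L2_push: "module k X ==> module k Z ==> bil H H X F ==> lin X Z f ==> s \<in> carrier HH ==>
   f (L2 X F s) = L2 Z (\<lambda>a b. f (F a b)) s"
  by (rule bilift_push) auto

lemma L3_push: "module k X ==> module k Z ==> tril H H H X F ==> lin X Z f ==> s \<in> carrier HHH ==>
   f (L3 X F s) = L3 Z (\<lambda>a b c. f (F a b c)) s"
  by (rule trilift_push) auto

lemma L2_mult: "module k X ==> bil H H X F ==> s \<in> carrier HH ==> t \<in> carrier HH ==>
   (\<And>a b a' b'. a \<in> carrier H ==> b \<in> carrier H ==> a' \<in> carrier H ==> b' \<in> carrier H ==>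
      F (a \<cdot> a') (b \<cdot> b') = K a' b' a b) ==>
   L2 X F (m2 s t) = L2 X (\<lambda>a' b'. L2 X (K a' b') s) t"
  by (subst bilift_mult) (auto intro!: L2_cong)

lemma L2_mult': "module k X ==> bil H H X F ==> s \<in> carrier HH ==> t \<in> carrier HH ==>
   (\<And>a b a' b'. a \<in> carrier H ==> b \<in> carrier H ==> a' \<in> carrier H ==> b' \<in> carrier H ==>
      F (a \<cdot> a') (b \<cdot> b') = K a b a' b') ==>
   L2 X F (m2 s t) = L2 X (\<lambda>a b. L2 X (K a b) t) s"
  by (subst bilift_mult') (auto intro!: L2_cong)

lemma L3_mult: "module k X ==> tril H H H X F ==> s \<in> carrier HHH ==> t \<in> carrier HHH ==>
   (\<And>a b c a' b' c'. a \<in> carrier H ==> b \<in> carrier H ==> c \<in> carrier H ==> a' \<in> carrier H ==> b' \<in> carrier H ==> c' \<in> carrier H ==>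
      F (a \<cdot> a') (b \<cdot> b') (c \<cdot> c') = K a' b' c' a b c) ==>
   L3 X F (m3 s t) = L3 X (\<lambda>a' b' c'. L3 X (K a' b' c') s) t"
  by (subst trilift_mult) (auto intro!: L3_cong)

lemma m3_in [simp]: "s \<in> carrier HHH ==> t \<in> carrier HHH ==> m3 s t \<in> carrier HHH"
  using tens_mult_in[of "tensor_alg k H H" H s t] by simp

lemma act_tobj: "act (V\<box>W) h =
    bilift k V W (V\<box>W) (\<lambda>v w. L2 (V\<box>W) (\<lambda>a b. pt k V W (act V a v) (act W b w)) (comul H h))"
  by (simp add: tnorm) (simp add: tensor_obj_def hmod_of_def)

lemma act_tens_pt:
  assumes V: "obj V" and W: "obj W" and h: "h \<in> carrier H" and v: "v \<in> carrier V" "w \<in> carrier W"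
  shows "act (V\<box>W) h (pt k V W v w) = L2 (V\<box>W) (\<lambda>a b. pt k V W (act V a v) (act W b w)) (comul H h)"
proof -
  have b: "bil V W (V\<box>W) (\<lambda>v w. L2 (V\<box>W) (\<lambda>a b. pt k V W (act V a v) (act W b w)) (comul H h))"
    using V W h by (auto intro!: LR)
  show ?thesis
    using bilift_pt[OF _ _ _ b v] V W by (simp add: act_tobj)
qed

lemma act_tens_lin:
  assumes V: "obj V" and W: "obj W" and h: "h \<in> carrier H"
  shows "lin (V\<box>W) (V\<box>W) (act (V\<box>W) h)"
proof -
  have b: "bil V W (V\<box>W) (\<lambda>v w. L2 (V\<box>W) (\<lambda>a b. pt k V W (act V a v) (act W b w)) (comul H h))"
    using V W h by (auto intro!: LR)
  show ?thesis
    using bilift_lin_o[OF _ _ _ b] V W by (simp add: act_tobj)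
qed

lemma act_tens:
  assumes V: "obj V" and W: "obj W" and h: "h \<in> carrier H" and t: "t \<in> carrier (V\<box>W)"
  shows "act (V\<box>W) h t = L2 (V\<box>W) (\<lambda>a b. tensor_map k V W V W (act V a) (act W b) t) (comul H h)"
proof (rule tens_ext_o[OF _ _ act_tens_lin[OF V W h] _ _ t])
  note t1 = tmap_lin_o[of V W V W] and t2 = lin_tmap_par1[of V W V W H, folded tnorm(6)] lin_tmap_par2[of V W V W H, folded tnorm(6)]
  show "lin (V\<box>W) (V\<box>W) (\<lambda>t. L2 (V\<box>W) (\<lambda>a b. tensor_map k V W V W (act V a) (act W b) t) (comul H h))"
    using V W h by (intro lin_bil_H1 bilI t1 t2) (auto intro!: LR act_lin simp: tobj_simps)
  show "act (V\<box>W) h (pt k V W v w) = L2 (V\<box>W) (\<lambda>a b. tensor_map k V W V W (act V a) (act W b) (pt k V W v w)) (comul H h)"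
    if "v \<in> carrier V" "w \<in> carrier W" for v w
    using that V W h by (subst act_tens_pt) (auto intro!: L2_cong simp: tmap_pt act_lin)
qed (use V W in auto)

lemma tobj_gr: "gr (V\<box>W) n = submodule_gen k (tensor_mod k V W)
              {pt k V W v w | v w p q. v \<in> gr V p \<and> w \<in> gr W q \<and> p + q = n}"
  by (simp add: tensor_obj_def hmod_of_def)

lemma tens_gr_props:
  assumes V: "obj V" and W: "obj W"
  shows tens_gr_submod: "submodule (gr (V\<box>W) n) k (V\<box>W)" (is ?g2)
    and tens_gr_pt: "v \<in> gr V p ==> w \<in> gr W q ==> p + q = n ==> pt k V W v w \<in> gr (V\<box>W) n" (is "PROP ?g1")
    and tens_gr_lin: "module k X ==> lin (V\<box>W) X f ==> submodule N k X ==>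
     (\<And>v w p q. v \<in> gr V p ==> w \<in> gr W q ==> p + q = n ==> f (pt k V W v w) \<in> N) ==>
     t \<in> gr (V\<box>W) n ==> f t \<in> N"
proof -
  let ?X = "{pt k V W v w | v w p q. v \<in> gr V p \<and> w \<in> gr W q \<and> p + q = n}"
  have M: "module k (tensor_mod k V W)" using V W by simp
  have X: "?X \<subseteq> carrier (tensor_mod k V W)" using gr_in[OF V] gr_in[OF W] by fastforce
  have sm: "submodule N k (V\<box>W) \<longleftrightarrow> submodule N k (tensor_mod k V W)" for N
    using submod_iff[of "V\<box>W" N] submod_iff[of "tensor_mod k V W" N] V W by (simp add: tobj_simps)
  show ?g2 unfolding sm tobj_gr by (rule submod_gen(1)[OF M X])
  show "PROP ?g1"
    unfolding tobj_gr by (rule subsetD[OF submod_gen(2)[OF M X]]) blast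
  show "f t \<in> N" if "module k X" "lin (V\<box>W) X f" "submodule N k X"
     "\<And>v w p q. v \<in> gr V p ==> w \<in> gr W q ==> p + q = n ==> f (pt k V W v w) \<in> N" "t \<in> gr (V\<box>W) n"
    by (rule lin_submodule_gen[OF M that(1) _ that(3) X _ that(5)[unfolded tobj_gr]])
      (use that(2,4) in "auto simp: tnorm")
qed

lemma tens_hinduct:
  assumes V: "obj V" and W: "obj W" and t: "t \<in> carrier (V\<box>W)"
    and h: "\<And>v w p q. v \<in> gr V p ==> w \<in> gr W q ==> P (pt k V W v w)"
    and a: "\<And>s t. s \<in> carrier (V\<box>W) ==> t \<in> carrier (V\<box>W) ==> P s ==> P t ==> P (s \<oplus>\<^bsub>V\<box>W\<^esub> t)"
  shows "P t"
  using obj_module[OF V] obj_module[OF W] t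
proof (induction rule: tens_induct_o)
  case (pt v w)
  note MV = obj_module[OF V] and MW = obj_module[OF W]
  note w = pt(2)
  from V pt(1) show ?case
  proof (induction rule: hom_induct)
    case (hom p v)
    note v = hom gr_in[OF V hom]
    from W w show ?case
      by (induction rule: hom_induct)
        (use v h a MV MW in "auto simp: lin_add[OF lin_pt2_o[OF MV MW lin_id v(2)]]")
  next
    case (add x y)
    then show ?case using a w by (auto simp: lin_add[OF lin_pt1_o[OF MV MW lin_id w]])
  qed
qed (rule a)

text \<open>The sign in the braiding is constant only on homogeneous arguments, so maps that contain
  the braiding are compared there.\<close>

lemma tens_hext:
  assumes V: "obj V" "obj W" and f: "lin (V\<box>W) X f" and g: "lin (V\<box>W) X g"
    and e: "\<And>v w p q. v \<in> gr V p ==> w \<in> gr W q ==> f (pt k V W v w) = g (pt k V W v w)"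
    and t: "t \<in> carrier (V\<box>W)"
  shows "f t = g t"
  by (rule tens_hinduct[OF V t]) (auto simp: e lin_add[OF f] lin_add[OF g])

lemma pt_zero: "module k V ==> module k W ==> w \<in> carrier W ==> pt k V W \<zero>\<^bsub>V\<^esub> w = \<zero>\<^bsub>V\<box>W\<^esub>"
  "module k V ==> module k W ==> v \<in> carrier V ==> pt k V W v \<zero>\<^bsub>W\<^esub> = \<zero>\<^bsub>V\<box>W\<^esub>"
  by (rule lin_zero[OF _ _ lin_pt1_o] lin_zero[OF _ _ lin_pt2_o]; simp add: lin_id)+

lemma tens_obj [simp]:
  assumes V: "obj V" and W: "obj W"
  shows "obj (V\<box>W)"
proof -
  note MV = obj_module[OF V] and MW = obj_module[OF W]
  have M: "module k (V\<box>W)" using MV MW by simp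
  let ?I = "gr_support V \<times> gr_support W"
  \<comment> \<open>The projection to degree n is the sum of the tensor products of the projections
    to degrees i and j over all i + j = n. Restricting i and j to the supports keeps the sum
    finite.\<close>
  define hp where "hp i = tensor_map k V W V W (\<lambda>v. hcomp V v (fst i)) (\<lambda>w. hcomp W w (snd i))" for i :: "int \<times> int"
  define J where "J n = {i \<in> ?I. fst i + snd i = n}" for n
  define P where "P n t = (\<Oplus>\<^bsub>V\<box>W\<^esub>i\<in>J n. hp i t)" for n t
  define S where "S = (\<lambda>i. fst i + snd i) ` ?I"
  have fI: "finite ?I" using V W by (simp add: gr_finite)
  have fJ: "finite (J n)" for n unfolding J_def using fI by simp
  have lh: "lin (V\<box>W) (V\<box>W) (hp i)" for i
    unfolding hp_def using V W by (intro tmap_lin_o hcomp_lin) auto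
  have hpt: "hp i (pt k V W v w) = (if fst i = p \<and> snd i = q then pt k V W v w else \<zero>\<^bsub>V\<box>W\<^esub>)"
    if "v \<in> gr V p" "w \<in> gr W q" for v w p q i
    using that gr_in[OF V that(1)] gr_in[OF W that(2)] V W
    by (simp add: hp_def tmap_pt hcomp_lin hcomp_hom[OF V that(1)] hcomp_hom[OF W that(2)] pt_zero)
  have lP: "lin (V\<box>W) (V\<box>W) (P n)" for n
    unfolding P_def by (intro lin_finsumf M fJ lh)
  note gV = gr_in[OF V] and gW = gr_in[OF W]
  have P0: "P n (pt k V W v w) = (if p + q = n then pt k V W v w else \<zero>\<^bsub>V\<box>W\<^esub>)"
    if vw: "v \<in> gr V p" "w \<in> gr W q" for v w p q n
  proof -
    have pc: "pt k V W v w \<in> carrier (V\<box>W)" using gV gW vw by auto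
    show ?thesis
    proof (cases "(p,q) \<in> J n")
      case True
      then have "P n (pt k V W v w) = hp (p,q) (pt k V W v w)"
        unfolding P_def using hpt[OF vw] pc by (intro finsum_single[OF M fJ]) (auto split: if_splits)
      then show ?thesis using True hpt[OF vw] by (auto simp: J_def)
    next
      case False
      have 0: "P n (pt k V W v w) = \<zero>\<^bsub>V\<box>W\<^esub>"
        unfolding P_def using hpt[OF vw] False by (intro finsum_eq_zero[OF M]) auto
      show ?thesis
      proof (cases "p + q = n")
        case True
        \<comment> \<open>Here the degrees add up to n but the pair lies outside the supports, so
          one factor, hence the tensor, is zero.\<close>
        then have "p \<notin> gr_support V \<or> q \<notin> gr_support W" using False by (auto simp: J_def)
        then have "pt k V W v w = \<zero>\<^bsub>V\<box>W\<^esub>"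
          using gr_nsupport[OF vw(1)] gr_nsupport[OF vw(2)] vw pt_zero[OF MV MW] gV gW by metis
        then show ?thesis using 0 by simp
      qed (use 0 in auto)
    qed
  qed
  have sub: "\<zero>\<^bsub>V\<box>W\<^esub> \<in> gr (V\<box>W) n" "t \<in> gr (V\<box>W) n ==> t \<in> carrier (V\<box>W)"
    "s \<in> gr (V\<box>W) n ==> t \<in> gr (V\<box>W) n ==> s \<oplus>\<^bsub>V\<box>W\<^esub> t \<in> gr (V\<box>W) n" for n s t
    using tens_gr_submod[OF V W, of n] unfolding submod_iff[OF M, of "gr (V\<box>W) n"] by blast+
  show ?thesis
  proof (rule objI[where S = S and P = P])
    show "module k (V\<box>W)" by (rule M)
    show "lin (V\<box>W) (V\<box>W) (act (V\<box>W) h)" if "h \<in> carrier H" for h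
      by (rule act_tens_lin[OF V W that])
    show "submodule (gr (V\<box>W) n) k (V\<box>W)" for n by (rule tens_gr_submod[OF V W])
    show "finite S" using fI by (simp add: S_def)
    show "lin (V\<box>W) (V\<box>W) (P n)" for n by (rule lP)
    note t2 = lin_tmap_par1[of V W V W H, folded tnorm(6)] lin_tmap_par2[of V W V W H, folded tnorm(6)]
    show lH: "lin H (V\<box>W) (\<lambda>h. act (V\<box>W) h t)" if t: "t \<in> carrier (V\<box>W)" for t
    proof (subst lin_cong[OF act_tens[OF V W _ t]])
      show "lin H (V\<box>W) (\<lambda>x. L2 (V\<box>W) (\<lambda>a b. tensor_map k V W V W (act V a) (act W b) t) (comul H x))"
        using V W t by (intro lin_bil_H2 bilI t2) (auto intro!: LR act_lin simp: tobj_simps)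
    qed auto
    show "act (V\<box>W) \<one>\<^sub>H t = t" if t: "t \<in> carrier (V\<box>W)" for t
    proof (rule tens_ext_o[OF MV MW act_tens_lin[OF V W] lin_id _ t])
      show "act (V\<box>W) \<one>\<^sub>H (pt k V W v w) = pt k V W v w" if "v \<in> carrier V" "w \<in> carrier W" for v w
        using V W that by (subst act_tens_pt, simp_all add: comul_one, subst L2_pt) (auto intro!: LR)
    qed auto
    show "act (V\<box>W) (h \<cdot> h') t = act (V\<box>W) h (act (V\<box>W) h' t)"
      if h: "h \<in> carrier H" "h' \<in> carrier H" and t: "t \<in> carrier (V\<box>W)" for h h' t
    proof (rule tens_ext_o[OF MV MW act_tens_lin[OF V W] lin_comp[OF act_tens_lin[OF V W h(2)] act_tens_lin[OF V W h(1)]] _ t])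
      fix v w assume vw: "v \<in> carrier V" "w \<in> carrier W"
      have b: "bil H H (V\<box>W) (\<lambda>a b. pt k V W (act V a v) (act W b w))" using V W vw by (auto intro!: LR)
      have "act (V\<box>W) h (act (V\<box>W) h' (pt k V W v w)) =
        L2 (V\<box>W) (\<lambda>a' b'. act (V\<box>W) h (pt k V W (act V a' v) (act W b' w))) (comul H h')"
        using V W vw h by (subst act_tens_pt, simp_all, subst L2_push[OF M M b act_tens_lin[OF V W h(1)]]) auto
      also have "... = L2 (V\<box>W) (\<lambda>a' b'. L2 (V\<box>W) (\<lambda>a b. pt k V W (act V a (act V a' v)) (act W b (act W b' w))) (comul H h)) (comul H h')"
        using V W vw h by (intro L2_cong) (auto simp: act_tens_pt)
      also have "... = L2 (V\<box>W) (\<lambda>a b. pt k V W (act V a v) (act W b w)) (m2 (comul H h) (comul H h'))"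
        using V W vw h by (intro L2_mult[symmetric] M b) (auto simp: act_mult)
      also have "... = act (V\<box>W) (h \<cdot> h') (pt k V W v w)"
        using V W vw h by (simp add: act_tens_pt comul_mult)
      finally show "act (V\<box>W) (h \<cdot> h') (pt k V W v w) = act (V\<box>W) h (act (V\<box>W) h' (pt k V W v w))" by simp
    qed (use h in auto)
    show "act (V\<box>W) h t \<in> gr (V\<box>W) n" if h: "h \<in> carrier H" and t: "t \<in> gr (V\<box>W) n" for h t n
    proof (rule tens_gr_lin[OF V W M act_tens_lin[OF V W h] tens_gr_submod[OF V W] _ t])
      fix v w p q assume vw: "v \<in> gr V p" "w \<in> gr W q" "p + q = n"
      then have "v \<in> carrier V" "w \<in> carrier W" using V W gr_in by auto
      then show "act (V\<box>W) h (pt k V W v w) \<in> gr (V\<box>W) n"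
        using V W h vw by (subst act_tens_pt) (auto intro!: bilift_submod[OF modH modH M _ tens_gr_submod[OF V W]] LR tens_gr_pt act_gr)
    qed
    show "P n t \<in> gr (V\<box>W) n" if t: "t \<in> carrier (V\<box>W)" for t n
      by (rule tens_hinduct[OF V W t])
        (use tens_gr_pt[OF V W] sub in "auto simp: P0 lin_add[OF lP]")
    show "P n t = t" if t: "t \<in> gr (V\<box>W) n" for t n
    proof -
      \<comment> \<open>Written as membership in the zero submodule so that
        \<open>tens_gr_lin\<close> reduces it to the generators of degree n.\<close>
      have "P n t \<ominus>\<^bsub>V\<box>W\<^esub> t \<in> {\<zero>\<^bsub>V\<box>W\<^esub>}"
        by (rule tens_gr_lin[OF V W M lin_subf[OF M lP lin_id] submod_zero[OF M] _ t])
         (use M gV gW in "simp add: P0")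
      then show ?thesis using M lin_closed[OF lP] sub(2)[OF t] by (simp add: m_sub_zero_iff)
    qed
    show "P n t = \<zero>\<^bsub>V\<box>W\<^esub>" if t: "t \<in> gr (V\<box>W) m" "m \<noteq> n" for t n m
    proof -
      have "P n t \<in> {\<zero>\<^bsub>V\<box>W\<^esub>}"
        by (rule tens_gr_lin[OF V W M lP submod_zero[OF M] _ t(1)]) (use t(2) in "auto simp: P0")
      then show ?thesis by simp
    qed
    show "t = (\<Oplus>\<^bsub>V\<box>W\<^esub>n\<in>S. P n t)" if t: "t \<in> carrier (V\<box>W)" for t
    proof (rule tens_hext[OF V W lin_id lin_finsumf _ t])
      fix v w p q assume vw: "v \<in> gr V p" "w \<in> gr W q"
      have pc: "pt k V W v w \<in> carrier (V\<box>W)" using gV gW vw by auto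
      show "pt k V W v w = (\<Oplus>\<^bsub>V\<box>W\<^esub>n\<in>S. P n (pt k V W v w))"
      proof (cases "p + q \<in> S")
        case True
        have "(\<Oplus>\<^bsub>V\<box>W\<^esub>n\<in>S. P n (pt k V W v w)) = P (p + q) (pt k V W v w)"
          using True pc fI by (intro finsum_single[OF M]) (auto simp: P0[OF vw] S_def)
        then show ?thesis using P0[OF vw] by simp
      next
        case False
        then have "p \<notin> gr_support V \<or> q \<notin> gr_support W" by (force simp: S_def)
        then have "pt k V W v w = \<zero>\<^bsub>V\<box>W\<^esub>"
          using gr_nsupport[OF vw(1)] gr_nsupport[OF vw(2)] vw pt_zero[OF MV MW] gV gW by metis
        moreover have "(\<Oplus>\<^bsub>V\<box>W\<^esub>n\<in>S. P n (pt k V W v w)) = \<zero>\<^bsub>V\<box>W\<^esub>"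
          by (rule finsum_eq_zero[OF M], subst P0[OF vw]) (simp add: calculation)
        ultimately show ?thesis by simp
      qed
    qed (use M lP fI in "auto simp: S_def")
  qed
qed

lemma tmap_mor:
  assumes f: "mor V X f" and g: "mor W Y g"
  shows "mor (V\<box>W) (X\<box>Y) (tensor_map k V W X Y f g)"
proof -
  note o = mor_obj[OF f] mor_obj[OF g]
  note M = o[THEN obj_module]
  have l: "lin (V\<box>W) (X\<box>Y) (tensor_map k V W X Y f g)"
    using M f g by (intro tmap_lin_o mor_lin)
  have "tensor_map k V W X Y f g t \<in> gr (X\<box>Y) n" if t: "t \<in> gr (V\<box>W) n" for t n
    by (rule tens_gr_lin[OF o(1,3) _ l gr_submod _ t])
      (use M o mor_lin[OF f] mor_lin[OF g] gr_in[OF o(1)] gr_in[OF o(3)] in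
        \<open>auto simp: tmap_pt intro!: tens_gr_pt mor_gr[OF f] mor_gr[OF g]\<close>)
  moreover have "tensor_map k V W X Y f g (act (V\<box>W) h t) = act (X\<box>Y) h (tensor_map k V W X Y f g t)"
    if h: "h \<in> carrier H" and t: "t \<in> carrier (V\<box>W)" for h t
  proof (rule tens_ext_o[OF M(1,3) lin_comp[OF act_lin l] lin_comp[OF l act_lin] _ t])
    fix v w assume vw: "v \<in> carrier V" "w \<in> carrier W"
    have "tensor_map k V W X Y f g (act (V\<box>W) h (pt k V W v w)) =
       L2 (X\<box>Y) (\<lambda>a b. tensor_map k V W X Y f g (pt k V W (act V a v) (act W b w))) (comul H h)"
      using o h vw by (subst act_tens_pt, simp_all, subst L2_push[OF _ _ _ l]) (auto intro!: LR)
    also have "... = act (X\<box>Y) h (tensor_map k V W X Y f g (pt k V W v w))"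
    proof -
      note fg = mor_in[OF f vw(1)] mor_in[OF g vw(2)]
      have "tensor_map k V W X Y f g (pt k V W v w) = pt k X Y (f v) (g w)"
        by (rule tmap_pt[OF M(1,3,2,4) mor_lin[OF f] mor_lin[OF g] vw])
      moreover have "tensor_map k V W X Y f g (pt k V W (act V a v) (act W b w)) = pt k X Y (act X a (f v)) (act Y b (g w))"
        if "a \<in> carrier H" "b \<in> carrier H" for a b
        using that o vw tmap_pt[OF M(1,3,2,4) mor_lin[OF f] mor_lin[OF g], of "act V a v" "act W b w"]
        by (simp add: mor_act[OF f that(1) vw(1)] mor_act[OF g that(2) vw(2)])
      ultimately show ?thesis using act_tens_pt[OF o(2,4) h fg] by (auto intro!: L2_cong)
    qed
    finally show "tensor_map k V W X Y f g (act (V\<box>W) h (pt k V W v w)) =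
      act (X\<box>Y) h (tensor_map k V W X Y f g (pt k V W v w))" .
  qed (use o h in auto)
  ultimately show ?thesis using o l by (auto simp: mor_def)
qed

section \<open>The associator\<close>

abbreviation as where "as \<equiv> associator k H"
abbreviation ai where "ai \<equiv> associator_inv k H"
abbreviation tm where "tm \<equiv> tensor_map k"
abbreviation T3l where "T3l V W X v w x \<equiv> pt k (V\<box>W) X (pt k V W v w) x"
abbreviation T3r where "T3r V W X v w x \<equiv> pt k V (W\<box>X) v (pt k W X w x)"

lemma lin_bil_o1: "module k V ==> module k W ==> module k X ==> module k Y ==>
    (\<And>y. y \<in> carrier Y ==> bil V W X (F y)) ==>
    (\<And>a b. a \<in> carrier V ==> b \<in> carrier W ==> lin Y X (\<lambda>y. F y a b)) ==> s \<in> carrier (V\<box>W) ==>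
    lin Y X (\<lambda>y. bilift k V W X (F y) s)"
  by (rule lin_bilift_par) (auto simp: tobj_simps)

lemma lin_act_pt:
  assumes "obj V" "obj W" "module k Z" "lin (V\<box>W) Z f" "h \<in> carrier H" "v \<in> carrier V" "w \<in> carrier W"
  shows "f (act (V\<box>W) h (pt k V W v w)) = L2 Z (\<lambda>a b. f (pt k V W (act V a v) (act W b w))) (comul H h)"
  using assms by (subst act_tens_pt, simp_all, subst L2_push[OF _ _ _ assms(4)]) (auto intro!: LR)

context
  fixes V :: "('k, 'h, 'v, 'm) hmod_scheme" and W :: "('k, 'h, 'w, 'n) hmod_scheme" and X :: "('k, 'h, 'x, 'p) hmod_scheme"
  assumes VWX: "obj V" "obj W" "obj X"
begin

lemma as_tril: "v \<in> carrier V ==> w \<in> carrier W ==> x \<in> carrier X ==>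
   tril H H H (V\<box>W\<box>X) (\<lambda>a b c. T3r V W X (act V a v) (act W b w) (act X c x))"
  using VWX by (auto intro!: LR)

lemma ai_tril: "v \<in> carrier V ==> w \<in> carrier W ==> x \<in> carrier X ==>
   tril H H H ((V\<box>W)\<box>X) (\<lambda>a b c. T3l V W X (act V a v) (act W b w) (act X c x))"
  using VWX by (auto intro!: LR)

lemma as_lin: "lin ((V\<box>W)\<box>X) (V\<box>W\<box>X) (as V W X)" (is ?g2)
  and as_pt: "v \<in> carrier V ==> w \<in> carrier W ==> x \<in> carrier X ==>
    as V W X (T3l V W X v w x) = L3 (V\<box>W\<box>X) (\<lambda>a b c. T3r V W X (act V a v) (act W b w) (act X c x)) (phi H)" (is "PROP ?g1")
proof -
  have t: "tril V W X (V\<box>W\<box>X) (\<lambda>v w x. L3 (V\<box>W\<box>X) (\<lambda>a b c. T3r V W X (act V a v) (act W b w) (act X c x)) (phi H))"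
    using VWX by (auto intro!: LR)
  show ?g2
    unfolding associator_def Let_def using VWX t by (intro trilift_lin_o) auto
  show "PROP ?g1"
    unfolding associator_def Let_def using VWX trilift_pt_o[OF _ _ _ _ t] by simp
qed

lemma ai_lin: "lin (V\<box>W\<box>X) ((V\<box>W)\<box>X) (ai V W X)"
  and ai_pt: "v \<in> carrier V ==> w \<in> carrier W ==> x \<in> carrier X ==>
    ai V W X (T3r V W X v w x) = L3 ((V\<box>W)\<box>X) (\<lambda>a b c. T3l V W X (act V a v) (act W b w) (act X c x)) \<psi>"
proof -
  let ?T = "(V\<box>W)\<box>X"
  let ?F = "\<lambda>v w x. L3 ?T (\<lambda>a b c. T3l V W X (act V a v) (act W b w) (act X c x)) \<psi>"
  have b: "bil W X ?T (\<lambda>w x. ?F v w x)" if "v \<in> carrier V" for v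
    using VWX that by (auto intro!: LR)
  have t: "bil V (W\<box>X) ?T (\<lambda>v t. bilift k W X ?T (\<lambda>w x. ?F v w x) t)"
    by (intro bilI bilift_lin_o b lin_bil_o1) (use VWX in "auto intro!: LR")
  show "lin (V\<box>W\<box>X) ?T (ai V W X)"
    unfolding associator_inv_def Let_def using VWX t by (intro bilift_lin_o) auto
  show "ai V W X (T3r V W X v w x) = ?F v w x" if "v \<in> carrier V" "w \<in> carrier W" "x \<in> carrier X"
    unfolding associator_inv_def Let_def using VWX that bilift_pt[OF _ _ _ t] bilift_pt[OF _ _ _ b] by simp
qed

lemma as_in [simp]: "t \<in> carrier ((V\<box>W)\<box>X) ==> as V W X t \<in> carrier (V\<box>W\<box>X)"
  and ai_in [simp]: "s \<in> carrier (V\<box>W\<box>X) ==> ai V W X s \<in> carrier ((V\<box>W)\<box>X)"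
  by (rule lin_closed[OF as_lin], assumption, rule lin_closed[OF ai_lin], assumption)

lemma ext_l: "lin ((V\<box>W)\<box>X) Z f ==> lin ((V\<box>W)\<box>X) Z g ==>
   (\<And>v w x. v \<in> carrier V ==> w \<in> carrier W ==> x \<in> carrier X ==> f (T3l V W X v w x) = g (T3l V W X v w x)) ==>
   t \<in> carrier ((V\<box>W)\<box>X) ==> f t = g t"
  using VWX tens3_ext[of V W X Z f g] by (simp add: tnorm tobj_simps)

lemma ext_r:
  assumes f: "lin (V\<box>W\<box>X) Z f" and g: "lin (V\<box>W\<box>X) Z g" and
   e: "(\<And>v w x. v \<in> carrier V ==> w \<in> carrier W ==> x \<in> carrier X ==> f (T3r V W X v w x) = g (T3r V W X v w x))" and
   t: "t \<in> carrier (V\<box>W\<box>X)"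
  shows "f t = g t"
proof (rule tens_ext_o[OF _ _ f g _ t])
  show "f (pt k V (W\<box>X) v s) = g (pt k V (W\<box>X) v s)" if v: "v \<in> carrier V" and s: "s \<in> carrier (W\<box>X)" for v s
    by (rule tens_ext_o[OF _ _ lin_comp[OF lin_pt2_o f] lin_comp[OF lin_pt2_o g] _ s])
      (use VWX v e in "auto intro: lin_id")
qed (use VWX in auto)

text \<open>By the module axiom, applying one map after the other multiplies \<phi> and \<psi> in
  the third tensor power of H, where they cancel.\<close>

lemma as_ai: "t \<in> carrier (V\<box>W\<box>X) ==> as V W X (ai V W X t) = t"
proof (erule ext_r[OF lin_comp[OF ai_lin as_lin] lin_id, rotated])
  let ?T = "V\<box>W\<box>X"
  fix v w x assume vwx: "v \<in> carrier V" "w \<in> carrier W" "x \<in> carrier X"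
  let ?G = "\<lambda>a b c. T3r V W X (act V a v) (act W b w) (act X c x)"
  have "as V W X (ai V W X (T3r V W X v w x)) =
    L3 ?T (\<lambda>a' b' c'. as V W X (T3l V W X (act V a' v) (act W b' w) (act X c' x))) \<psi>"
    using VWX vwx by (subst ai_pt, simp_all, subst L3_push[OF _ _ ai_tril as_lin]) auto
  also have "... = L3 ?T (\<lambda>a' b' c'. L3 ?T (\<lambda>a b c.
      T3r V W X (act V a (act V a' v)) (act W b (act W b' w)) (act X c (act X c' x))) (phi H)) \<psi>"
    using VWX vwx by (intro L3_cong) (simp add: as_pt)
  also have "... = L3 ?T ?G (m3 (phi H) \<psi>)"
    using VWX vwx by (intro L3_mult[symmetric] as_tril) (auto simp: act_mult)
  also have "... = T3r V W X v w x"
    using VWX vwx by (simp add: phi_phi_inv L3_pt[OF _ as_tril])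
  finally show "as V W X (ai V W X (T3r V W X v w x)) = T3r V W X v w x" .
qed

lemma ai_as: "t \<in> carrier ((V\<box>W)\<box>X) ==> ai V W X (as V W X t) = t"
proof (erule ext_l[OF lin_comp[OF as_lin ai_lin] lin_id, rotated])
  let ?T = "(V\<box>W)\<box>X"
  fix v w x assume vwx: "v \<in> carrier V" "w \<in> carrier W" "x \<in> carrier X"
  let ?G = "\<lambda>a b c. T3l V W X (act V a v) (act W b w) (act X c x)"
  have "ai V W X (as V W X (T3l V W X v w x)) =
    L3 ?T (\<lambda>a' b' c'. ai V W X (T3r V W X (act V a' v) (act W b' w) (act X c' x))) (phi H)"
    using VWX vwx by (subst as_pt, simp_all, subst L3_push[OF _ _ as_tril ai_lin]) auto
  also have "... = L3 ?T (\<lambda>a' b' c'. L3 ?T (\<lambda>a b c.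
      T3l V W X (act V a (act V a' v)) (act W b (act W b' w)) (act X c (act X c' x))) \<psi>) (phi H)"
    using VWX vwx by (intro L3_cong) (simp add: ai_pt)
  also have "... = L3 ?T ?G (m3 \<psi> (phi H))"
    using VWX vwx by (intro L3_mult[symmetric] ai_tril) (auto simp: act_mult)
  also have "... = T3l V W X v w x"
    using VWX vwx by (simp add: phi_inv_phi L3_pt[OF _ ai_tril])
  finally show "ai V W X (as V W X (T3l V W X v w x)) = T3l V W X v w x" .
qed

end

subsection \<open>Coassociativity and equivariance\<close>

text \<open>(\<Delta> \<otimes> id)\<Delta>(h) and, below, (id \<otimes> \<Delta>)\<Delta>(h), both
  written in (H \<otimes> H) \<otimes> H, where the quasi-coassociativity axiom compares
  them.\<close>

definition dL where "dL h = L2 HHH (\<lambda>a b. pt k HH H (comul H a) b) (comul H h)"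
definition dR where "dR h = L2 HHH (\<lambda>a b. L2 HHH (\<lambda>b1 b2. p3 a b1 b2) (comul H b)) (comul H h)"

lemma dL_bil: "bil H H HHH (\<lambda>a b. pt k HH H (comul H a) b)"
  by (auto intro!: LR)

lemma dR_bil: "bil H H HHH (\<lambda>a b. L2 HHH (\<lambda>b1 b2. p3 a b1 b2) (comul H b))"
  by (auto intro!: LR)

lemma dL_in [simp]: "h \<in> carrier H ==> dL h \<in> carrier HHH"
  and dR_in [simp]: "h \<in> carrier H ==> dR h \<in> carrier HHH"
  by (auto simp: dL_def dR_def intro!: L2_in dL_bil dR_bil)

lemma L3_ptHH:
  assumes "module k X" "tril H H H X F" "s \<in> carrier HH" "b \<in> carrier H"
  shows "L3 X F (pt k HH H s b) = L2 X (\<lambda>a1 a2. F a1 a2 b) s"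
  by (rule sym, rule bilift_eq[OF _ _ _ lin_comp[OF pt_bilinear(1) trilift_lin]])
    (use assms L3_pt[OF assms(1,2)] in auto)

lemma L3_dL:
  assumes "module k X" "tril H H H X F" "h \<in> carrier H"
  shows "L3 X F (dL h) = L2 X (\<lambda>a b. L2 X (\<lambda>a1 a2. F a1 a2 b) (comul H a)) (comul H h)"
  unfolding dL_def using assms
  by (subst L2_push[OF _ _ dL_bil trilift_lin]) (auto intro!: L2_cong simp: L3_ptHH)

lemma L3_dR:
  assumes "module k X" "tril H H H X F" "h \<in> carrier H"
  shows "L3 X F (dR h) = L2 X (\<lambda>a b. L2 X (\<lambda>b1 b2. F a b1 b2) (comul H b)) (comul H h)"
proof -
  have l: "lin HHH X (L3 X F)" using assms by (intro trilift_lin) auto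
  have "L3 X F (L2 HHH (\<lambda>b1 b2. p3 a b1 b2) (comul H b)) = L2 X (\<lambda>b1 b2. F a b1 b2) (comul H b)"
    if "a \<in> carrier H" "b \<in> carrier H" for a b
    using assms that L3_pt[OF assms(1,2)]
    by (subst L2_push[OF _ _ _ l]) (auto intro!: L2_cong LR)
  then show ?thesis
    unfolding dR_def using assms
    by (subst L2_push[OF _ _ dR_bil l]) (auto intro!: L2_cong)
qed

lemma ring_H3: "ring (tensor_alg k (tensor_alg k H H) H)"
  using algH3 unfolding assoc_alg_def by blast

text \<open>The axiom conjugates by \<phi>; here one factor is moved across. The first form serves
  maps built from \<phi> (the associator, evaluation), the second those built from \<psi>
  (currying).\<close>

lemma coassoc:
  assumes h: "h \<in> carrier H"
  shows "m3 (dR h) (phi H) = m3 (phi H) (dL h)" (is ?g2) "m3 \<psi> (dR h) = m3 (dL h) \<psi>" (is ?g1)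
proof -
  interpret H3: ring "tensor_alg k (tensor_alg k H H) H" by (rule ring_H3)
  have e: "dR h = m3 (m3 (phi H) (dL h)) \<psi>"
    using qtqh h unfolding quasitriangular_quasi_Hopf_def quasi_bialgebra_def by (simp add: dL_def dR_def)
  have c: "phi H \<in> carrier (tensor_alg k (tensor_alg k H H) H)" "\<psi> \<in> carrier (tensor_alg k (tensor_alg k H H) H)"
     "dL h \<in> carrier (tensor_alg k (tensor_alg k H H) H)" using h by simp_all
  show ?g2
    unfolding e using c phi_inv_phi by (simp only: H3.m_assoc H3.m_closed H3.r_one)
  show ?g1
    unfolding e using c phi_inv_phi by (simp only: H3.m_assoc[symmetric] H3.m_closed H3.l_one)
qed

text \<open>Acting before the associator multiplies \<phi> on the right by \<open>dL h\<close>,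
  acting afterwards multiplies it on the left by \<open>dR h\<close>; quasi-coassociativity is the
  equality of the two products.\<close>

lemma as_mor:
  assumes o: "obj V" "obj W" "obj X"
  shows "mor ((V\<box>W)\<box>X) (V\<box>W\<box>X) (as V W X)"
proof -
  let ?S = "(V\<box>W)\<box>X" and ?T = "V\<box>W\<box>X"
  note M = o[THEN obj_module]
  note l = as_lin[OF o]
  have oT: "obj ?S" "obj ?T" "obj (V\<box>W)" "obj (W\<box>X)" using o by auto
  note MT = oT[THEN obj_module]
  have "as V W X (act ?S h t) = act ?T h (as V W X t)" if h: "h \<in> carrier H" and t: "t \<in> carrier ?S" for h t
  proof (rule ext_l[OF o lin_comp[OF act_lin l] lin_comp[OF l act_lin] _ t])
    fix v w x assume vwx: "v \<in> carrier V" "w \<in> carrier W" "x \<in> carrier X"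
    let ?G = "\<lambda>a b c. T3r V W X (act V a v) (act W b w) (act X c x)"
    let ?K = "\<lambda>a' b' c'. L3 ?T (\<lambda>a b c.
        T3r V W X (act V a (act V a' v)) (act W b (act W b' w)) (act X c (act X c' x))) (phi H)"
    let ?K' = "\<lambda>a' b' c'. L3 ?T (\<lambda>a b c.
        T3r V W X (act V a (act V a' v)) (act W b (act W b' w)) (act X c (act X c' x))) (dR h)"
    have "as V W X (act ?S h (T3l V W X v w x)) =
       L2 ?T (\<lambda>a b. as V W X (pt k (V\<box>W) X (act (V\<box>W) a (pt k V W v w)) (act X b x))) (comul H h)"
      using vwx h o by (intro lin_act_pt l) auto
    also have "... = L2 ?T (\<lambda>a b. L2 ?T (\<lambda>a1 a2. as V W X (T3l V W X (act V a1 v) (act W a2 w) (act X b x))) (comul H a)) (comul H h)"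
      using vwx h o by (intro L2_cong lin_act_pt lin_comp[OF lin_pt1_o l] lin_id) auto
    also have "... = L2 ?T (\<lambda>a b. L2 ?T (\<lambda>a1 a2. ?K a1 a2 b) (comul H a)) (comul H h)"
      using vwx h o by (intro L2_cong) (simp add: as_pt)
    also have "... = L3 ?T ?K (dL h)"
      using vwx h o by (intro L3_dL[symmetric]) (auto intro!: LR)
    also have "... = L3 ?T ?G (m3 (phi H) (dL h))"
      using vwx h o by (intro L3_mult[symmetric] as_tril) (auto simp: act_mult)
    also have "... = L3 ?T ?G (m3 (dR h) (phi H))" using coassoc(1)[OF h] by simp
    also have "... = L3 ?T ?K' (phi H)"
      using vwx h o by (intro L3_mult as_tril) (auto simp: act_mult)
    also have "... = L3 ?T (\<lambda>a b c. act ?T h (?G a b c)) (phi H)"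
    proof (rule L3_cong)
      fix a b c assume abc: "a \<in> carrier H" "b \<in> carrier H" "c \<in> carrier H"
      have "act ?T h (?G a b c) = L2 ?T (\<lambda>a1 a2. pt k V (W\<box>X) (act V a1 (act V a v)) (act (W\<box>X) a2 (pt k W X (act W b w) (act X c x)))) (comul H h)"
        using vwx h o abc by (intro act_tens_pt) auto
      also have "... = L2 ?T (\<lambda>a1 a2. L2 ?T (\<lambda>b1 b2. T3r V W X (act V a1 (act V a v)) (act W b1 (act W b w)) (act X b2 (act X c x))) (comul H a2)) (comul H h)"
        using vwx h o abc by (intro L2_cong lin_act_pt lin_pt2_o lin_id) auto
      also have "... = ?K' a b c"
        using vwx h o abc by (intro L3_dR[symmetric]) (auto intro!: LR)
      finally show "?K' a b c = act ?T h (?G a b c)" by simp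
    qed
    also have "... = act ?T h (L3 ?T ?G (phi H))"
      using vwx h o by (intro L3_push[symmetric] as_tril act_lin) auto
    also have "... = act ?T h (as V W X (T3l V W X v w x))"
      using vwx o by (simp add: as_pt)
    finally show "as V W X (act ?S h (T3l V W X v w x)) = act ?T h (as V W X (T3l V W X v w x))" .
  qed (use oT h in auto)
  moreover have "as V W X t \<in> gr ?T n" if t: "t \<in> gr ?S n" for t n
  proof (rule tens_gr_lin[OF oT(3) o(3) MT(2) l gr_submod[OF oT(2)] _ t])
    fix s x p q assume s: "s \<in> gr (V\<box>W) p" and x: "x \<in> gr X q" and pq: "p + q = n"
    have xc: "x \<in> carrier X" using gr_in[OF o(3) x] .
    show "as V W X (pt k (V\<box>W) X s x) \<in> gr ?T n"
    proof (rule tens_gr_lin[OF o(1,2) MT(2) lin_comp[OF lin_pt1_o l] gr_submod[OF oT(2)] _ s])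
      fix v w p' q' assume vw: "v \<in> gr V p'" "w \<in> gr W q'" "p' + q' = p"
      then have vwc: "v \<in> carrier V" "w \<in> carrier W" using gr_in[OF o(1)] gr_in[OF o(2)] by auto
      show "as V W X (T3l V W X v w x) \<in> gr ?T n"
        unfolding as_pt[OF o vwc xc]
        by (rule trilift_submod[OF _ _ _ _ as_tril gr_submod])
          (use o vw x pq vwc xc in "auto intro!: tens_gr_pt act_gr")
    qed (use M MT xc lin_id in auto)
  qed
  ultimately show ?thesis using o l by (auto simp: mor_def)
qed

text \<open>Equivariance is inherited from the inverse map; the degree is checked on
  generators.\<close>

lemma ai_mor:
  assumes o: "obj V" "obj W" "obj X"
  shows "mor (V\<box>W\<box>X) ((V\<box>W)\<box>X) (ai V W X)"
proof -
  let ?S = "(V\<box>W)\<box>X" and ?T = "V\<box>W\<box>X"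
  note M = o[THEN obj_module]
  note l = ai_lin[OF o]
  have oT: "obj ?S" "obj ?T" "obj (V\<box>W)" "obj (W\<box>X)" using o by auto
  note MT = oT[THEN obj_module]
  have "ai V W X (act ?T h t) = act ?S h (ai V W X t)" if h: "h \<in> carrier H" and t: "t \<in> carrier ?T" for h t
  proof -
    have "ai V W X (act ?T h t) = ai V W X (act ?T h (as V W X (ai V W X t)))"
      using o t by (simp add: as_ai)
    also have "... = ai V W X (as V W X (act ?S h (ai V W X t)))"
      using o t h mor_act[OF as_mor[OF o]] by simp
    also have "... = act ?S h (ai V W X t)"
      using o t h by (simp add: ai_as)
    finally show ?thesis .
  qed
  moreover have "ai V W X t \<in> gr ?S n" if t: "t \<in> gr ?T n" for t n
  proof (rule tens_gr_lin[OF o(1) oT(4) MT(1) l gr_submod[OF oT(1)] _ t])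
    fix v s p q assume v: "v \<in> gr V p" and s: "s \<in> gr (W\<box>X) q" and pq: "p + q = n"
    have vc: "v \<in> carrier V" using gr_in[OF o(1) v] .
    show "ai V W X (pt k V (W\<box>X) v s) \<in> gr ?S n"
    proof (rule tens_gr_lin[OF o(2,3) MT(1) lin_comp[OF lin_pt2_o l] gr_submod[OF oT(1)] _ s])
      fix w x p' q' assume vw: "w \<in> gr W p'" "x \<in> gr X q'" "p' + q' = q"
      then have vwc: "w \<in> carrier W" "x \<in> carrier X" using gr_in[OF o(2)] gr_in[OF o(3)] by auto
      show "ai V W X (T3r V W X v w x) \<in> gr ?S n"
        unfolding ai_pt[OF o vc vwc]
        by (rule trilift_submod[OF _ _ _ _ ai_tril gr_submod])
          (use o vw v pq vwc vc in \<open>auto intro!: tens_gr_pt[where p = "p + p'"] tens_gr_pt act_gr\<close>)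
    qed (use M MT vc lin_id in auto)
  qed
  ultimately show ?thesis using o l by (auto simp: mor_def)
qed

text \<open>Morphisms commute with the action, hence with each leg of \<phi>.\<close>

lemma as_nat:
  assumes m: "mor V V' f" "mor W W' g" "mor X X' h" and t: "t \<in> carrier ((V\<box>W)\<box>X)"
  shows "as V' W' X' (tm (V\<box>W) X (V'\<box>W') X' (tm V W V' W' f g) h t) =
    tm V (W\<box>X) V' (W'\<box>X') f (tm W X W' X' g h) (as V W X t)"
proof -
  note o = m[THEN mor_obj(1)] and o' = m[THEN mor_obj(2)] and ml = m[THEN mor_lin]
  note M = o[THEN obj_module] o'[THEN obj_module]
  have t1: "mor (V\<box>W) (V'\<box>W') (tm V W V' W' f g)" "mor (W\<box>X) (W'\<box>X') (tm W X W' X' g h)"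
    using m by (auto intro: tmap_mor)
  have t2: "mor ((V\<box>W)\<box>X) ((V'\<box>W')\<box>X') (tm (V\<box>W) X (V'\<box>W') X' (tm V W V' W' f g) h)"
    "mor (V\<box>(W\<box>X)) (V'\<box>(W'\<box>X')) (tm V (W\<box>X) V' (W'\<box>X') f (tm W X W' X' g h))"
    using m t1 by (auto intro: tmap_mor)
  show ?thesis
  proof (rule ext_l[OF o lin_comp[OF mor_lin[OF t2(1)] as_lin[OF o']] lin_comp[OF as_lin[OF o] mor_lin[OF t2(2)]] _ t])
    fix v w x assume vwx: "v \<in> carrier V" "w \<in> carrier W" "x \<in> carrier X"
    note fv = mor_in[OF m(1) vwx(1)] mor_in[OF m(2) vwx(2)] mor_in[OF m(3) vwx(3)]
    have 1: "tm (V\<box>W) X (V'\<box>W') X' (tm V W V' W' f g) h (T3l V W X v w x) = T3l V' W' X' (f v) (g w) (h x)"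
      using vwx M ml t1[THEN mor_lin] by (simp add: tmap_pt)
    have 2: "tm V (W\<box>X) V' (W'\<box>X') f (tm W X W' X' g h) (T3r V W X v w x) = T3r V' W' X' (f v) (g w) (h x)"
      if "v \<in> carrier V" "w \<in> carrier W" "x \<in> carrier X" for v w x
      using that M ml t1[THEN mor_lin] by (simp add: tmap_pt)
    show "as V' W' X' (tm (V\<box>W) X (V'\<box>W') X' (tm V W V' W' f g) h (T3l V W X v w x)) =
      tm V (W\<box>X) V' (W'\<box>X') f (tm W X W' X' g h) (as V W X (T3l V W X v w x))"
      unfolding 1 as_pt[OF o' fv] as_pt[OF o vwx]
      using o o' vwx by (subst L3_push[OF _ _ as_tril mor_lin[OF t2(2)]])
        (auto intro!: L3_cong simp: 2 mor_act[OF m(1)] mor_act[OF m(2)] mor_act[OF m(3)])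
  qed
qed

lemma ai_nat:
  assumes m: "mor V V' f" "mor W W' g" "mor X X' h" and t: "t \<in> carrier (V\<box>W\<box>X)"
  shows "ai V' W' X' (tm V (W\<box>X) V' (W'\<box>X') f (tm W X W' X' g h) t) =
    tm (V\<box>W) X (V'\<box>W') X' (tm V W V' W' f g) h (ai V W X t)"
proof -
  note o = m[THEN mor_obj(1)] and o' = m[THEN mor_obj(2)]
  have t2: "mor ((V\<box>W)\<box>X) ((V'\<box>W')\<box>X') (tm (V\<box>W) X (V'\<box>W') X' (tm V W V' W' f g) h)"
    using m by (auto intro: tmap_mor)
  show ?thesis
    using as_nat[OF m ai_in[OF o t]] as_ai[OF o t] ai_as[OF o' mor_in[OF t2 ai_in[OF o t]]] by simp
qed

section \<open>The pentagon\<close>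

abbreviation pure4H where "pure4H a b c d \<equiv> pure4 H H H H a b c d"

lemma lin_L3_expand:
  assumes X: "module k X" and Y: "module k Y" and f: "lin Y X f"
    and P: "tril H H H Y P" and e: "\<And>a b c. a \<in> carrier H ==> b \<in> carrier H ==> c \<in> carrier H ==> f (P a b c) = G a b c"
    and s: "s \<in> carrier HHH"
  shows "f (L3 Y P s) = L3 X G s"
  using L3_push[OF Y X P f s] L3_cong[of "\<lambda>a b c. f (P a b c)" G] e by simp

lemma lin_L2_expand:
  assumes X: "module k X" and Y: "module k Y" and f: "lin Y X f"
    and P: "bil H H Y P" and e: "\<And>a b. a \<in> carrier H ==> b \<in> carrier H ==> f (P a b) = G a b"
    and s: "s \<in> carrier HH"
  shows "f (L2 Y P s) = L2 X G s"
  using L2_push[OF Y X P f s] L2_cong[of "\<lambda>a b. f (P a b)" G] e by simp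

text \<open>The five images of an element of H \<otimes> H \<otimes> H in the fourth tensor power
  that occur in the pentagon: \<Delta> on the last, first and middle leg (\<open>QA\<close>,
  \<open>QB\<close>, \<open>QD\<close>), and a 1 in front or behind (\<open>QC\<close>,
  \<open>QE\<close>). The argument is left free because they are also applied to \<psi>.\<close>

definition QA where "QA s = L3 HHHH (\<lambda>a b c. L2 HHHH (\<lambda>c1 c2. pure4H a b c1 c2) (comul H c)) s"
definition QB where "QB s = L3 HHHH (\<lambda>a b c. L2 HHHH (\<lambda>a1 a2. pure4H a1 a2 b c) (comul H a)) s"
definition QC where "QC s = L3 HHHH (\<lambda>a b c. pure4H \<one>\<^sub>H a b c) s"
definition QD where "QD s = L3 HHHH (\<lambda>a b c. L2 HHHH (\<lambda>b1 b2. pure4H a b1 b2 c) (comul H b)) s"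
definition QE where "QE s = L3 HHHH (\<lambda>a b c. pure4H a b c \<one>\<^sub>H) s"

abbreviation "PA \<equiv> QA (phi H)"
abbreviation "PB \<equiv> QB (phi H)"
abbreviation "PC \<equiv> QC (phi H)"
abbreviation "PD \<equiv> QD (phi H)"
abbreviation "PE \<equiv> QE (phi H)"

lemma pentagon_H: "m4 PA PB = m4 (m4 PC PD) PE"
proof -
  have "trilift k H H H HHHH (\<lambda>a b c. bilift k H H HHHH (\<lambda>c1 c2. pure4H a b c1 c2) (comul H c)) (phi H)
       \<otimes>\<^bsub>tensor_alg k (tensor_alg k (tensor_alg k H H) H) H\<^esub>
     trilift k H H H HHHH (\<lambda>a b c. bilift k H H HHHH (\<lambda>a1 a2. pure4H a1 a2 b c) (comul H a)) (phi H) =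
     trilift k H H H HHHH (\<lambda>a b c. pure4H \<one>\<^sub>H a b c) (phi H)
       \<otimes>\<^bsub>tensor_alg k (tensor_alg k (tensor_alg k H H) H) H\<^esub>
     trilift k H H H HHHH (\<lambda>a b c. bilift k H H HHHH (\<lambda>b1 b2. pure4H a b1 b2 c) (comul H b)) (phi H)
       \<otimes>\<^bsub>tensor_alg k (tensor_alg k (tensor_alg k H H) H) H\<^esub>
     trilift k H H H HHHH (\<lambda>a b c. pure4H a b c \<one>\<^sub>H) (phi H)"
    using qtqh unfolding quasitriangular_quasi_Hopf_def quasi_bialgebra_def by simp
  then show ?thesis by (simp add: QA_def QB_def QC_def QD_def QE_def)
qed

lemma P_trils:
  "tril H H H HHHH (\<lambda>a b c. L2 HHHH (\<lambda>c1 c2. pure4H a b c1 c2) (comul H c))"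
  "tril H H H HHHH (\<lambda>a b c. L2 HHHH (\<lambda>a1 a2. pure4H a1 a2 b c) (comul H a))"
  "tril H H H HHHH (\<lambda>a b c. pure4H \<one>\<^sub>H a b c)"
  "tril H H H HHHH (\<lambda>a b c. L2 HHHH (\<lambda>b1 b2. pure4H a b1 b2 c) (comul H b))"
  "tril H H H HHHH (\<lambda>a b c. pure4H a b c \<one>\<^sub>H)"
  by (auto intro!: LR)

lemma P_in [simp]: "s \<in> carrier HHH ==> QA s \<in> carrier HHHH" "s \<in> carrier HHH ==> QB s \<in> carrier HHHH" "s \<in> carrier HHH ==> QC s \<in> carrier HHHH" "s \<in> carrier HHH ==> QD s \<in> carrier HHHH" "s \<in> carrier HHH ==> QE s \<in> carrier HHHH"
  by (auto simp: QA_def QB_def QC_def QD_def QE_def intro!: L3_in P_trils)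

lemma P_expand:
  assumes X: "module k X" and f: "lin HHHH X f" and s: "s \<in> carrier HHH"
  shows "f (QA s) = L3 X (\<lambda>a b c. L2 X (\<lambda>c1 c2. f (pure4H a b c1 c2)) (comul H c)) s"
  "f (QB s) = L3 X (\<lambda>a b c. L2 X (\<lambda>a1 a2. f (pure4H a1 a2 b c)) (comul H a)) s"
  "f (QC s) = L3 X (\<lambda>a b c. f (pure4H \<one>\<^sub>H a b c)) s"
  "f (QD s) = L3 X (\<lambda>a b c. L2 X (\<lambda>b1 b2. f (pure4H a b1 b2 c)) (comul H b)) s"
  "f (QE s) = L3 X (\<lambda>a b c. f (pure4H a b c \<one>\<^sub>H)) s"
  unfolding QA_def QB_def QC_def QD_def QE_def
  by (rule lin_L3_expand[OF X _ f]; (rule P_trils)?; (rule lin_L2_expand[OF X _ f])?; auto intro!: LR s)+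

lemma algH4: "assoc_alg k (tensor_alg k (tensor_alg k (tensor_alg k H H) H) H)"
  by simp

lemma m4_in [simp]: "s \<in> carrier HHHH ==> t \<in> carrier HHHH ==> m4 s t \<in> carrier HHHH"
  using tens_mult_in[of "tensor_alg k (tensor_alg k H H) H" H s t] by simp

lemma m4_lin: "s \<in> carrier HHHH ==> lin HHHH HHHH (\<lambda>t. m4 s t)" "t \<in> carrier HHHH ==> lin HHHH HHHH (\<lambda>s. m4 s t)"
  using bilD[OF tensor_mult_bil(1)[OF algH3 algH]] by (simp_all)

lemma m4_pure: "a \<in> carrier H ==> b \<in> carrier H ==> c \<in> carrier H ==> d \<in> carrier H ==>
   a' \<in> carrier H ==> b' \<in> carrier H ==> c' \<in> carrier H ==> d' \<in> carrier H ==>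
   m4 (pure4H a b c d) (pure4H a' b' c' d') = pure4H (a \<cdot> a') (b \<cdot> b') (c \<cdot> c') (d \<cdot> d')"
  using tensor_mult_pt[OF algH3 algH, of "p3 a b c" d "p3 a' b' c'" d']
    tensor_mult_pt[OF algH2 algH, of "p2 a b" c "p2 a' b'" c'] tensor_mult_pt[OF algH algH, of a b a' b']
  by simp

text \<open>Each composite of associators is the action of a product in the fourth tensor power of H
  on the vectors v, w, x, y. The rightmost factor belongs to the associator applied first. Once both
  sides are written in this way, \<open>pentagon_H\<close> identifies the two products.\<close>

lemma pentagon:
  assumes o: "obj V" "obj W" "obj X" "obj Y" and t: "t \<in> carrier (((V\<box>W)\<box>X)\<box>Y)"
  shows "as V W (X\<box>Y) (as (V\<box>W) X Y t) =
    tm V ((W\<box>X)\<box>Y) V (W\<box>X\<box>Y) (\<lambda>v. v) (as W X Y) (as V (W\<box>X) Y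
      (tm ((V\<box>W)\<box>X) Y (V\<box>W\<box>X) Y (as V W X) (\<lambda>y. y) t))"
proof -
  let ?T = "V\<box>W\<box>X\<box>Y"
  note M = o[THEN obj_module]
  have oT: "obj ?T" using o by simp
  note MT = obj_module[OF oT]
  let ?p = "\<lambda>v w x y. pt k V (W\<box>X\<box>Y) v (pt k W (X\<box>Y) w (pt k X Y x y))"
  let ?q = "\<lambda>v w x y a b c d. ?p (act V a v) (act W b w) (act X c x) (act Y d y)"
  \<comment> \<open>For fixed vectors, the linear map by which the fourth tensor power of H acts on
    them and lands in the target.\<close>
  let ?Q = "\<lambda>v w x y. L4 ?T (?q v w x y)"
  let ?r = "tm V ((W\<box>X)\<box>Y) V (W\<box>X\<box>Y) (\<lambda>v. v) (as W X Y)"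
  let ?e = "tm ((V\<box>W)\<box>X) Y (V\<box>W\<box>X) Y (as V W X) (\<lambda>y. y)"
  have lr: "lin (V\<box>(W\<box>X)\<box>Y) ?T ?r" using o by (intro tmap_lin_o as_lin lin_id) auto
  have le: "lin (((V\<box>W)\<box>X)\<box>Y) ((V\<box>W\<box>X)\<box>Y) ?e" using o by (intro tmap_lin_o as_lin lin_id) auto
  have lL: "lin (((V\<box>W)\<box>X)\<box>Y) ?T (\<lambda>t. as V W (X\<box>Y) (as (V\<box>W) X Y t))"
    using o by (intro lin_comp[OF as_lin as_lin]) auto
  have la: "lin ((V\<box>W\<box>X)\<box>Y) ?T (\<lambda>s. ?r (as V (W\<box>X) Y s))"
    using o by (intro lin_comp[OF as_lin lr]) auto
  show ?thesis
  proof (rule ext_l[OF _ _ _ lL lin_comp[OF le la] _ t])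
    fix s x y assume s: "s \<in> carrier (V\<box>W)" and x: "x \<in> carrier X" and y: "y \<in> carrier Y"
    show "as V W (X\<box>Y) (as (V\<box>W) X Y (T3l (V\<box>W) X Y s x y)) = ?r (as V (W\<box>X) Y (?e (T3l (V\<box>W) X Y s x y)))"
    proof (rule tens_ext_o[OF M(1,2) lin_comp[OF lin_pt1_o[OF _ _ lin_pt1_o[OF _ _ lin_id]] lL]
        lin_comp[OF lin_pt1_o[OF _ _ lin_pt1_o[OF _ _ lin_id]] lin_comp[OF le la]] _ s])
      fix v w assume v: "v \<in> carrier V" and w: "w \<in> carrier W"
      note vw = v w x y
      have q: "quadl H H H H ?T (?q v w x y)"
        if "v \<in> carrier V" "w \<in> carrier W" "x \<in> carrier X" "y \<in> carrier Y" for v w x y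
        using o that by (auto intro!: LR)
      note Ql = quadlift_lin[OF modH modH modH modH MT q]
      have Qp: "?Q v w x y (pure4H a b c d) = ?q v w x y a b c d"
        if "v \<in> carrier V" "w \<in> carrier W" "x \<in> carrier X" "y \<in> carrier Y" "a \<in> carrier H" "b \<in> carrier H" "c \<in> carrier H" "d \<in> carrier H"
        for v w x y a b c d
        using that by (intro quadlift_pt[OF modH modH modH modH MT q])
      \<comment> \<open>Right multiplication by a pure tensor becomes its action on the vectors;
        this is what lets a product be taken apart from the right.\<close>
      have Qm: "?Q v w x y (m4 s (pure4H a b c d)) = ?Q (act V a v) (act W b w) (act X c x) (act Y d y) s"
        if vw: "v \<in> carrier V" "w \<in> carrier W" "x \<in> carrier X" "y \<in> carrier Y" and
           abcd: "a \<in> carrier H" "b \<in> carrier H" "c \<in> carrier H" "d \<in> carrier H" and s: "s \<in> carrier HHHH"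
        for v w x y a b c d s
        by (rule tens4_ext[OF modH modH modH modH lin_comp[OF m4_lin(2) Ql[OF vw]] Ql _ s])
          (use vw abcd o in "auto simp: Qp m4_pure act_mult")
      have QA: "?Q v w x y PA = L3 ?T (\<lambda>a b c. L2 ?T (\<lambda>c1 c2. ?q v w x y a b c1 c2) (comul H c)) (phi H)"
        if "v \<in> carrier V" "w \<in> carrier W" "x \<in> carrier X" "y \<in> carrier Y" for v w x y
        using that by (subst P_expand(1)[OF MT Ql]) (auto intro!: L3_cong L2_cong simp only: phi_in Qp)
      have QC: "?Q v w x y PC = L3 ?T (\<lambda>a b c. ?q v w x y \<one>\<^sub>H a b c) (phi H)"
        if "v \<in> carrier V" "w \<in> carrier W" "x \<in> carrier X" "y \<in> carrier Y" for v w x y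
        using that by (subst P_expand(3)[OF MT Ql]) (auto intro!: L3_cong simp only: phi_in Qp alg_one_in[OF algH])
      have "as V W (X\<box>Y) (as (V\<box>W) X Y (T3l (V\<box>W) X Y (pt k V W v w) x y)) =
        L3 ?T (\<lambda>a b c. as V W (X\<box>Y) (pt k (V\<box>W) (X\<box>Y) (act (V\<box>W) a (pt k V W v w)) (pt k X Y (act X b x) (act Y c y)))) (phi H)"
        using o vw by (subst as_pt, simp_all, subst L3_push[OF _ _ as_tril as_lin]) auto
      also have "... = L3 ?T (\<lambda>a b c. L2 ?T (\<lambda>a1 a2. ?Q (act V a1 v) (act W a2 w) (act X b x) (act Y c y) PA) (comul H a)) (phi H)"
      proof (rule L3_cong)
        fix a b c assume abc: "a \<in> carrier H" "b \<in> carrier H" "c \<in> carrier H"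
        let ?x = "act X b x" and ?y = "act Y c y"
        have z: "?x \<in> carrier X" "?y \<in> carrier Y" using o vw abc by auto
        have "as V W (X\<box>Y) (pt k (V\<box>W) (X\<box>Y) (act (V\<box>W) a (pt k V W v w)) (pt k X Y ?x ?y)) =
          L2 ?T (\<lambda>a1 a2. as V W (X\<box>Y) (T3l V W (X\<box>Y) (act V a1 v) (act W a2 w) (pt k X Y ?x ?y))) (comul H a)"
          using o vw abc z by (intro lin_act_pt lin_comp[OF lin_pt1_o as_lin] lin_id) auto
        also have "... = L2 ?T (\<lambda>a1 a2. ?Q (act V a1 v) (act W a2 w) ?x ?y PA) (comul H a)"
        proof (rule L2_cong)
          fix a1 a2 assume a12: "a1 \<in> carrier H" "a2 \<in> carrier H"
          let ?v = "act V a1 v" and ?w = "act W a2 w"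
          have u: "?v \<in> carrier V" "?w \<in> carrier W" using o vw a12 by auto
          have "as V W (X\<box>Y) (T3l V W (X\<box>Y) ?v ?w (pt k X Y ?x ?y)) =
             L3 ?T (\<lambda>a b c. T3r V W (X\<box>Y) (act V a ?v) (act W b ?w) (act (X\<box>Y) c (pt k X Y ?x ?y))) (phi H)"
            using o u z by (intro as_pt) auto
          also have "... = ?Q ?v ?w ?x ?y PA"
            unfolding QA[OF u z]
            by (rule L3_cong, rule lin_act_pt) (use o u z in "auto intro!: LR")
          finally show "as V W (X\<box>Y) (T3l V W (X\<box>Y) ?v ?w (pt k X Y ?x ?y)) = ?Q ?v ?w ?x ?y PA" .
        qed
        finally show "as V W (X\<box>Y) (pt k (V\<box>W) (X\<box>Y) (act (V\<box>W) a (pt k V W v w)) (pt k X Y ?x ?y)) =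
          L2 ?T (\<lambda>a1 a2. ?Q (act V a1 v) (act W a2 w) ?x ?y PA) (comul H a)" .
      qed
      also have "... = L3 ?T (\<lambda>a b c. L2 ?T (\<lambda>a1 a2. ?Q v w x y (m4 PA (pure4H a1 a2 b c))) (comul H a)) (phi H)"
        using o vw by (intro L3_cong L2_cong) (simp add: Qm)
      \<comment> \<open>The associator applied first lets one leg act on V \<otimes> W through
        \<Delta>, which is the factor \<open>PB\<close>.\<close>
      also have "... = ?Q v w x y (m4 PA PB)"
        by (rule P_expand(2)[OF MT lin_comp[OF m4_lin(1) Ql[OF vw]], symmetric]) simp_all
      also have "... = ?Q v w x y (m4 (m4 PC PD) PE)" by (simp add: pentagon_H)
      also have "... = L3 ?T (\<lambda>a b c. ?Q v w x y (m4 (m4 PC PD) (pure4H a b c \<one>\<^sub>H))) (phi H)"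
        by (rule P_expand(5)[OF MT lin_comp[OF m4_lin(1) Ql[OF vw]]]) simp_all
      also have "... = L3 ?T (\<lambda>a b c. ?r (as V (W\<box>X) Y (pt k (V\<box>W\<box>X) Y (T3r V W X (act V a v) (act W b w) (act X c x)) y))) (phi H)"
      proof (rule L3_cong)
        fix a b c assume abc: "a \<in> carrier H" "b \<in> carrier H" "c \<in> carrier H"
        let ?v = "act V a v" and ?w = "act W b w" and ?x = "act X c x"
        have z: "?v \<in> carrier V" "?w \<in> carrier W" "?x \<in> carrier X" "y \<in> carrier Y" using o vw abc by auto
        have "?Q v w x y (m4 (m4 PC PD) (pure4H a b c \<one>\<^sub>H)) = ?Q ?v ?w ?x y (m4 PC PD)"
          using o vw abc by (simp add: Qm)
        also have "... = L3 ?T (\<lambda>a b c. L2 ?T (\<lambda>b1 b2. ?Q ?v ?w ?x y (m4 PC (pure4H a b1 b2 c))) (comul H b)) (phi H)"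
          by (rule P_expand(4)[OF MT lin_comp[OF m4_lin(1) Ql[OF z]]]) simp_all
        also have "... = L3 ?T (\<lambda>a b c. ?r (T3r V (W\<box>X) Y (act V a ?v) (act (W\<box>X) b (pt k W X ?w ?x)) (act Y c y))) (phi H)"
        proof (rule L3_cong)
          fix a b c assume abc: "a \<in> carrier H" "b \<in> carrier H" "c \<in> carrier H"
          have u: "act V a ?v \<in> carrier V" "act Y c y \<in> carrier Y" using o z abc by auto
          have "?r (T3r V (W\<box>X) Y (act V a ?v) (act (W\<box>X) b (pt k W X ?w ?x)) (act Y c y)) =
            L2 ?T (\<lambda>b1 b2. ?r (T3r V (W\<box>X) Y (act V a ?v) (pt k W X (act W b1 ?w) (act X b2 ?x)) (act Y c y))) (comul H b)"
            using o z u abc by (intro lin_act_pt lin_comp[OF lin_pt2_o[OF _ _ lin_pt1_o] lr] lin_id) auto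
          also have "... = L2 ?T (\<lambda>b1 b2. ?Q ?v ?w ?x y (m4 PC (pure4H a b1 b2 c))) (comul H b)"
          proof (rule L2_cong)
            fix b1 b2 assume b12: "b1 \<in> carrier H" "b2 \<in> carrier H"
            let ?w' = "act W b1 ?w" and ?x' = "act X b2 ?x" and ?v' = "act V a ?v" and ?y' = "act Y c y"
            have u': "?w' \<in> carrier W" "?x' \<in> carrier X" using o z b12 by auto
            have "?r (T3r V (W\<box>X) Y ?v' (pt k W X ?w' ?x') ?y') = pt k V (W\<box>X\<box>Y) ?v' (as W X Y (T3l W X Y ?w' ?x' ?y'))"
              using o u u' by (intro tmap_pt as_lin lin_id) auto
            also have "... = L3 ?T (\<lambda>a b c. ?p ?v' (act W a ?w') (act X b ?x') (act Y c ?y')) (phi H)"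
              unfolding as_pt[OF o(2-4) u' u(2)]
              using o u u' by (intro L3_push lin_pt2_o lin_id as_tril) auto
            also have "... = ?Q ?v' ?w' ?x' ?y' PC"
              using o u by (simp add: QC[OF u(1) u' u(2)])
            also have "... = ?Q ?v ?w ?x y (m4 PC (pure4H a b1 b2 c))"
              using z abc b12 by (simp add: Qm)
            finally show "?r (T3r V (W\<box>X) Y ?v' (pt k W X ?w' ?x') ?y') = ?Q ?v ?w ?x y (m4 PC (pure4H a b1 b2 c))" .
          qed
          finally show "L2 ?T (\<lambda>b1 b2. ?Q ?v ?w ?x y (m4 PC (pure4H a b1 b2 c))) (comul H b) =
            ?r (T3r V (W\<box>X) Y (act V a ?v) (act (W\<box>X) b (pt k W X ?w ?x)) (act Y c y))" by simp
        qed
        also have "... = ?r (L3 (V\<box>(W\<box>X)\<box>Y) (\<lambda>a b c. T3r V (W\<box>X) Y (act V a ?v) (act (W\<box>X) b (pt k W X ?w ?x)) (act Y c y)) (phi H))"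
          using o z by (intro L3_push[symmetric] as_tril lr) auto
        also have "... = ?r (as V (W\<box>X) Y (pt k (V\<box>W\<box>X) Y (T3r V W X ?v ?w ?x) y))"
          using o z by (subst as_pt) auto
        finally show "?Q v w x y (m4 (m4 PC PD) (pure4H a b c \<one>\<^sub>H)) = ?r (as V (W\<box>X) Y (pt k (V\<box>W\<box>X) Y (T3r V W X ?v ?w ?x) y))" .
      qed
      also have "... = ?r (as V (W\<box>X) Y (pt k (V\<box>W\<box>X) Y (L3 (V\<box>W\<box>X) (\<lambda>a b c. T3r V W X (act V a v) (act W b w) (act X c x)) (phi H)) y))"
        using o vw by (intro L3_push[symmetric] as_tril lin_comp[OF lin_pt1_o la] lin_id) auto
      also have "... = ?r (as V (W\<box>X) Y (?e (T3l (V\<box>W) X Y (pt k V W v w) x y)))"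
        using o vw by (simp add: tmap_pt as_lin lin_id as_pt)
      finally show "as V W (X\<box>Y) (as (V\<box>W) X Y (T3l (V\<box>W) X Y (pt k V W v w) x y)) =
        ?r (as V (W\<box>X) Y (?e (T3l (V\<box>W) X Y (pt k V W v w) x y)))" .
    qed (use o x y in auto)
  qed (use o in auto)
qed

section \<open>The braiding\<close>

abbreviation br where "br \<equiv> braiding k H"

text \<open>The braiding without its sign. It is given by one formula on all vectors, whereas the
  sign is a matter of homogeneous ones, so the two are treated separately.\<close>

definition br0 where
  "br0 V W v w = L2 (W\<box>V) (\<lambda>a b. pt k W V (act W b w) (act V a v)) (rmat H)"

lemma koszul_in: "module k X ==> x \<in> carrier X ==> koszul X m n x \<in> carrier X"
  by (simp add: koszul_def)

lemma lin_koszul: "module k X ==> lin Y X f ==> lin Y X (\<lambda>y. koszul X m n (f y))"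
  by (cases "even (m * n)") (auto simp: koszul_def lin_negf)

lemma koszul_push: "module k X ==> module k Y ==> lin X Y f ==> x \<in> carrier X ==> f (koszul X m n x) = koszul Y m n (f x)"
  by (simp add: koszul_def lin_neg)

lemma koszul_koszul: "module k X ==> x \<in> carrier X ==> koszul X m p (koszul X n p x) = koszul X (m + n) p x"
  "module k X ==> x \<in> carrier X ==> koszul X p m (koszul X p n x) = koszul X p (m + n) x"
  by (auto simp: koszul_def)

lemma koszul_zero: "module k X ==> koszul X m n \<zero>\<^bsub>X\<^esub> = \<zero>\<^bsub>X\<^esub>"
  by (simp add: koszul_def)

lemma lin_hcomp: "obj V ==> lin Y V f ==> lin Y V (\<lambda>y. hcomp V (f y) n)"
  by (rule lin_comp[OF _ hcomp_lin])

lemma br0_bil: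
  assumes "obj V" "obj W" "module k Y"
  shows "lin Y V f ==> w \<in> carrier W ==> lin Y (W\<box>V) (\<lambda>y. br0 V W (f y) w)"
    "lin Y W g ==> v \<in> carrier V ==> lin Y (W\<box>V) (\<lambda>y. br0 V W v (g y))"
  unfolding br0_def using assms by (auto intro!: LR act_in dest: lin_closed)

lemma br0_in [simp]: "obj V ==> obj W ==> v \<in> carrier V ==> w \<in> carrier W ==> br0 V W v w \<in> carrier (W\<box>V)"
  unfolding br0_def by (auto intro!: LR)

lemma br0_zero: "obj V ==> obj W ==> w \<in> carrier W ==> br0 V W \<zero>\<^bsub>V\<^esub> w = \<zero>\<^bsub>W\<box>V\<^esub>"
  "obj V ==> obj W ==> v \<in> carrier V ==> br0 V W v \<zero>\<^bsub>W\<^esub> = \<zero>\<^bsub>W\<box>V\<^esub>"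
  using lin_zero[OF _ _ br0_bil(1)[OF _ _ _ lin_id], of V W w] lin_zero[OF _ _ br0_bil(2)[OF _ _ _ lin_id], of W V v]
  by simp_all

lemma br_bil:
  assumes V: "obj V" and W: "obj W"
  shows "bil V W (W\<box>V) (\<lambda>v w. \<Oplus>\<^bsub>W\<box>V\<^esub>m\<in>gr_support V. \<Oplus>\<^bsub>W\<box>V\<^esub>n\<in>gr_support W. koszul (W\<box>V) m n
         (br0 V W (hcomp V v m) (hcomp W w n)))"
  by (intro bilI lin_finsumf lin_koszul br0_bil(1)[OF V W] br0_bil(2)[OF V W] lin_hcomp[OF V] lin_hcomp[OF W] lin_id)
    (use V W in "auto simp: gr_finite intro!: br0_bil lin_hcomp lin_id")

lemma br_eq: "br V W = bilift k V W (W\<box>V) (\<lambda>v w. \<Oplus>\<^bsub>W\<box>V\<^esub>m\<in>gr_support V. \<Oplus>\<^bsub>W\<box>V\<^esub>n\<in>gr_support W. koszul (W\<box>V) m n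
         (br0 V W (hcomp V v m) (hcomp W w n)))"
  by (simp add: braiding_def Let_def br0_def)

lemma br_lin: "obj V ==> obj W ==> lin (V\<box>W) (W\<box>V) (br V W)"
  unfolding br_eq by (intro bilift_lin_o br_bil) auto

text \<open>The double sum over degrees has at most one nonzero term. If a degree lies outside its
  support, that term is missing, but then the vector itself is zero.\<close>

lemma br_hom:
  assumes V: "obj V" and W: "obj W" and v: "v \<in> gr V p" and w: "w \<in> gr W q"
  shows "br V W (pt k V W v w) = koszul (W\<box>V) p q (br0 V W v w)"
proof -
  let ?T = "W\<box>V"
  have M: "module k ?T" using V W by simp
  have vw: "v \<in> carrier V" "w \<in> carrier W" using gr_in[OF V v] gr_in[OF W w] by auto
  let ?f = "\<lambda>m n. koszul ?T m n (br0 V W (hcomp V v m) (hcomp W w n))"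
  have f: "?f m n = (if m = p \<and> n = q then koszul ?T p q (br0 V W v w) else \<zero>\<^bsub>?T\<^esub>)" for m n
    using V W vw by (simp add: hcomp_hom[OF V v] hcomp_hom[OF W w] br0_zero koszul_zero)
  have c: "koszul ?T p q (br0 V W v w) \<in> carrier ?T" using V W vw by (simp add: koszul_in)
  have "br V W (pt k V W v w) = (\<Oplus>\<^bsub>?T\<^esub>m\<in>gr_support V. \<Oplus>\<^bsub>?T\<^esub>n\<in>gr_support W. ?f m n)"
    unfolding br_eq by (rule bilift_pt[OF _ _ _ br_bil]) (use V W vw in auto)
  also have "... = koszul ?T p q (br0 V W v w)"
  proof (cases "p \<in> gr_support V \<and> q \<in> gr_support W")
    case True
    have i: "(\<Oplus>\<^bsub>?T\<^esub>n\<in>gr_support W. ?f m n) = (if m = p then koszul ?T p q (br0 V W v w) else \<zero>\<^bsub>?T\<^esub>)" for m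
    proof (cases "m = p")
      case True
      have "(\<Oplus>\<^bsub>?T\<^esub>n\<in>gr_support W. ?f m n) = ?f m q"
        by (rule finsum_single[OF M gr_finite[OF W]]) (use \<open>p \<in> gr_support V \<and> q \<in> gr_support W\<close> True c in "simp_all add: f")
      then show ?thesis using True by (simp add: f)
    next
      case False
      then show ?thesis by (simp add: finsum_eq_zero[OF M] f)
    qed
    show ?thesis unfolding i
      by (subst finsum_single[OF M gr_finite[OF V], of p]) (use True c in simp_all)
  next
    case False
    then have "v = \<zero>\<^bsub>V\<^esub> \<or> w = \<zero>\<^bsub>W\<^esub>" using gr_nsupport[OF v] gr_nsupport[OF w] by auto
    then have 0: "br0 V W v w = \<zero>\<^bsub>?T\<^esub>" using br0_zero(1)[OF V W vw(2)] br0_zero(2)[OF V W vw(1)] by metis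
    have "?f m n = \<zero>\<^bsub>?T\<^esub>" for m n unfolding f 0 by (simp add: koszul_zero M)
    then show ?thesis using 0 by (simp add: finsum_eq_zero[OF M] koszul_zero[OF M])
  qed
  finally show ?thesis .
qed

lemma m2_in [simp]: "s \<in> carrier HH ==> t \<in> carrier HH ==> m2 s t \<in> carrier HH"
  by simp

definition comul_op where "comul_op h = L2 HH (\<lambda>a b. p2 b a) (comul H h)"

lemma comul_op_bil: "bil H H HH (\<lambda>a b. p2 b a)"
  by (auto intro!: LR)

lemma comul_op_in [simp]: "h \<in> carrier H ==> comul_op h \<in> carrier HH"
  unfolding comul_op_def by (auto intro!: L2_in comul_op_bil)

lemma ring_H2: "ring (tensor_alg k H H)"
  using algH2 unfolding assoc_alg_def by blast

lemma R_comul: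
  assumes h: "h \<in> carrier H"
  shows "m2 (comul_op h) (rmat H) = m2 (rmat H) (comul H h)"
proof -
  interpret H2: ring "tensor_alg k H H" by (rule ring_H2)
  have u: "rmat H \<in> Units (tensor_alg k H H)"
    and e: "comul_op h = m2 (m2 (rmat H) (comul H h)) (inv\<^bsub>tensor_alg k H H\<^esub> (rmat H))"
    using qtqh h unfolding quasitriangular_quasi_Hopf_def universal_R_def by (simp_all add: comul_op_def)
  have c: "rmat H \<in> carrier (tensor_alg k H H)" "comul H h \<in> carrier (tensor_alg k H H)"
    using h by simp_all
  show ?thesis unfolding e using c u H2.Units_inv_closed[OF u] H2.Units_l_inv[OF u]
    by (simp only: H2.m_assoc H2.m_closed H2.r_one)
qed

lemma L2_comul_op: "module k X ==> bil H H X F ==> h \<in> carrier H ==> L2 X F (comul_op h) = L2 X (\<lambda>a b. F b a) (comul H h)"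
  unfolding comul_op_def by (rule lin_L2_expand[OF _ _ bilift_lin comul_op_bil]) (auto simp: L2_pt)

lemma br0_gr:
  assumes "obj V" "obj W" "v \<in> gr V p" "w \<in> gr W q" "p + q = n"
  shows "br0 V W v w \<in> gr (W\<box>V) n"
proof -
  have "v \<in> carrier V" "w \<in> carrier W" using gr_in assms by auto
  then show ?thesis unfolding br0_def using assms
    by (intro bilift_submod[OF _ _ _ _ gr_submod]) (auto intro!: LR tens_gr_pt[where p = q and q = p] act_gr)
qed

lemma koszul_gr: "obj V ==> v \<in> gr V p ==> koszul V m n v \<in> gr V p"
  using submod_neg[OF obj_module gr_submod] by (auto simp: koszul_def)

text \<open>Equivariance is \<open>R_comul\<close>: R intertwines \<Delta> with the coproduct whose
  legs are exchanged. The sign is unaffected because the action preserves degrees.\<close>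

lemma br_mor:
  assumes V: "obj V" and W: "obj W"
  shows "mor (V\<box>W) (W\<box>V) (br V W)"
proof -
  let ?T = "W\<box>V"
  note l = br_lin[OF V W]
  have oT: "obj ?T" using V W by simp
  note M = obj_module[OF V] obj_module[OF W] and MT = obj_module[OF oT]
  have "br V W (act (V\<box>W) h t) = act ?T h (br V W t)" if h: "h \<in> carrier H" and t: "t \<in> carrier (V\<box>W)" for h t
  proof (rule tens_hext[OF V W lin_comp[OF act_lin l] lin_comp[OF l act_lin] _ t])
    fix v w p q assume vw: "v \<in> gr V p" "w \<in> gr W q"
    have c: "v \<in> carrier V" "w \<in> carrier W" using gr_in[OF V] gr_in[OF W] vw by auto
    let ?G = "\<lambda>a b. pt k W V (act W b w) (act V a v)"
    have G: "bil H H ?T ?G" using V W c by (auto intro!: LR)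
    have "br V W (act (V\<box>W) h (pt k V W v w)) = L2 ?T (\<lambda>a b. br V W (pt k V W (act V a v) (act W b w))) (comul H h)"
      using V W h c by (intro lin_act_pt l) auto
    also have "... = L2 ?T (\<lambda>a b. koszul ?T p q (br0 V W (act V a v) (act W b w))) (comul H h)"
      using V W h vw by (intro L2_cong br_hom) (auto intro: act_gr)
    also have "... = koszul ?T p q (L2 ?T (\<lambda>a b. br0 V W (act V a v) (act W b w)) (comul H h))"
      using V W h c by (intro L2_push[symmetric] lin_koszul lin_id) (auto intro!: LR br0_bil(1)[OF V W] br0_bil(2)[OF V W])
    also have "L2 ?T (\<lambda>a b. br0 V W (act V a v) (act W b w)) (comul H h) = L2 ?T ?G (m2 (rmat H) (comul H h))"
      unfolding br0_def using V W h c by (intro L2_mult[symmetric] G) (auto simp: act_mult)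
    also have "... = L2 ?T ?G (m2 (comul_op h) (rmat H))" using R_comul[OF h] by simp
    also have "... = L2 ?T (\<lambda>a b. L2 ?T (\<lambda>a' b'. pt k W V (act W b' (act W b w)) (act V a' (act V a v))) (comul_op h)) (rmat H)"
      using V W h c by (intro L2_mult G) (auto simp: act_mult)
    also have "... = L2 ?T (\<lambda>a b. act ?T h (?G a b)) (rmat H)"
    proof (rule L2_cong)
      fix a b assume "a \<in> carrier H" "b \<in> carrier H"
      then show "L2 ?T (\<lambda>a' b'. pt k W V (act W b' (act W b w)) (act V a' (act V a v))) (comul_op h) = act ?T h (?G a b)"
        using V W h c by (subst L2_comul_op) (auto intro!: LR simp: act_tens_pt)
    qed
    also have "... = act ?T h (br0 V W v w)" unfolding br0_def
      using V W h c by (intro L2_push[symmetric] act_lin G) auto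
    also have "koszul ?T p q (act ?T h (br0 V W v w)) = act ?T h (koszul ?T p q (br0 V W v w))"
      using V W h c by (intro koszul_push[symmetric] act_lin) auto
    also have "... = act ?T h (br V W (pt k V W v w))" using br_hom[OF V W vw] by simp
    finally show "br V W (act (V\<box>W) h (pt k V W v w)) = act ?T h (br V W (pt k V W v w))" .
  qed (use V W h in auto)
  moreover have "br V W t \<in> gr ?T n" if t: "t \<in> gr (V\<box>W) n" for t n
    by (rule tens_gr_lin[OF V W MT l gr_submod[OF oT] _ t])
      (use V W oT in "auto simp: br_hom intro!: koszul_gr br0_gr")
  ultimately show ?thesis using V W l by (auto simp: mor_def)
qed

text \<open>Morphisms commute with the legs of R and preserve degrees, hence signs.\<close>

lemma br_nat:
  assumes f: "mor V V' f" and g: "mor W W' g" and t: "t \<in> carrier (V\<box>W)"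
  shows "br V' W' (tm V W V' W' f g t) = tm W V W' V' g f (br V W t)"
proof -
  note o = mor_obj(1)[OF f] mor_obj(1)[OF g] mor_obj(2)[OF f] mor_obj(2)[OF g]
  note M = o[THEN obj_module]
  have l: "lin (V\<box>W) (V'\<box>W') (tm V W V' W' f g)" "lin (W\<box>V) (W'\<box>V') (tm W V W' V' g f)"
    by (rule mor_lin, rule tmap_mor[OF f g] tmap_mor[OF g f])+
  show ?thesis
  proof (rule tens_hext[OF o(1,2) lin_comp[OF l(1) br_lin[OF o(3,4)]] lin_comp[OF br_lin[OF o(1,2)] l(2)] _ t])
    fix v w p q assume vw: "v \<in> gr V p" "w \<in> gr W q"
    have c: "v \<in> carrier V" "w \<in> carrier W" using gr_in[OF o(1)] gr_in[OF o(2)] vw by auto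
    note fc = mor_in[OF f] mor_in[OF g] and fl = mor_lin[OF f] mor_lin[OF g]
    have "tm W V W' V' g f (br0 V W v w) = br0 V' W' (f v) (g w)"
      unfolding br0_def
      by (rule lin_L2_expand[OF _ _ l(2)])
        (use o c fl in "auto intro!: LR simp: tmap_pt mor_act[OF f] mor_act[OF g]")
    moreover have "tm V W V' W' f g (pt k V W v w) = pt k V' W' (f v) (g w)"
      using M fl c by (simp add: tmap_pt)
    ultimately show "br V' W' (tm V W V' W' f g (pt k V W v w)) = tm W V W' V' g f (br V W (pt k V W v w))"
      using o c koszul_push[OF _ _ l(2), of "br0 V W v w" p q]
      by (simp add: br_hom[OF o(1,2) vw] br_hom[OF o(3,4) mor_gr[OF f vw(1)] mor_gr[OF g vw(2)]])
  qed
qed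

subsection \<open>The hexagons\<close>

definition R12 where "R12 = L2 HHH (\<lambda>a b. p3 a b \<one>\<^sub>H) (rmat H)"
definition R13 where "R13 = L2 HHH (\<lambda>a b. p3 a \<one>\<^sub>H b) (rmat H)"
definition R23 where "R23 = L2 HHH (\<lambda>a b. p3 \<one>\<^sub>H a b) (rmat H)"
text \<open>The digits give the order of the legs, of \<phi> for the letter p and of \<psi> for the
  letter q: \<open>p231\<close> is \<phi>2 \<otimes> \<phi>3 \<otimes> \<phi>1. \<open>RL\<close>
  and \<open>RR\<close> are (\<Delta> \<otimes> id)(R) and (id \<otimes> \<Delta>)(R).\<close>

definition p231 where "p231 = L3 HHH (\<lambda>a b c. p3 b c a) (phi H)"
definition p213 where "p213 = L3 HHH (\<lambda>a b c. p3 b a c) (phi H)"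
definition q132 where "q132 = L3 HHH (\<lambda>a b c. p3 a c b) \<psi>"
definition q312 where "q312 = L3 HHH (\<lambda>a b c. p3 c a b) \<psi>"
definition RL where "RL = L2 HHH (\<lambda>a b. pt k HH H (comul H a) b) (rmat H)"
definition RR where "RR = L2 HHH (\<lambda>a b. L2 HHH (\<lambda>b1 b2. p3 a b1 b2) (comul H b)) (rmat H)"

lemma hexagon_H:
  "RL = m3 (m3 (m3 (m3 p231 R13) q132) R23) (phi H)"
  "RR = m3 (m3 (m3 (m3 q312 R13) p213) R12) \<psi>"
  using qtqh unfolding quasitriangular_quasi_Hopf_def universal_R_def Let_def
  by (simp_all add: RL_def RR_def p231_def p213_def q132_def q312_def R12_def R13_def R23_def)

lemma hex_bil:
  "bil H H HHH (\<lambda>a b. p3 a b \<one>\<^sub>H)" "bil H H HHH (\<lambda>a b. p3 a \<one>\<^sub>H b)"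
  "bil H H HHH (\<lambda>a b. p3 \<one>\<^sub>H a b)"
  "tril H H H HHH (\<lambda>a b c. p3 b c a)" "tril H H H HHH (\<lambda>a b c. p3 b a c)"
  "tril H H H HHH (\<lambda>a b c. p3 a c b)" "tril H H H HHH (\<lambda>a b c. p3 c a b)"
  by (auto intro!: LR)

lemma hex_in [simp]: "R12 \<in> carrier HHH" "R13 \<in> carrier HHH" "R23 \<in> carrier HHH" "p231 \<in> carrier HHH"
  "p213 \<in> carrier HHH" "q132 \<in> carrier HHH" "q312 \<in> carrier HHH"
  unfolding p231_def p213_def q132_def q312_def R12_def R13_def R23_def
  by (auto intro!: L2_in L3_in hex_bil)

context
  fixes X :: "('k, 'x, 'm) module_scheme" and f
  assumes X: "module k X" and f: "lin HHH X f"
begin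

lemma R_expand: "f R12 = L2 X (\<lambda>a b. f (p3 a b \<one>\<^sub>H)) (rmat H)" "f R13 = L2 X (\<lambda>a b. f (p3 a \<one>\<^sub>H b)) (rmat H)"
  "f R23 = L2 X (\<lambda>a b. f (p3 \<one>\<^sub>H a b)) (rmat H)"
  unfolding R12_def R13_def R23_def
  using X f by (auto intro!: L2_push[OF _ X hex_bil(1) f] L2_push[OF _ X hex_bil(2) f] L2_push[OF _ X hex_bil(3) f])

lemma p_expand: "f p231 = L3 X (\<lambda>a b c. f (p3 b c a)) (phi H)" "f p213 = L3 X (\<lambda>a b c. f (p3 b a c)) (phi H)"
  "f q132 = L3 X (\<lambda>a b c. f (p3 a c b)) \<psi>" "f q312 = L3 X (\<lambda>a b c. f (p3 c a b)) \<psi>"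
  unfolding p231_def p213_def q132_def q312_def
  using X f by (auto intro!: L3_push[OF _ X hex_bil(4) f] L3_push[OF _ X hex_bil(5) f] L3_push[OF _ X hex_bil(6) f] L3_push[OF _ X hex_bil(7) f])

lemma phi_expand: "f (phi H) = L3 X (\<lambda>a b c. f (p3 a b c)) (phi H)" "f \<psi> = L3 X (\<lambda>a b c. f (p3 a b c)) \<psi>"
  using X f by (auto intro!: trilift_eq[symmetric])

lemma RL_expand: "f RL = L2 X (\<lambda>a b. f (pt k HH H (comul H a) b)) (rmat H)"
  unfolding RL_def using X f by (intro L2_push dL_bil) auto

lemma RR_expand: "f RR = L2 X (\<lambda>a b. L2 X (\<lambda>b1 b2. f (p3 a b1 b2)) (comul H b)) (rmat H)"
  unfolding RR_def using X f by (intro lin_L2_expand[OF X _ f dR_bil] L2_push) (auto intro!: LR)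

lemmas hex_expand = R_expand p_expand phi_expand RL_expand RR_expand

end

lemma m3_lin: "s \<in> carrier HHH ==> lin HHH HHH (\<lambda>t. m3 s t)" "t \<in> carrier HHH ==> lin HHH HHH (\<lambda>s. m3 s t)"
  using bilD[OF tensor_mult_bil(1)[OF algH2 algH]] by (simp_all)

lemma m3_pure: "a \<in> carrier H ==> b \<in> carrier H ==> c \<in> carrier H ==>
   a' \<in> carrier H ==> b' \<in> carrier H ==> c' \<in> carrier H ==>
   m3 (p3 a b c) (p3 a' b' c') = p3 (a \<cdot> a') (b \<cdot> b') (c \<cdot> c')"
  using tensor_mult_pt[OF algH2 algH, of "p2 a b" c "p2 a' b'" c'] tensor_mult_pt[OF algH algH, of a b a' b']
  by simp

text \<open>A linear map \<open>Q\<close> on triples of vectors and elements of \<open>H \<otimes> H \<otimes> H\<close> that turns right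
  multiplication into the action on the vectors.\<close>

definition act3 where
  "act3 V W X T Q \<longleftrightarrow> (\<forall>v\<in>carrier V. \<forall>w\<in>carrier W. \<forall>x\<in>carrier X. lin HHH T (Q v w x) \<and>
    (\<forall>a\<in>carrier H. \<forall>b\<in>carrier H. \<forall>c\<in>carrier H. \<forall>s\<in>carrier HHH.
       Q v w x (m3 s (p3 a b c)) = Q (act V a v) (act W b w) (act X c x) s)) \<and>
   (\<forall>s\<in>carrier HHH. tril V W X T (\<lambda>v w x. Q v w x s))"

lemma act3_tril:
  assumes "act3 V W X T Q" "s \<in> carrier HHH"
  shows "lin Y V f ==> w \<in> carrier W ==> x \<in> carrier X ==> lin Y T (\<lambda>y. Q (f y) w x s)"
   "lin Y W g ==> v \<in> carrier V ==> x \<in> carrier X ==> lin Y T (\<lambda>y. Q v (g y) x s)"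
   "lin Y X h ==> v \<in> carrier V ==> w \<in> carrier W ==> lin Y T (\<lambda>y. Q v w (h y) s)"
  using assms by (auto simp: act3_def tril_def intro: lin_comp[where f = f] lin_comp[where f = g] lin_comp[where f = h])

text \<open>The three legs first act on the arguments of G, so a right factor acts on the vectors
  before everything else. In the hexagons, G merely permutes and brackets the vectors.\<close>

lemma act3I:
  assumes o: "obj V" "obj W" "obj X" and T: "module k T" and G: "tril V W X T G"
  shows "act3 V W X T (\<lambda>v w x. L3 T (\<lambda>a b c. G (act V a v) (act W b w) (act X c x)))"
proof -
  have G1: "lin Y V f ==> w \<in> carrier W ==> x \<in> carrier X ==> lin Y T (\<lambda>y. G (f y) w x)"
   and G2: "lin Y W g ==> v \<in> carrier V ==> x \<in> carrier X ==> lin Y T (\<lambda>y. G v (g y) x)"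
   and G3: "lin Y X h ==> v \<in> carrier V ==> w \<in> carrier W ==> lin Y T (\<lambda>y. G v w (h y))"
     for Y :: "('k, 'z, 'zz) module_scheme" and f g h v w x
    using G by (auto simp: tril_def intro: lin_comp[where f = f] lin_comp[where f = g] lin_comp[where f = h])
  have G': "tril H H H T (\<lambda>a b c. G (act V a v) (act W b w) (act X c x))"
    if "v \<in> carrier V" "w \<in> carrier W" "x \<in> carrier X" for v w x
    using o that G unfolding tril_def by (auto intro: lin_comp[OF act_lin1])
  have l: "lin HHH T (L3 T (\<lambda>a b c. G (act V a v) (act W b w) (act X c x)))"
    if "v \<in> carrier V" "w \<in> carrier W" "x \<in> carrier X" for v w x
    using T G'[OF that] by (intro trilift_lin) auto
  have "L3 T (\<lambda>a b c. G (act V a v) (act W b w) (act X c x)) (m3 s (p3 a b c)) =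
    L3 T (\<lambda>a' b' c'. G (act V a' (act V a v)) (act W b' (act W b w)) (act X c' (act X c x))) s"
    if "v \<in> carrier V" "w \<in> carrier W" "x \<in> carrier X" "s \<in> carrier HHH"
      "a \<in> carrier H" "b \<in> carrier H" "c \<in> carrier H" for v w x s a b c
    by (rule tens3_ext[OF modH modH modH lin_comp[OF m3_lin(2) l] l _ that(4)])
      (use that o T in "auto simp: m3_pure L3_pt[OF T G'] act_mult")
  moreover have "tril V W X T (\<lambda>v w x. L3 T (\<lambda>a b c. G (act V a v) (act W b w) (act X c x)) s)"
    if s: "s \<in> carrier HHH" for s
    by (intro trilI lin_tri_H1) (use o T s G' G in "auto simp: tril_def intro: lin_comp[OF act_lin]")
  ultimately show ?thesis using l by (auto simp: act3_def)
qed

lemma act3_lin: "act3 V W X T Q ==> v \<in> carrier V ==> w \<in> carrier W ==> x \<in> carrier X ==> lin HHH T (Q v w x)"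
  by (auto simp: act3_def)

text \<open>Removes the rightmost factor of a product and turns it into a sum over translated
  vectors. Each clause has the shape that one braiding or associator produces in the expansion of a
  hexagon.\<close>

lemma act3_expand:
  assumes Q: "act3 V W X T Q" and o: "obj V" "obj W" "obj X" and T: "module k T"
    and v: "v \<in> carrier V" "w \<in> carrier W" "x \<in> carrier X" and s: "s \<in> carrier HHH"
  shows "Q v w x (m3 s R12) = L2 T (\<lambda>a b. Q (act V a v) (act W b w) x s) (rmat H)" (is ?g7)
   "Q v w x (m3 s R13) = L2 T (\<lambda>a b. Q (act V a v) w (act X b x) s) (rmat H)" (is ?g6)
   "Q v w x (m3 s R23) = L2 T (\<lambda>a b. Q v (act W a w) (act X b x) s) (rmat H)" (is ?g5)
   "Q v w x (m3 s (phi H)) = L3 T (\<lambda>a b c. Q (act V a v) (act W b w) (act X c x) s) (phi H)" (is ?g4)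
   "Q v w x (m3 s p213) = L3 T (\<lambda>a b c. Q (act V b v) (act W a w) (act X c x) s) (phi H)" (is ?g3)
   "Q v w x (m3 s q132) = L3 T (\<lambda>a b c. Q (act V a v) (act W c w) (act X b x) s) \<psi>" (is ?g2)
   "Q v w x (m3 s \<psi>) = L3 T (\<lambda>a b c. Q (act V a v) (act W b w) (act X c x) s) \<psi>" (is ?g1)
proof -
  have l: "lin HHH T (\<lambda>t. Q v w x (m3 s t))"
    by (rule lin_comp[OF m3_lin(1)[OF s] act3_lin[OF Q v]])
  have e: "Q v w x (m3 s (p3 a b c)) = Q (act V a v) (act W b w) (act X c x) s"
    if "a \<in> carrier H" "b \<in> carrier H" "c \<in> carrier H" for a b c
    using Q v s that by (auto simp: act3_def)
  show ?g7
   ?g6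
   ?g5
   ?g4
   ?g3
   ?g2
   ?g1
    unfolding hex_expand[OF T l] by (rule L2_cong L3_cong; use e o v in simp)+
qed

lemma br_br0:
  assumes o: "obj V" "obj W" and f: "module k T" "lin (W\<box>V) T f" and vw: "v \<in> gr V p" "w \<in> gr W q"
  shows "f (br V W (pt k V W v w)) = koszul T p q (L2 T (\<lambda>a b. f (pt k W V (act W b w) (act V a v))) (rmat H))"
proof -
  have c: "v \<in> carrier V" "w \<in> carrier W" using gr_in[OF o(1)] gr_in[OF o(2)] vw by auto
  have "f (br0 V W v w) = L2 T (\<lambda>a b. f (pt k W V (act W b w) (act V a v))) (rmat H)"
    unfolding br0_def by (rule L2_push[OF _ f(1) _ f(2)]) (use o c in "auto intro!: LR")
  then show ?thesis using o c f by (simp add: br_hom[OF o vw] koszul_push[of _ T f])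
qed

text \<open>One braiding inside a hexagon: its sign joins the sign collected by the maps applied
  later, and the sum over R remains to be absorbed as a factor. \<open>as_step\<close> and
  \<open>ai_step\<close> do the same for the associators, which bring no sign of their own.\<close>

lemma br_step:
  assumes o: "obj V" "obj W" and T: "module k T" and g: "lin (W\<box>V) T g" and vw: "v \<in> gr V p" "w \<in> gr W q"
    and K: "bil H H T K"
    and e: "\<And>a b. a \<in> carrier H ==> b \<in> carrier H ==> g (pt k W V (act W b w) (act V a v)) = koszul T m n (K a b)"
  shows "g (br V W (pt k V W v w)) = koszul T p q (koszul T m n (L2 T K (rmat H)))"
proof -
  have "L2 T (\<lambda>a b. g (pt k W V (act W b w) (act V a v))) (rmat H) = L2 T (\<lambda>a b. koszul T m n (K a b)) (rmat H)"
    by (rule L2_cong) (rule e)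
  also have "... = koszul T m n (L2 T K (rmat H))"
    by (rule L2_push[OF T T K lin_koszul[OF T lin_id], symmetric]) simp
  finally show ?thesis by (simp add: br_br0[OF o T g vw])
qed

lemma as_step:
  assumes o: "obj V" "obj W" "obj X" and T: "module k T" and g: "lin (V\<box>W\<box>X) T g"
    and v: "v \<in> carrier V" "w \<in> carrier W" "x \<in> carrier X" and K: "tril H H H T K"
    and e: "\<And>a b c. a \<in> carrier H ==> b \<in> carrier H ==> c \<in> carrier H ==>
      g (T3r V W X (act V a v) (act W b w) (act X c x)) = koszul T m n (K a b c)"
  shows "g (as V W X (T3l V W X v w x)) = koszul T m n (L3 T K (phi H))"
proof -
  have "g (as V W X (T3l V W X v w x)) = L3 T (\<lambda>a b c. koszul T m n (K a b c)) (phi H)"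
    unfolding as_pt[OF o v] by (rule lin_L3_expand[OF T _ g as_tril[OF o v] e]) (use o in auto)
  also have "... = koszul T m n (L3 T K (phi H))"
    by (rule L3_push[OF T T K lin_koszul[OF T lin_id], symmetric]) simp
  finally show ?thesis .
qed

lemma ai_step:
  assumes o: "obj V" "obj W" "obj X" and T: "module k T" and g: "lin ((V\<box>W)\<box>X) T g"
    and v: "v \<in> carrier V" "w \<in> carrier W" "x \<in> carrier X" and K: "tril H H H T K"
    and e: "\<And>a b c. a \<in> carrier H ==> b \<in> carrier H ==> c \<in> carrier H ==>
      g (T3l V W X (act V a v) (act W b w) (act X c x)) = koszul T m n (K a b c)"
  shows "g (ai V W X (T3r V W X v w x)) = koszul T m n (L3 T K \<psi>)"
proof -
  have "g (ai V W X (T3r V W X v w x)) = L3 T (\<lambda>a b c. koszul T m n (K a b c)) \<psi>"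
    unfolding ai_pt[OF o v] by (rule lin_L3_expand[OF T _ g ai_tril[OF o v] e]) (use o in auto)
  also have "... = koszul T m n (L3 T K \<psi>)"
    by (rule L3_push[OF T T K lin_koszul[OF T lin_id], symmetric]) simp
  finally show ?thesis .
qed

text \<open>The composite is read from its last map backwards, so that each earlier map adds a
  factor on the right; the result is the right side of the first hexagon axiom. The signs for n, p
  and m, p combine to the sign for m + n, p.\<close>

lemma hexagon1:
  assumes o: "obj V" "obj W" "obj X" and t: "t \<in> carrier ((V\<box>W)\<box>X)"
  shows "br (V\<box>W) X t = as X V W (tm (V\<box>X) W (X\<box>V) W (br V X) (\<lambda>w. w) (ai V X W
     (tm V (W\<box>X) V (X\<box>W) (\<lambda>v. v) (br W X) (as V W X t))))"
proof -
  let ?T = "X\<box>V\<box>W"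
  note gc = gr_in[OF o(1)] gr_in[OF o(2)] gr_in[OF o(3)]
  have MT: "module k ?T" using o by simp
  define G where "G v w x = T3r X V W x v w" for v w x
  define Q where "Q v w x = L3 ?T (\<lambda>a b c. G (act V a v) (act W b w) (act X c x))" for v w x
  have Gt: "tril H H H ?T (\<lambda>a b c. G (act V a v) (act W b w) (act X c x))"
    if "v \<in> carrier V" "w \<in> carrier W" "x \<in> carrier X" for v w x
    unfolding G_def using o that by (auto intro!: LR)
  have Q: "act3 V W X ?T Q" unfolding Q_def by (rule act3I[OF o MT]) (use o in "auto simp: G_def intro!: LR")
  note Qt = act3_tril[OF Q] and Qe = act3_expand[OF Q o MT, symmetric] and Ql = act3_lin[OF Q]
  have Qp: "Q v w x (p3 a b c) = G (act V a v) (act W b w) (act X c x)"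
    if "v \<in> carrier V" "w \<in> carrier W" "x \<in> carrier X" "a \<in> carrier H" "b \<in> carrier H" "c \<in> carrier H" for v w x a b c
    unfolding Q_def using that by (intro L3_pt MT Gt)
  let ?s1 = "m3 p231 R13" and ?s2 = "m3 (m3 p231 R13) q132" and ?s3 = "m3 (m3 (m3 p231 R13) q132) R23"
  let ?f1 = "tm V (W\<box>X) V (X\<box>W) (\<lambda>v. v) (br W X)"
  let ?f3 = "\<lambda>s. as X V W (tm (V\<box>X) W (X\<box>V) W (br V X) (\<lambda>w. w) s)"
  have lf1: "lin (V\<box>W\<box>X) (V\<box>X\<box>W) ?f1" using o by (intro tmap_lin_o lin_id br_lin) auto
  have lf3: "lin ((V\<box>X)\<box>W) ?T ?f3" using o by (intro lin_comp[OF tmap_lin_o as_lin] lin_id br_lin) auto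
  have lf2: "lin (V\<box>X\<box>W) ?T (\<lambda>s. ?f3 (ai V X W s))" using o by (intro lin_comp[OF ai_lin lf3]) auto
  have lf0: "lin (V\<box>W\<box>X) ?T (\<lambda>s. ?f3 (ai V X W (?f1 s)))" by (rule lin_comp[OF lf1 lf2])
  have lR: "lin ((V\<box>W)\<box>X) ?T (\<lambda>t. ?f3 (ai V X W (?f1 (as V W X t))))"
    using o by (intro lin_comp[OF as_lin lf0])
  have lL: "lin ((V\<box>W)\<box>X) ?T (br (V\<box>W) X)" using o by (intro br_lin) auto
  \<comment> \<open>The associator applied last contributes the leftmost factor.\<close>
  have s0: "as X V W (T3l X V W x v w) = Q v w x p231"
    if c: "v \<in> carrier V" "w \<in> carrier W" "x \<in> carrier X" for v w x
    unfolding hex_expand(4)[OF MT Ql[OF c]] as_pt[OF o(3,1,2) c(3,1,2)] using c by (intro L3_cong) (simp add: Qp G_def)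
  have s1: "?f3 (T3l V X W v x w) = koszul ?T m p (Q v w x ?s1)"
    if v: "v \<in> gr V m" and x: "x \<in> gr X p" and w: "w \<in> carrier W" for v x w m p
  proof -
    have "?f3 (T3l V X W v x w) = as X V W (pt k (X\<box>V) W (br V X (pt k V X v x)) w)"
      using o gc v x w by (simp add: tmap_pt br_lin lin_id)
    \<comment> \<open>No sign has been collected yet, hence the trivial degrees 0 and 0.\<close>
    also have "... = koszul ?T m p (koszul ?T 0 0 (L2 ?T (\<lambda>a b. Q (act V a v) w (act X b x) p231) (rmat H)))"
      using o gc v x w by (intro br_step MT lin_comp[OF lin_pt1_o as_lin] lin_id) (auto simp: s0 koszul_def intro!: LR Qt)
    finally show ?thesis using gc v x w by (simp add: Qe koszul_def)
  qed
  have s2: "?f3 (ai V X W (T3r V X W v x w)) = koszul ?T m p (Q v w x ?s2)"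
    if v: "v \<in> gr V m" and x: "x \<in> gr X p" and w: "w \<in> carrier W" for v x w m p
  proof -
    have "?f3 (ai V X W (T3r V X W v x w)) = koszul ?T m p (L3 ?T (\<lambda>a b c. Q (act V a v) (act W c w) (act X b x) ?s1) \<psi>)"
      using o gc v x w by (intro ai_step MT lf3) (auto simp: s1 act_gr intro!: LR Qt)
    then show ?thesis using gc v x w by (simp add: Qe)
  qed
  have s3: "?f3 (ai V X W (?f1 (T3r V W X v w x))) = koszul ?T (m + n) p (Q v w x ?s3)"
    if v: "v \<in> gr V m" and w: "w \<in> gr W n" and x: "x \<in> gr X p" for v w x m n p
  proof -
    have "?f3 (ai V X W (?f1 (T3r V W X v w x))) = ?f3 (ai V X W (pt k V (X\<box>W) v (br W X (pt k W X w x))))"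
      using o gc v w x by (simp add: tmap_pt br_lin lin_id)
    also have "... = koszul ?T n p (koszul ?T m p (L2 ?T (\<lambda>a b. Q v (act W a w) (act X b x) ?s2) (rmat H)))"
      using o gc v w x by (intro br_step w x MT lin_comp[OF lin_pt2_o lf2] lin_id) (auto simp: s2[OF v] act_gr intro!: LR Qt)
    also have "... = koszul ?T (m + n) p (Q v w x ?s3)"
      using gc v w x lin_closed[OF Ql] by (simp add: Qe koszul_koszul(1)[OF MT] add.commute)
    finally show ?thesis .
  qed
  \<comment> \<open>In the braiding of V \<otimes> W past X, the first leg of R acts on V \<otimes>
    W through \<Delta>; this is the left side of the hexagon axiom.\<close>
  have L: "br (V\<box>W) X (T3l V W X v w x) = koszul ?T (m + n) p (Q v w x RL)"
    if v: "v \<in> gr V m" and w: "w \<in> gr W n" and x: "x \<in> gr X p" for v w x m n p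
  proof -
    have c: "v \<in> carrier V" "w \<in> carrier W" "x \<in> carrier X" using gc v w x by auto
    have "Q v w x (pt k HH H (comul H a) b) = pt k X (V\<box>W) (act X b x) (act (V\<box>W) a (pt k V W v w))"
      if "a \<in> carrier H" "b \<in> carrier H" for a b
    proof -
      have "Q v w x (pt k HH H (comul H a) b) = L2 ?T (\<lambda>a1 a2. G (act V a1 v) (act W a2 w) (act X b x)) (comul H a)"
        unfolding Q_def using c that by (intro L3_ptHH MT Gt) auto
      also have "... = pt k X (V\<box>W) (act X b x) (act (V\<box>W) a (pt k V W v w))"
        unfolding G_def using c that o by (intro lin_act_pt[symmetric] lin_pt2_o lin_id) auto
      finally show ?thesis .
    qed
    then have "Q v w x RL = br0 (V\<box>W) X (pt k V W v w) x"
      unfolding br0_def hex_expand(10)[OF MT Ql[OF c]] by (rule L2_cong)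
    then show ?thesis using o by (simp add: br_hom[OF _ o(3) tens_gr_pt[OF o(1,2) v w refl] x])
  qed
  show ?thesis
  proof (rule tens_hext[OF _ o(3) lL lR _ t])
    fix s x r p assume s: "s \<in> gr (V\<box>W) r" and x: "x \<in> gr X p"
    have cx: "x \<in> carrier X" and cs: "s \<in> carrier (V\<box>W)" using gr_in[OF _ x] gr_in[OF _ s] o by auto
    show "br (V\<box>W) X (pt k (V\<box>W) X s x) = ?f3 (ai V X W (?f1 (as V W X (pt k (V\<box>W) X s x))))"
    proof (rule tens_hext[OF o(1,2) lin_comp[OF lin_pt1_o lL] lin_comp[OF lin_pt1_o lR] _ cs])
      fix v w m n assume v: "v \<in> gr V m" and w: "w \<in> gr W n"
      have "?f3 (ai V X W (?f1 (as V W X (T3l V W X v w x)))) =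
        koszul ?T (m + n) p (L3 ?T (\<lambda>a b c. Q (act V a v) (act W b w) (act X c x) ?s3) (phi H))"
        using o gc v w x by (intro as_step MT lf0) (auto simp: s3 act_gr intro!: LR Qt)
      then show "br (V\<box>W) X (T3l V W X v w x) = ?f3 (ai V X W (?f1 (as V W X (T3l V W X v w x))))"
        using gc v w x by (simp add: Qe L hexagon_H)
    qed (use o cx lin_id in auto)
  qed (use o in auto)
qed

text \<open>The mirror image for (id \<otimes> \<Delta>)(R): inverse associators stand at both ends
  of the composite, and the signs add up in the second argument.\<close>

lemma hexagon2:
  assumes o: "obj V" "obj W" "obj X" and t: "t \<in> carrier (V\<box>W\<box>X)"
  shows "br V (W\<box>X) t = ai W X V (tm W (V\<box>X) W (X\<box>V) (\<lambda>w. w) (br V X) (as W V X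
     (tm (V\<box>W) X (W\<box>V) X (br V W) (\<lambda>x. x) (ai V W X t))))"
proof -
  let ?T = "(W\<box>X)\<box>V"
  note gc = gr_in[OF o(1)] gr_in[OF o(2)] gr_in[OF o(3)]
  have MT: "module k ?T" using o by simp
  define G where "G v w x = T3l W X V w x v" for v w x
  define Q where "Q v w x = L3 ?T (\<lambda>a b c. G (act V a v) (act W b w) (act X c x))" for v w x
  have Gt: "tril H H H ?T (\<lambda>a b c. G (act V a v) (act W b w) (act X c x))"
    if "v \<in> carrier V" "w \<in> carrier W" "x \<in> carrier X" for v w x
    unfolding G_def using o that by (auto intro!: LR)
  have Q: "act3 V W X ?T Q" unfolding Q_def by (rule act3I[OF o MT]) (use o in "auto simp: G_def intro!: LR")
  note Qt = act3_tril[OF Q] and Qe = act3_expand[OF Q o MT, symmetric] and Ql = act3_lin[OF Q]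
  have Qp: "Q v w x (p3 a b c) = G (act V a v) (act W b w) (act X c x)"
    if "v \<in> carrier V" "w \<in> carrier W" "x \<in> carrier X" "a \<in> carrier H" "b \<in> carrier H" "c \<in> carrier H" for v w x a b c
    unfolding Q_def using that by (intro L3_pt MT Gt)
  let ?s1 = "m3 q312 R13" and ?s2 = "m3 (m3 q312 R13) p213" and ?s3 = "m3 (m3 (m3 q312 R13) p213) R12"
  let ?f1 = "tm (V\<box>W) X (W\<box>V) X (br V W) (\<lambda>x. x)"
  let ?f3 = "\<lambda>s. ai W X V (tm W (V\<box>X) W (X\<box>V) (\<lambda>w. w) (br V X) s)"
  have lf1: "lin ((V\<box>W)\<box>X) ((W\<box>V)\<box>X) ?f1" using o by (intro tmap_lin_o lin_id br_lin) auto
  have lf3: "lin (W\<box>V\<box>X) ?T ?f3" using o by (intro lin_comp[OF tmap_lin_o ai_lin] lin_id br_lin) auto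
  have lf2: "lin ((W\<box>V)\<box>X) ?T (\<lambda>s. ?f3 (as W V X s))" using o by (intro lin_comp[OF as_lin lf3]) auto
  have lf0: "lin ((V\<box>W)\<box>X) ?T (\<lambda>s. ?f3 (as W V X (?f1 s)))" by (rule lin_comp[OF lf1 lf2])
  have lR: "lin (V\<box>W\<box>X) ?T (\<lambda>t. ?f3 (as W V X (?f1 (ai V W X t))))"
    using o by (intro lin_comp[OF ai_lin lf0])
  have lL: "lin (V\<box>W\<box>X) ?T (br V (W\<box>X))" using o by (intro br_lin) auto
  have s0: "ai W X V (T3r W X V w x v) = Q v w x q312"
    if c: "v \<in> carrier V" "w \<in> carrier W" "x \<in> carrier X" for v w x
    unfolding hex_expand(7)[OF MT Ql[OF c]] ai_pt[OF o(2,3,1) c(2,3,1)] using c by (intro L3_cong) (simp add: Qp G_def)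
  have s1: "?f3 (T3r W V X w v x) = koszul ?T m p (Q v w x ?s1)"
    if v: "v \<in> gr V m" and x: "x \<in> gr X p" and w: "w \<in> carrier W" for v x w m p
  proof -
    have "?f3 (T3r W V X w v x) = ai W X V (pt k W (X\<box>V) w (br V X (pt k V X v x)))"
      using o gc v x w by (simp add: tmap_pt br_lin lin_id)
    also have "... = koszul ?T m p (koszul ?T 0 0 (L2 ?T (\<lambda>a b. Q (act V a v) w (act X b x) q312) (rmat H)))"
      using o gc v x w by (intro br_step MT lin_comp[OF lin_pt2_o ai_lin] lin_id) (auto simp: s0 koszul_def intro!: LR Qt)
    finally show ?thesis using gc v x w by (simp add: Qe koszul_def)
  qed
  have s2: "?f3 (as W V X (T3l W V X w v x)) = koszul ?T m p (Q v w x ?s2)"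
    if v: "v \<in> gr V m" and x: "x \<in> gr X p" and w: "w \<in> carrier W" for v x w m p
  proof -
    have "?f3 (as W V X (T3l W V X w v x)) = koszul ?T m p (L3 ?T (\<lambda>a b c. Q (act V b v) (act W a w) (act X c x) ?s1) (phi H))"
      using o gc v x w by (intro as_step MT lf3) (auto simp: s1 act_gr intro!: LR Qt)
    then show ?thesis using gc v x w by (simp add: Qe)
  qed
  have s3: "?f3 (as W V X (?f1 (T3l V W X v w x))) = koszul ?T m (n + p) (Q v w x ?s3)"
    if v: "v \<in> gr V m" and w: "w \<in> gr W n" and x: "x \<in> gr X p" for v w x m n p
  proof -
    have "?f3 (as W V X (?f1 (T3l V W X v w x))) = ?f3 (as W V X (pt k (W\<box>V) X (br V W (pt k V W v w)) x))"
      using o gc v w x by (simp add: tmap_pt br_lin lin_id)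
    also have "... = koszul ?T m n (koszul ?T m p (L2 ?T (\<lambda>a b. Q (act V a v) (act W b w) x ?s2) (rmat H)))"
      using o gc v w x by (intro br_step v w MT lin_comp[OF lin_pt1_o lf2] lin_id) (auto simp: s2[OF _ x] act_gr intro!: LR Qt)
    also have "... = koszul ?T m (n + p) (Q v w x ?s3)"
      using gc v w x lin_closed[OF Ql] by (simp add: Qe koszul_koszul(2)[OF MT])
    finally show ?thesis .
  qed
  have L: "br V (W\<box>X) (T3r V W X v w x) = koszul ?T m (n + p) (Q v w x RR)"
    if v: "v \<in> gr V m" and w: "w \<in> gr W n" and x: "x \<in> gr X p" for v w x m n p
  proof -
    have c: "v \<in> carrier V" "w \<in> carrier W" "x \<in> carrier X" using gc v w x by auto
    have "L2 ?T (\<lambda>b1 b2. Q v w x (p3 a b1 b2)) (comul H b) = pt k (W\<box>X) V (act (W\<box>X) b (pt k W X w x)) (act V a v)"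
      if ab: "a \<in> carrier H" "b \<in> carrier H" for a b
    proof -
      have "L2 ?T (\<lambda>b1 b2. Q v w x (p3 a b1 b2)) (comul H b) = L2 ?T (\<lambda>b1 b2. G (act V a v) (act W b1 w) (act X b2 x)) (comul H b)"
        using c ab by (intro L2_cong Qp) auto
      also have "... = pt k (W\<box>X) V (act (W\<box>X) b (pt k W X w x)) (act V a v)"
        unfolding G_def using c ab o by (intro lin_act_pt[symmetric] lin_pt1_o lin_id) auto
      finally show ?thesis .
    qed
    then have "Q v w x RR = br0 V (W\<box>X) v (pt k W X w x)"
      unfolding br0_def hex_expand(11)[OF MT Ql[OF c]] by (rule L2_cong)
    then show ?thesis using o by (simp add: br_hom[OF o(1) _ v tens_gr_pt[OF o(2,3) w x refl]])
  qed
  show ?thesis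
  proof (rule tens_hext[OF o(1) _ lL lR _ t])
    fix v s m r assume v: "v \<in> gr V m" and s: "s \<in> gr (W\<box>X) r"
    have cv: "v \<in> carrier V" and cs: "s \<in> carrier (W\<box>X)" using gr_in[OF _ v] gr_in[OF _ s] o by auto
    show "br V (W\<box>X) (pt k V (W\<box>X) v s) = ?f3 (as W V X (?f1 (ai V W X (pt k V (W\<box>X) v s))))"
    proof (rule tens_hext[OF o(2,3) lin_comp[OF lin_pt2_o lL] lin_comp[OF lin_pt2_o lR] _ cs])
      fix w x n p assume w: "w \<in> gr W n" and x: "x \<in> gr X p"
      have "?f3 (as W V X (?f1 (ai V W X (T3r V W X v w x)))) =
        koszul ?T m (n + p) (L3 ?T (\<lambda>a b c. Q (act V a v) (act W b w) (act X c x) ?s3) \<psi>)"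
        using o gc v w x by (intro ai_step MT lf0) (auto simp: s3 act_gr intro!: LR Qt)
      then show "br V (W\<box>X) (T3r V W X v w x) = ?f3 (as W V X (?f1 (ai V W X (T3r V W X v w x))))"
        using gc v w x by (simp add: Qe L hexagon_H)
    qed (use o cv lin_id in auto)
  qed (use o in auto)
qed

section \<open>Counit identities\<close>

lemmas LE = LR lin_eps lin_smultf

lemma eps_comul:
  assumes X: "module k X" and f: "lin H X f" and h: "h \<in> carrier H"
  shows "L2 X (\<lambda>a b. counit H a \<odot>\<^bsub>X\<^esub> f b) (comul H h) = f h" (is ?g2)
    "L2 X (\<lambda>a b. counit H b \<odot>\<^bsub>X\<^esub> f a) (comul H h) = f h" (is ?g1)
proof -
  have e: "L2 H (\<lambda>a b. counit H a \<odot>\<^bsub>H\<^esub> b) (comul H h) = h" "L2 H (\<lambda>a b. counit H b \<odot>\<^bsub>H\<^esub> a) (comul H h) = h"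
    using qtqh h unfolding quasitriangular_quasi_Hopf_def quasi_bialgebra_def by simp_all
  have "f (L2 H (\<lambda>a b. counit H a \<odot>\<^bsub>H\<^esub> b) (comul H h)) = L2 X (\<lambda>a b. counit H a \<odot>\<^bsub>X\<^esub> f b) (comul H h)"
    by (rule lin_L2_expand[OF X _ f]) (use h in "auto intro!: LE simp: lin_smult[OF f]")
  moreover have "f (L2 H (\<lambda>a b. counit H b \<odot>\<^bsub>H\<^esub> a) (comul H h)) = L2 X (\<lambda>a b. counit H b \<odot>\<^bsub>X\<^esub> f a) (comul H h)"
    by (rule lin_L2_expand[OF X _ f]) (use h in "auto intro!: LE simp: lin_smult[OF f]")
  ultimately show ?g2
    ?g1 using e by simp_all
qed

text \<open>Multiplicativity on pure tensors extends to all tensors. It yields that a counit or a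
  coproduct applied to a single leg is an algebra map.\<close>

lemma L3_hom:
  assumes C: "assoc_alg k C" and F: "tril H H H C F"
    and m: "\<And>a b c a' b' c'. a \<in> carrier H ==> b \<in> carrier H ==> c \<in> carrier H ==> a' \<in> carrier H ==> b' \<in> carrier H ==> c' \<in> carrier H ==>
      F (a \<cdot> a') (b \<cdot> b') (c \<cdot> c') = F a b c \<otimes>\<^bsub>C\<^esub> F a' b' c'"
    and s: "s \<in> carrier HHH" and t: "t \<in> carrier HHH"
  shows "L3 C F (m3 s t) = L3 C F s \<otimes>\<^bsub>C\<^esub> L3 C F t"
proof -
  note M = alg_module[OF C]
  have Fc: "F a b c \<in> carrier C" if "a \<in> carrier H" "b \<in> carrier H" "c \<in> carrier H" for a b c
    using F that by (auto simp: tril_def dest: lin_closed)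
  have sc: "L3 C F s \<in> carrier C" using M F s by (intro L3_in)
  have "L3 C F (m3 s t) = L3 C (\<lambda>a' b' c'. L3 C (\<lambda>a b c. F a b c \<otimes>\<^bsub>C\<^esub> F a' b' c') s) t"
    by (rule L3_mult[OF M F s t]) (rule m)
  also have "... = L3 C (\<lambda>a' b' c'. L3 C F s \<otimes>\<^bsub>C\<^esub> F a' b' c') t"
    using Fc by (intro L3_cong L3_push[OF M M F lin_mult1[OF C lin_id] s, symmetric]) auto
  also have "... = L3 C F s \<otimes>\<^bsub>C\<^esub> L3 C F t"
    by (rule L3_push[OF M M F lin_mult2[OF C lin_id sc] t, symmetric])
  finally show ?thesis .
qed

lemma m2_pure: "a \<in> carrier H ==> b \<in> carrier H ==> a' \<in> carrier H ==> b' \<in> carrier H ==>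
   m2 (p2 a b) (p2 a' b') = p2 (a \<cdot> a') (b \<cdot> b')"
  by (rule tensor_mult_pt) auto

lemma alg_smult:
  assumes "assoc_alg k A" "c \<in> carrier k" "d \<in> carrier k" "x \<in> carrier A" "y \<in> carrier A"
  shows "(c \<odot>\<^bsub>A\<^esub> x) \<otimes>\<^bsub>A\<^esub> (d \<odot>\<^bsub>A\<^esub> y) = (c \<otimes>\<^bsub>k\<^esub> d) \<odot>\<^bsub>A\<^esub> (x \<otimes>\<^bsub>A\<^esub> y)"
proof -
  interpret k: cring k by (rule cringk)
  show ?thesis using assms
    by (auto simp: assoc_alg_def m_smult_smult ring.ring_simprules(5) k.m_comm)
qed

text \<open>The counit on one leg, as algebra maps from the third to the second tensor power of H;
  being multiplicative, they can be applied to every factor of a hexagon.\<close>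

definition E1 where "E1 = L3 HH (\<lambda>a b c. counit H a \<odot>\<^bsub>HH\<^esub> p2 b c)"
definition E2 where "E2 = L3 HH (\<lambda>a b c. counit H b \<odot>\<^bsub>HH\<^esub> p2 a c)"
definition E3 where "E3 = L3 HH (\<lambda>a b c. counit H c \<odot>\<^bsub>HH\<^esub> p2 a b)"

lemma E_tril: "tril H H H HH (\<lambda>a b c. counit H a \<odot>\<^bsub>HH\<^esub> p2 b c)" "tril H H H HH (\<lambda>a b c. counit H b \<odot>\<^bsub>HH\<^esub> p2 a c)"
  "tril H H H HH (\<lambda>a b c. counit H c \<odot>\<^bsub>HH\<^esub> p2 a b)"
  by (auto intro!: LE)

lemma E_lin: "lin HHH HH E1" "lin HHH HH E2" "lin HHH HH E3"
  unfolding E1_def E2_def E3_def by (intro trilift_lin E_tril; simp)+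

lemma E_in [simp]: "s \<in> carrier HHH ==> E1 s \<in> carrier HH" "s \<in> carrier HHH ==> E2 s \<in> carrier HH" "s \<in> carrier HHH ==> E3 s \<in> carrier HH"
  using E_lin[THEN lin_closed] by auto

lemma E_pure: "a \<in> carrier H ==> b \<in> carrier H ==> c \<in> carrier H ==> E1 (p3 a b c) = counit H a \<odot>\<^bsub>HH\<^esub> p2 b c"
  "a \<in> carrier H ==> b \<in> carrier H ==> c \<in> carrier H ==> E2 (p3 a b c) = counit H b \<odot>\<^bsub>HH\<^esub> p2 a c"
  "a \<in> carrier H ==> b \<in> carrier H ==> c \<in> carrier H ==> E3 (p3 a b c) = counit H c \<odot>\<^bsub>HH\<^esub> p2 a b"
  unfolding E1_def E2_def E3_def by (subst L3_pt[OF _ E_tril(1)] L3_pt[OF _ E_tril(2)] L3_pt[OF _ E_tril(3)]; simp)+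

lemma E_mult:
  assumes "s \<in> carrier HHH" "t \<in> carrier HHH"
  shows "E1 (m3 s t) = m2 (E1 s) (E1 t)" (is ?g3) "E2 (m3 s t) = m2 (E2 s) (E2 t)" (is ?g2) "E3 (m3 s t) = m2 (E3 s) (E3 t)" (is ?g1)
proof -
  have e: "m2 (c \<odot>\<^bsub>HH\<^esub> p2 a b) (c' \<odot>\<^bsub>HH\<^esub> p2 a' b') = (c \<otimes>\<^bsub>k\<^esub> c') \<odot>\<^bsub>HH\<^esub> p2 (a \<cdot> a') (b \<cdot> b')"
    if "c \<in> carrier k" "c' \<in> carrier k" "a \<in> carrier H" "b \<in> carrier H" "a' \<in> carrier H" "b' \<in> carrier H" for c c' a b a' b'
    using alg_smult[OF algH2, of c c' "p2 a b" "p2 a' b'"] that by (simp add: m2_pure)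
  show ?g3
    using L3_hom[OF algH2 _ _ assms, of "\<lambda>a b c. counit H a \<odot>\<^bsub>HH\<^esub> p2 b c"] E_tril(1)
    by (simp add: E1_def e eps_mult tril_def)
  show ?g2
    using L3_hom[OF algH2 _ _ assms, of "\<lambda>a b c. counit H b \<odot>\<^bsub>HH\<^esub> p2 a c"] E_tril(2)
    by (simp add: E2_def e eps_mult tril_def)
  show ?g1
    using L3_hom[OF algH2 _ _ assms, of "\<lambda>a b c. counit H c \<odot>\<^bsub>HH\<^esub> p2 a b"] E_tril(3)
    by (simp add: E3_def e eps_mult tril_def)
qed

lemma E2_phi: "E2 (phi H) = one2"
  using qtqh unfolding quasitriangular_quasi_Hopf_def quasi_bialgebra_def by (simp add: E2_def)

lemma L2_E:
  assumes X: "module k X" and F: "bil H H X F" and s: "s \<in> carrier HHH"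
  shows "L2 X F (E1 s) = L3 X (\<lambda>a b c. counit H a \<odot>\<^bsub>X\<^esub> F b c) s"
   "L2 X F (E2 s) = L3 X (\<lambda>a b c. counit H b \<odot>\<^bsub>X\<^esub> F a c) s"
   "L2 X F (E3 s) = L3 X (\<lambda>a b c. counit H c \<odot>\<^bsub>X\<^esub> F a b) s"
  unfolding E1_def E2_def E3_def
  by (rule lin_L3_expand[OF X _ bilift_lin _ _ s];
    use X F E_tril in \<open>simp add: lin_smult[OF bilift_lin] L2_pt\<close>)+

text \<open>The counit on a middle leg of the fourth tensor power. Applied to the pentagon, these
  maps isolate the two outer counit conditions on \<phi>, which are not among the axioms.\<close>

definition D2 where "D2 = L4 HHH (\<lambda>a b c d. counit H b \<odot>\<^bsub>HHH\<^esub> p3 a c d)"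
definition D3 where "D3 = L4 HHH (\<lambda>a b c d. counit H c \<odot>\<^bsub>HHH\<^esub> p3 a b d)"

lemma D_quadl: "quadl H H H H HHH (\<lambda>a b c d. counit H b \<odot>\<^bsub>HHH\<^esub> p3 a c d)" "quadl H H H H HHH (\<lambda>a b c d. counit H c \<odot>\<^bsub>HHH\<^esub> p3 a b d)"
  by (auto intro!: LE)

lemma D_lin: "lin HHHH HHH D2" "lin HHHH HHH D3"
  unfolding D2_def D3_def by (intro quadlift_lin D_quadl; simp)+

lemma D_pure: "a \<in> carrier H ==> b \<in> carrier H ==> c \<in> carrier H ==> d \<in> carrier H ==> D2 (pure4H a b c d) = counit H b \<odot>\<^bsub>HHH\<^esub> p3 a c d"
  "a \<in> carrier H ==> b \<in> carrier H ==> c \<in> carrier H ==> d \<in> carrier H ==> D3 (pure4H a b c d) = counit H c \<odot>\<^bsub>HHH\<^esub> p3 a b d"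
  unfolding D2_def D3_def by (subst quadlift_pt[OF _ _ _ _ _ D_quadl(1)] quadlift_pt[OF _ _ _ _ _ D_quadl(2)]; simp)+

lemma D_in [simp]: "s \<in> carrier HHHH ==> D2 s \<in> carrier HHH" "s \<in> carrier HHHH ==> D3 s \<in> carrier HHH"
  using D_lin[THEN lin_closed] by auto

lemma D_mult:
  assumes s: "s \<in> carrier HHHH" and t: "t \<in> carrier HHHH"
  shows "D2 (m4 s t) = m3 (D2 s) (D2 t)" (is ?g2) "D3 (m4 s t) = m3 (D3 s) (D3 t)" (is ?g1)
proof -
  have e: "m3 (z \<odot>\<^bsub>HHH\<^esub> p3 a b c) (z' \<odot>\<^bsub>HHH\<^esub> p3 a' b' c') = (z \<otimes>\<^bsub>k\<^esub> z') \<odot>\<^bsub>HHH\<^esub> p3 (a \<cdot> a') (b \<cdot> b') (c \<cdot> c')"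
    if "z \<in> carrier k" "z' \<in> carrier k" "a \<in> carrier H" "b \<in> carrier H" "c \<in> carrier H" "a' \<in> carrier H" "b' \<in> carrier H" "c' \<in> carrier H" for z z' a b c a' b' c'
    using alg_smult[OF algH3, of z z' "p3 a b c" "p3 a' b' c'"] that by (simp add: m3_pure)
  have *: "D (m4 s t) = m3 (D s) (D t)" if l: "lin HHHH HHH D" and
    p: "\<And>a b c d a' b' c' d'. a \<in> carrier H ==> b \<in> carrier H ==> c \<in> carrier H ==> d \<in> carrier H ==>
      a' \<in> carrier H ==> b' \<in> carrier H ==> c' \<in> carrier H ==> d' \<in> carrier H ==>
      D (m4 (pure4H a b c d) (pure4H a' b' c' d')) = m3 (D (pure4H a b c d)) (D (pure4H a' b' c' d'))" for D
  proof (rule tens4_ext[OF modH modH modH modH lin_comp[OF m4_lin(1)[OF s] l] lin_comp[OF l m3_lin(1)] _ t])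
    show "D s \<in> carrier HHH" by (rule lin_closed[OF l s])
    fix a' b' c' d' assume a': "a' \<in> carrier H" "b' \<in> carrier H" "c' \<in> carrier H" "d' \<in> carrier H"
    let ?p = "pure4H a' b' c' d'"
    have pc: "?p \<in> carrier HHHH" using a' by simp
    show "D (m4 s ?p) = m3 (D s) (D ?p)"
      by (rule tens4_ext[OF modH modH modH modH lin_comp[OF m4_lin(2)[OF pc] l] lin_comp[OF l m3_lin(2)[OF lin_closed[OF l pc]]] _ s])
        (rule p; use a' in simp)
  qed
  show ?g2 by (rule *[OF D_lin(1)]) (simp add: m4_pure D_pure e eps_mult)
  show ?g1 by (rule *[OF D_lin(2)]) (simp add: m4_pure D_pure e eps_mult)
qed

lemma L3_phi_id: "s \<in> carrier HHH ==> L3 HHH (\<lambda>a b c. p3 a b c) s = s"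
  by (rule trilift_pt_id) auto

lemma m3_unit: "s \<in> carrier HHH ==> m3 (one3) s = s" "s \<in> carrier HHH ==> m3 s (one3) = s"
  using alg_lone[OF algH3, of s] alg_rone[OF algH3, of s] by simp_all

lemma m2_unit: "s \<in> carrier HH ==> m2 (one2) s = s" "s \<in> carrier HH ==> m2 s (one2) = s"
  using alg_lone[OF algH2, of s] alg_rone[OF algH2, of s] by simp_all

lemma m3_cancel:
  assumes "x \<in> carrier HHH"
  shows "m3 x (phi H) = phi H ==> x = one3" "m3 (phi H) x = phi H ==> x = one3"
proof -
  show "x = one3" if "m3 x (phi H) = phi H"
    using that alg_assoc[OF algH3, of x "phi H" "\<psi>"] assms m3_unit by (simp add: phi_phi_inv)
  show "x = one3" if "m3 (phi H) x = phi H"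
    using that alg_assoc[OF algH3, of "\<psi>" "phi H" x] assms m3_unit by (simp add: phi_inv_phi)
qed

lemma E_units: "E1 (one3) = one2" "E2 (one3) = one2"
   "E3 (one3) = one2"
  by (simp_all add: E_pure)

lemma z1: "L2 HHH (\<lambda>a b. p3 \<one>\<^sub>H a b) (comul H \<one>\<^sub>H) = one3"
  and z2: "L2 HHH (\<lambda>a b. p3 a b \<one>\<^sub>H) (comul H \<one>\<^sub>H) = one3"
  unfolding comul_one by (subst L2_pt; auto intro!: LR)+

text \<open>By the counit axiom for \<Delta> and the axiom for the middle leg of \<phi>, four of the
  five factors become 1 or \<phi>. The pentagon shrinks to \<phi> = (1 \<otimes>
  \<open>E1\<close>(\<phi>)) \<phi>.\<close>

lemma D2_phis: "D2 PA = one3" (is ?g3) "D2 PB = phi H" "D2 PC = L2 HHH (\<lambda>a b. p3 \<one>\<^sub>H a b) (E1 (phi H))" (is ?g2)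
  "D2 PD = phi H" "D2 PE = one3" (is ?g1)
proof -
  have M: "module k HHH" by simp
  note ex = P_expand[OF M D_lin(1) phi_in]
  have "D2 PA = L3 HHH (\<lambda>a b c. counit H b \<odot>\<^bsub>HHH\<^esub> L2 HHH (\<lambda>c1 c2. p3 a c1 c2) (comul H c)) (phi H)"
    unfolding ex by (intro L3_cong lin_L2_expand[symmetric] lin_smultf lin_id) (auto simp: D_pure intro!: LR)
  also have "... = L2 HHH (\<lambda>a c. L2 HHH (\<lambda>c1 c2. p3 a c1 c2) (comul H c)) (E2 (phi H))"
    by (rule L2_E(2)[symmetric]) (auto intro!: LR)
  also have "... = one3" unfolding E2_phi
    by (subst L2_pt) (auto simp: z1 intro!: LR)
  finally show ?g3 .
  have "D2 PB = L3 HHH (\<lambda>a b c. L2 HHH (\<lambda>a1 a2. counit H a2 \<odot>\<^bsub>HHH\<^esub> p3 a1 b c) (comul H a)) (phi H)"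
    unfolding ex by (intro L3_cong L2_cong) (simp add: D_pure)
  also have "... = L3 HHH (\<lambda>a b c. p3 a b c) (phi H)"
    by (intro L3_cong eps_comul(2)) (auto intro!: LR)
  finally show "D2 PB = phi H" by (simp add: L3_phi_id)
  have "D2 PC = L3 HHH (\<lambda>a b c. counit H a \<odot>\<^bsub>HHH\<^esub> p3 \<one>\<^sub>H b c) (phi H)"
    unfolding ex by (intro L3_cong) (simp add: D_pure)
  then show ?g2
    by (subst L2_E(1)) (auto intro!: LR)
  have "D2 PD = L3 HHH (\<lambda>a b c. L2 HHH (\<lambda>b1 b2. counit H b1 \<odot>\<^bsub>HHH\<^esub> p3 a b2 c) (comul H b)) (phi H)"
    unfolding ex by (intro L3_cong L2_cong) (simp add: D_pure)
  also have "... = L3 HHH (\<lambda>a b c. p3 a b c) (phi H)"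
    by (intro L3_cong eps_comul(1)) (auto intro!: LR)
  finally show "D2 PD = phi H" by (simp add: L3_phi_id)
  have "D2 PE = L3 HHH (\<lambda>a b c. counit H b \<odot>\<^bsub>HHH\<^esub> p3 a c \<one>\<^sub>H) (phi H)"
    unfolding ex by (intro L3_cong) (simp add: D_pure)
  also have "... = L2 HHH (\<lambda>a c. p3 a c \<one>\<^sub>H) (E2 (phi H))"
    by (rule L2_E(2)[symmetric]) (auto intro!: LR)
  also have "... = one3" unfolding E2_phi by (subst L2_pt) (auto intro!: LR)
  finally show ?g1 .
qed

text \<open>The same on the third leg; the pentagon shrinks to \<phi> = \<phi>
  (\<open>E3\<close>(\<phi>) \<otimes> 1).\<close>

lemma D3_phis: "D3 PA = phi H" "D3 PB = one3" (is ?g3) "D3 PC = one3" (is ?g2)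
  "D3 PD = phi H" "D3 PE = L2 HHH (\<lambda>a b. p3 a b \<one>\<^sub>H) (E3 (phi H))" (is ?g1)
proof -
  have M: "module k HHH" by simp
  note ex = P_expand[OF M D_lin(2) phi_in]
  have "D3 PB = L3 HHH (\<lambda>a b c. counit H b \<odot>\<^bsub>HHH\<^esub> L2 HHH (\<lambda>a1 a2. p3 a1 a2 c) (comul H a)) (phi H)"
    unfolding ex by (intro L3_cong lin_L2_expand[symmetric] lin_smultf lin_id) (auto simp: D_pure intro!: LR)
  also have "... = L2 HHH (\<lambda>a c. L2 HHH (\<lambda>a1 a2. p3 a1 a2 c) (comul H a)) (E2 (phi H))"
    by (rule L2_E(2)[symmetric]) (auto intro!: LR)
  also have "... = one3" unfolding E2_phi
    by (subst L2_pt) (auto simp: z2 intro!: LR)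
  finally show ?g3 .
  have "D3 PA = L3 HHH (\<lambda>a b c. L2 HHH (\<lambda>c1 c2. counit H c1 \<odot>\<^bsub>HHH\<^esub> p3 a b c2) (comul H c)) (phi H)"
    unfolding ex by (intro L3_cong L2_cong) (simp add: D_pure)
  also have "... = L3 HHH (\<lambda>a b c. p3 a b c) (phi H)"
    by (intro L3_cong eps_comul(1)) (auto intro!: LR)
  finally show "D3 PA = phi H" by (simp add: L3_phi_id)
  have "D3 PC = L3 HHH (\<lambda>a b c. counit H b \<odot>\<^bsub>HHH\<^esub> p3 \<one>\<^sub>H a c) (phi H)"
    unfolding ex by (intro L3_cong) (simp add: D_pure)
  also have "... = L2 HHH (\<lambda>a c. p3 \<one>\<^sub>H a c) (E2 (phi H))"
    by (rule L2_E(2)[symmetric]) (auto intro!: LR)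
  also have "... = one3" unfolding E2_phi by (subst L2_pt) (auto intro!: LR)
  finally show ?g2 .
  have "D3 PD = L3 HHH (\<lambda>a b c. L2 HHH (\<lambda>b1 b2. counit H b2 \<odot>\<^bsub>HHH\<^esub> p3 a b1 c) (comul H b)) (phi H)"
    unfolding ex by (intro L3_cong L2_cong) (simp add: D_pure)
  also have "... = L3 HHH (\<lambda>a b c. p3 a b c) (phi H)"
    by (intro L3_cong eps_comul(2)) (auto intro!: LR)
  finally show "D3 PD = phi H" by (simp add: L3_phi_id)
  have "D3 PE = L3 HHH (\<lambda>a b c. counit H c \<odot>\<^bsub>HHH\<^esub> p3 a b \<one>\<^sub>H) (phi H)"
    unfolding ex by (intro L3_cong) (simp add: D_pure)
  then show ?g1
    by (subst L2_E(3)) (auto intro!: LR)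
qed

lemma L2_id: "s \<in> carrier HH ==> L2 HH (\<lambda>a b. p2 a b) s = s"
  by (rule bilift_pt_id) auto

text \<open>As \<phi> is invertible, the shrunken pentagon forces 1 \<otimes>
  \<open>E1\<close>(\<phi>) = 1.\<close>

lemma E1_phi: "E1 (phi H) = one2"
proof -
  let ?x = "L2 HHH (\<lambda>a b. p3 \<one>\<^sub>H a b) (E1 (phi H))"
  have x: "?x \<in> carrier HHH" by (rule L2_in) (auto intro!: LR)
  have "D2 (m4 PA PB) = D2 (m4 (m4 PC PD) PE)" by (simp add: pentagon_H)
  then have "phi H = m3 ?x (phi H)" using x by (simp add: D_mult D2_phis m3_unit)
  then have "?x = one3" using m3_cancel(1)[OF x] by simp
  \<comment> \<open>A second counit, on the first leg, strips off the leading 1.\<close>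
  then have "E1 ?x = one2" by (simp add: E_units)
  moreover have "E1 ?x = L2 HH (\<lambda>a b. p2 a b) (E1 (phi H))"
    by (rule lin_L2_expand[OF _ _ E_lin(1)]) (auto simp: E_pure intro!: LR)
  ultimately show ?thesis by (simp add: L2_id)
qed

lemma E3_phi: "E3 (phi H) = one2"
proof -
  let ?x = "L2 HHH (\<lambda>a b. p3 a b \<one>\<^sub>H) (E3 (phi H))"
  have x: "?x \<in> carrier HHH" by (rule L2_in) (auto intro!: LR)
  have "D3 (m4 PA PB) = D3 (m4 (m4 PC PD) PE)" by (simp add: pentagon_H)
  then have "phi H = m3 (phi H) ?x" using x by (simp add: D_mult D3_phis m3_unit)
  then have "?x = one3" using m3_cancel(2)[OF x] by simp
  then have "E3 ?x = one2" by (simp add: E_units)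
  moreover have "E3 ?x = L2 HH (\<lambda>a b. p2 a b) (E3 (phi H))"
    by (rule lin_L2_expand[OF _ _ E_lin(3)]) (auto simp: E_pure intro!: LR)
  ultimately show ?thesis by (simp add: L2_id)
qed

lemma E_phi_inv: "E1 \<psi> = one2" (is ?g3) "E2 \<psi> = one2" (is ?g2) "E3 \<psi> = one2" (is ?g1)
proof -
  have e: "m3 (phi H) \<psi> = one3" using phi_phi_inv by simp
  note E = E_mult[of "phi H" "\<psi>", unfolded e E_units, OF phi_in phi_inv_in]
  show ?g3 using E(1)[symmetric] E1_phi m2_unit(1)[of "E1 \<psi>"] by simp
  show ?g2 using E(2)[symmetric] E2_phi m2_unit(1)[of "E2 \<psi>"] by simp
  show ?g1 using E(3)[symmetric] E3_phi m2_unit(1)[of "E3 \<psi>"] by simp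
qed

text \<open>The working form of the counit conditions: a counit on any leg of \<phi> or \<psi>
  removes the whole element from a sum. This makes associators trivial when one factor is
  invariant.\<close>

lemma phi_eps:
  assumes X: "module k X" and F: "bil H H X F"
  shows "L3 X (\<lambda>a b c. counit H a \<odot>\<^bsub>X\<^esub> F b c) (phi H) = F \<one>\<^sub>H \<one>\<^sub>H"
   "L3 X (\<lambda>a b c. counit H b \<odot>\<^bsub>X\<^esub> F a c) (phi H) = F \<one>\<^sub>H \<one>\<^sub>H"
   "L3 X (\<lambda>a b c. counit H c \<odot>\<^bsub>X\<^esub> F a b) (phi H) = F \<one>\<^sub>H \<one>\<^sub>H"
   "L3 X (\<lambda>a b c. counit H a \<odot>\<^bsub>X\<^esub> F b c) \<psi> = F \<one>\<^sub>H \<one>\<^sub>H"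
   "L3 X (\<lambda>a b c. counit H b \<odot>\<^bsub>X\<^esub> F a c) \<psi> = F \<one>\<^sub>H \<one>\<^sub>H"
   "L3 X (\<lambda>a b c. counit H c \<odot>\<^bsub>X\<^esub> F a b) \<psi> = F \<one>\<^sub>H \<one>\<^sub>H"
  using L2_E[OF X F, of "phi H", symmetric] L2_E[OF X F, of "\<psi>", symmetric] L2_pt[OF X F]
  by (simp_all add: E1_phi E2_phi E3_phi E_phi_inv)

section \<open>Counit conditions for the universal R-matrix\<close>

definition eR where "eR = L2 H (\<lambda>a b. counit H a \<odot>\<^bsub>H\<^esub> b) (rmat H)"
definition Re where "Re = L2 H (\<lambda>a b. counit H b \<odot>\<^bsub>H\<^esub> a) (rmat H)"

lemma eR_bil: "bil H H H (\<lambda>a b. counit H a \<odot>\<^bsub>H\<^esub> b)" "bil H H H (\<lambda>a b. counit H b \<odot>\<^bsub>H\<^esub> a)"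
  by (auto intro!: LE)

lemma eR_in [simp]: "eR \<in> carrier H" "Re \<in> carrier H"
  unfolding eR_def Re_def by (auto intro!: L2_in eR_bil)

lemma R_cancel:
  assumes x: "x \<in> carrier HH" and e: "m2 x (rmat H) = rmat H"
  shows "x = one2"
proof -
  interpret H2: ring "tensor_alg k H H" by (rule ring_H2)
  have u: "rmat H \<in> Units (tensor_alg k H H)"
    using qtqh unfolding quasitriangular_quasi_Hopf_def universal_R_def by simp
  have "m2 (m2 x (rmat H)) (inv\<^bsub>tensor_alg k H H\<^esub> (rmat H)) = m2 (rmat H) (inv\<^bsub>tensor_alg k H H\<^esub> (rmat H))" by (simp only: e)
  then show ?thesis using x u H2.Units_inv_closed[OF u] H2.Units_r_inv[OF u] H2.m_assoc[of x "rmat H" "inv\<^bsub>tensor_alg k H H\<^esub> (rmat H)"]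
    m2_unit[OF x] by simp
qed

text \<open>Under the counit on the first leg of the first hexagon, the left side and
  \<open>R23\<close> become R, \<open>R13\<close> becomes 1 \<otimes> \<open>eR\<close>, and the
  associators disappear. Invertibility of R then gives 1 \<otimes> \<open>eR\<close> = 1.\<close>

lemma eR_one: "eR = \<one>\<^sub>H"
proof -
  have M: "module k HH" by simp
  note ex = hex_expand[OF M E_lin(1)]
  have 1: "E1 RL = rmat H"
  proof -
    have "E1 RL = L2 HH (\<lambda>a b. L2 HH (\<lambda>a1 a2. counit H a1 \<odot>\<^bsub>HH\<^esub> p2 a2 b) (comul H a)) (rmat H)"
      unfolding ex unfolding E1_def by (intro L2_cong L3_ptHH E_tril) auto
    also have "... = L2 HH (\<lambda>a b. p2 a b) (rmat H)" by (intro L2_cong eps_comul(1)) (auto intro!: LR)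
    finally show ?thesis by (simp add: L2_id)
  qed
  have 2: "E1 p231 = one2"
  proof -
    have "E1 p231 = L3 HH (\<lambda>a b c. counit H b \<odot>\<^bsub>HH\<^esub> p2 c a) (phi H)"
      unfolding ex by (intro L3_cong E_pure)
    also have "... = one2" by (rule phi_eps(2)) (auto intro!: LR)
    finally show ?thesis .
  qed
  have 3: "E1 R13 = p2 \<one>\<^sub>H eR"
  proof -
    have "E1 R13 = L2 HH (\<lambda>a b. p2 \<one>\<^sub>H (counit H a \<odot>\<^bsub>H\<^esub> b)) (rmat H)"
      unfolding ex by (intro L2_cong) (simp add: E_pure lin_smult[OF pt_bilinear(2)])
    also have "... = p2 \<one>\<^sub>H eR" unfolding eR_def by (rule L2_push[symmetric]) (auto intro!: LE)
    finally show ?thesis .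
  qed
  have 4: "E1 q132 = one2"
  proof -
    have "E1 q132 = L3 HH (\<lambda>a b c. counit H a \<odot>\<^bsub>HH\<^esub> p2 c b) \<psi>"
      unfolding ex by (intro L3_cong E_pure)
    also have "... = one2" by (rule phi_eps(4)) (auto intro!: LR)
    finally show ?thesis .
  qed
  have 5: "E1 R23 = rmat H"
  proof -
    have "E1 R23 = L2 HH (\<lambda>a b. p2 a b) (rmat H)"
      unfolding ex by (intro L2_cong) (simp add: E_pure)
    then show ?thesis by (simp add: L2_id)
  qed
  have "rmat H = E1 (m3 (m3 (m3 (m3 p231 R13) q132) R23) (phi H))" using 1 hexagon_H(1) by simp
  also have "... = m2 (p2 \<one>\<^sub>H eR) (rmat H)" by (simp add: E_mult 2 3 4 5 E1_phi m2_unit)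
  finally have "p2 \<one>\<^sub>H eR = one2" by (intro R_cancel) simp_all
  then have "L2 H (\<lambda>a b. counit H a \<odot>\<^bsub>H\<^esub> b) (p2 \<one>\<^sub>H eR) = L2 H (\<lambda>a b. counit H a \<odot>\<^bsub>H\<^esub> b) (one2)" by simp
  then show ?thesis by (simp add: L2_pt[OF _ eR_bil(1)])
qed

text \<open>The counit on the third leg of the second hexagon gives R = (\<open>Re\<close> \<otimes>
  1) R in the same way.\<close>

lemma Re_one: "Re = \<one>\<^sub>H"
proof -
  have M: "module k HH" by simp
  note ex = hex_expand[OF M E_lin(3)]
  have 1: "E3 RR = rmat H"
  proof -
    have "E3 RR = L2 HH (\<lambda>a b. L2 HH (\<lambda>b1 b2. counit H b2 \<odot>\<^bsub>HH\<^esub> p2 a b1) (comul H b)) (rmat H)"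
      unfolding ex by (intro L2_cong E_pure) auto
    also have "... = L2 HH (\<lambda>a b. p2 a b) (rmat H)" by (intro L2_cong eps_comul(2)) (auto intro!: LR)
    finally show ?thesis by (simp add: L2_id)
  qed
  have 2: "E3 q312 = one2"
  proof -
    have "E3 q312 = L3 HH (\<lambda>a b c. counit H b \<odot>\<^bsub>HH\<^esub> p2 c a) \<psi>"
      unfolding ex by (intro L3_cong E_pure)
    also have "... = one2" by (rule phi_eps(5)) (auto intro!: LR)
    finally show ?thesis .
  qed
  have 3: "E3 R13 = p2 Re \<one>\<^sub>H"
  proof -
    have "E3 R13 = L2 HH (\<lambda>a b. p2 (counit H b \<odot>\<^bsub>H\<^esub> a) \<one>\<^sub>H) (rmat H)"
      unfolding ex by (intro L2_cong) (simp add: E_pure lin_smult[OF pt_bilinear(1)])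
    also have "... = p2 Re \<one>\<^sub>H" unfolding Re_def by (rule L2_push[symmetric]) (auto intro!: LE)
    finally show ?thesis .
  qed
  have 4: "E3 p213 = one2"
  proof -
    have "E3 p213 = L3 HH (\<lambda>a b c. counit H c \<odot>\<^bsub>HH\<^esub> p2 b a) (phi H)"
      unfolding ex by (intro L3_cong E_pure)
    also have "... = one2" by (rule phi_eps(3)) (auto intro!: LR)
    finally show ?thesis .
  qed
  have 5: "E3 R12 = rmat H"
  proof -
    have "E3 R12 = L2 HH (\<lambda>a b. p2 a b) (rmat H)"
      unfolding ex by (intro L2_cong) (simp add: E_pure)
    then show ?thesis by (simp add: L2_id)
  qed
  have "rmat H = E3 (m3 (m3 (m3 (m3 q312 R13) p213) R12) \<psi>)" using 1 hexagon_H(2) by simp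
  also have "... = m2 (p2 Re \<one>\<^sub>H) (rmat H)" by (simp add: E_mult 2 3 4 5 E_phi_inv m2_unit)
  finally have "p2 Re \<one>\<^sub>H = one2" by (intro R_cancel) simp_all
  then have "L2 H (\<lambda>a b. counit H b \<odot>\<^bsub>H\<^esub> a) (p2 Re \<one>\<^sub>H) = L2 H (\<lambda>a b. counit H b \<odot>\<^bsub>H\<^esub> a) (one2)" by simp
  then show ?thesis by (simp add: L2_pt[OF _ eR_bil(2)])
qed

lemma R_eps:
  assumes X: "module k X" and f: "lin H X f"
  shows "L2 X (\<lambda>a b. counit H a \<odot>\<^bsub>X\<^esub> f b) (rmat H) = f \<one>\<^sub>H" (is ?g2)
    "L2 X (\<lambda>a b. counit H b \<odot>\<^bsub>X\<^esub> f a) (rmat H) = f \<one>\<^sub>H" (is ?g1)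
proof -
  have "f eR = L2 X (\<lambda>a b. counit H a \<odot>\<^bsub>X\<^esub> f b) (rmat H)" unfolding eR_def
    by (rule lin_L2_expand[OF X _ f eR_bil(1)]) (auto simp: lin_smult[OF f])
  moreover have "f Re = L2 X (\<lambda>a b. counit H b \<odot>\<^bsub>X\<^esub> f a) (rmat H)" unfolding Re_def
    by (rule lin_L2_expand[OF X _ f eR_bil(2)]) (auto simp: lin_smult[OF f])
  ultimately show ?g2
    ?g1 using eR_one Re_one by simp_all
qed

section \<open>Internal homs\<close>

abbreviation hom where "hom \<equiv> hom_obj k H"

lemma hom_simps [simp]:
  "carrier (hom V W) = Lin k V W" "zero (hom V W) = (\<lambda>v\<in>carrier V. \<zero>\<^bsub>W\<^esub>)"
  "add (hom V W) L L' = (\<lambda>v\<in>carrier V. L v \<oplus>\<^bsub>W\<^esub> L' v)" "smult (hom V W) c L = (\<lambda>v\<in>carrier V. c \<odot>\<^bsub>W\<^esub> L v)"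
  "act (hom V W) h L = (\<lambda>v\<in>carrier V. L2 W (\<lambda>a b. act W a (L (act V (antip H b) v))) (comul H h))"
  "gr (hom V W) n = {L \<in> Lin k V W. \<forall>m. \<forall>v\<in>gr V m. L v \<in> gr W (m + n)}"
  by (auto simp: hom_obj_def)

lemma Lin_lin: "L \<in> Lin k V W ==> lin V W L"
  and Lin_ext: "L \<in> Lin k V W ==> L \<in> extensional (carrier V)"
  by (auto simp: Lin_iff)

lemma Lin_in: "L \<in> Lin k V W ==> v \<in> carrier V ==> L v \<in> carrier W"
  by (rule lin_closed[OF Lin_lin])

lemma LinI: "module k V ==> lin V W f ==> (\<lambda>v\<in>carrier V. f v) \<in> Lin k V W"
  by (simp add: Lin_iff lin_restrict)

lemma Lin_eqI: "L \<in> Lin k V W ==> L' \<in> Lin k V W ==> (\<And>v. v \<in> carrier V ==> L v = L' v) ==> L = L'"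
  by (rule extensionalityI[OF Lin_ext Lin_ext])

lemma hom_module [simp]:
  assumes V: "module k V" and W: "module k W"
  shows "module k (hom V W)"
proof (rule moduleI', goal_cases)
  case (1 x y)
  then show ?case using V W lin_addf[OF W Lin_lin Lin_lin, of x V y] by (simp add: LinI)
next
  case 2
  then show ?case using V W by (simp add: LinI lin_zerof)
next
  case (3 x y z)
  then show ?case using W Lin_in[of x V W] Lin_in[of y V W] Lin_in[of z V W] by (auto simp: fun_eq_iff restrict_def m_assoc[OF W])
next
  case (4 x y)
  then show ?case using W Lin_in[of x V W] Lin_in[of y V W] by (auto simp: fun_eq_iff restrict_def m_comm[OF W])
next
  case (5 x)
  then show ?case using W Lin_in[of x V W] Lin_ext[of x V W]
    by (auto simp: fun_eq_iff restrict_def extensional_def)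
next
  case (6 x)
  then show ?case using W Lin_in[of x V W] by (auto simp: fun_eq_iff restrict_def m_neg_smult[OF W, symmetric])
next
  case (7 c x)
  then show ?case using V W lin_smultf[OF W Lin_lin, of x V c] by (simp add: LinI)
next
  case (8 c d x)
  then show ?case using W Lin_in[of x V W] by (auto simp: fun_eq_iff restrict_def m_add_smult[OF W])
next
  case (9 c x y)
  then show ?case using W Lin_in[of x V W] Lin_in[of y V W] by (auto simp: fun_eq_iff restrict_def m_smult_add[OF W])
next
  case (10 c d x)
  then show ?case using W Lin_in[of x V W] by (auto simp: fun_eq_iff restrict_def m_smult_smult[OF W])
next
  case (11 x)
  then show ?case using W Lin_in[of x V W] Lin_ext[of x V W]
    by (auto simp: fun_eq_iff restrict_def extensional_def)
qed

lemma lin_eval: "v \<in> carrier V ==> lin (hom V W) W (\<lambda>L. L v)"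
  by (auto intro!: linI simp: Lin_in)

lemma lin_homI:
  assumes "module k V" "module k W" "\<And>y. y \<in> carrier Y ==> F y \<in> Lin k V W" "\<And>v. v \<in> carrier V ==> lin Y W (\<lambda>y. F y v)"
    and Y: "module k Y"
  shows "lin Y (hom V W) F"
proof (rule linI)
  fix x y assume xy: "x \<in> carrier Y" "y \<in> carrier Y"
  have "F x \<oplus>\<^bsub>hom V W\<^esub> F y \<in> Lin k V W"
    using m_add[OF hom_module[OF assms(1,2)]] assms(3) xy by simp
  then show "F (x \<oplus>\<^bsub>Y\<^esub> y) = F x \<oplus>\<^bsub>hom V W\<^esub> F y"
    by (intro Lin_eqI[OF assms(3)]) (use xy Y in "auto simp: lin_add[OF assms(4)]")
next
  fix c y assume xy: "c \<in> carrier k" "y \<in> carrier Y"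
  have "c \<odot>\<^bsub>hom V W\<^esub> F y \<in> Lin k V W"
    using m_smult[OF hom_module[OF assms(1,2)]] assms(3) xy by simp
  then show "F (c \<odot>\<^bsub>Y\<^esub> y) = c \<odot>\<^bsub>hom V W\<^esub> F y"
    by (intro Lin_eqI[OF assms(3)]) (use xy Y in "auto simp: lin_smult[OF assms(4)]")
qed (use assms in simp)

lemma lin_hom_pt: "lin Y (hom V W) F ==> v \<in> carrier V ==> lin Y W (\<lambda>y. F y v)"
  by (rule lin_comp[OF _ lin_eval])

lemma hom_act_bil:
  assumes "obj V" "obj W" "L \<in> Lin k V W" "v \<in> carrier V"
  shows "bil H H W (\<lambda>a b. act W a (L (act V (antip H b) v)))"
  using assms by (auto intro!: LR lin_comp[OF _ Lin_lin[OF assms(3)]] Lin_in[OF assms(3)])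

lemma hom_act_pt: "v \<in> carrier V ==> act (hom V W) h L v = L2 W (\<lambda>a b. act W a (L (act V (antip H b) v))) (comul H h)"
  by simp

lemma hom_act_Lin:
  assumes o: "obj V" "obj W" and h: "h \<in> carrier H" and L: "L \<in> Lin k V W"
  shows "act (hom V W) h L \<in> Lin k V W"
proof -
  have "lin V W (\<lambda>v. L2 W (\<lambda>a b. act W a (L (act V (antip H b) v))) (comul H h))"
    using o h L by (auto intro!: LR lin_comp[OF _ Lin_lin[OF L]] Lin_in[OF L])
  then show ?thesis using o by (simp add: LinI)
qed

text \<open>The action is associative because \<Delta> is multiplicative and the antipode reverses
  products. For the grading, the component of L in degree n sends v of degree m to the component of
  L v in degree m + n; the degrees that matter are differences of degrees in the two
  supports.\<close>

lemma hom_obj_obj [simp]: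
  assumes V: "obj V" and W: "obj W"
  shows "obj (hom V W)"
proof -
  note MV = obj_module[OF V] and MW = obj_module[OF W] and o = V W
  have M: "module k (hom V W)" using MV MW by simp
  define q where "q n L v = (\<Oplus>\<^bsub>W\<^esub>m\<in>gr_support V. hcomp W (L (hcomp V v m)) (m + n))" for n L v
  define P where "P n L = (\<lambda>v\<in>carrier V. q n L v)" for n L
  define S where "S = (\<lambda>i. snd i - fst i) ` (gr_support V \<times> gr_support W)"
  have fS: "finite S" using V W by (simp add: S_def gr_finite)
  have lq: "lin V W (q n L)" if "L \<in> Lin k V W" for n L
    unfolding q_def using V W that
    by (intro lin_finsumf lin_hcomp lin_comp[OF hcomp_lin Lin_lin]) (auto simp: gr_finite)
  have PL: "P n L \<in> Lin k V W" if "L \<in> Lin k V W" for n L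
    unfolding P_def using MV lq[OF that] by (rule LinI)
  have lqL: "lin (hom V W) W (\<lambda>L. q n L v)" if "v \<in> carrier V" for n v
    unfolding q_def using V W that by (intro lin_finsumf lin_hcomp lin_eval) (auto simp: gr_finite)
  have q0: "q n L v = hcomp W (L v) (m + n)" if L: "L \<in> Lin k V W" and v: "v \<in> gr V m" for n L v m
  proof (cases "m \<in> gr_support V")
    case True
    have vc: "v \<in> carrier V" using gr_in[OF V v] .
    have z: "L \<zero>\<^bsub>V\<^esub> = \<zero>\<^bsub>W\<^esub>" by (rule lin_zero[OF MV MW Lin_lin[OF L]])
    have z2: "hcomp W \<zero>\<^bsub>W\<^esub> i = \<zero>\<^bsub>W\<^esub>" for i by (rule lin_zero[OF MW MW hcomp_lin[OF W]])
    have "q n L v = hcomp W (L (hcomp V v m)) (m + n)" unfolding q_def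
      using True gr_finite[OF V] by (intro finsum_single[OF MW]) (use V W L vc in "auto simp: hcomp_hom[OF V v] Lin_in z z2")
    then show ?thesis by (simp add: hcomp_hom[OF V v])
  next
    case False
    then have v0: "v = \<zero>\<^bsub>V\<^esub>" using gr_nsupport[OF v] by simp
    have "q n L v = \<zero>\<^bsub>W\<^esub>" unfolding v0 by (rule lin_zero[OF MV MW lq[OF L]])
    then show ?thesis using lin_zero[OF MV MW Lin_lin[OF L]] lin_zero[OF MW MW hcomp_lin[OF W]] v0 by simp
  qed
  have gL: "L \<in> Lin k V W" "v \<in> gr V m ==> L v \<in> gr W (m + n)" if "L \<in> gr (hom V W) n" for L n v m using that by auto
  show ?thesis
  proof (rule objI[where S = S and P = P])
    show "module k (hom V W)" by (rule M)
    show "finite S" by (rule fS)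
    show "lin (hom V W) (hom V W) (act (hom V W) h)" if h: "h \<in> carrier H" for h
    proof (rule lin_homI[OF MV MW])
      show "lin (hom V W) W (\<lambda>L. act (hom V W) h L v)" if v: "v \<in> carrier V" for v
        unfolding hom_act_pt[OF v]
        by (intro lin_bil_H1 hom_act_bil lin_act2 lin_eval) (use o h v in auto)
    qed (use o h hom_act_Lin[OF o] in "auto simp del: hom_simps(5)")
    show "lin H (hom V W) (\<lambda>h. act (hom V W) h L)" if L: "L \<in> carrier (hom V W)" for L
    proof (rule lin_homI[OF MV MW])
      show "lin H W (\<lambda>h. act (hom V W) h L v)" if v: "v \<in> carrier V" for v
        unfolding hom_act_pt[OF v]
        by (intro lin_bil_H2 hom_act_bil lin_comul lin_id) (use o L v in auto)
    qed (use o L hom_act_Lin[OF o] in "auto simp del: hom_simps(5)")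
    show "act (hom V W) \<one>\<^sub>H L = L" if L: "L \<in> carrier (hom V W)" for L
    proof (rule Lin_eqI)
      show "act (hom V W) \<one>\<^sub>H L v = L v" if v: "v \<in> carrier V" for v
        unfolding hom_act_pt[OF v] comul_one
        by (subst L2_pt[OF _ hom_act_bil]) (use o L v Lin_in[of L V W v] in auto)
    qed (use o L hom_act_Lin[OF o] in "auto simp del: hom_simps(5)")
    show "act (hom V W) (h \<cdot> h') L = act (hom V W) h (act (hom V W) h' L)"
      if h: "h \<in> carrier H" "h' \<in> carrier H" and L: "L \<in> carrier (hom V W)" for h h' L
    proof (rule Lin_eqI)
      have L': "L \<in> Lin k V W" using L by simp
      fix v assume v: "v \<in> carrier V"
      have "act (hom V W) (h \<cdot> h') L v = L2 W (\<lambda>a b. act W a (L (act V (antip H b) v))) (m2 (comul H h) (comul H h'))"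
        using h v by (simp add: comul_mult)
      also have "... = L2 W (\<lambda>a b. L2 W (\<lambda>a' b'. act W a (act W a' (L (act V (antip H b') (act V (antip H b) v))))) (comul H h')) (comul H h)"
        by (rule L2_mult'[OF MW hom_act_bil[OF o L' v]]) (use h o v Lin_in[OF L'] in "auto simp: S_mult act_mult")
      also have "... = L2 W (\<lambda>a b. act W a (act (hom V W) h' L (act V (antip H b) v))) (comul H h)"
      proof (rule L2_cong)
        fix a b assume ab: "a \<in> carrier H" "b \<in> carrier H"
        then have c: "act V (antip H b) v \<in> carrier V" using o v by simp
        show "L2 W (\<lambda>a' b'. act W a (act W a' (L (act V (antip H b') (act V (antip H b) v))))) (comul H h') =
          act W a (act (hom V W) h' L (act V (antip H b) v))"
          unfolding hom_act_pt[OF c]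
          by (intro L2_push[OF MW MW hom_act_bil[OF o L' c] act_lin, symmetric]) (use o ab h in auto)
      qed
      also have "... = act (hom V W) h (act (hom V W) h' L) v" using v by simp
      finally show "act (hom V W) (h \<cdot> h') L v = act (hom V W) h (act (hom V W) h' L) v" .
    qed (use o L h hom_act_Lin[OF o] in "auto simp del: hom_simps(5)")
    show "submodule (gr (hom V W) n) k (hom V W)" for n
      using m_zero[OF M] m_add[OF M] m_smult[OF M] gr_in[OF V] by (auto simp: submod_iff[OF M] gr_add[OF W] gr_smult[OF W] W)
    show "act (hom V W) h L \<in> gr (hom V W) n" if h: "h \<in> carrier H" and L: "L \<in> gr (hom V W) n" for h L n
    proof -
      have "act (hom V W) h L v \<in> gr W (m + n)" if v: "v \<in> gr V m" for v m
      proof -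
        have vc: "v \<in> carrier V" using gr_in[OF V v] .
        show ?thesis unfolding hom_act_pt[OF vc]
          by (rule bilift_submod[OF _ _ _ hom_act_bil[OF o gL(1)[OF L] vc] gr_submod]) (use o h v in "auto intro!: act_gr gL(2)[OF L]")
      qed
      then show ?thesis using hom_act_Lin[OF o h gL(1)[OF L]] by (simp del: hom_simps(5))
    qed
    show "lin (hom V W) (hom V W) (P n)" for n
      using lqL MV MW PL by (intro lin_homI) (auto simp: P_def)
    show "P n L \<in> gr (hom V W) n" if L: "L \<in> carrier (hom V W)" for n L
    proof -
      have L': "L \<in> Lin k V W" using L by simp
      have "P n L v \<in> gr W (m + n)" if v: "v \<in> gr V m" for v m
        using gr_in[OF V v] hcomp_gr[OF W Lin_in[OF L' gr_in[OF V v]]] by (simp add: P_def q0[OF L' v])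
      then show ?thesis using PL[OF L'] by simp
    qed
    show "P n L = L" if L: "L \<in> gr (hom V W) n" for n L
    proof (rule Lin_eqI[OF PL[OF gL(1)[OF L]] gL(1)[OF L]])
      fix v assume v: "v \<in> carrier V"
      have "q n L v = L v"
        by (rule hom_ext[OF V v lq[OF gL(1)[OF L]] Lin_lin[OF gL(1)[OF L]]])
          (use gL(1)[OF L] hcomp_hom[OF W gL(2)[OF L]] in "simp add: q0")
      then show "P n L v = L v" using v by (simp add: P_def)
    qed
    show "P n L = \<zero>\<^bsub>hom V W\<^esub>" if L: "L \<in> gr (hom V W) m" and mn: "m \<noteq> n" for n m L
    proof (rule Lin_eqI[OF PL[OF gL(1)[OF L]]])
      show "\<zero>\<^bsub>hom V W\<^esub> \<in> Lin k V W" using m_zero[OF M] by (simp del: hom_simps(2))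
      fix v assume v: "v \<in> carrier V"
      have "q n L v = \<zero>\<^bsub>W\<^esub>"
        by (rule hom_ext[OF V v lq[OF gL(1)[OF L]] lin_zerof[OF MW]])
          (use gL(1)[OF L] hcomp_hom[OF W gL(2)[OF L]] mn in "simp add: q0")
      then show "P n L v = \<zero>\<^bsub>hom V W\<^esub> v" using v by (simp add: P_def)
    qed
    show "L = (\<Oplus>\<^bsub>hom V W\<^esub>n\<in>S. P n L)" if L: "L \<in> carrier (hom V W)" for L
    proof (rule Lin_eqI)
      have L': "L \<in> Lin k V W" using L by simp
      have Pc: "(\<lambda>n. P n L) \<in> S \<rightarrow> carrier (hom V W)" using PL[OF L'] by auto
      show "L \<in> Lin k V W" by (rule L')
      show "(\<Oplus>\<^bsub>hom V W\<^esub>n\<in>S. P n L) \<in> Lin k V W" using finsum_closed'[OF M Pc] by simp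
      fix v assume v: "v \<in> carrier V"
      have "L v = (\<Oplus>\<^bsub>W\<^esub>n\<in>S. q n L v)"
      proof (rule hom_ext[OF V v Lin_lin[OF L'] lin_finsumf])
        fix m v assume v: "v \<in> gr V m"
        have Lv: "L v \<in> carrier W" using Lin_in[OF L' gr_in[OF V v]] .
        show "L v = (\<Oplus>\<^bsub>W\<^esub>n\<in>S. q n L v)"
        proof (cases "m \<in> gr_support V")
          case True
          interpret W: module k W by (rule MW)
          have "(\<Oplus>\<^bsub>W\<^esub>n\<in>S. q n L v) = (\<Oplus>\<^bsub>W\<^esub>n\<in>S. hcomp W (L v) (m + n))" by (simp add: q0[OF L' v])
          \<comment> \<open>For v of degree m, running through n amounts to running through the
            shifted degrees m + n. As m lies in the support of V, these cover the support of
            W.\<close>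
          also have "... = (\<Oplus>\<^bsub>W\<^esub>l\<in>(\<lambda>n. m + n) ` S. hcomp W (L v) l)"
            using W Lv by (intro W.finsum_reindex[symmetric]) (auto intro: inj_onI)
          also have "... = (\<Oplus>\<^bsub>W\<^esub>l\<in>gr_support W. hcomp W (L v) l)"
          proof (rule finsum_mono_neutral[OF MW _ _ _, symmetric])
            show "gr_support W \<subseteq> (\<lambda>n. m + n) ` S"
            proof
              fix l assume "l \<in> gr_support W"
              then have "l - m \<in> S" unfolding S_def using True by (intro image_eqI[of _ _ "(m, l)"]) auto
              then show "l \<in> (\<lambda>n. m + n) ` S" by (intro image_eqI[of _ _ "l - m"]) auto
            qed
          qed (use fS W Lv gr_nsupport[OF hcomp_gr[OF W Lv]] in auto)
          finally show ?thesis using hcomp_sum[OF W Lv] by simp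
        next
          case False
          then have v0: "v = \<zero>\<^bsub>V\<^esub>" using gr_nsupport[OF v] by simp
          have "q n L v = \<zero>\<^bsub>W\<^esub>" for n unfolding v0 by (rule lin_zero[OF MV MW lq[OF L']])
          then show ?thesis using lin_zero[OF MV MW Lin_lin[OF L']] v0 by (simp add: finsum_eq_zero[OF MW])
        qed
      qed (use MW MV fS lq[OF L'] in auto)
      moreover have "(\<Oplus>\<^bsub>hom V W\<^esub>n\<in>S. P n L) v = (\<Oplus>\<^bsub>W\<^esub>n\<in>S. P n L v)"
        by (rule lin_finsum[OF M MW lin_eval[OF v] fS Pc])
      ultimately show "L v = (\<Oplus>\<^bsub>hom V W\<^esub>n\<in>S. P n L) v" using v by (simp add: P_def)
    qed
  qed
qed

section \<open>Currying and evaluation\<close>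

text \<open>Two independent Sweedler sums commute: both sides are linear in s, so only pure s has to
  be considered.\<close>

lemma fubini32:
  assumes X: "module k X"
    and F1: "\<And>d e. d \<in> carrier H ==> e \<in> carrier H ==> tril H H H X (\<lambda>a b c. F a b c d e)"
    and F2: "\<And>a b c. a \<in> carrier H ==> b \<in> carrier H ==> c \<in> carrier H ==> bil H H X (\<lambda>d e. F a b c d e)"
    and t: "t \<in> carrier HHH" and s: "s \<in> carrier HH"
  shows "L3 X (\<lambda>a b c. L2 X (\<lambda>d e. F a b c d e) s) t = L2 X (\<lambda>d e. L3 X (\<lambda>a b c. F a b c d e) t) s"
proof (rule bilift_eq[OF modH modH X _ _ s, symmetric])
  have tr: "tril H H H X (\<lambda>a b c. L2 X (\<lambda>d e. F a b c d e) s)" if s: "s \<in> carrier HH" for s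
    by (intro trilI lin_bil_H1) (use X F1 F2 s in "auto simp: tril_def")
  show "lin HH X (\<lambda>s. L3 X (\<lambda>a b c. L2 X (\<lambda>d e. F a b c d e) s) t)"
    using X tr F2 t by (intro lin_tri_H1 lin_bil_H2) (auto intro: lin_id)
  show "L3 X (\<lambda>a b c. F a b c d e) t = L3 X (\<lambda>a b c. L2 X (\<lambda>d e. F a b c d e) (p2 d e)) t"
    if "d \<in> carrier H" "e \<in> carrier H" for d e
    using that X F2 by (intro L3_cong) (simp add: L2_pt)
qed

lemma L3_mult':
  assumes X: "module k X" and F: "tril H H H X F" and s: "s \<in> carrier HHH" and t: "t \<in> carrier HHH"
   and K: "\<And>a b c a' b' c'. a \<in> carrier H ==> b \<in> carrier H ==> c \<in> carrier H ==> a' \<in> carrier H ==> b' \<in> carrier H ==> c' \<in> carrier H ==>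
      F (a \<cdot> a') (b \<cdot> b') (c \<cdot> c') = K a b c a' b' c'"
  shows "L3 X F (m3 s t) = L3 X (\<lambda>a b c. L3 X (K a b c) t) s"
proof -
  have l: "lin HHH X (L3 X F)" using X F by (intro trilift_lin) auto
  show ?thesis
  proof (rule trilift_eq[OF modH modH modH X lin_comp[OF m3_lin(2)[OF t] l] _ s, symmetric])
    fix a b c assume abc: "a \<in> carrier H" "b \<in> carrier H" "c \<in> carrier H"
    show "L3 X (K a b c) t = L3 X F (m3 (p3 a b c) t)"
      by (rule trilift_eq[OF modH modH modH X lin_comp[OF m3_lin(1) l] _ t])
        (use abc X F K in "auto simp: m3_pure L3_pt")
  qed
qed

abbreviation bS where "bS b c \<equiv> b \<cdot> beta H \<cdot> antip H c"
abbreviation Sa where "Sa b c \<equiv> antip H b \<cdot> alpha H \<cdot> c"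

lemma Hassoc: "x \<in> carrier H ==> y \<in> carrier H ==> z \<in> carrier H ==> x \<cdot> y \<cdot> z = x \<cdot> (y \<cdot> z)"
  by (rule alg_assoc[OF algH])

lemma antipode_push:
  assumes X: "module k X" and f: "lin H X f" and h: "h \<in> carrier H"
  shows "L2 X (\<lambda>a b. f (Sa a b)) (comul H h) = counit H h \<odot>\<^bsub>X\<^esub> f (alpha H)" (is ?g2)
    "L2 X (\<lambda>a b. f (bS a b)) (comul H h) = counit H h \<odot>\<^bsub>X\<^esub> f (beta H)" (is ?g1)
proof -
  have e: "L2 H Sa (comul H h) = counit H h \<odot>\<^bsub>H\<^esub> alpha H" "L2 H bS (comul H h) = counit H h \<odot>\<^bsub>H\<^esub> beta H"
    using qtqh h unfolding quasitriangular_quasi_Hopf_def quasi_antipode_def by simp_all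
  have "f (L2 H Sa (comul H h)) = L2 X (\<lambda>a b. f (Sa a b)) (comul H h)"
    using X f h by (intro L2_push) (auto intro!: LR)
  moreover have "f (L2 H bS (comul H h)) = L2 X (\<lambda>a b. f (bS a b)) (comul H h)"
    using X f h by (intro L2_push) (auto intro!: LR)
  ultimately show ?g2
    ?g1
    using h by (simp_all add: e lin_smult[OF f])
qed

lemma antipode_phi:
  assumes X: "module k X" and f: "lin H X f"
  shows "L3 X (\<lambda>a b c. f (bS a b \<cdot> alpha H \<cdot> c)) (phi H) = f \<one>\<^sub>H" (is ?g2)
    "L3 X (\<lambda>a b c. f (Sa a b \<cdot> beta H \<cdot> antip H c)) \<psi> = f \<one>\<^sub>H" (is ?g1)
proof -
  have e: "L3 H (\<lambda>a b c. bS a b \<cdot> alpha H \<cdot> c) (phi H) = \<one>\<^sub>H"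
    "L3 H (\<lambda>a b c. Sa a b \<cdot> beta H \<cdot> antip H c) \<psi> = \<one>\<^sub>H"
    using qtqh unfolding quasitriangular_quasi_Hopf_def quasi_antipode_def by simp_all
  have "f (L3 H (\<lambda>a b c. bS a b \<cdot> alpha H \<cdot> c) (phi H)) = L3 X (\<lambda>a b c. f (bS a b \<cdot> alpha H \<cdot> c)) (phi H)"
    using X f by (intro L3_push) (auto intro!: LR)
  moreover have "f (L3 H (\<lambda>a b c. Sa a b \<cdot> beta H \<cdot> antip H c) \<psi>) = L3 X (\<lambda>a b c. f (Sa a b \<cdot> beta H \<cdot> antip H c)) \<psi>"
    using X f by (intro L3_push) (auto intro!: LR)
  ultimately show ?g2
    ?g1
    by (simp_all add: e)
qed

text \<open>The tensor at which currying evaluates its argument: by \<open>zeta_eq\<close>, the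
  curried f at v and w is f of this element. Separating it from f reduces linearity, degree and
  equivariance of currying to properties of one element.\<close>

definition zu where
  "zu V W v w = L3 (V\<box>W) (\<lambda>a b c. pt k V W (act V a v) (act W (bS b c) w)) \<psi>"

lemma zu_tril: "obj V ==> obj W ==> v \<in> carrier V ==> w \<in> carrier W ==>
   tril H H H (V\<box>W) (\<lambda>a b c. pt k V W (act V a v) (act W (bS b c) w))"
  by (auto intro!: LR)

lemma zu_in [simp]: "obj V ==> obj W ==> v \<in> carrier V ==> w \<in> carrier W ==> zu V W v w \<in> carrier (V\<box>W)"
  unfolding zu_def by (auto intro!: L3_in zu_tril)

lemma zu_lin:
  assumes "obj V" "obj W" "module k Y"
  shows "lin Y V f ==> w \<in> carrier W ==> lin Y (V\<box>W) (\<lambda>y. zu V W (f y) w)"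
    "lin Y W g ==> v \<in> carrier V ==> lin Y (V\<box>W) (\<lambda>y. zu V W v (g y))"
  unfolding zu_def using assms by (auto intro!: LR act_in dest: lin_closed)

lemma zu_gr:
  assumes o: "obj V" "obj W" and vw: "v \<in> gr V p" "w \<in> gr W q"
  shows "zu V W v w \<in> gr (V\<box>W) (p + q)"
proof -
  have c: "v \<in> carrier V" "w \<in> carrier W" using gr_in[OF o(1) vw(1)] gr_in[OF o(2) vw(2)] by auto
  show ?thesis unfolding zu_def
    by (rule trilift_submod[OF _ _ _ _ zu_tril[OF o c] gr_submod])
      (use o vw in "auto intro!: tens_gr_pt act_gr")
qed

text \<open>What equivariance of currying amounts to before f is applied: the left side is the
  action of h on an internal hom, the right side the action of h on v.\<close>

lemma zu_shift:
  assumes o: "obj V" "obj W" and v: "v \<in> carrier V" and w: "w \<in> carrier W" and h: "h \<in> carrier H"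
  shows "L2 (V\<box>W) (\<lambda>h1 h2. act (V\<box>W) h1 (zu V W v (act W (antip H h2) w))) (comul H h) = zu V W (act V h v) w"
proof -
  let ?T = "V\<box>W"
  have MT: "module k ?T" using o by simp
  let ?G = "\<lambda>a b c. pt k V W (act V a v) (act W (bS b c) w)"
  let ?K = "\<lambda>x y z. L3 ?T (\<lambda>a b c. pt k V W (act V x (act V a v)) (act W y (act W (bS b c) (act W (antip H z) w)))) \<psi>"
  let ?M = "\<lambda>x y z. L3 ?T (\<lambda>a b c. pt k V W (act V a (act V x v)) (act W (b \<cdot> bS y z \<cdot> antip H c) w)) \<psi>"
  have "L2 ?T (\<lambda>h1 h2. act ?T h1 (zu V W v (act W (antip H h2) w))) (comul H h) =
     L2 ?T (\<lambda>h1 h2. L2 ?T (\<lambda>x y. ?K x y h2) (comul H h1)) (comul H h)"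
  proof (rule L2_cong)
    fix h1 h2 assume hh: "h1 \<in> carrier H" "h2 \<in> carrier H"
    let ?w = "act W (antip H h2) w"
    have w': "?w \<in> carrier W" using o w hh by simp
    have "act ?T h1 (zu V W v ?w) = L3 ?T (\<lambda>a b c. act ?T h1 (pt k V W (act V a v) (act W (bS b c) ?w))) \<psi>"
      unfolding zu_def by (rule L3_push[OF MT MT zu_tril[OF o v w'] act_lin]) (use o hh in auto)
    also have "... = L3 ?T (\<lambda>a b c. L2 ?T (\<lambda>x y. pt k V W (act V x (act V a v)) (act W y (act W (bS b c) ?w))) (comul H h1)) \<psi>"
      using o v w' hh by (intro L3_cong act_tens_pt) auto
    also have "... = L2 ?T (\<lambda>x y. ?K x y h2) (comul H h1)"
      using o v w' hh by (intro fubini32) (auto intro!: LR)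
    finally show "act ?T h1 (zu V W v ?w) = L2 ?T (\<lambda>x y. ?K x y h2) (comul H h1)" .
  qed
  also have "... = L3 ?T ?K (dL h)"
    using o v w h by (intro L3_dL[symmetric]) (auto intro!: LR)
  also have "... = L3 ?T ?G (m3 (dL h) \<psi>)"
    using o v w h by (intro L3_mult'[symmetric] zu_tril) (auto simp: act_mult S_mult)
  \<comment> \<open>Quasi-coassociativity moves h to the right of \<psi>. There its second and third
    legs enclose \<beta> and collapse to a counit by the antipode axiom.\<close>
  also have "... = L3 ?T ?G (m3 \<psi> (dR h))" using coassoc(2)[OF h] by simp
  also have "... = L3 ?T ?M (dR h)"
    using o v w h by (intro L3_mult zu_tril) (auto simp: act_mult S_mult)
  also have "... = L2 ?T (\<lambda>h1 h2. L2 ?T (\<lambda>y z. ?M h1 y z) (comul H h2)) (comul H h)"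
    using o v w h by (intro L3_dR) (auto intro!: LR)
  also have "... = L2 ?T (\<lambda>h1 h2. counit H h2 \<odot>\<^bsub>?T\<^esub> zu V W (act V h1 v) w) (comul H h)"
  proof (rule L2_cong)
    fix h1 h2 assume hh: "h1 \<in> carrier H" "h2 \<in> carrier H"
    show "L2 ?T (\<lambda>y z. ?M h1 y z) (comul H h2) = counit H h2 \<odot>\<^bsub>?T\<^esub> zu V W (act V h1 v) w"
      unfolding zu_def
      by (rule antipode_push(2)[where f = "\<lambda>s. L3 ?T (\<lambda>a b c. pt k V W (act V a (act V h1 v)) (act W (b \<cdot> s \<cdot> antip H c) w)) \<psi>"])
        (use o v w hh in "auto intro!: LR")
  qed
  also have "... = zu V W (act V h v) w"
    using o v w h by (intro eps_comul(2) zu_lin) (auto intro!: LR)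
  finally show ?thesis .
qed

lemma zeta_eq:
  assumes o: "obj V" "obj W" and X: "module k X" "lin (V\<box>W) X f" and v: "v \<in> carrier V" "w \<in> carrier W"
  shows "zeta k H V W X f v w = f (zu V W v w)"
  unfolding zu_def using o X v by (subst L3_push[OF _ X(1) zu_tril X(2)]) (auto simp: zeta_def)

lemma zeta_Lin:
  assumes o: "obj V" "obj W" and X: "module k X" "lin (V\<box>W) X f" and v: "v \<in> carrier V"
  shows "zeta k H V W X f v \<in> Lin k W X"
proof -
  have "lin W X (zeta k H V W X f v) = lin W X (\<lambda>w. f (zu V W v w))"
    by (rule lin_cong[OF zeta_eq[OF o X v]]) (use o in auto)
  moreover have "lin W X (\<lambda>w. f (zu V W v w))"
    by (rule lin_comp[OF zu_lin(2)[OF o] X(2)]) (use o v lin_id in auto)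
  ultimately show ?thesis using v by (simp add: Lin_iff zeta_def)
qed

lemma zeta_lin:
  assumes o: "obj V" "obj W" and X: "module k X" "lin (V\<box>W) X f"
  shows "lin V (hom W X) (zeta k H V W X f)"
proof (rule lin_homI)
  show "lin V X (\<lambda>v. zeta k H V W X f v w)" if w: "w \<in> carrier W" for w
  proof (subst lin_cong[OF zeta_eq[OF o X _ w]])
    show "lin V X (\<lambda>v. f (zu V W v w))" by (rule lin_comp[OF zu_lin(1)[OF o] X(2)]) (use o w lin_id in auto)
  qed (use o in auto)
qed (use zeta_Lin[OF o X] o X in auto)

lemma zeta_mor:
  assumes f: "mor (V\<box>W) X f" and o: "obj V" "obj W"
  shows "mor V (hom W X) (zeta k H V W X f)"
proof -
  let ?z = "zeta k H V W X f" and ?T = "V\<box>W"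
  have oX: "obj X" using mor_obj(2)[OF f] .
  note MX = obj_module[OF oX] and l = mor_lin[OF f]
  note ze = zeta_eq[OF o MX l] and zL = zeta_Lin[OF o MX l]
  have "?z (act V h v) = act (hom W X) h (?z v)" if h: "h \<in> carrier H" and v: "v \<in> carrier V" for h v
  proof (rule Lin_eqI[OF zL hom_act_Lin[OF o(2) oX h zL[OF v]]])
    show "act V h v \<in> carrier V" using o h v by simp
    fix w assume w: "w \<in> carrier W"
    have "act (hom W X) h (?z v) w = L2 X (\<lambda>a b. act X a (f (zu V W v (act W (antip H b) w)))) (comul H h)"
      unfolding hom_act_pt[OF w] using o v w by (intro L2_cong) (simp add: ze)
    also have "... = L2 X (\<lambda>a b. f (act ?T a (zu V W v (act W (antip H b) w)))) (comul H h)"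
      using o v w by (intro L2_cong) (simp add: mor_act[OF f])
    also have "... = f (L2 ?T (\<lambda>a b. act ?T a (zu V W v (act W (antip H b) w))) (comul H h))"
      using o v w h MX by (intro L2_push[symmetric] l) (auto intro!: LR zu_lin)
    also have "... = ?z (act V h v) w"
      using o v w h by (simp add: zu_shift ze)
    finally show "?z (act V h v) w = act (hom W X) h (?z v) w" by simp
  qed
  moreover have "?z v \<in> gr (hom W X) n" if v: "v \<in> gr V n" for v n
  proof -
    have vc: "v \<in> carrier V" using gr_in[OF o(1) v] .
    have "?z v w \<in> gr X (m + n)" if w: "w \<in> gr W m" for w m
      using ze[OF vc gr_in[OF o(2) w]] mor_gr[OF f zu_gr[OF o v w]] by (simp add: add.commute)
    then show ?thesis using zL[OF vc] by simp
  qed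
  ultimately show ?thesis using o oX zeta_lin[OF o MX l] unfolding mor_def by (simp del: hom_simps)
qed

abbreviation ev' where "ev' V W \<equiv> ev k H V W"

text \<open>The value of evaluation at L and v. Because of \<phi> and \<alpha> it is in general not
  L v; that value is recovered in \<open>zeta_ev\<close>.\<close>

definition eF where "eF V W L v = L3 W (\<lambda>a b c. act W a (L (act V (Sa b c) v))) (phi H)"

lemma eF_tril:
  assumes "obj V" "obj W" "L \<in> Lin k V W" "v \<in> carrier V"
  shows "tril H H H W (\<lambda>a b c. act W a (L (act V (Sa b c) v)))"
  using assms by (auto intro!: LR lin_comp[OF _ Lin_lin[OF assms(3)]] Lin_in[OF assms(3)])

lemma eF_bil:
  assumes o: "obj V" "obj W"
  shows "bil (hom V W) V W (eF V W)"
  unfolding eF_def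
proof (rule bilI)
  show "lin (hom V W) W (\<lambda>L. L3 W (\<lambda>a b c. act W a (L (act V (Sa b c) v))) (phi H))" if "v \<in> carrier V" for v
    by (intro lin_tri_H1 eF_tril lin_act2 lin_eval) (use o that in auto)
  show "lin V W (\<lambda>v. L3 W (\<lambda>a b c. act W a (L (act V (Sa b c) v))) (phi H))" if L: "L \<in> carrier (hom V W)" for L
  proof -
    have L': "L \<in> Lin k V W" using L by simp
    show ?thesis
      by (intro lin_tri_H1 eF_tril lin_act2 lin_comp[OF _ Lin_lin[OF L']] lin_id) (use o L' in auto)
  qed
qed

lemma ev_eq: "ev' V W = bilift k (hom V W) V W (eF V W)"
  by (simp add: ev_def zeta_inv_def eF_def[abs_def])

lemma ev_lin: "obj V ==> obj W ==> lin (hom V W\<box>V) W (ev' V W)"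
  unfolding ev_eq by (intro bilift_lin_o eF_bil) auto

lemma ev_pt: "obj V ==> obj W ==> L \<in> Lin k V W ==> v \<in> carrier V ==> ev' V W (pt k (hom V W) V L v) = eF V W L v"
  unfolding ev_eq by (intro bilift_pt eF_bil) auto

text \<open>Dual to \<open>zu_shift\<close>: two legs of h act on the operator and a third on the
  vector. Moved to the left of \<phi>, the last two enclose \<alpha>, where the antipode axiom
  absorbs them, and h survives as the action on the result.\<close>

lemma ev_mor:
  assumes o: "obj V" "obj W"
  shows "mor (hom V W\<box>V) W (ev' V W)"
proof -
  let ?E = "hom V W" and ?e = "ev' V W"
  note l = ev_lin[OF o]
  have oE: "obj ?E" using o by simp
  note M = obj_module[OF o(1)] obj_module[OF o(2)] obj_module[OF oE]
  have "?e (act (?E\<box>V) h t) = act W h (?e t)" if h: "h \<in> carrier H" and t: "t \<in> carrier (?E\<box>V)" for h t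
  proof (rule tens_ext_o[OF M(3,1) lin_comp[OF act_lin l] lin_comp[OF l act_lin] _ t])
    fix L v assume L: "L \<in> carrier ?E" and v: "v \<in> carrier V"
    have L': "L \<in> Lin k V W" using L by simp
    note LL = lin_comp[OF _ Lin_lin[OF L']] and Li = Lin_in[OF L']
    let ?G = "\<lambda>a b c. act W a (L (act V (Sa b c) v))"
    let ?K = "\<lambda>x y z. L3 W (\<lambda>a b c. act W a (act W x (L (act V (antip H y) (act V (Sa b c) (act V z v)))))) (phi H)"
    have "?e (act (?E\<box>V) h (pt k ?E V L v)) = L2 W (\<lambda>h1 h2. ?e (pt k ?E V (act ?E h1 L) (act V h2 v))) (comul H h)"
      using o oE h L v by (intro lin_act_pt l) auto
    also have "... = L2 W (\<lambda>h1 h2. L2 W (\<lambda>x y. ?K x y h2) (comul H h1)) (comul H h)"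
    proof (rule L2_cong)
      fix h1 h2 assume hh: "h1 \<in> carrier H" "h2 \<in> carrier H"
      have v': "act V h2 v \<in> carrier V" using o v hh by simp
      have "?e (pt k ?E V (act ?E h1 L) (act V h2 v)) = eF V W (act ?E h1 L) (act V h2 v)"
        using o hh v' hom_act_Lin[OF o hh(1) L'] by (intro ev_pt)
      also have "... = L3 W (\<lambda>a b c. L2 W (\<lambda>x y. act W a (act W x (L (act V (antip H y) (act V (Sa b c) (act V h2 v)))))) (comul H h1)) (phi H)"
        unfolding eF_def
      proof (rule L3_cong)
        fix a b c assume abc: "a \<in> carrier H" "b \<in> carrier H" "c \<in> carrier H"
        have u: "act V (Sa b c) (act V h2 v) \<in> carrier V" using o v' abc by simp
        show "act W a (act ?E h1 L (act V (Sa b c) (act V h2 v))) =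
          L2 W (\<lambda>x y. act W a (act W x (L (act V (antip H y) (act V (Sa b c) (act V h2 v)))))) (comul H h1)"
          unfolding hom_act_pt[OF u] by (rule L2_push[OF M(2,2) hom_act_bil[OF o L' u] act_lin]) (use o abc hh in auto)
      qed
      also have "... = L2 W (\<lambda>x y. ?K x y h2) (comul H h1)"
        using o v' hh by (intro fubini32) (auto intro!: LR LL simp: Li)
      finally show "?e (pt k ?E V (act ?E h1 L) (act V h2 v)) = L2 W (\<lambda>x y. ?K x y h2) (comul H h1)" .
    qed
    also have "... = L3 W ?K (dL h)"
      using o v h by (intro L3_dL[symmetric]) (auto intro!: LR LL simp: Li)
    also have "... = L3 W ?G (m3 (phi H) (dL h))"
      using o v h by (intro L3_mult[symmetric] eF_tril L') (auto simp: act_mult S_mult Li)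
    also have "... = L3 W ?G (m3 (dR h) (phi H))" using coassoc(1)[OF h] by simp
    also have "... = L3 W (\<lambda>a b c. L3 W (\<lambda>x y z. act W x (act W a (L (act V (antip H b \<cdot> Sa y z \<cdot> c) v)))) (dR h)) (phi H)"
      using o v h by (intro L3_mult eF_tril L') (auto simp: act_mult S_mult Li)
    also have "... = L3 W (\<lambda>a b c. act W h (?G a b c)) (phi H)"
    proof (rule L3_cong)
      fix a b c assume abc: "a \<in> carrier H" "b \<in> carrier H" "c \<in> carrier H"
      have "L3 W (\<lambda>x y z. act W x (act W a (L (act V (antip H b \<cdot> Sa y z \<cdot> c) v)))) (dR h) =
        L2 W (\<lambda>h1 h2. L2 W (\<lambda>y z. act W h1 (act W a (L (act V (antip H b \<cdot> Sa y z \<cdot> c) v)))) (comul H h2)) (comul H h)"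
        using o v h abc by (intro L3_dR) (auto intro!: LR LL simp: Li)
      also have "... = L2 W (\<lambda>h1 h2. counit H h2 \<odot>\<^bsub>W\<^esub> act W h1 (?G a b c)) (comul H h)"
      proof (rule L2_cong)
        fix h1 h2 assume hh: "h1 \<in> carrier H" "h2 \<in> carrier H"
        show "L2 W (\<lambda>y z. act W h1 (act W a (L (act V (antip H b \<cdot> Sa y z \<cdot> c) v)))) (comul H h2) = counit H h2 \<odot>\<^bsub>W\<^esub> act W h1 (?G a b c)"
          by (rule antipode_push(1)[where f = "\<lambda>s. act W h1 (act W a (L (act V (antip H b \<cdot> s \<cdot> c) v)))"])
            (use o v hh abc in "auto intro!: LR LL simp: Li")
      qed
      also have "... = act W h (?G a b c)"
        using o v h abc by (intro eps_comul(2)) (auto intro!: LR simp: Li)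
      finally show "L3 W (\<lambda>x y z. act W x (act W a (L (act V (antip H b \<cdot> Sa y z \<cdot> c) v)))) (dR h) = act W h (?G a b c)" .
    qed
    also have "... = act W h (L3 W ?G (phi H))"
      by (rule L3_push[OF M(2,2) eF_tril[OF o L' v] act_lin, symmetric]) (use o h in auto)
    also have "... = act W h (?e (pt k ?E V L v))" using o L' v by (simp add: ev_pt eF_def)
    finally show "?e (act (?E\<box>V) h (pt k ?E V L v)) = act W h (?e (pt k ?E V L v))" .
  qed (use o oE h in auto)
  moreover have "?e t \<in> gr W n" if t: "t \<in> gr (?E\<box>V) n" for t n
  proof (rule tens_gr_lin[OF oE o(1) M(2) l gr_submod[OF o(2)] _ t])
    fix L v p q assume L: "L \<in> gr ?E p" and v: "v \<in> gr V q" and pq: "p + q = n"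
    have L': "L \<in> Lin k V W" and Lg: "\<And>m v. v \<in> gr V m ==> L v \<in> gr W (m + p)" using L by auto
    have vc: "v \<in> carrier V" using gr_in[OF o(1) v] .
    have n: "n = q + p" using pq by simp
    show "?e (pt k ?E V L v) \<in> gr W n" unfolding ev_pt[OF o L' vc] eF_def n
      by (rule trilift_submod[OF _ _ _ _ eF_tril[OF o L' vc] gr_submod])
        (use o v in "auto intro!: act_gr Lg")
  qed
  ultimately show ?thesis using o oE l by (auto simp: mor_def)
qed

section \<open>The pentagon rearranged with inverse associators\<close>

lemma L2_hom2:
  assumes C: "assoc_alg k C" and F: "bil H H C F" "bil H H C F'" "bil H H C F''"
    and m: "\<And>a b a' b'. a \<in> carrier H ==> b \<in> carrier H ==> a' \<in> carrier H ==> b' \<in> carrier H ==>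
      F'' (a \<cdot> a') (b \<cdot> b') = F a b \<otimes>\<^bsub>C\<^esub> F' a' b'"
    and s: "s \<in> carrier HH" and t: "t \<in> carrier HH"
  shows "L2 C F'' (m2 s t) = L2 C F s \<otimes>\<^bsub>C\<^esub> L2 C F' t"
proof -
  note M = alg_module[OF C]
  have Fc: "F' a b \<in> carrier C" if "a \<in> carrier H" "b \<in> carrier H" for a b
    using F(2) that by (auto simp: bil_def dest: lin_closed)
  have sc: "L2 C F s \<in> carrier C" using M F s by (intro L2_in)
  have "L2 C F'' (m2 s t) = L2 C (\<lambda>a' b'. L2 C (\<lambda>a b. F a b \<otimes>\<^bsub>C\<^esub> F' a' b') s) t"
    by (rule L2_mult[OF M F(3) s t]) (rule m)
  also have "... = L2 C (\<lambda>a' b'. L2 C F s \<otimes>\<^bsub>C\<^esub> F' a' b') t"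
    using Fc by (intro L2_cong L2_push[OF M M F(1) lin_mult1[OF C lin_id] s, symmetric]) auto
  also have "... = L2 C F s \<otimes>\<^bsub>C\<^esub> L2 C F' t"
    by (rule L2_push[OF M M F(2) lin_mult2[OF C lin_id sc] t, symmetric])
  finally show ?thesis .
qed

lemma L3_hom4:
  assumes F: "tril H H H HHHH F"
    and m: "\<And>a b c a' b' c'. a \<in> carrier H ==> b \<in> carrier H ==> c \<in> carrier H ==> a' \<in> carrier H ==> b' \<in> carrier H ==> c' \<in> carrier H ==>
      F (a \<cdot> a') (b \<cdot> b') (c \<cdot> c') = m4 (F a b c) (F a' b' c')"
    and s: "s \<in> carrier HHH" and t: "t \<in> carrier HHH"
  shows "L3 HHHH F (m3 s t) = m4 (L3 HHHH F s) (L3 HHHH F t)"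
  using L3_hom[OF algH4 _ _ s t, of F] F m by (simp add: tril_def)

lemma L2_hom4:
  assumes F: "bil H H HHHH F" "bil H H HHHH F'" "bil H H HHHH F''"
    and m: "\<And>a b a' b'. a \<in> carrier H ==> b \<in> carrier H ==> a' \<in> carrier H ==> b' \<in> carrier H ==>
      F'' (a \<cdot> a') (b \<cdot> b') = m4 (F a b) (F' a' b')"
    and s: "s \<in> carrier HH" and t: "t \<in> carrier HH"
  shows "L2 HHHH F'' (m2 s t) = m4 (L2 HHHH F s) (L2 HHHH F' t)"
  using L2_hom2[OF algH4 _ _ _ _ s t, of F F' F''] F m by (simp add: bil_def)

text \<open>\<Delta> is an algebra map, hence so are all five maps; they therefore send \<psi> to
  the inverse of the image of \<phi>.\<close>

lemma Q_mult:
  assumes s: "s \<in> carrier HHH" and t: "t \<in> carrier HHH"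
  shows "QA (m3 s t) = m4 (QA s) (QA t)" (is ?g5) "QB (m3 s t) = m4 (QB s) (QB t)" (is ?g4) "QC (m3 s t) = m4 (QC s) (QC t)" (is ?g3)
    "QD (m3 s t) = m4 (QD s) (QD t)" (is ?g2) "QE (m3 s t) = m4 (QE s) (QE t)" (is ?g1)
proof -
  note h = L3_hom4[OF _ _ s t]
  show ?g5 unfolding QA_def
    by (rule h, rule P_trils) (subst comul_mult, simp_all, rule L2_hom4, auto intro!: LR simp: m4_pure)
  show ?g4 unfolding QB_def
    by (rule h, rule P_trils) (subst comul_mult, simp_all, rule L2_hom4, auto intro!: LR simp: m4_pure)
  show ?g3 unfolding QC_def
    by (rule h, rule P_trils) (simp add: m4_pure)
  show ?g2 unfolding QD_def
    by (rule h, rule P_trils) (subst comul_mult, simp_all, rule L2_hom4, auto intro!: LR simp: m4_pure)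
  show ?g1 unfolding QE_def
    by (rule h, rule P_trils) (simp add: m4_pure)
qed

abbreviation "one4 \<equiv> pure4H \<one>\<^sub>H \<one>\<^sub>H \<one>\<^sub>H \<one>\<^sub>H"

lemma Q_one: "QA (one3) = one4" "QB (one3) = one4" "QC (one3) = one4"
  "QD (one3) = one4" "QE (one3) = one4"
  unfolding QA_def QB_def QC_def QD_def QE_def
  by (subst L3_pt[OF _ P_trils(1)] L3_pt[OF _ P_trils(2)] L3_pt[OF _ P_trils(3)] L3_pt[OF _ P_trils(4)] L3_pt[OF _ P_trils(5)],
    simp_all add: comul_one; subst L2_pt; auto intro!: LR)+

lemma m4_unit: "s \<in> carrier HHHH ==> m4 one4 s = s" "s \<in> carrier HHHH ==> m4 s one4 = s"
  using alg_lone[OF algH4, of s] alg_rone[OF algH4, of s] by simp_all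

lemma m4_assoc: "s \<in> carrier HHHH ==> t \<in> carrier HHHH ==> u \<in> carrier HHHH ==> m4 (m4 s t) u = m4 s (m4 t u)"
  using alg_assoc[OF algH4, of s t u] by simp

lemma Q_inv:
  "m4 (QA \<psi>) PA = one4" "m4 PB (QB \<psi>) = one4" "m4 (QC \<psi>) PC = one4"
  "m4 (QD \<psi>) PD = one4" "m4 PE (QE \<psi>) = one4"
  using phi_phi_inv phi_inv_phi by (simp_all add: Q_mult[symmetric] Q_one)

text \<open>The two forms that make evaluation and currying mutually inverse. In each, two of the
  three factors on the right are absorbed by the antipode axioms, and the remaining one yields a
  normalisation of \<alpha> against \<beta>.\<close>

lemma pentagon_H':
  "m4 PB (QE \<psi>) = m4 (QA \<psi>) (m4 PC PD)"
  "m4 PE (QB \<psi>) = m4 (QD \<psi>) (m4 (QC \<psi>) PA)"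
proof -
  let ?i = "\<psi>"
  have "m4 PB (QE ?i) = m4 (m4 (QA ?i) PA) (m4 PB (QE ?i))" by (simp add: Q_inv m4_unit)
  also have "... = m4 (QA ?i) (m4 (m4 PA PB) (QE ?i))" by (simp add: m4_assoc)
  also have "... = m4 (QA ?i) (m4 (m4 PC PD) (m4 PE (QE ?i)))" unfolding pentagon_H by (simp add: m4_assoc)
  also have "... = m4 (QA ?i) (m4 PC PD)" by (simp add: Q_inv m4_unit)
  finally show "m4 PB (QE ?i) = m4 (QA ?i) (m4 PC PD)" .
  have "m4 (QD ?i) (m4 (QC ?i) PA) = m4 (QD ?i) (m4 (QC ?i) (m4 PA (m4 PB (QB ?i))))" by (simp add: Q_inv m4_unit)
  also have "... = m4 (QD ?i) (m4 (QC ?i) (m4 (m4 PA PB) (QB ?i)))" by (simp add: m4_assoc)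
  also have "... = m4 (QD ?i) (m4 (m4 (QC ?i) PC) (m4 PD (m4 PE (QB ?i))))" unfolding pentagon_H by (simp add: m4_assoc)
  also have "... = m4 (m4 (QD ?i) PD) (m4 PE (QB ?i))" by (subst Q_inv(3)) (simp add: m4_unit m4_assoc)
  also have "... = m4 PE (QB ?i)" unfolding Q_inv by (simp add: m4_unit)
  finally show "m4 PE (QB ?i) = m4 (QD ?i) (m4 (QC ?i) PA)" by simp
qed

text \<open>The composite is the map \<open>?G\<close> of the proof applied to the left side of the
  first rearranged pentagon. On the right side the outer two factors disappear, and
  \<open>PC\<close> is removed by the axiom that a \<beta> S(b) \<alpha> c sums to 1 over
  \<phi>.\<close>

lemma ev_zeta:
  assumes f: "mor (V\<box>W) X f" and o: "obj V" "obj W" and v: "v \<in> carrier V" and w: "w \<in> carrier W"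
  shows "ev' W X (pt k (hom W X) W (zeta k H V W X f v) w) = f (pt k V W v w)"
proof -
  let ?T = "V\<box>W" and ?i = "\<psi>"
  have oX: "obj X" using mor_obj(2)[OF f] .
  note M = obj_module[OF oX] and l = mor_lin[OF f]
  \<comment> \<open>The last three legs act on w as b \<beta> S(c) \<alpha> d, which combines the
    \<beta> of currying with the \<alpha> of evaluation.\<close>
  let ?G = "\<lambda>a b c d. f (pt k V W (act V a v) (act W (bS b c \<cdot> alpha H \<cdot> d) w))"
  note lf = lin_comp[OF _ l]
  have q: "quadl H H H H X ?G" using o v w by (auto intro!: LR lf)
  note Gl = quadlift_lin[OF modH modH modH modH M q]
  note Gp = quadlift_pt[OF modH modH modH modH M q]
  \<comment> \<open>Left multiplication by \<open>QA\<close> of \<psi> puts S(r1) \<alpha> r2 in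
    place of \<alpha>. The antipode axiom leaves a counit on the last leg of \<psi>, which removes
    \<psi> altogether.\<close>
  have GA: "L4 X ?G (m4 (QA ?i) t) = L4 X ?G t" if t: "t \<in> carrier HHHH" for t
  proof (rule tens4_ext[OF modH modH modH modH lin_comp[OF m4_lin(1) Gl] Gl _ t])
    fix a b c d assume abc: "a \<in> carrier H" "b \<in> carrier H" "c \<in> carrier H" "d \<in> carrier H"
    let ?g = "\<lambda>p q s. f (pt k V W (act V (p \<cdot> a) v) (act W (q \<cdot> b \<cdot> beta H \<cdot> antip H c \<cdot> s \<cdot> d) w))"
    have "L4 X ?G (m4 (QA ?i) (pure4H a b c d)) =
      L3 X (\<lambda>p q r. L2 X (\<lambda>r1 r2. L4 X ?G (m4 (pure4H p q r1 r2) (pure4H a b c d))) (comul H r)) ?i"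
      by (rule P_expand(1)[OF M lin_comp[OF m4_lin(2) Gl]]) (use abc in simp_all)
    also have "... = L3 X (\<lambda>p q r. counit H r \<odot>\<^bsub>X\<^esub> ?g p q (alpha H)) ?i"
    proof (rule L3_cong)
      fix p q r assume pqr: "p \<in> carrier H" "q \<in> carrier H" "r \<in> carrier H"
      have "L2 X (\<lambda>r1 r2. L4 X ?G (m4 (pure4H p q r1 r2) (pure4H a b c d))) (comul H r) = L2 X (\<lambda>r1 r2. ?g p q (Sa r1 r2)) (comul H r)"
        by (rule L2_cong) (use abc pqr in "simp add: m4_pure Gp Hassoc S_mult")
      also have "... = counit H r \<odot>\<^bsub>X\<^esub> ?g p q (alpha H)"
        by (rule antipode_push(1)[OF M _ pqr(3)]) (use o v w abc pqr in "auto intro!: LR lf")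
      finally show "L2 X (\<lambda>r1 r2. L4 X ?G (m4 (pure4H p q r1 r2) (pure4H a b c d))) (comul H r) = counit H r \<odot>\<^bsub>X\<^esub> ?g p q (alpha H)" .
    qed
    also have "... = ?g \<one>\<^sub>H \<one>\<^sub>H (alpha H)" by (rule phi_eps(6)[OF M]) (use o v w abc in "auto intro!: LR lf")
    also have "... = L4 X ?G (pure4H a b c d)" using abc by (simp add: Gp)
    finally show "L4 X ?G (m4 (QA ?i) (pure4H a b c d)) = L4 X ?G (pure4H a b c d)" .
  qed simp
  \<comment> \<open>Right multiplication by \<open>PD\<close> puts r1 \<beta> S(r2) in place of
    \<beta>; the resulting counit on the middle leg removes \<phi>.\<close>
  have GD: "L4 X ?G (m4 t PD) = L4 X ?G t" if t: "t \<in> carrier HHHH" for t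
  proof (rule tens4_ext[OF modH modH modH modH lin_comp[OF m4_lin(2) Gl] Gl _ t])
    fix a b c d assume abc: "a \<in> carrier H" "b \<in> carrier H" "c \<in> carrier H" "d \<in> carrier H"
    let ?g = "\<lambda>p r s. f (pt k V W (act V (a \<cdot> p) v) (act W (b \<cdot> s \<cdot> antip H c \<cdot> alpha H \<cdot> d \<cdot> r) w))"
    have "L4 X ?G (m4 (pure4H a b c d) PD) =
      L3 X (\<lambda>p q r. L2 X (\<lambda>r1 r2. L4 X ?G (m4 (pure4H a b c d) (pure4H p r1 r2 r))) (comul H q)) (phi H)"
      by (rule P_expand(4)[OF M lin_comp[OF m4_lin(1) Gl]]) (use abc in simp_all)
    also have "... = L3 X (\<lambda>p q r. counit H q \<odot>\<^bsub>X\<^esub> ?g p r (beta H)) (phi H)"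
    proof (rule L3_cong)
      fix p q r assume pqr: "p \<in> carrier H" "q \<in> carrier H" "r \<in> carrier H"
      have "L2 X (\<lambda>r1 r2. L4 X ?G (m4 (pure4H a b c d) (pure4H p r1 r2 r))) (comul H q) = L2 X (\<lambda>r1 r2. ?g p r (bS r1 r2)) (comul H q)"
        by (rule L2_cong) (use abc pqr in "simp add: m4_pure Gp Hassoc S_mult")
      also have "... = counit H q \<odot>\<^bsub>X\<^esub> ?g p r (beta H)"
        by (rule antipode_push(2)[OF M _ pqr(2)]) (use o v w abc pqr in "auto intro!: LR lf")
      finally show "L2 X (\<lambda>r1 r2. L4 X ?G (m4 (pure4H a b c d) (pure4H p r1 r2 r))) (comul H q) = counit H q \<odot>\<^bsub>X\<^esub> ?g p r (beta H)" .
    qed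
    also have "... = ?g \<one>\<^sub>H \<one>\<^sub>H (beta H)" by (rule phi_eps(2)[OF M]) (use o v w abc in "auto intro!: LR lf")
    also have "... = L4 X ?G (pure4H a b c d)" using abc by (simp add: Gp)
    finally show "L4 X ?G (m4 (pure4H a b c d) PD) = L4 X ?G (pure4H a b c d)" .
  qed simp
  have zL: "zeta k H V W X f v \<in> Lin k W X" using o oX l v by (intro zeta_Lin) auto
  have "ev' W X (pt k (hom W X) W (zeta k H V W X f v) w) = L3 X (\<lambda>a b c. act X a (f (zu V W v (act W (Sa b c) w)))) (phi H)"
    unfolding ev_pt[OF o(2) oX zL w] eF_def using o oX l v w by (intro L3_cong) (simp add: zeta_eq)
  also have "... = L3 X (\<lambda>a b c. L2 X (\<lambda>a1 a2. L4 X ?G (m4 (pure4H a1 a2 b c) (QE ?i))) (comul H a)) (phi H)"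
  proof (rule L3_cong)
    fix a b c assume abc: "a \<in> carrier H" "b \<in> carrier H" "c \<in> carrier H"
    let ?w = "act W (Sa b c) w"
    have w': "?w \<in> carrier W" using o w abc by simp
    let ?F = "\<lambda>p q r a1 a2. f (pt k V W (act V a1 (act V p v)) (act W a2 (act W (bS q r) ?w)))"
    have "act X a (f (zu V W v ?w)) = f (act ?T a (zu V W v ?w))"
      using f abc o v w by (simp add: mor_act)
    also have "... = L3 X (\<lambda>p q r. f (act ?T a (pt k V W (act V p v) (act W (bS q r) ?w)))) ?i"
      unfolding zu_def by (rule L3_push[OF _ M zu_tril[OF o v w'] lin_comp[OF act_lin l]]) (use o abc in auto)
    also have "... = L3 X (\<lambda>p q r. L2 X (\<lambda>a1 a2. ?F p q r a1 a2) (comul H a)) ?i"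
      using o v w' abc l M by (intro L3_cong lin_act_pt) auto
    also have "... = L2 X (\<lambda>a1 a2. L3 X (\<lambda>p q r. ?F p q r a1 a2) ?i) (comul H a)"
      using o v w' abc M by (intro fubini32) (auto intro!: LR lf)
    also have "... = L2 X (\<lambda>a1 a2. L4 X ?G (m4 (pure4H a1 a2 b c) (QE ?i))) (comul H a)"
    proof (rule L2_cong)
      fix a1 a2 assume a12: "a1 \<in> carrier H" "a2 \<in> carrier H"
      have "L4 X ?G (m4 (pure4H a1 a2 b c) (QE ?i)) = L3 X (\<lambda>p q r. L4 X ?G (m4 (pure4H a1 a2 b c) (pure4H p q r \<one>\<^sub>H))) ?i"
        by (rule P_expand(5)[OF M lin_comp[OF m4_lin(1) Gl]]) (use abc a12 in simp_all)
      also have "... = L3 X (\<lambda>p q r. ?F p q r a1 a2) ?i"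
        by (rule L3_cong) (use o v w abc a12 in "simp add: m4_pure Gp Hassoc S_mult act_mult[symmetric]")
      finally show "L3 X (\<lambda>p q r. ?F p q r a1 a2) ?i = L4 X ?G (m4 (pure4H a1 a2 b c) (QE ?i))" by simp
    qed
    finally show "act X a (f (zu V W v ?w)) = L2 X (\<lambda>a1 a2. L4 X ?G (m4 (pure4H a1 a2 b c) (QE ?i))) (comul H a)" .
  qed
  also have "... = L4 X ?G (m4 PB (QE ?i))"
    by (rule P_expand(2)[OF M lin_comp[OF m4_lin(2) Gl], symmetric]) simp_all
  also have "... = L4 X ?G (m4 PC PD)" unfolding pentagon_H' by (rule GA) simp
  also have "... = L4 X ?G PC" by (rule GD) simp
  also have "... = L3 X (\<lambda>a b c. L4 X ?G (pure4H \<one>\<^sub>H a b c)) (phi H)" by (rule P_expand(3)[OF M Gl]) simp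
  also have "... = L3 X (\<lambda>a b c. f (pt k V W v (act W (bS a b \<cdot> alpha H \<cdot> c) w))) (phi H)"
    by (rule L3_cong) (use o v in "simp add: Gp")
  also have "... = f (pt k V W v (act W \<one>\<^sub>H w))"
    by (rule antipode_phi(1)[OF M]) (use o v w in "auto intro!: LR lf")
  finally show ?thesis using o w by simp
qed

text \<open>The other composite, at a single operator: the second rearranged pentagon takes the role
  of the first. The formula is the way back from evaluations to values, on which both
  \<open>hom_mor_zero\<close> and the descent of the sum to the quotient rest.\<close>

lemma zeta_ev:
  assumes o: "obj V" "obj W" and L: "L \<in> Lin k V W" and v: "v \<in> carrier V"
  shows "L3 W (\<lambda>a b c. ev' V W (pt k (hom V W) V (act (hom V W) a L) (act V (bS b c) v))) \<psi> = L v"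
proof -
  let ?i = "\<psi>"
  note M = obj_module[OF o(2)]
  note lf = lin_comp[OF _ Lin_lin[OF L]] and Li = Lin_in[OF L]
  \<comment> \<open>Now evaluation is inside, so \<alpha> precedes \<beta> in the element S(b)
    \<alpha> c \<beta> S(d) that acts on v. Accordingly the normalisation axiom for \<psi> is the
    one that finishes the computation.\<close>
  let ?G = "\<lambda>a b c d. act W a (L (act V (Sa b c \<cdot> beta H \<cdot> antip H d) v))"
  have q: "quadl H H H H W ?G" using o v by (auto intro!: LR lf simp: Li)
  note Gl = quadlift_lin[OF modH modH modH modH M q]
  note Gp = quadlift_pt[OF modH modH modH modH M q]
  have GD: "L4 W ?G (m4 (QD ?i) t) = L4 W ?G t" if t: "t \<in> carrier HHHH" for t
  proof (rule tens4_ext[OF modH modH modH modH lin_comp[OF m4_lin(1) Gl] Gl _ t])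
    fix a b c d assume abc: "a \<in> carrier H" "b \<in> carrier H" "c \<in> carrier H" "d \<in> carrier H"
    let ?g = "\<lambda>p r s. act W (p \<cdot> a) (L (act V (antip H b \<cdot> s \<cdot> c \<cdot> beta H \<cdot> antip H d \<cdot> antip H r) v))"
    have "L4 W ?G (m4 (QD ?i) (pure4H a b c d)) =
      L3 W (\<lambda>p q r. L2 W (\<lambda>r1 r2. L4 W ?G (m4 (pure4H p r1 r2 r) (pure4H a b c d))) (comul H q)) ?i"
      by (rule P_expand(4)[OF M lin_comp[OF m4_lin(2) Gl]]) (use abc in simp_all)
    also have "... = L3 W (\<lambda>p q r. counit H q \<odot>\<^bsub>W\<^esub> ?g p r (alpha H)) ?i"
    proof (rule L3_cong)
      fix p q r assume pqr: "p \<in> carrier H" "q \<in> carrier H" "r \<in> carrier H"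
      have "L2 W (\<lambda>r1 r2. L4 W ?G (m4 (pure4H p r1 r2 r) (pure4H a b c d))) (comul H q) = L2 W (\<lambda>r1 r2. ?g p r (Sa r1 r2)) (comul H q)"
        by (rule L2_cong) (use abc pqr in "simp add: m4_pure Gp Hassoc S_mult")
      also have "... = counit H q \<odot>\<^bsub>W\<^esub> ?g p r (alpha H)"
        by (rule antipode_push(1)[OF M _ pqr(2)]) (use o v abc pqr in "auto intro!: LR lf simp: Li")
      finally show "L2 W (\<lambda>r1 r2. L4 W ?G (m4 (pure4H p r1 r2 r) (pure4H a b c d))) (comul H q) = counit H q \<odot>\<^bsub>W\<^esub> ?g p r (alpha H)" .
    qed
    also have "... = ?g \<one>\<^sub>H \<one>\<^sub>H (alpha H)" by (rule phi_eps(5)[OF M]) (use o v abc in "auto intro!: LR lf simp: Li")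
    also have "... = L4 W ?G (pure4H a b c d)" using abc by (simp add: Gp S_one)
    finally show "L4 W ?G (m4 (QD ?i) (pure4H a b c d)) = L4 W ?G (pure4H a b c d)" .
  qed simp
  have GA: "L4 W ?G (m4 t PA) = L4 W ?G t" if t: "t \<in> carrier HHHH" for t
  proof (rule tens4_ext[OF modH modH modH modH lin_comp[OF m4_lin(2) Gl] Gl _ t])
    fix a b c d assume abc: "a \<in> carrier H" "b \<in> carrier H" "c \<in> carrier H" "d \<in> carrier H"
    let ?g = "\<lambda>p q s. act W (a \<cdot> p) (L (act V (antip H q \<cdot> antip H b \<cdot> alpha H \<cdot> c \<cdot> s \<cdot> antip H d) v))"
    have "L4 W ?G (m4 (pure4H a b c d) PA) =
      L3 W (\<lambda>p q r. L2 W (\<lambda>r1 r2. L4 W ?G (m4 (pure4H a b c d) (pure4H p q r1 r2))) (comul H r)) (phi H)"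
      by (rule P_expand(1)[OF M lin_comp[OF m4_lin(1) Gl]]) (use abc in simp_all)
    also have "... = L3 W (\<lambda>p q r. counit H r \<odot>\<^bsub>W\<^esub> ?g p q (beta H)) (phi H)"
    proof (rule L3_cong)
      fix p q r assume pqr: "p \<in> carrier H" "q \<in> carrier H" "r \<in> carrier H"
      have "L2 W (\<lambda>r1 r2. L4 W ?G (m4 (pure4H a b c d) (pure4H p q r1 r2))) (comul H r) = L2 W (\<lambda>r1 r2. ?g p q (bS r1 r2)) (comul H r)"
        by (rule L2_cong) (use abc pqr in "simp add: m4_pure Gp Hassoc S_mult")
      also have "... = counit H r \<odot>\<^bsub>W\<^esub> ?g p q (beta H)"
        by (rule antipode_push(2)[OF M _ pqr(3)]) (use o v abc pqr in "auto intro!: LR lf simp: Li")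
      finally show "L2 W (\<lambda>r1 r2. L4 W ?G (m4 (pure4H a b c d) (pure4H p q r1 r2))) (comul H r) = counit H r \<odot>\<^bsub>W\<^esub> ?g p q (beta H)" .
    qed
    also have "... = ?g \<one>\<^sub>H \<one>\<^sub>H (beta H)" by (rule phi_eps(3)[OF M]) (use o v abc in "auto intro!: LR lf simp: Li")
    also have "... = L4 W ?G (pure4H a b c d)" using abc by (simp add: Gp S_one)
    finally show "L4 W ?G (m4 (pure4H a b c d) PA) = L4 W ?G (pure4H a b c d)" .
  qed simp
  have "L3 W (\<lambda>a b c. ev' V W (pt k (hom V W) V (act (hom V W) a L) (act V (bS b c) v))) ?i =
    L3 W (\<lambda>a b c. L2 W (\<lambda>a1 a2. L4 W ?G (m4 PE (pure4H a1 a2 b c))) (comul H a)) ?i"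
  proof (rule L3_cong)
    fix a b c assume abc: "a \<in> carrier H" "b \<in> carrier H" "c \<in> carrier H"
    let ?v = "act V (bS b c) v"
    have v': "?v \<in> carrier V" using o v abc by simp
    let ?F = "\<lambda>p q r a1 a2. act W p (act W a1 (L (act V (antip H a2) (act V (Sa q r) ?v))))"
    have "ev' V W (pt k (hom V W) V (act (hom V W) a L) ?v) = eF V W (act (hom V W) a L) ?v"
      by (rule ev_pt[OF o hom_act_Lin[OF o abc(1) L] v'])
    also have "... = L3 W (\<lambda>p q r. L2 W (\<lambda>a1 a2. ?F p q r a1 a2) (comul H a)) (phi H)"
      unfolding eF_def
    proof (rule L3_cong)
      fix p q r assume pqr: "p \<in> carrier H" "q \<in> carrier H" "r \<in> carrier H"
      have u: "act V (Sa q r) ?v \<in> carrier V" using o v' pqr by simp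
      show "act W p (act (hom V W) a L (act V (Sa q r) ?v)) = L2 W (\<lambda>a1 a2. ?F p q r a1 a2) (comul H a)"
        unfolding hom_act_pt[OF u] by (rule L2_push[OF M M hom_act_bil[OF o L u] act_lin]) (use o abc pqr in auto)
    qed
    also have "... = L2 W (\<lambda>a1 a2. L3 W (\<lambda>p q r. ?F p q r a1 a2) (phi H)) (comul H a)"
      using o v' abc by (intro fubini32) (auto intro!: LR lf simp: Li)
    also have "... = L2 W (\<lambda>a1 a2. L4 W ?G (m4 PE (pure4H a1 a2 b c))) (comul H a)"
    proof (rule L2_cong)
      fix a1 a2 assume a12: "a1 \<in> carrier H" "a2 \<in> carrier H"
      have "L4 W ?G (m4 PE (pure4H a1 a2 b c)) = L3 W (\<lambda>p q r. L4 W ?G (m4 (pure4H p q r \<one>\<^sub>H) (pure4H a1 a2 b c))) (phi H)"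
        by (rule P_expand(5)[OF M lin_comp[OF m4_lin(2) Gl]]) (use abc a12 in simp_all)
      also have "... = L3 W (\<lambda>p q r. ?F p q r a1 a2) (phi H)"
        by (rule L3_cong) (use o v abc a12 in "simp add: m4_pure Gp Hassoc S_mult act_mult[symmetric] Li")
      finally show "L3 W (\<lambda>p q r. ?F p q r a1 a2) (phi H) = L4 W ?G (m4 PE (pure4H a1 a2 b c))" by simp
    qed
    finally show "ev' V W (pt k (hom V W) V (act (hom V W) a L) ?v) = L2 W (\<lambda>a1 a2. L4 W ?G (m4 PE (pure4H a1 a2 b c))) (comul H a)" .
  qed
  also have "... = L4 W ?G (m4 PE (QB ?i))"
    by (rule P_expand(2)[OF M lin_comp[OF m4_lin(1) Gl], symmetric]) simp_all
  also have "... = L4 W ?G (m4 (QC ?i) PA)" unfolding pentagon_H' by (rule GD) simp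
  also have "... = L4 W ?G (QC ?i)" by (rule GA) simp
  also have "... = L3 W (\<lambda>a b c. L4 W ?G (pure4H \<one>\<^sub>H a b c)) ?i" by (rule P_expand(3)[OF M Gl]) simp
  also have "... = L3 W (\<lambda>a b c. L (act V (Sa a b \<cdot> beta H \<cdot> antip H c) v)) ?i"
    by (rule L3_cong) (use o v in "simp add: Gp Li")
  also have "... = L (act V \<one>\<^sub>H v)"
    by (rule antipode_phi(2)[OF M]) (use o v in "auto intro!: LR lf")
  finally show ?thesis using o v by simp
qed

section \<open>Moving a factor past another\<close>

abbreviation tl where "tl X W Y f \<equiv> tm X W Y W f (\<lambda>w. w)"
abbreviation tr where "tr V X Y g \<equiv> tm V X V Y (\<lambda>v. v) g"

lemma tl_mor: "mor X Y f ==> obj W ==> mor (X\<box>W) (Y\<box>W) (tl X W Y f)"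
  by (intro tmap_mor mor_id)

lemma tr_mor: "mor X Y f ==> obj V ==> mor (V\<box>X) (V\<box>Y) (tr V X Y f)"
  by (intro tmap_mor mor_id)

lemma tm_in: "mor V X f ==> mor W Y g ==> t \<in> carrier (V\<box>W) ==> tm V W X Y f g t \<in> carrier (X\<box>Y)"
  by (rule mor_in[OF tmap_mor])

lemma tm_comp: "mor V X f ==> mor W Y g ==> mor X X' f' ==> mor Y Y' g' ==> t \<in> carrier (V\<box>W) ==>
    tm X Y X' Y' f' g' (tm V W X Y f g t) = tm V W X' Y' (\<lambda>x. f' (f x)) (\<lambda>x. g' (g x)) t"
  using mor_obj[of V X f] mor_obj[of W Y g] mor_obj[of X X' f'] mor_obj[of Y Y' g']
  by (intro tmap_comp mor_lin) (auto simp: tobj_simps)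

lemma tm_id: "obj V ==> obj W ==> t \<in> carrier (V\<box>W) ==> tm V W V W (\<lambda>x. x) (\<lambda>x. x) t = t"
  by (intro tmap_id) (auto simp: tobj_simps)

lemma tm_idI: "obj V ==> obj W ==> t \<in> carrier (V\<box>W) ==> (\<And>v. v \<in> carrier V ==> f v = v) ==>
    (\<And>w. w \<in> carrier W ==> g w = w) ==> tm V W V W f g t = t"
  using tmap_cong[of V f "\<lambda>v. v" W g "\<lambda>w. w" V W] tm_id[of V W t] by simp

lemma tl_cong: "(\<And>x. x \<in> carrier X ==> f x = f' x) ==> tl X W Y f t = tl X W Y f' t"
  by (subst tmap_cong[of X f f' W "\<lambda>w. w" "\<lambda>w. w"]) simp_all

lemma tr_cong: "(\<And>x. x \<in> carrier X ==> f x = f' x) ==> tr W X Y f t = tr W X Y f' t"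
  by (subst tmap_cong[of W "\<lambda>w. w" "\<lambda>w. w" X f f']) simp_all

lemma tl_comp: "mor X Y f ==> mor Y Z g ==> obj W ==> t \<in> carrier (X\<box>W) ==>
    tl Y W Z g (tl X W Y f t) = tl X W Z (\<lambda>x. g (f x)) t"
  by (rule tm_comp[OF _ mor_id _ mor_id])

lemma tr_comp: "mor X Y f ==> mor Y Z g ==> obj V ==> t \<in> carrier (V\<box>X) ==>
    tr V Y Z g (tr V X Y f t) = tr V X Z (\<lambda>x. g (f x)) t"
  by (rule tm_comp[OF mor_id _ mor_id])

lemma tl_tr: "mor X Y f ==> mor V W g ==> t \<in> carrier (X\<box>V) ==> tl X W Y f (tr X V W g t) = tr Y V W g (tl X V Y f t)"
  using mor_obj[of X Y f] mor_obj[of V W g] by (simp add: tm_comp[of _ _ _ _ _ _ _ _ _ _ t] mor_id)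

text \<open>From here to \<open>ai_tr\<close>: naturality with a morphism in one slot. The tensor
  map of two identities that appears for the other slots is removed by \<open>tm_id\<close>.\<close>

lemma as_tl: "mor V V' f ==> obj W ==> obj X ==> t \<in> carrier ((V\<box>W)\<box>X) ==>
    as V' W X (tl (V\<box>W) X (V'\<box>W) (tl V W V' f) t) = tl V (W\<box>X) V' f (as V W X t)"
  using as_nat[OF _ mor_id mor_id, of V V' f W X t]
    tmap_cong[of V f f "W\<box>X" "tm W X W X (\<lambda>x. x) (\<lambda>x. x)" "\<lambda>x. x" V' "W\<box>X"] by (simp add: tm_id)

lemma as_tm: "mor W W' f ==> obj V ==> obj X ==> t \<in> carrier ((V\<box>W)\<box>X) ==>
    as V W' X (tl (V\<box>W) X (V\<box>W') (tr V W W' f) t) = tr V (W\<box>X) (W'\<box>X) (tl W X W' f) (as V W X t)"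
  by (rule as_nat[OF mor_id _ mor_id])

lemma as_tr: "mor X X' f ==> obj V ==> obj W ==> t \<in> carrier ((V\<box>W)\<box>X) ==>
    as V W X' (tr (V\<box>W) X X' f t) = tr V (W\<box>X) (W\<box>X') (tr W X X' f) (as V W X t)"
  using as_nat[OF mor_id mor_id, of V W X X' f t]
    tmap_cong[of "V\<box>W" "tm V W V W (\<lambda>x. x) (\<lambda>x. x)" "\<lambda>x. x" X f f "V\<box>W" X'] by (simp add: tm_id)

lemma ai_tl: "mor V V' f ==> obj W ==> obj X ==> t \<in> carrier (V\<box>W\<box>X) ==>
    ai V' W X (tl V (W\<box>X) V' f t) = tl (V\<box>W) X (V'\<box>W) (tl V W V' f) (ai V W X t)"
  using ai_nat[OF _ mor_id mor_id, of V V' f W X t]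
    tmap_cong[of V f f "W\<box>X" "tm W X W X (\<lambda>x. x) (\<lambda>x. x)" "\<lambda>x. x" V' "W\<box>X"] by (simp add: tm_id)

lemma ai_tm: "mor W W' f ==> obj V ==> obj X ==> t \<in> carrier (V\<box>W\<box>X) ==>
    ai V W' X (tr V (W\<box>X) (W'\<box>X) (tl W X W' f) t) = tl (V\<box>W) X (V\<box>W') (tr V W W' f) (ai V W X t)"
  by (rule ai_nat[OF mor_id _ mor_id])

lemma ai_tr: "mor X X' f ==> obj V ==> obj W ==> t \<in> carrier (V\<box>W\<box>X) ==>
    ai V W X' (tr V (W\<box>X) (W\<box>X') (tr W X X' f) t) = tr (V\<box>W) X X' f (ai V W X t)"
  using ai_nat[OF mor_id mor_id, of V W X X' f t]
    tmap_cong[of "V\<box>W" "tm V W V W (\<lambda>x. x) (\<lambda>x. x)" "\<lambda>x. x" X f f "V\<box>W" X'] by (simp add: tm_id)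

lemma br_tl: "mor V V' f ==> obj W ==> t \<in> carrier (V\<box>W) ==> br V' W (tl V W V' f t) = tr W V V' f (br V W t)"
  by (rule br_nat[OF _ mor_id])

lemma br_tr: "mor W W' f ==> obj V ==> t \<in> carrier (V\<box>W) ==> br V W' (tr V W W' f t) = tl W V W' f (br V W t)"
  by (rule br_nat[OF mor_id])

text \<open>\<open>E \<otimes> (V \<otimes> W) \<rightarrow> V \<otimes> (E \<otimes> W)\<close>, through which an operator in \<open>E\<close> reaches the second factor.\<close>

definition B where "B E V W t = as V E W (tl (E\<box>V) W (V\<box>E) (br E V) (ai E V W t))"

lemmas MR = as_mor ai_mor br_mor tl_mor tr_mor mor_id tens_obj tm_in mor_in[OF as_mor] mor_in[OF ai_mor] mor_in[OF br_mor]

lemma B_mor: "obj E ==> obj V ==> obj W ==> mor (E\<box>V\<box>W) (V\<box>E\<box>W) (B E V W)"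
  unfolding B_def[abs_def] by (intro mor_comp[OF mor_comp[OF ai_mor tl_mor] as_mor] br_mor tens_obj)

text \<open>Naturality in this and the other two arguments is inherited from the three maps that
  \<open>B\<close> is composed of. It allows operators and module actions to be pulled
  through.\<close>

lemma B_1:
  assumes f: "mor E E' f" and o: "obj V" "obj W" and t: "t \<in> carrier (E\<box>V\<box>W)"
  shows "B E' V W (tl E (V\<box>W) E' f t) = tr V (E\<box>W) (E'\<box>W) (tl E W E' f) (B E V W t)"
proof -
  note e = mor_obj[OF f]
  let ?s = "ai E V W t"
  have s: "?s \<in> carrier ((E\<box>V)\<box>W)" using e o t by (auto intro: MR)
  have "tl (E'\<box>V) W (V\<box>E') (br E' V) (tl (E\<box>V) W (E'\<box>V) (tl E V E' f) ?s) =
    tl (E\<box>V) W (V\<box>E') (\<lambda>x. br E' V (tl E V E' f x)) ?s"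
    using e o s f by (intro tl_comp MR t)
  also have "... = tl (E\<box>V) W (V\<box>E') (\<lambda>x. tr V E E' f (br E V x)) ?s"
    by (rule tl_cong, rule br_tl[OF f o(1)])
  also have "... = tl (V\<box>E) W (V\<box>E') (tr V E E' f) (tl (E\<box>V) W (V\<box>E) (br E V) ?s)"
    using e o s f by (intro tl_comp[symmetric] MR t)
  finally show ?thesis
    using e o s f t by (simp add: B_def ai_tl as_tm MR)
qed

lemma B_2:
  assumes f: "mor V V' f" and o: "obj E" "obj W" and t: "t \<in> carrier (E\<box>V\<box>W)"
  shows "B E V' W (tr E (V\<box>W) (V'\<box>W) (tl V W V' f) t) = tl V (E\<box>W) V' f (B E V W t)"
proof -
  note e = mor_obj[OF f]
  let ?s = "ai E V W t"
  have s: "?s \<in> carrier ((E\<box>V)\<box>W)" using e o t by (auto intro: MR)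
  have "tl (E\<box>V') W (V'\<box>E) (br E V') (tl (E\<box>V) W (E\<box>V') (tr E V V' f) ?s) =
    tl (E\<box>V) W (V'\<box>E) (\<lambda>x. br E V' (tr E V V' f x)) ?s"
    using e o s f by (intro tl_comp MR t)
  also have "... = tl (E\<box>V) W (V'\<box>E) (\<lambda>x. tl V E V' f (br E V x)) ?s"
    by (rule tl_cong, rule br_tr[OF f o(1)])
  also have "... = tl (V\<box>E) W (V'\<box>E) (tl V E V' f) (tl (E\<box>V) W (V\<box>E) (br E V) ?s)"
    using e o s f by (intro tl_comp[symmetric] MR t)
  finally show ?thesis
    using e o s f t by (simp add: B_def ai_tm as_tl MR)
qed

lemma B_3:
  assumes f: "mor W W' f" and o: "obj E" "obj V" and t: "t \<in> carrier (E\<box>V\<box>W)"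
  shows "B E V W' (tr E (V\<box>W) (V\<box>W') (tr V W W' f) t) = tr V (E\<box>W) (E\<box>W') (tr E W W' f) (B E V W t)"
  using mor_obj[OF f] o f t by (simp add: B_def ai_tr as_tr tl_tr[of _ _ _ _ _ f] MR)

text \<open>The pentagon solved for a mixture of associators and their inverses.\<close>

lemma pentagon_ai:
  assumes o: "obj P" "obj V" "obj A" "obj W" and x: "x \<in> carrier (P\<box>(V\<box>A)\<box>W)"
  shows "ai P V (A\<box>W) (tr P ((V\<box>A)\<box>W) (V\<box>A\<box>W) (as V A W) x) =
    as (P\<box>V) A W (tl (P\<box>V\<box>A) W ((P\<box>V)\<box>A) (ai P V A) (ai P (V\<box>A) W x))"
proof -
  let ?y = "ai P (V\<box>A) W x"
  have y: "?y \<in> carrier ((P\<box>V\<box>A)\<box>W)" using o x by (auto intro: MR)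
  \<comment> \<open>The pentagon is applied to this element, chosen so that its innermost associator
    restores \<open>?y\<close>.\<close>
  let ?t = "tl (P\<box>V\<box>A) W ((P\<box>V)\<box>A) (ai P V A) ?y"
  have t: "?t \<in> carrier (((P\<box>V)\<box>A)\<box>W)" using o y by (intro MR x)
  have "tl ((P\<box>V)\<box>A) W (P\<box>V\<box>A) (as P V A) ?t = tl (P\<box>V\<box>A) W (P\<box>V\<box>A) (\<lambda>x. as P V A (ai P V A x)) ?y"
    using o y by (intro tl_comp MR x)
  also have "... = ?y" using o y by (intro tm_idI) (auto simp: as_ai)
  finally have "as P V (A\<box>W) (as (P\<box>V) A W ?t) = tr P ((V\<box>A)\<box>W) (V\<box>A\<box>W) (as V A W) x"
    using o t x by (simp add: pentagon as_ai)
  then have "ai P V (A\<box>W) (tr P ((V\<box>A)\<box>W) (V\<box>A\<box>W) (as V A W) x) =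
    ai P V (A\<box>W) (as P V (A\<box>W) (as (P\<box>V) A W ?t))" by simp
  also have "... = as (P\<box>V) A W ?t" using o t by (intro ai_as MR x)
  finally show ?thesis .
qed

text \<open>Moving P past V \<otimes> A at once or past V and then A gives the same. The first
  clause only rearranges brackets around a single braiding with V, so the pentagon suffices; the
  second splits the braiding with V \<otimes> A and takes a hexagon.\<close>

lemma B_through_tensor:
  assumes o: "obj P" "obj V" "obj A" "obj W" and x: "x \<in> carrier (P\<box>(V\<box>A)\<box>W)"
  shows B_assoc1: "tr V ((P\<box>A)\<box>W) (P\<box>A\<box>W) (as P A W)
      (as V (P\<box>A) W (tl (P\<box>V\<box>A) W (V\<box>P\<box>A) (B P V A) (ai P (V\<box>A) W x))) =
      B P V (A\<box>W) (tr P ((V\<box>A)\<box>W) (V\<box>A\<box>W) (as V A W) x)" (is ?A)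
    and B_assoc2: "as V A (P\<box>W) (B P (V\<box>A) W x) = tr V (P\<box>A\<box>W) (A\<box>P\<box>W) (B P A W)
      (B P V (A\<box>W) (tr P ((V\<box>A)\<box>W) (V\<box>A\<box>W) (as V A W) x))" (is ?B)
proof -
  let ?y = "ai P (V\<box>A) W x"
  have y: "?y \<in> carrier ((P\<box>V\<box>A)\<box>W)" using o x by (auto intro: MR)
  let ?t = "tl (P\<box>V\<box>A) W ((P\<box>V)\<box>A) (ai P V A) ?y"
  have t: "?t \<in> carrier (((P\<box>V)\<box>A)\<box>W)" using o y by (intro MR x)
  let ?u = "tl ((P\<box>V)\<box>A) W ((V\<box>P)\<box>A) (tl (P\<box>V) A (V\<box>P) (br P V)) ?t"
  have u: "?u \<in> carrier (((V\<box>P)\<box>A)\<box>W)" using o t by (intro MR x)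
  let ?v = "tl ((V\<box>P)\<box>A) W (V\<box>P\<box>A) (as V P A) ?u"
  have v: "?v \<in> carrier ((V\<box>P\<box>A)\<box>W)" using o u by (intro MR x)
  have m1: "mor (P\<box>V\<box>A) ((V\<box>P)\<box>A) (\<lambda>x. tl (P\<box>V) A (V\<box>P) (br P V) (ai P V A x))"
    using o by (intro mor_comp[OF ai_mor tl_mor] MR x)
  have e1: "?u = tl (P\<box>V\<box>A) W ((V\<box>P)\<box>A) (\<lambda>x. tl (P\<box>V) A (V\<box>P) (br P V) (ai P V A x)) ?y"
    using o y by (intro tl_comp MR x)
  have e2: "?v = tl (P\<box>V\<box>A) W (V\<box>P\<box>A) (B P V A) ?y"
    unfolding e1 B_def[abs_def] using o y by (intro tl_comp m1 MR x)
  have r: "B P V (A\<box>W) (tr P ((V\<box>A)\<box>W) (V\<box>A\<box>W) (as V A W) x) = as V P (A\<box>W) (as (V\<box>P) A W ?u)"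
    unfolding B_def pentagon_ai[OF o x] using o t by (simp add: as_tl MR)
  also have "... = tr V ((P\<box>A)\<box>W) (P\<box>A\<box>W) (as P A W) (as V (P\<box>A) W ?v)"
    using o u by (intro pentagon)
  finally have r2: "B P V (A\<box>W) (tr P ((V\<box>A)\<box>W) (V\<box>A\<box>W) (as V A W) x) =
    tr V ((P\<box>A)\<box>W) (P\<box>A\<box>W) (as P A W) (as V (P\<box>A) W ?v)" .
  then show ?A by (simp add: e2)
  let ?w = "tl (V\<box>P\<box>A) W (V\<box>A\<box>P) (tr V (P\<box>A) (A\<box>P) (br P A)) ?v"
  have w: "?w \<in> carrier ((V\<box>A\<box>P)\<box>W)" using o v by (intro MR x)
  let ?z = "tl (V\<box>A\<box>P) W ((V\<box>A)\<box>P) (ai V A P) ?w"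
  have z: "?z \<in> carrier (((V\<box>A)\<box>P)\<box>W)" using o w by (intro MR x)
  let ?c = "\<lambda>x. tr V (P\<box>A) (A\<box>P) (br P A) (B P V A x)"
  have m2: "mor (P\<box>V\<box>A) (V\<box>A\<box>P) ?c"
    using o by (intro mor_comp[OF B_mor tr_mor] MR x)
  have e3: "?w = tl (P\<box>V\<box>A) W (V\<box>A\<box>P) ?c ?y"
    unfolding e2 using o y by (intro tl_comp B_mor MR x)
  have "?z = tl (P\<box>V\<box>A) W ((V\<box>A)\<box>P) (\<lambda>x. ai V A P (?c x)) ?y"
    unfolding e3 using o y by (intro tl_comp m2 MR x)
  \<comment> \<open>The second hexagon recognises the two successive braidings, past V and past A,
    as the braiding past V \<otimes> A.\<close>
  also have "... = tl (P\<box>V\<box>A) W ((V\<box>A)\<box>P) (br P (V\<box>A)) ?y"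
    by (rule tl_cong) (simp add: B_def hexagon2[OF o(1-3)])
  finally have bz: "B P (V\<box>A) W x = as (V\<box>A) P W ?z" by (simp add: B_def)
  have "tl ((V\<box>A)\<box>P) W (V\<box>A\<box>P) (as V A P) ?z = tl (V\<box>A\<box>P) W (V\<box>A\<box>P) (\<lambda>x. as V A P (ai V A P x)) ?w"
    using o w by (intro tl_comp MR x)
  also have "... = ?w" using o w by (intro tm_idI) (auto simp: as_ai)
  finally have "as V A (P\<box>W) (B P (V\<box>A) W x) = tr V ((A\<box>P)\<box>W) (A\<box>P\<box>W) (as A P W) (as V (A\<box>P) W ?w)"
    unfolding bz using o z by (simp add: pentagon)
  also have "as V (A\<box>P) W ?w = tr V ((P\<box>A)\<box>W) ((A\<box>P)\<box>W) (tl (P\<box>A) W (A\<box>P) (br P A)) (as V (P\<box>A) W ?v)"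
    using o v by (intro as_tm MR x)
  also have "tr V ((A\<box>P)\<box>W) (A\<box>P\<box>W) (as A P W) ... =
     tr V ((P\<box>A)\<box>W) (A\<box>P\<box>W) (\<lambda>x. as A P W (tl (P\<box>A) W (A\<box>P) (br P A) x)) (as V (P\<box>A) W ?v)"
    using o v by (intro tr_comp MR x)
  also have "... = tr V ((P\<box>A)\<box>W) (A\<box>P\<box>W) (\<lambda>x. B P A W (as P A W x)) (as V (P\<box>A) W ?v)"
    using o by (intro tr_cong) (simp add: B_def ai_as)
  also have "... = tr V (P\<box>A\<box>W) (A\<box>P\<box>W) (B P A W) (tr V ((P\<box>A)\<box>W) (P\<box>A\<box>W) (as P A W) (as V (P\<box>A) W ?v))"
    using o v by (intro tr_comp[symmetric] B_mor MR x)
  finally show ?B unfolding r2 .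
qed

section \<open>Invariant elements and the unit\<close>

lemma pt_smult1: "module k V ==> module k W ==> c \<in> carrier k ==> v \<in> carrier V ==> w \<in> carrier W ==>
    pt k V W (c \<odot>\<^bsub>V\<^esub> v) w = c \<odot>\<^bsub>V\<box>W\<^esub> pt k V W v w"
  by (rule lin_smult[OF lin_pt1_o[OF _ _ lin_id]])

lemma pt_smult2: "module k V ==> module k W ==> c \<in> carrier k ==> v \<in> carrier V ==> w \<in> carrier W ==>
    pt k V W v (c \<odot>\<^bsub>W\<^esub> w) = c \<odot>\<^bsub>V\<box>W\<^esub> pt k V W v w"
  by (rule lin_smult[OF lin_pt2_o[OF _ _ lin_id]])

text \<open>\<open>c \<mapsto> c e\<close> is a morphism from \<open>I[p]\<close> to \<open>F\<close>.\<close>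

definition inv_el where
  "inv_el F p e \<longleftrightarrow> e \<in> gr F p \<and> (\<forall>h\<in>carrier H. act F h e = counit H h \<odot>\<^bsub>F\<^esub> e)"

lemma inv_el_in: "obj F ==> inv_el F p e ==> e \<in> carrier F"
  by (auto simp: inv_el_def intro: gr_in)

context
  fixes F :: "('k, 'h, 'f, 'm) hmod_scheme" and e p
  assumes F: "obj F" and e: "inv_el F p e"
begin

private lemma ei: "e \<in> carrier F" "e \<in> gr F p" "h \<in> carrier H ==> act F h e = counit H h \<odot>\<^bsub>F\<^esub> e"
  using inv_el_in[OF F e] e by (auto simp: inv_el_def)

text \<open>One leg of \<phi> acts on the invariant element by the counit, and
  \<open>phi_eps\<close> then removes \<phi>.\<close>

lemma as_inv1:
  assumes o: "obj V" "obj W" and v: "v \<in> carrier V" "w \<in> carrier W"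
  shows "as F V W (pt k (F\<box>V) W (pt k F V e v) w) = pt k F (V\<box>W) e (pt k V W v w)"
proof -
  let ?T = "F\<box>V\<box>W"
  have "as F V W (T3l F V W e v w) = L3 ?T (\<lambda>a b c. counit H a \<odot>\<^bsub>?T\<^esub> T3r F V W e (act V b v) (act W c w)) (phi H)"
    unfolding as_pt[OF F o ei(1) v] using F o ei v by (intro L3_cong) (simp add: pt_smult1)
  also have "... = T3r F V W e (act V \<one>\<^sub>H v) (act W \<one>\<^sub>H w)"
    by (rule phi_eps(1)) (use F o ei v in "auto intro!: LR")
  finally show ?thesis using o v by simp
qed

lemma as_inv2:
  assumes o: "obj V" "obj W" and v: "v \<in> carrier V" "w \<in> carrier W"
  shows "as V F W (pt k (V\<box>F) W (pt k V F v e) w) = pt k V (F\<box>W) v (pt k F W e w)"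
proof -
  let ?T = "V\<box>F\<box>W"
  have "as V F W (T3l V F W v e w) = L3 ?T (\<lambda>a b c. counit H b \<odot>\<^bsub>?T\<^esub> T3r V F W (act V a v) e (act W c w)) (phi H)"
    unfolding as_pt[OF o(1) F o(2) v(1) ei(1) v(2)] using F o ei v by (intro L3_cong) (simp add: pt_smult1 pt_smult2)
  also have "... = T3r V F W (act V \<one>\<^sub>H v) e (act W \<one>\<^sub>H w)"
    by (rule phi_eps(2)) (use F o ei v in "auto intro!: LR")
  finally show ?thesis using o v by simp
qed

lemma ai_inv1:
  assumes o: "obj V" "obj W" and v: "v \<in> carrier V" "w \<in> carrier W"
  shows "ai F V W (pt k F (V\<box>W) e (pt k V W v w)) = pt k (F\<box>V) W (pt k F V e v) w"
  using F o v ei by (simp add: as_inv1[symmetric] ai_as)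

text \<open>R disappears by \<open>R_eps\<close> and only the sign is left, in either
  direction.\<close>

lemma br_inv:
  assumes o: "obj V" and v: "v \<in> gr V q"
  shows "br F V (pt k F V e v) = koszul (V\<box>F) p q (pt k V F v e)" (is ?g2)
    "br V F (pt k V F v e) = koszul (F\<box>V) q p (pt k F V e v)" (is ?g1)
proof -
  have vc: "v \<in> carrier V" using gr_in[OF o v] .
  have "br0 F V e v = L2 (V\<box>F) (\<lambda>a b. counit H a \<odot>\<^bsub>V\<box>F\<^esub> pt k V F (act V b v) e) (rmat H)"
    unfolding br0_def using F o vc ei by (intro L2_cong) (simp add: pt_smult2)
  also have "... = pt k V F (act V \<one>\<^sub>H v) e"
    by (rule R_eps(1)) (use F o ei vc in "auto intro!: LR")
  finally show ?g2
    using br_hom[OF F o ei(2) v] o vc by simp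
  have "br0 V F v e = L2 (F\<box>V) (\<lambda>a b. counit H b \<odot>\<^bsub>F\<box>V\<^esub> pt k F V e (act V a v)) (rmat H)"
    unfolding br0_def using F o vc ei by (intro L2_cong) (simp add: pt_smult1)
  also have "... = pt k F V e (act V \<one>\<^sub>H v)"
    by (rule R_eps(2)) (use F o ei vc in "auto intro!: LR")
  finally show ?g1
    using br_hom[OF o F v ei(2)] o vc by simp
qed

lemma pt_inv_lin: "obj V ==> lin V (F\<box>V) (pt k F V e)"
  using F ei lin_pt2_o[OF _ _ lin_id, of F V e] by simp

text \<open>Inserting e shifts degrees by p; the case p = 0 is that of the unit in end(V).\<close>

lemma pt_inv_mor:
  assumes o: "obj V" and p: "p = 0"
  shows "mor V (F\<box>V) (pt k F V e)"
proof -
  have "act (F\<box>V) h (pt k F V e v) = pt k F V e (act V h v)" if h: "h \<in> carrier H" and v: "v \<in> carrier V" for h v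
  proof -
    have "act (F\<box>V) h (pt k F V e v) = L2 (F\<box>V) (\<lambda>a b. counit H a \<odot>\<^bsub>F\<box>V\<^esub> pt k F V e (act V b v)) (comul H h)"
      unfolding act_tens_pt[OF F o h ei(1) v] using F o v ei by (intro L2_cong) (simp add: pt_smult1)
    also have "... = pt k F V e (act V h v)" by (rule eps_comul(1)) (use F o ei h v in "auto intro!: LR")
    finally show ?thesis .
  qed
  moreover have "pt k F V e v \<in> gr (F\<box>V) n" if v: "v \<in> gr V n" for v n
    using tens_gr_pt[OF F o ei(2) v] p by simp
  ultimately show ?thesis using F o pt_inv_lin by (simp add: mor_def)
qed

lemma br_inv0:
  assumes o: "obj V" and p: "p = 0" and v: "v \<in> carrier V"
  shows "br F V (pt k F V e v) = pt k V F v e"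
proof (rule hom_ext[OF o v])
  show "lin V (V\<box>F) (\<lambda>v. br F V (pt k F V e v))" using F o by (intro lin_comp[OF pt_inv_lin br_lin])
  show "lin V (V\<box>F) (\<lambda>v. pt k V F v e)" using F o ei by (auto intro!: LR)
qed (simp add: br_inv[OF o] koszul_def p)

end

lemma I_inv: "inv_el (unit_obj k H p) p \<one>\<^bsub>k\<^esub>"
  using cringk by (auto simp: inv_el_def cring.cring_simprules)

lemma I_pt:
  assumes o: "obj V" and v: "v \<in> carrier V" and c: "c \<in> carrier k"
  shows "pt k (unit_obj k H p) V c v = pt k (unit_obj k H p) V \<one>\<^bsub>k\<^esub> (c \<odot>\<^bsub>V\<^esub> v)"
proof -
  have M: "module k (unit_obj k H p)" "module k V" using o by simp_all
  interpret k: cring k by (rule cringk)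
  show ?thesis using pt_smult1[OF M c, of "\<one>\<^bsub>k\<^esub>" v] pt_smult2[OF M c, of "\<one>\<^bsub>k\<^esub>" v] c v by simp
qed

text \<open>On homogeneous vectors both braidings amount to a sign, the same for both, so they
  cancel. \<open>I_pt\<close> reduces everything to the generator 1 of I[p].\<close>

lemma br_br_I:
  assumes o: "obj V" and t: "t \<in> carrier (unit_obj k H p\<box>V)"
  shows "br V (unit_obj k H p) (br (unit_obj k H p) V t) = t"
proof (rule tens_ext_o[OF _ _ lin_comp[OF br_lin br_lin] lin_id _ t])
  let ?I = "unit_obj k H p"
  fix c v assume "c \<in> carrier ?I" and v: "v \<in> carrier V"
  then have c: "c \<in> carrier k" by simp
  note i = I_inv[of p]
  have "br V ?I (br ?I V (pt k ?I V \<one>\<^bsub>k\<^esub> u)) = pt k ?I V \<one>\<^bsub>k\<^esub> u" if u: "u \<in> carrier V" for u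
  proof (rule hom_ext[OF o u])
    show "lin V (?I\<box>V) (\<lambda>u. br V ?I (br ?I V (pt k ?I V \<one>\<^bsub>k\<^esub> u)))"
      using o by (intro lin_comp[OF lin_comp[OF pt_inv_lin[OF _ i] br_lin] br_lin]) simp_all
    show "lin V (?I\<box>V) (\<lambda>u. pt k ?I V \<one>\<^bsub>k\<^esub> u)" using pt_inv_lin[OF _ i o] by simp
    fix u n assume u: "u \<in> gr V n"
    have uc: "u \<in> carrier V" "\<one>\<^bsub>k\<^esub> \<in> carrier ?I" using gr_in[OF o u] inv_el_in[OF _ i] by simp_all
    show "br V ?I (br ?I V (pt k ?I V \<one>\<^bsub>k\<^esub> u)) = pt k ?I V \<one>\<^bsub>k\<^esub> u"
      using o uc koszul_push[OF _ _ br_lin[OF o, of ?I], of "pt k V ?I u \<one>\<^bsub>k\<^esub>"]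
      by (simp add: br_inv[OF _ i o u]) (simp add: koszul_def mult.commute)
  qed
  then show "br V ?I (br ?I V (pt k ?I V c v)) = pt k ?I V c v"
    using I_pt[OF o v c, of p] o v c by simp
qed (use o in auto)

lemma iunit_Lin: "obj V ==> iunit H V \<in> Lin k V V"
  unfolding iunit_def by (intro LinI act_lin) auto

text \<open>The antipode axiom for \<beta> says precisely that h acts on the unit of end(V) by the
  counit.\<close>

lemma iunit_inv:
  assumes o: "obj V"
  shows "inv_el (hom V V) 0 (iunit H V)"
proof -
  note L = iunit_Lin[OF o]
  have "act (hom V V) h (iunit H V) = counit H h \<odot>\<^bsub>hom V V\<^esub> iunit H V" if h: "h \<in> carrier H" for h
  proof (rule Lin_eqI[OF hom_act_Lin[OF o o h L]])
    show "counit H h \<odot>\<^bsub>hom V V\<^esub> iunit H V \<in> Lin k V V"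
      using m_smult[OF obj_module[OF hom_obj_obj[OF o o]], of "counit H h" "iunit H V"] L h by (simp del: hom_simps(4))
    fix v assume v: "v \<in> carrier V"
    have "act (hom V V) h (iunit H V) v = L2 V (\<lambda>a b. act V (bS a b) v) (comul H h)"
      unfolding hom_act_pt[OF v] using o v by (intro L2_cong) (simp add: iunit_def act_mult)
    also have "... = counit H h \<odot>\<^bsub>V\<^esub> act V (beta H) v"
      by (rule antipode_push(2)) (use o v h in "auto intro!: LR")
    finally show "act (hom V V) h (iunit H V) v = (counit H h \<odot>\<^bsub>hom V V\<^esub> iunit H V) v"
      using v by (simp add: iunit_def)
  qed
  moreover have "iunit H V \<in> gr (hom V V) 0" using L o gr_in[OF o] act_gr[OF o] by (auto simp: iunit_def)
  ultimately show ?thesis by (simp add: inv_el_def del: hom_simps)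
qed

text \<open>The \<alpha> of evaluation and the \<beta> of the unit meet in a \<beta> S(b) \<alpha>
  c, which sums to 1 over \<phi>. So the unit evaluates to the identity, although as a map it is the
  action of \<beta>.\<close>

lemma ev_iunit: "obj V ==> v \<in> carrier V ==> ev' V V (pt k (hom V V) V (iunit H V) v) = v"
proof -
  assume o: "obj V" and v: "v \<in> carrier V"
  have "eF V V (iunit H V) v = L3 V (\<lambda>a b c. act V (bS a b \<cdot> alpha H \<cdot> c) v) (phi H)"
    unfolding eF_def using o v by (intro L3_cong) (simp add: iunit_def act_mult Hassoc)
  also have "... = act V \<one>\<^sub>H v" by (rule antipode_phi(1)) (use o v in "auto intro!: LR")
  finally show ?thesis using o v by (simp add: ev_pt iunit_Lin)
qed

section \<open>Internal composition, commutators and tensor products\<close>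

lemma mor_sub:
  assumes f: "mor V W f" and g: "mor V W g"
  shows "mor V W (\<lambda>x. f x \<ominus>\<^bsub>W\<^esub> g x)"
proof -
  note o = mor_obj[OF f] and M = mor_obj[OF f, THEN obj_module]
  have "f (act V h v) \<ominus>\<^bsub>W\<^esub> g (act V h v) = act W h (f v \<ominus>\<^bsub>W\<^esub> g v)" if "h \<in> carrier H" "v \<in> carrier V" for h v
    using lin_sub[OF M(2,2) act_lin[OF o(2) that(1)], of "f v" "g v"] mor_in[OF f that(2)] mor_in[OF g that(2)] mor_act[OF f that] mor_act[OF g that] by simp
  then show ?thesis unfolding mor_def using o lin_subf[OF M(2) mor_lin[OF f] mor_lin[OF g]]
      submod_sub[OF M(2) gr_submod[OF o(2)]] mor_gr[OF f] mor_gr[OF g] by auto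
qed

lemma mor_add:
  assumes f: "mor V W f" and g: "mor V W g"
  shows "mor V W (\<lambda>x. f x \<oplus>\<^bsub>W\<^esub> g x)"
proof -
  note o = mor_obj[OF f] and M = mor_obj[OF f, THEN obj_module]
  have "f (act V h v) \<oplus>\<^bsub>W\<^esub> g (act V h v) = act W h (f v \<oplus>\<^bsub>W\<^esub> g v)" if "h \<in> carrier H" "v \<in> carrier V" for h v
    using lin_add[OF act_lin[OF o(2) that(1)], of "f v" "g v"] mor_in[OF f that(2)] mor_in[OF g that(2)] mor_act[OF f that] mor_act[OF g that] by simp
  then show ?thesis unfolding mor_def using o lin_addf[OF M(2) mor_lin[OF f] mor_lin[OF g]]
      gr_submod[OF o(2)] mor_gr[OF f] mor_gr[OF g] submod_iff[OF M(2)] by auto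
qed

text \<open>Translates of g y are values of g at translates of y, so every evaluation that occurs in
  \<open>zeta_ev\<close> for g y vanishes. The argument uses the hypothesis at all translates of y,
  not at y alone.\<close>

lemma hom_mor_zero:
  assumes g: "mor Y (hom V W) g" and o: "obj V" "obj W"
    and z: "\<And>y v. y \<in> carrier Y ==> v \<in> carrier V ==> ev' V W (pt k (hom V W) V (g y) v) = \<zero>\<^bsub>W\<^esub>"
    and y: "y \<in> carrier Y"
  shows "g y = \<zero>\<^bsub>hom V W\<^esub>"
proof (rule Lin_eqI[where V = V and W = W])
  show L: "g y \<in> Lin k V W" using mor_in[OF g y] by simp
  show "\<zero>\<^bsub>hom V W\<^esub> \<in> Lin k V W" using o by (simp add: LinI lin_zerof)
  fix v assume v: "v \<in> carrier V"
  have "g y v = L3 W (\<lambda>a b c. ev' V W (pt k (hom V W) V (act (hom V W) a (g y)) (act V (bS b c) v))) \<psi>"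
    using zeta_ev[OF o L v] by simp
  also have "... = L3 W (\<lambda>a b c. \<zero>\<^bsub>W\<^esub>) \<psi>"
  proof (rule L3_cong)
    fix a b c assume "a \<in> carrier H" "b \<in> carrier H" "c \<in> carrier H"
    then show "ev' V W (pt k (hom V W) V (act (hom V W) a (g y)) (act V (bS b c) v)) = \<zero>\<^bsub>W\<^esub>"
      using o v y z mor_obj(1)[OF g] by (simp add: mor_act[OF g, symmetric] del: hom_simps)
  qed
  also have "... = \<zero>\<^bsub>W\<^esub>"
    using L3_push[of W W "\<lambda>a b c. \<zero>\<^bsub>W\<^esub>" "\<lambda>x. \<zero>\<^bsub>W\<^esub>" "\<psi>"] o lin_zerof[of W H] lin_zerof[of W W] by (simp add: tril_def)
  finally show "g y v = \<zero>\<^bsub>hom V W\<^esub> v" using v by simp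
qed

lemma icomp_props:
  assumes o: "obj V" "obj W" "obj X"
  shows icomp_mor: "mor (hom W X\<box>hom V W) (hom V X) (icomp k H V W X)" (is ?g2)
  and icomp_ev: "s \<in> carrier (hom W X\<box>hom V W) ==> v \<in> carrier V ==>
    ev' V X (pt k (hom V X) V (icomp k H V W X s) v) =
    ev' W X (tr (hom W X) (hom V W\<box>V) W (ev' V W) (as (hom W X) (hom V W) V (pt k (hom W X\<box>hom V W) V s v)))" (is "PROP ?g1")
proof -
  have m: "mor ((hom W X\<box>hom V W)\<box>V) X (\<lambda>t. ev' W X (tr (hom W X) (hom V W\<box>V) W (ev' V W) (as (hom W X) (hom V W) V t)))"
    using o by (intro mor_comp[OF mor_comp[OF as_mor tr_mor] ev_mor] ev_mor hom_obj_obj)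
  show ?g2
    unfolding icomp_def using o by (intro zeta_mor[OF m]) auto
  show "PROP ?g1"
    unfolding icomp_def using o by (intro ev_zeta[OF m]) auto
qed

text \<open>After evaluation, internal composition becomes composition of operators, up to the
  associator. It is stated for families over P and Q, because morphisms can be moved by naturality
  and single operators cannot.\<close>

lemma ev_icomp:
  assumes o: "obj V" "obj W" "obj X" and f: "mor P (hom W X) f" and g: "mor Q (hom V W) g" and t: "t \<in> carrier ((P\<box>Q)\<box>V)"
  shows "ev' V X (tl (P\<box>Q) V (hom V X) (\<lambda>s. icomp k H V W X (tm P Q (hom W X) (hom V W) f g s)) t) =
    ev' W X (tm P (Q\<box>V) (hom W X) W f (\<lambda>s. ev' V W (tl Q V (hom V W) g s)) (as P Q V t))"
proof -
  let ?E = "hom W X" and ?F = "hom V W"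
  note q = mor_obj(1)[OF f] mor_obj(1)[OF g]
  have oh: "obj ?E" "obj ?F" "obj (hom V X)" using o by auto
  have m1: "mor (P\<box>Q) (hom V X) (\<lambda>s. icomp k H V W X (tm P Q ?E ?F f g s))"
    using o by (intro mor_comp[OF tmap_mor[OF f g] icomp_mor])
  have m2: "mor (Q\<box>V) W (\<lambda>s. ev' V W (tl Q V ?F g s))"
    using o by (intro mor_comp[OF tl_mor[OF g] ev_mor])
  show ?thesis
  proof (rule tens_ext_o[OF _ _ lin_comp[OF mor_lin[OF tl_mor[OF m1 o(1)]] ev_lin[OF o(1,3)]]
        lin_comp[OF lin_comp[OF as_lin[OF q o(1)] mor_lin[OF tmap_mor[OF f m2]]] ev_lin[OF o(2,3)]] _ t])
    fix s v assume s: "s \<in> carrier (P\<box>Q)" and v: "v \<in> carrier V"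
    let ?s = "tm P Q ?E ?F f g s"
    have s': "?s \<in> carrier (?E\<box>?F)" by (rule tm_in[OF f g s])
    have "ev' V X (tl (P\<box>Q) V (hom V X) (\<lambda>s. icomp k H V W X (tm P Q ?E ?F f g s)) (pt k (P\<box>Q) V s v)) =
      ev' W X (tr ?E (?F\<box>V) W (ev' V W) (as ?E ?F V (pt k (?E\<box>?F) V ?s v)))"
      using q o oh s v s' mor_lin[OF m1] by (simp add: tmap_pt lin_id icomp_ev del: hom_simps)
    also have "pt k (?E\<box>?F) V ?s v = tl (P\<box>Q) V (?E\<box>?F) (tm P Q ?E ?F f g) (pt k (P\<box>Q) V s v)"
      using q o oh s v mor_lin[OF tmap_mor[OF f g]] by (simp add: tmap_pt lin_id)
    also have "as ?E ?F V ... = tm P (Q\<box>V) ?E (?F\<box>V) f (tl Q V ?F g) (as P Q V (pt k (P\<box>Q) V s v))"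
      using q o s v by (intro as_nat[OF f g mor_id]) auto
    also have "tr ?E (?F\<box>V) W (ev' V W) ... = tm P (Q\<box>V) ?E W f (\<lambda>s. ev' V W (tl Q V ?F g s)) (as P Q V (pt k (P\<box>Q) V s v))"
      using q o oh s v by (intro tm_comp[OF f tl_mor[OF g] mor_id ev_mor]) auto
    finally show "ev' V X (tl (P\<box>Q) V (hom V X) (\<lambda>s. icomp k H V W X (tm P Q ?E ?F f g s)) (pt k (P\<box>Q) V s v)) =
      ev' W X (tm P (Q\<box>V) ?E W f (\<lambda>s. ev' V W (tl Q V ?F g s)) (as P Q V (pt k (P\<box>Q) V s v)))" .
  qed (use q o in auto)
qed

lemma pt_inv_mor2:
  assumes F: "obj F" and e: "inv_el F 0 e" and o: "obj V"
  shows "mor V (V\<box>F) (\<lambda>v. pt k V F v e)"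
  by (rule mor_cong[OF mor_comp[OF pt_inv_mor[OF F e o refl] br_mor[OF F o]]]) (simp add: br_inv0[OF F e o refl])

lemma ai_inv:
  assumes F: "obj F" and e: "inv_el F 0 e" and o: "obj V" "obj W" and t: "t \<in> carrier (V\<box>W)"
  shows "ai F V W (pt k F (V\<box>W) e t) = tl V W (F\<box>V) (pt k F V e) t"
  by (rule tens_ext_o[OF _ _ lin_comp[OF pt_inv_lin[OF F e] ai_lin] mor_lin[OF tl_mor] _ t])
    (use F o in "auto simp: ai_inv1[OF F e] tmap_pt lin_id pt_inv_lin[OF F e] intro!: pt_inv_mor[OF F e]")

lemma lhat_mor: "mor (A\<box>V) V l ==> obj A ==> obj V ==> mor A (hom V V) (lhat k H A V l)"
  unfolding lhat_def by (rule zeta_mor)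

lemma lhat_ev:
  assumes l: "mor (A\<box>V) V l" and o: "obj A" "obj V" and t: "t \<in> carrier (A\<box>V)"
  shows "ev' V V (tl A V (hom V V) (lhat k H A V l) t) = l t"
proof (rule tens_ext_o[OF _ _ lin_comp[OF mor_lin[OF tl_mor[OF lhat_mor[OF l o] o(2)]] ev_lin[OF o(2,2)]] mor_lin[OF l] _ t])
  fix a v assume a: "a \<in> carrier A" and v: "v \<in> carrier V"
  show "ev' V V (tl A V (hom V V) (lhat k H A V l) (pt k A V a v)) = l (pt k A V a v)"
    using o a v mor_lin[OF lhat_mor[OF l o]] ev_zeta[OF l o a v] by (simp add: tmap_pt lin_id lhat_def)
qed (use o in auto)

text \<open>The commutator on all of end(V) \<otimes> end(V), where it is a morphism;
  \<open>icommutator\<close> is its value at a pure tensor.\<close>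

definition comm where
  "comm V s = icomp k H V V V s \<ominus>\<^bsub>hom V V\<^esub> icomp k H V V V (br (hom V V) (hom V V) s)"

lemma comm_mor: "obj V ==> mor (hom V V\<box>hom V V) (hom V V) (comm V)"
  unfolding comm_def[abs_def] by (intro mor_sub mor_comp[OF br_mor] icomp_mor hom_obj_obj)

lemma icommutator_comm: "icommutator k H V L L' = comm V (pt k (hom V V) (hom V V) L L')"
  by (simp add: icommutator_def comm_def Let_def)

lemma middle_swap_B: "middle_swap k H E F V X t =
    ai E V (F\<box>X) (tr E (F\<box>V\<box>X) (V\<box>F\<box>X) (B F V X) (as E F (V\<box>X) t))"
  by (simp add: middle_swap_def B_def[abs_def])

section \<open>Evaluation of the internal tensor product\<close>

context
  fixes V :: "('k, 'h, 'v, 'm) hmod_scheme" and W :: "('k, 'h, 'w, 'n) hmod_scheme"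
  assumes VW: "obj V" "obj W"
begin

private abbreviation "E \<equiv> hom V V"
private abbreviation "F \<equiv> hom W W"
private abbreviation "T \<equiv> V\<box>W"

private lemma EF: "obj E" "obj F" "obj T" using VW by auto

lemma itensor_mor: "mor (E\<box>F) (hom T T) (itensor k H V V W W)" (is ?g2)
  and itensor_ev: "s \<in> carrier (E\<box>F) ==> t \<in> carrier T ==>
    ev' T T (pt k (hom T T) T (itensor k H V V W W s) t) =
    tm (E\<box>V) (F\<box>W) V W (ev' V V) (ev' W W) (ai E V (F\<box>W)
      (tr E (F\<box>T) (V\<box>F\<box>W) (B F V W) (as E F T (pt k (E\<box>F) T s t))))" (is "PROP ?g1")
proof -
  have m: "mor ((E\<box>F)\<box>T) T (\<lambda>t. tm (E\<box>V) (F\<box>W) V W (ev' V V) (ev' W W) (middle_swap k H E F V W t))"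
    unfolding middle_swap_B using VW EF
    by (intro mor_comp[OF mor_comp[OF mor_comp[OF as_mor tr_mor] ai_mor] tmap_mor] B_mor ev_mor tens_obj)
  show ?g2
    unfolding itensor_def using EF by (intro zeta_mor[OF m]) auto
  show "PROP ?g1"
    unfolding itensor_def middle_swap_B[symmetric] using EF by (intro ev_zeta[OF m]) auto
qed

text \<open>The unit is invariant of degree 0, so it passes V and all brackets unchanged, and
  evaluation turns it into the identity of W. Only the bracket between L, V and W survives.\<close>

lemma itensor_iunit_right:
  assumes L: "L \<in> carrier E" and t: "t \<in> carrier T"
  shows "ev' T T (pt k (hom T T) T (itensor k H V V W W (pt k E F L (iunit H W))) t) =
    tl (E\<box>V) W V (ev' V V) (ai E V W (pt k E T L t))"
proof -
  let ?e = "iunit H W"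
  note i = iunit_inv[OF VW(2)]
  note ec = inv_el_in[OF EF(2) i]
  note M = VW[THEN obj_module] EF[THEN obj_module]
  note m = pt_inv_mor[OF EF(2) i VW(2) refl]
  have s: "pt k E F L ?e \<in> carrier (E\<box>F)" using L ec by simp
  have lE: "lin E (E\<box>F) (\<lambda>L. pt k E F L ?e)" using M ec by (auto intro!: LR)
  show ?thesis
  proof (rule tens_ext_o[OF M(1,2) _ _ _ t])
    show "lin T T (\<lambda>t. ev' T T (pt k (hom T T) T (itensor k H V V W W (pt k E F L ?e)) t))"
      using M EF mor_in[OF itensor_mor s] by (intro lin_comp[OF lin_pt2_o[OF _ _ lin_id] ev_lin]) (auto simp del: hom_simps)
    show "lin T T (\<lambda>t. tl (E\<box>V) W V (ev' V V) (ai E V W (pt k E T L t)))"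
      using M EF VW L by (intro lin_comp[OF lin_comp[OF lin_pt2_o[OF _ _ lin_id] ai_lin] mor_lin[OF tl_mor[OF ev_mor]]]) auto
    fix v w assume v: "v \<in> carrier V" and w: "w \<in> carrier W"
    let ?t = "pt k V W v w" and ?x = "ai E V W (pt k E T L (pt k V W v w))"
    have x: "?x \<in> carrier ((E\<box>V)\<box>W)" using VW EF L v w by (intro mor_in[OF ai_mor]) auto
    have "B F V W (pt k F T ?e ?t) = pt k V (F\<box>W) v (pt k F W ?e w)"
      using VW EF v w ec by (simp add: B_def ai_inv1[OF EF(2) i] tmap_pt lin_id br_lin br_inv0[OF EF(2) i _ refl] as_inv2[OF EF(2) i])
    then have "ev' T T (pt k (hom T T) T (itensor k H V V W W (pt k E F L ?e)) ?t) =
      tm (E\<box>V) (F\<box>W) V W (ev' V V) (ev' W W) (ai E V (F\<box>W) (pt k E (V\<box>F\<box>W) L (pt k V (F\<box>W) v (pt k F W ?e w))))"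
      using VW EF v w s L ec by (simp add: itensor_ev as_inv2[OF EF(2) i] tmap_pt lin_id mor_lin[OF B_mor] del: hom_simps)
    \<comment> \<open>The unit is inserted by the morphism w \<mapsto> 1 \<otimes> w, so that
      naturality of the inverse associator can take it out of the bracket.\<close>
    also have "pt k E (V\<box>F\<box>W) L (pt k V (F\<box>W) v (pt k F W ?e w)) =
      tr E (V\<box>W) (V\<box>F\<box>W) (tr V W (F\<box>W) (pt k F W ?e)) (pt k E T L ?t)"
      using VW EF v w L mor_lin[OF m] mor_lin[OF tr_mor[OF m VW(1)]] by (simp add: tmap_pt lin_id del: hom_simps)
    also have "ai E V (F\<box>W) ... = tr (E\<box>V) W (F\<box>W) (pt k F W ?e) ?x"
      using VW EF v w L by (intro ai_tr[OF m]) auto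
    also have "tm (E\<box>V) (F\<box>W) V W (ev' V V) (ev' W W) ... = tm (E\<box>V) W V W (ev' V V) (\<lambda>w. ev' W W (pt k F W ?e w)) ?x"
      using VW EF x by (intro tm_comp[OF mor_id m] ev_mor) auto
    also have "... = tl (E\<box>V) W V (ev' V V) ?x"
      by (subst tmap_cong[of "E\<box>V" "ev' V V" "ev' V V" W "\<lambda>w. ev' W W (pt k F W ?e w)" "\<lambda>w. w"]) (simp_all add: ev_iunit VW)
    finally show "ev' T T (pt k (hom T T) T (itensor k H V V W W (pt k E F L ?e)) ?t) = tl (E\<box>V) W V (ev' V V) ?x" .
  qed
qed

text \<open>With the unit in the first factor the outer brackets are trivial, but L still has to
  cross V; this crossing is \<open>B\<close>.\<close>

lemma itensor_iunit_left:
  assumes L: "L \<in> carrier F" and t: "t \<in> carrier T"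
  shows "ev' T T (pt k (hom T T) T (itensor k H V V W W (pt k E F (iunit H V) L)) t) =
    tr V (F\<box>W) W (ev' W W) (B F V W (pt k F T L t))"
proof -
  let ?e = "iunit H V" and ?s = "B F V W (pt k F T L t)"
  note i = iunit_inv[OF VW(1)]
  note ec = inv_el_in[OF EF(1) i]
  note M = VW[THEN obj_module] EF[THEN obj_module]
  note m = pt_inv_mor[OF EF(1) i VW(1) refl]
  have s: "pt k E F ?e L \<in> carrier (E\<box>F)" using L ec by simp
  have b: "?s \<in> carrier (V\<box>F\<box>W)" using VW EF L t by (intro mor_in[OF B_mor]) auto
  have "ev' T T (pt k (hom T T) T (itensor k H V V W W (pt k E F ?e L)) t) =
    tm (E\<box>V) (F\<box>W) V W (ev' V V) (ev' W W) (ai E V (F\<box>W) (pt k E (V\<box>F\<box>W) ?e ?s))"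
    using VW EF s t L ec by (simp add: itensor_ev as_inv1[OF EF(1) i] tmap_pt lin_id mor_lin[OF B_mor] del: hom_simps)
  also have "... = tm (E\<box>V) (F\<box>W) V W (ev' V V) (ev' W W) (tl V (F\<box>W) (E\<box>V) (pt k E V ?e) ?s)"
    using VW EF b by (simp add: ai_inv[OF EF(1) i])
  also have "... = tm V (F\<box>W) V W (\<lambda>v. ev' V V (pt k E V ?e v)) (ev' W W) ?s"
    using VW EF b by (intro tm_comp[OF m mor_id] ev_mor) auto
  also have "... = tr V (F\<box>W) W (ev' W W) ?s"
    by (subst tmap_cong[of V "\<lambda>v. ev' V V (pt k E V ?e v)" "\<lambda>v. v" "F\<box>W" "ev' W W" "ev' W W"]) (simp_all add: ev_iunit VW)
  finally show ?thesis .
qed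

end

section \<open>Connections and the Leibniz rule\<close>

text \<open>The rule e(p, a v) = \<delta>(p, a) v + a e(p, v), with p carried past a by
  \<open>B\<close>. Here e and \<delta> are families of evaluated operators over P, and l is the
  action of A on V.\<close>

definition leib where
  "leib P A V l \<delta> e \<longleftrightarrow> (\<forall>t\<in>carrier (P\<box>A\<box>V). e (tr P (A\<box>V) V l t) =
     l (tl (P\<box>A) V A \<delta> (ai P A V t)) \<oplus>\<^bsub>V\<^esub> l (tr A (P\<box>V) V e (B P A V t)))"

context
  fixes A :: "('k, 'h, 'a) halg" and d
  assumes A: "obj A" and d: "mor (unit_obj k H 1) (hom A A) d"
begin

definition conF where "conF V = bilift k (prod_obj (hom V V) (unit_obj k H 1)) A (hom V V) (\<lambda>(L, c) a.
   icommutator k H V L (lhat k H A V (lact V) a) \<ominus>\<^bsub>hom V V\<^esub>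
   lhat k H A V (lact V) (ev' A A (pt k (hom A A) A (d c) a)))"

lemma con_eq: "con k H A d V = sub_obj (prod_obj (hom V V) (unit_obj k H 1))
   (a_kernel (prod_obj (hom V V) (unit_obj k H 1)) (hom A (hom V V)) (zeta k H (prod_obj (hom V V) (unit_obj k H 1)) A (hom V V) (conF V)))"
  by (simp add: con_def conF_def Let_def)

context
  fixes V :: "('k, 'h, 'a, 'v) hbimod"
  assumes V: "obj V" and l: "mor (A\<box>V) V (lact V)"
begin

private abbreviation "EV \<equiv> hom V V"
private abbreviation "I1 \<equiv> unit_obj k H 1"
private abbreviation "K \<equiv> prod_obj EV I1"
private abbreviation "EA \<equiv> hom A A"
private abbreviation "lh \<equiv> lhat k H A V (lact V)"
private abbreviation "z \<equiv> zeta k H K A EV (conF V)"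

private lemma oE: "obj EV" "obj K" "obj EA" using V A by auto
private lemma lh: "mor A EV lh" by (rule lhat_mor[OF l A V])

text \<open>An element-free form of \<open>conF\<close>, visibly a morphism, whereas
  \<open>conF\<close> is only given by its values on pure tensors.\<close>

private definition "G s = comm V (tm K A EV EV fst lh s) \<ominus>\<^bsub>EV\<^esub> lh (ev' A A (tl K A EA (\<lambda>p. d (snd p)) s))"

private lemma dsnd: "mor K EA (\<lambda>p. d (snd p))"
  by (rule mor_comp[OF prod_mor(2) d]) (use oE in auto)

private lemma fstm: "mor K EV fst"
  by (rule prod_mor(1)) (use oE in auto)

private lemma G_mor: "mor (K\<box>A) EV G"
  unfolding G_def[abs_def]
  by (intro mor_sub mor_comp[OF tmap_mor[OF fstm lh] comm_mor] mor_comp[OF mor_comp[OF tl_mor[OF dsnd] ev_mor] lh] A V)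

private lemma conF_G: "s \<in> carrier (K\<box>A) ==> conF V s = G s"
  unfolding conF_def
proof (rule bilift_eq_o[OF _ _ _ mor_lin[OF G_mor]])
  fix p a assume p: "p \<in> carrier K" and a: "a \<in> carrier A"
  then show "(case p of (L, c) \<Rightarrow> \<lambda>a. icommutator k H V L (lh a) \<ominus>\<^bsub>EV\<^esub> lh (ev' A A (pt k EA A (d c) a))) a = G (pt k K A p a)"
    using oE A mor_lin[OF fstm] mor_lin[OF lh] mor_lin[OF dsnd]
    by (cases p) (simp add: G_def tmap_pt lin_id icommutator_comm del: hom_simps)
qed (use oE A in auto)

private lemma z_mor: "mor K (hom A EV) z"
  by (rule zeta_mor[OF mor_cong[OF G_mor conF_G]]) (use oE A in auto)

lemma con_obj: "obj (con k H A d V)"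
  unfolding con_eq by (rule kernel_obj[OF z_mor])

lemma con_carrier: "x \<in> carrier (con k H A d V) \<longleftrightarrow> x \<in> carrier K \<and> z x = \<zero>\<^bsub>hom A EV\<^esub>"
  by (simp add: con_eq kernel_eq del: hom_simps prod_simps)

lemma con_incl: "mor (con k H A d V) K (\<lambda>x. x)"
  using oE con_obj con_carrier unfolding con_eq by (intro sub_incl_mor) auto

text \<open>Two curryings stand between membership and the rule: the kernel condition is curried
  over A, and its values lie in end(V). Evaluation removes both. From membership to the rule its
  linearity is enough; the converse goes through \<open>hom_mor_zero\<close>, which is why g is a
  family and not an element.\<close>

lemma con_leib:
  assumes g: "mor P K g"
  defines "e \<equiv> \<lambda>t. ev' V V (tl P V EV (\<lambda>p. fst (g p)) t)"
    and "\<delta> \<equiv> \<lambda>t. ev' A A (tl P A EA (\<lambda>p. d (snd (g p))) t)"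
  shows "(\<forall>p\<in>carrier P. g p \<in> carrier (con k H A d V)) \<longleftrightarrow> leib P A V (lact V) \<delta> e"
proof -
  note P = mor_obj(1)[OF g]
  let ?pr = "\<lambda>p. fst (g p)" and ?F = "\<lambda>t. G (tl P A K g t)"
  let ?h = "\<lambda>f u. ev' V V (tl (P\<box>A) V EV f u)"
  note o = oE A V P
  note M = A[THEN obj_module] V[THEN obj_module] P[THEN obj_module] oE[THEN obj_module]
  have pr: "mor P EV ?pr" by (rule mor_comp[OF g fstm])
  have ds: "mor P EA (\<lambda>p. d (snd (g p)))" by (rule mor_comp[OF g dsnd])
  have em: "mor (P\<box>V) V e" unfolding e_def by (intro mor_comp[OF tl_mor[OF pr] ev_mor] V)
  have dm: "mor (P\<box>A) A \<delta>" unfolding \<delta>_def by (intro mor_comp[OF tl_mor[OF ds] ev_mor] A)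
  have Fm: "mor (P\<box>A) EV ?F" by (rule mor_comp[OF tl_mor[OF g A] G_mor])
  \<comment> \<open>The three terms of the condition: the operator after the action of a, the action
    of a after the operator, and the action of \<delta>(p, a).\<close>
  define X1 where "X1 t = icomp k H V V V (tm P A EV EV ?pr lh t)" for t
  define X2 where "X2 t = icomp k H V V V (tm A P EV EV lh ?pr t)" for t
  define X3 where "X3 t = lh (\<delta> t)" for t
  have X1: "mor (P\<box>A) EV X1" unfolding X1_def by (intro mor_comp[OF tmap_mor[OF pr lh] icomp_mor] V)
  have X2: "mor (A\<box>P) EV X2" unfolding X2_def by (intro mor_comp[OF tmap_mor[OF lh pr] icomp_mor] V)
  have X3: "mor (P\<box>A) EV X3" unfolding X3_def by (intro mor_comp[OF dm lh])
  have X2': "mor (P\<box>A) EV (\<lambda>t. X2 (br P A t))" by (intro mor_comp[OF br_mor X2] P A)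
  have FX: "?F t = X1 t \<ominus>\<^bsub>EV\<^esub> X2 (br P A t) \<ominus>\<^bsub>EV\<^esub> X3 t" if t: "t \<in> carrier (P\<box>A)" for t
    using t tm_comp[OF g mor_id[OF A] fstm lh t] tm_comp[OF g mor_id[OF A] dsnd mor_id[OF A] t] br_nat[OF pr lh t]
    by (simp add: G_def comm_def X1_def X2_def X3_def \<delta>_def)
  \<comment> \<open>Under evaluation the internal products become composites, and the three terms
    turn into e(p, a v), a e(p, v) and \<delta>(p, a) v.\<close>
  have evF: "?h ?F u =
     e (tr P (A\<box>V) V (lact V) (as P A V u)) \<ominus>\<^bsub>V\<^esub>
     lact V (tr A (P\<box>V) V e (as A P V (tl (P\<box>A) V (A\<box>P) (br P A) u))) \<ominus>\<^bsub>V\<^esub> lact V (tl (P\<box>A) V A \<delta> u)"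
    if u: "u \<in> carrier ((P\<box>A)\<box>V)" for u
  proof -
    have ps: "pt k EV V (x \<ominus>\<^bsub>EV\<^esub> y) v = pt k EV V x v \<ominus>\<^bsub>EV\<box>V\<^esub> pt k EV V y v"
      if "x \<in> carrier EV" "y \<in> carrier EV" "v \<in> carrier V" for x y v
      by (rule lin_sub[OF _ _ lin_pt1_o[OF _ _ lin_id]]) (use M that in "simp_all del: hom_simps")
    have tls: "tl (P\<box>A) V EV (\<lambda>t. f t \<ominus>\<^bsub>EV\<^esub> f' t) u = tl (P\<box>A) V EV f u \<ominus>\<^bsub>EV\<box>V\<^esub> tl (P\<box>A) V EV f' u"
      if f: "mor (P\<box>A) EV f" "mor (P\<box>A) EV f'" for f f'
      by (rule tens_ext_o[OF _ _ mor_lin[OF tl_mor[OF mor_sub[OF f] V]] lin_subf[OF _ mor_lin[OF tl_mor[OF f(1) V]] mor_lin[OF tl_mor[OF f(2) V]]] _ u])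
        (use M f[THEN mor_lin] f[THEN mor_in] mor_lin[OF mor_sub[OF f]] in
          \<open>auto simp: tmap_pt lin_id ps simp del: hom_simps\<close>)
    have in1: "tl (P\<box>A) V EV f u \<in> carrier (EV\<box>V)" if "mor (P\<box>A) EV f" for f
      by (rule tm_in[OF that mor_id[OF V] u])
    have as: "as P A V u \<in> carrier (P\<box>A\<box>V)" using o u by simp
    let ?u = "tl (P\<box>A) V (A\<box>P) (br P A) u"
    have u': "?u \<in> carrier ((A\<box>P)\<box>V)" using o u by (intro MR)
    have as': "as A P V ?u \<in> carrier (A\<box>P\<box>V)" using o u' by simp
    have "?h ?F u = ?h (\<lambda>t. X1 t \<ominus>\<^bsub>EV\<^esub> X2 (br P A t) \<ominus>\<^bsub>EV\<^esub> X3 t) u"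
      by (rule arg_cong[where f = "ev' V V"], rule tl_cong[OF FX])
    also have "... = ?h X1 u \<ominus>\<^bsub>V\<^esub> ?h (\<lambda>t. X2 (br P A t)) u \<ominus>\<^bsub>V\<^esub> ?h X3 u"
      using M V X1 X2' X3 in1 by (simp add: tls mor_sub lin_sub[OF _ _ ev_lin] del: hom_simps)
    also have "?h X1 u = e (tr P (A\<box>V) V (lact V) (as P A V u))"
    proof -
      have "?h X1 u = ev' V V (tm P (A\<box>V) EV V ?pr (\<lambda>s. ev' V V (tl A V EV lh s)) (as P A V u))"
        unfolding X1_def[abs_def] by (rule ev_icomp[OF V V V pr lh u])
      also have "... = ev' V V (tm P (A\<box>V) EV V ?pr (lact V) (as P A V u))"
        by (subst tmap_cong[of P ?pr ?pr "A\<box>V" "\<lambda>s. ev' V V (tl A V EV lh s)" "lact V"]) (simp_all add: lhat_ev[OF l A V])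
      also have "... = e (tr P (A\<box>V) V (lact V) (as P A V u))"
        unfolding e_def using tm_comp[OF mor_id[OF P] l pr mor_id[OF V] as] by simp
      finally show ?thesis .
    qed
    also have "?h (\<lambda>t. X2 (br P A t)) u = lact V (tr A (P\<box>V) V e (as A P V ?u))"
    proof -
      have "tl (P\<box>A) V EV (\<lambda>t. X2 (br P A t)) u = tl (A\<box>P) V EV X2 ?u"
        using o u by (intro tl_comp[symmetric] br_mor X2)
      moreover have "ev' V V (tl (A\<box>P) V EV X2 ?u) = ev' V V (tm A (P\<box>V) EV V lh e (as A P V ?u))"
        unfolding X2_def[abs_def] e_def by (rule ev_icomp[OF V V V lh pr u'])
      moreover have "tm A (P\<box>V) EV V lh e (as A P V ?u) = tl A V EV lh (tr A (P\<box>V) V e (as A P V ?u))"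
        using tm_comp[OF mor_id[OF A] em lh mor_id[OF V] as'] by simp
      moreover have "tr A (P\<box>V) V e (as A P V ?u) \<in> carrier (A\<box>V)"
        by (rule tm_in[OF mor_id[OF A] em as'])
      ultimately show ?thesis by (simp add: lhat_ev[OF l A V])
    qed
    also have "?h X3 u = lact V (tl (P\<box>A) V A \<delta> u)"
      using tl_comp[OF dm lh V u] lhat_ev[OF l A V tm_in[OF dm mor_id[OF V] u]] by (simp add: X3_def[abs_def])
    finally show ?thesis .
  qed
  have leib: "leib P A V (lact V) \<delta> e \<longleftrightarrow> (\<forall>u\<in>carrier ((P\<box>A)\<box>V). ?h ?F u = \<zero>\<^bsub>V\<^esub>)"
  proof -
    interpret V: abelian_group V using M(2) by (simp add: module_def)
    have iff: "x \<ominus>\<^bsub>V\<^esub> y \<ominus>\<^bsub>V\<^esub> w = \<zero>\<^bsub>V\<^esub> \<longleftrightarrow> x = w \<oplus>\<^bsub>V\<^esub> y" if "x \<in> carrier V" "y \<in> carrier V" "w \<in> carrier V" for x y w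
    proof -
      have "x \<ominus>\<^bsub>V\<^esub> y \<ominus>\<^bsub>V\<^esub> w = x \<ominus>\<^bsub>V\<^esub> (w \<oplus>\<^bsub>V\<^esub> y)"
        using that by (simp add: V.minus_eq V.minus_add V.a_ac)
      then show ?thesis using that M(2) by (simp add: m_sub_zero_iff)
    qed
    have "e (tr P (A\<box>V) V (lact V) t) = lact V (tl (P\<box>A) V A \<delta> (ai P A V t)) \<oplus>\<^bsub>V\<^esub> lact V (tr A (P\<box>V) V e (B P A V t))
      \<longleftrightarrow> ?h ?F (ai P A V t) = \<zero>\<^bsub>V\<^esub>" if t: "t \<in> carrier (P\<box>A\<box>V)" for t
    proof -
      have u: "ai P A V t \<in> carrier ((P\<box>A)\<box>V)" using o t by simp
      have b: "as A P V (tl (P\<box>A) V (A\<box>P) (br P A) (ai P A V t)) = B P A V t" by (simp add: B_def)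
      have "e (tr P (A\<box>V) V (lact V) t) \<in> carrier V" by (intro mor_in[OF em] tm_in[OF mor_id l] P t)
      moreover have "lact V (tl (P\<box>A) V A \<delta> (ai P A V t)) \<in> carrier V" by (intro mor_in[OF l] tm_in[OF dm mor_id] V u)
      moreover have "lact V (tr A (P\<box>V) V e (B P A V t)) \<in> carrier V"
        by (intro mor_in[OF l] tm_in[OF mor_id em] mor_in[OF B_mor] P V A t)
      ultimately show ?thesis unfolding evF[OF u] b using o t by (simp add: iff as_ai)
    qed
    then have "leib P A V (lact V) \<delta> e \<longleftrightarrow> (\<forall>t\<in>carrier (P\<box>A\<box>V). ?h ?F (ai P A V t) = \<zero>\<^bsub>V\<^esub>)"
      by (simp add: leib_def)
    \<comment> \<open>The inverse associator is onto, so it makes no difference on which bracketing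
      the rule is tested.\<close>
    also have "... \<longleftrightarrow> (\<forall>u\<in>carrier ((P\<box>A)\<box>V). ?h ?F u = \<zero>\<^bsub>V\<^esub>)"
    proof
      assume a: "\<forall>t\<in>carrier (P\<box>A\<box>V). ?h ?F (ai P A V t) = \<zero>\<^bsub>V\<^esub>"
      have "?h ?F u = \<zero>\<^bsub>V\<^esub>" if u: "u \<in> carrier ((P\<box>A)\<box>V)" for u
        using bspec[OF a, of "as P A V u"] o u by (simp add: ai_as)
      then show "\<forall>u\<in>carrier ((P\<box>A)\<box>V). ?h ?F u = \<zero>\<^bsub>V\<^esub>" by blast
    qed (use o in simp)
    finally show ?thesis .
  qed
  \<comment> \<open>Evaluation undoes the currying over A.\<close>
  have zc: "ev' A EV (pt k (hom A EV) A (z (g p)) a) = ?F (pt k P A p a)" if p: "p \<in> carrier P" and a: "a \<in> carrier A" for p a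
  proof -
    have gp: "g p \<in> carrier K" by (rule mor_in[OF g p])
    have "ev' A EV (pt k (hom A EV) A (z (g p)) a) = conF V (pt k K A (g p) a)"
      by (rule ev_zeta[OF mor_cong[OF G_mor conF_G] oE(2) A gp a])
    then show ?thesis using M o p a gp mor_lin[OF g] by (simp add: conF_G tmap_pt lin_id del: prod_simps)
  qed
  have pure: "?h ?F (pt k (P\<box>A) V s v) = ev' V V (pt k EV V (?F s) v)"
    if s: "s \<in> carrier (P\<box>A)" and v: "v \<in> carrier V" for s v
    using M s v mor_lin[OF Fm] by (simp add: tmap_pt lin_id del: hom_simps)
  have ev0: "ev' X Y (pt k (hom X Y) X \<zero>\<^bsub>hom X Y\<^esub> x) = \<zero>\<^bsub>Y\<^esub>" if "obj X" "obj Y" "x \<in> carrier X"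
    for X :: "('k, 'h, 'x, 'l) hmod_scheme" and Y :: "('k, 'h, 'y, 'p) hmod_scheme" and x
    using that lin_zero[OF _ _ ev_lin[OF that(1,2)]] by (simp add: pt_zero del: hom_simps)
  show ?thesis unfolding leib
  proof
    assume c: "\<forall>p\<in>carrier P. g p \<in> carrier (con k H A d V)"
    have F0: "?F t = \<zero>\<^bsub>EV\<^esub>" if t: "t \<in> carrier (P\<box>A)" for t
    proof (rule tens_ext_o[OF M(3,1) mor_lin[OF Fm] lin_zerof[OF M(4)] _ t])
      fix p a assume pa: "p \<in> carrier P" "a \<in> carrier A"
      have "z (g p) = \<zero>\<^bsub>hom A EV\<^esub>" using c pa con_carrier by blast
      then show "?F (pt k P A p a) = \<zero>\<^bsub>EV\<^esub>" using zc[OF pa] ev0[OF A oE(1) pa(2)] by simp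
    qed
    show "\<forall>u\<in>carrier ((P\<box>A)\<box>V). ?h ?F u = \<zero>\<^bsub>V\<^esub>"
    proof
      fix u assume u: "u \<in> carrier ((P\<box>A)\<box>V)"
      show "?h ?F u = \<zero>\<^bsub>V\<^esub>"
        by (rule tens_ext_o[OF _ M(2) lin_comp[OF mor_lin[OF tl_mor[OF Fm V]] ev_lin[OF V V]] lin_zerof[OF M(2)] _ u])
          (use M pure F0 ev0[OF V V] in "simp_all del: hom_simps")
    qed
  next
    assume c: "\<forall>u\<in>carrier ((P\<box>A)\<box>V). ?h ?F u = \<zero>\<^bsub>V\<^esub>"
    have F0: "?F s = \<zero>\<^bsub>EV\<^esub>" if s: "s \<in> carrier (P\<box>A)" for s
      by (rule hom_mor_zero[OF Fm V V _ s]) (use c pure in "simp del: hom_simps")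
    have "z (g p) = \<zero>\<^bsub>hom A EV\<^esub>" if p: "p \<in> carrier P" for p
      by (rule hom_mor_zero[OF mor_comp[OF g z_mor] A oE(1) _ p]) (use zc F0 in "simp del: hom_simps")
    then show "\<forall>p\<in>carrier P. g p \<in> carrier (con k H A d V)"
      using mor_in[OF g] by (simp add: con_carrier del: hom_simps prod_simps)
  qed
qed

end
end

section \<open>Leibniz rules on tensor products\<close>

lemma tm_add:
  assumes f: "mor X Y f" "mor X Y f'" and g: "mor W Z g" and t: "t \<in> carrier (X\<box>W)"
  shows "tm X W Y Z (\<lambda>x. f x \<oplus>\<^bsub>Y\<^esub> f' x) g t = tm X W Y Z f g t \<oplus>\<^bsub>Y\<box>Z\<^esub> tm X W Y Z f' g t"
proof (rule tens_ext_o[OF _ _ mor_lin[OF tmap_mor[OF mor_add[OF f] g]] lin_addf[OF _ mor_lin[OF tmap_mor[OF f(1) g]] mor_lin[OF tmap_mor[OF f(2) g]]] _ t])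
  note M = mor_obj[OF f(1), THEN obj_module] mor_obj[OF g, THEN obj_module]
  fix x w assume xw: "x \<in> carrier X" "w \<in> carrier W"
  then show "tm X W Y Z (\<lambda>x. f x \<oplus>\<^bsub>Y\<^esub> f' x) g (pt k X W x w) = tm X W Y Z f g (pt k X W x w) \<oplus>\<^bsub>Y\<box>Z\<^esub> tm X W Y Z f' g (pt k X W x w)"
    using M f[THEN mor_lin] mor_lin[OF mor_add[OF f]] mor_lin[OF g] f[THEN mor_in] mor_in[OF g]
      lin_add[OF lin_pt1_o[OF M(2,4) lin_id], of "g w" "f x" "f' x"] by (simp add: tmap_pt)
qed (use mor_obj[OF f(1), THEN obj_module] mor_obj[OF g, THEN obj_module] in auto)

lemma tm_addr:
  assumes f: "mor X Y f" and g: "mor W Z g" "mor W Z g'" and t: "t \<in> carrier (X\<box>W)"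
  shows "tm X W Y Z f (\<lambda>x. g x \<oplus>\<^bsub>Z\<^esub> g' x) t = tm X W Y Z f g t \<oplus>\<^bsub>Y\<box>Z\<^esub> tm X W Y Z f g' t"
proof (rule tens_ext_o[OF _ _ mor_lin[OF tmap_mor[OF f mor_add[OF g]]] lin_addf[OF _ mor_lin[OF tmap_mor[OF f g(1)]] mor_lin[OF tmap_mor[OF f g(2)]]] _ t])
  note M = mor_obj[OF f, THEN obj_module] mor_obj[OF g(1), THEN obj_module]
  fix x w assume xw: "x \<in> carrier X" "w \<in> carrier W"
  then show "tm X W Y Z f (\<lambda>x. g x \<oplus>\<^bsub>Z\<^esub> g' x) (pt k X W x w) = tm X W Y Z f g (pt k X W x w) \<oplus>\<^bsub>Y\<box>Z\<^esub> tm X W Y Z f g' (pt k X W x w)"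
    using M g[THEN mor_lin] mor_lin[OF mor_add[OF g]] mor_lin[OF f] g[THEN mor_in] mor_in[OF f]
      lin_add[OF lin_pt2_o[OF M(2,4) lin_id], of "f x" "g w" "g' w"] by (simp add: tmap_pt)
qed (use mor_obj[OF f, THEN obj_module] mor_obj[OF g(1), THEN obj_module] in auto)

lemma tm_subr:
  assumes f: "mor X Y f" and g: "mor W Z g" "mor W Z g'" and t: "t \<in> carrier (X\<box>W)"
  shows "tm X W Y Z f (\<lambda>x. g x \<ominus>\<^bsub>Z\<^esub> g' x) t = tm X W Y Z f g t \<ominus>\<^bsub>Y\<box>Z\<^esub> tm X W Y Z f g' t"
proof (rule tens_ext_o[OF _ _ mor_lin[OF tmap_mor[OF f mor_sub[OF g]]] lin_subf[OF _ mor_lin[OF tmap_mor[OF f g(1)]] mor_lin[OF tmap_mor[OF f g(2)]]] _ t])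
  note M = mor_obj[OF f, THEN obj_module] mor_obj[OF g(1), THEN obj_module]
  fix x w assume xw: "x \<in> carrier X" "w \<in> carrier W"
  then show "tm X W Y Z f (\<lambda>x. g x \<ominus>\<^bsub>Z\<^esub> g' x) (pt k X W x w) = tm X W Y Z f g (pt k X W x w) \<ominus>\<^bsub>Y\<box>Z\<^esub> tm X W Y Z f g' (pt k X W x w)"
    using M g[THEN mor_lin] mor_lin[OF mor_sub[OF g]] mor_lin[OF f] g[THEN mor_in] mor_in[OF f]
      lin_sub[OF _ _ lin_pt2_o[OF M(2,4) lin_id], of "f x" "g w" "g' w"] by (simp add: tmap_pt)
qed (use mor_obj[OF f, THEN obj_module] mor_obj[OF g(1), THEN obj_module] in auto)

text \<open>The braiding is symmetric against \<open>I[1]\<close>, through which \<open>\<delta>\<close> factors.\<close>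

lemma swap_derivation:
  assumes s: "mor P (unit_obj k H p) s" and D: "mor (unit_obj k H p\<box>A) A D" and V: "obj V"
    and l: "\<forall>t\<in>carrier (V\<box>A). l (br V A t) = r t" and t: "t \<in> carrier (P\<box>V\<box>A)"
  defines "\<delta> \<equiv> \<lambda>t. D (tl P A (unit_obj k H p) s t)"
  shows "r (tr V (P\<box>A) A \<delta> (B P V A t)) = l (tl (P\<box>A) V A \<delta> (ai P A V (tr P (V\<box>A) (A\<box>V) (br V A) t)))"
proof -
  let ?I = "unit_obj k H p"
  note o = mor_obj(1)[OF s] unit_obj_obj[of p] mor_obj(2)[OF D] V
  note sl = tl_mor[OF s o(3)]
  let ?t = "tl P (V\<box>A) ?I s t" and ?x = "tr P (V\<box>A) (A\<box>V) (br V A) t"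
  have t': "?t \<in> carrier (?I\<box>V\<box>A)" by (rule tm_in[OF s mor_id t]) (use o in simp)
  have x: "?x \<in> carrier (P\<box>A\<box>V)" using o t by (intro MR)
  have b: "B P V A t \<in> carrier (V\<box>P\<box>A)" using o t by (intro mor_in[OF B_mor])
  have b': "B ?I V A ?t \<in> carrier (V\<box>?I\<box>A)" using o t' by (intro mor_in[OF B_mor])
  have 1: "tr V (P\<box>A) A \<delta> (B P V A t) = tr V (?I\<box>A) A D (B ?I V A ?t)"
    unfolding \<delta>_def B_1[OF s V o(3) t] by (rule tr_comp[OF sl D V b, symmetric])
  \<comment> \<open>The second hexagon makes V braid back past I directly after \<open>B\<close> has
    braided I past V; the two cancel by \<open>br_br_I\<close>.\<close>
  have "br V (?I\<box>A) (B ?I V A ?t) = ai ?I A V (tr ?I (V\<box>A) (A\<box>V) (br V A) ?t)"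
  proof -
    let ?u = "ai ?I V A ?t"
    have u: "?u \<in> carrier ((?I\<box>V)\<box>A)" using o t' by simp
    have "tl (V\<box>?I) A (?I\<box>V) (br V ?I) (tl (?I\<box>V) A (V\<box>?I) (br ?I V) ?u) =
       tl (?I\<box>V) A (?I\<box>V) (\<lambda>x. br V ?I (br ?I V x)) ?u" using o by (intro tl_comp MR u)
    also have "... = ?u" using o u by (intro tm_idI) (auto simp: br_br_I)
    finally show ?thesis
      using o b' t' u by (simp add: hexagon2) (simp add: B_def ai_as as_ai MR)
  qed
  then have "r (tr V (?I\<box>A) A D (B ?I V A ?t)) = l (tl (?I\<box>A) V A D (ai ?I A V (tr ?I (V\<box>A) (A\<box>V) (br V A) ?t)))"
    using bspec[OF l tm_in[OF mor_id[OF V] D b']] br_tr[OF D V b'] by simp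
  also have "tr ?I (V\<box>A) (A\<box>V) (br V A) ?t = tl P (A\<box>V) ?I s ?x"
    using o t by (intro tl_tr[OF s, symmetric] MR)
  also have "ai ?I A V ... = tl (P\<box>A) V (?I\<box>A) (tl P A ?I s) (ai P A V ?x)"
    using o x by (intro ai_tl[OF s])
  also have "tl (?I\<box>A) V A D ... = tl (P\<box>A) V A \<delta> (ai P A V ?x)"
    unfolding \<delta>_def by (rule tl_comp[OF sl D V]) (use o x in simp)
  finally show ?thesis by (simp only: 1)
qed

text \<open>By symmetry, v a is the left action after a braiding, so the left rule applies to the
  braided element. The term with e returns to a right action by naturality and the first hexagon. In
  the term with \<delta>, P would have to cross V and return; the hypothesis \<open>d\<close>,
  supplied by \<open>swap_derivation\<close>, says that this changes nothing.\<close>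

lemma leib_right:
  assumes leib: "leib P A V l \<delta> e" and e: "mor (P\<box>V) V e" and l: "mor (A\<box>V) V l" and o: "obj P" "obj V" "obj A"
    and lr: "\<forall>t\<in>carrier (V\<box>A). l (br V A t) = r t"
    and d: "\<And>t. t \<in> carrier (P\<box>V\<box>A) ==>
      r (tr V (P\<box>A) A \<delta> (B P V A t)) = l (tl (P\<box>A) V A \<delta> (ai P A V (tr P (V\<box>A) (A\<box>V) (br V A) t)))"
    and t: "t \<in> carrier (P\<box>V\<box>A)" and dm: "mor (P\<box>A) A \<delta>"
  shows "e (tr P (V\<box>A) V r t) = r (tl (P\<box>V) A V e (ai P V A t)) \<oplus>\<^bsub>V\<^esub> r (tr V (P\<box>A) A \<delta> (B P V A t))"
proof -
  let ?x = "tr P (V\<box>A) (A\<box>V) (br V A) t" and ?u = "ai P V A t"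
  have x: "?x \<in> carrier (P\<box>A\<box>V)" using o t by (intro MR)
  have u: "?u \<in> carrier ((P\<box>V)\<box>A)" using o t by simp
  have "tr P (V\<box>A) V r t = tr P (A\<box>V) V l ?x"
    using tr_comp[OF br_mor[OF o(2,3)] l o(1) t] tr_cong[of "V\<box>A" r "\<lambda>x. l (br V A x)" P V t] lr by simp
  then have 1: "e (tr P (V\<box>A) V r t) = l (tl (P\<box>A) V A \<delta> (ai P A V ?x)) \<oplus>\<^bsub>V\<^esub> l (tr A (P\<box>V) V e (B P A V ?x))"
    using leib x by (simp add: leib_def)
  have "r (tl (P\<box>V) A V e ?u) = l (br V A (tl (P\<box>V) A V e ?u))"
    by (rule bspec[OF lr, symmetric], rule tm_in[OF e mor_id[OF o(3)] u])
  also have "... = l (tr A (P\<box>V) V e (br (P\<box>V) A ?u))" by (simp only: br_tl[OF e o(3) u])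
  \<comment> \<open>The first hexagon splits the braiding of P \<otimes> V with A: the part with V
    is already contained in \<open>?x\<close>, the part with P is \<open>B\<close>.\<close>
  also have "br (P\<box>V) A ?u = B P A V ?x" using o t u by (simp add: hexagon1 B_def as_ai)
  finally have 2: "l (tr A (P\<box>V) V e (B P A V ?x)) = r (tl (P\<box>V) A V e ?u)" by simp
  have "r (tl (P\<box>V) A V e ?u) \<in> carrier V" unfolding 2[symmetric] using o x by (intro mor_in[OF l] tm_in[OF mor_id e] mor_in[OF B_mor])
  moreover have "r (tr V (P\<box>A) A \<delta> (B P V A t)) \<in> carrier V" unfolding d[OF t]
    by (intro mor_in[OF l] tm_in[OF dm mor_id]) (use o x in auto)
  ultimately show ?thesis unfolding 1 2 using d[OF t] o by (simp add: m_comm)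
qed

text \<open>What L \<circledast> 1 + 1 \<circledast> L' becomes after evaluation, in terms of the
  evaluated families e and e'; \<open>ev_bp\<close> makes the connection.\<close>

definition kap where "kap P V W e e' t = tl (P\<box>V) W V e (ai P V W t) \<oplus>\<^bsub>V\<box>W\<^esub> tr V (P\<box>W) W e' (B P V W t)"

lemma kap_mor: "mor (P\<box>V) V e ==> mor (P\<box>W) W e' ==> obj P ==> mor (P\<box>V\<box>W) (V\<box>W) (kap P V W e e')"
  unfolding kap_def[abs_def] using mor_obj(2)[of "P\<box>V" V e] mor_obj(2)[of "P\<box>W" W e']
  by (intro mor_add mor_comp[OF ai_mor tl_mor] mor_comp[OF B_mor tr_mor]) auto

section \<open>Sums of two operators: relations and the Leibniz rule\<close>

context
  fixes P :: "('k, 'h, 'p, 'm1) hmod_scheme" and A :: "('k, 'h, 'a, 'm2) hmod_scheme"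
    and V :: "('k, 'h, 'v, 'm3) hmod_scheme" and W :: "('k, 'h, 'w, 'm4) hmod_scheme"
    and lV rV lW \<delta> eV eW
  assumes o: "obj P" "obj A" "obj V" "obj W"
    and lV: "mor (A\<box>V) V lV" and rV: "mor (V\<box>A) V rV" and lW: "mor (A\<box>W) W lW"
    and d: "mor (P\<box>A) A \<delta>" and eV: "mor (P\<box>V) V eV" and eW: "mor (P\<box>W) W eW"
    and leibV: "leib P A V lV \<delta> eV" and leibW: "leib P A W lW \<delta> eW"
begin

private abbreviation "TT \<equiv> V\<box>W"
private abbreviation "\<kappa> \<equiv> kap P V W eV eW"

private lemma km: "mor (P\<box>TT) TT \<kappa>" by (rule kap_mor[OF eV eW o(1)])

text \<open>A relation is the difference of (v a) \<otimes> w and v \<otimes> (a w). On either half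
  the sum of operators produces three terms, in which v, a or w is hit. On the first half the term
  at a comes from the right rule on V, on the second half from the rule on W; as both contain the
  same \<delta>, the results are the two halves of one relation.\<close>

lemma kap_rel:
  assumes r: "\<And>t. t \<in> carrier (P\<box>V\<box>A) ==>
      eV (tr P (V\<box>A) V rV t) = rV (tl (P\<box>V) A V eV (ai P V A t)) \<oplus>\<^bsub>V\<^esub> rV (tr V (P\<box>A) A \<delta> (B P V A t))"
    and x: "x \<in> carrier (P\<box>(V\<box>A)\<box>W)"
  defines "\<rho> \<equiv> \<lambda>s. tl (V\<box>A) W V rV s \<ominus>\<^bsub>TT\<^esub> tr V (A\<box>W) W lW (as V A W s)"
  shows "\<exists>s\<in>carrier ((V\<box>A)\<box>W). \<kappa> (tr P ((V\<box>A)\<box>W) TT \<rho> x) = \<rho> s"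
proof -
  let ?VA = "V\<box>A" and ?AW = "A\<box>W" and ?PA = "P\<box>A" and ?PV = "P\<box>V" and ?PW = "P\<box>W"
  note MT = obj_module[OF tens_obj[OF o(3,4)]]
  let ?y = "ai P ?VA W x" and ?x = "tr P (?VA\<box>W) (V\<box>?AW) (as V A W) x"
  have y: "?y \<in> carrier ((P\<box>?VA)\<box>W)" using o x by simp
  have x': "?x \<in> carrier (P\<box>V\<box>?AW)" using o x by (intro MR)
  have mB: "mor (P\<box>?VA) (V\<box>?PA) (B P V A)" using o by (intro B_mor)
  let ?f1 = "\<lambda>s. tl ?PV A V eV (ai P V A s)" and ?f2 = "\<lambda>s. tr V ?PA A \<delta> (B P V A s)"
  have f1: "mor (P\<box>?VA) ?VA ?f1" by (intro mor_comp[OF ai_mor tl_mor[OF eV]] o)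
  have f2: "mor (P\<box>?VA) ?VA ?f2" by (intro mor_comp[OF mB tr_mor[OF d]] o)
  \<comment> \<open>The elements in which V, A (through \<delta>) and W are hit; their sum is the
    witness.\<close>
  let ?X1 = "tl (P\<box>?VA) W ?VA ?f1 ?y" and ?X2 = "tl (P\<box>?VA) W ?VA ?f2 ?y" and ?X3 = "tr ?VA ?PW W eW (B P ?VA W x)"
  have X1: "?X1 \<in> carrier (?VA\<box>W)" by (rule tm_in[OF f1 mor_id[OF o(4)] y])
  have X2: "?X2 \<in> carrier (?VA\<box>W)" by (rule tm_in[OF f2 mor_id[OF o(4)] y])
  have bx: "B P ?VA W x \<in> carrier (?VA\<box>?PW)" using o x by (intro mor_in[OF B_mor]) auto
  have X3: "?X3 \<in> carrier (?VA\<box>W)" by (rule tm_in[OF mor_id eW bx]) (use o in simp)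
  let ?L = "tl ?VA W V rV" and ?N = "\<lambda>s. tr V ?AW W lW (as V A W s)"
  have mL: "mor (?VA\<box>W) TT ?L" by (rule tl_mor[OF rV o(4)])
  have mN: "mor (?VA\<box>W) TT ?N" by (intro mor_comp[OF as_mor tr_mor[OF lW]] o)
  have a: "tl ?PV W V eV (ai P V W (tr P (?VA\<box>W) TT ?L x)) = ?L ?X1 \<oplus>\<^bsub>TT\<^esub> ?L ?X2"
  proof -
    have "tl ?PV W V eV (ai P V W (tr P (?VA\<box>W) TT ?L x)) = tl ?PV W V eV (tl (P\<box>?VA) W ?PV (tr P ?VA V rV) ?y)"
      using o x by (simp add: ai_tm[OF rV])
    also have "... = tl (P\<box>?VA) W V (\<lambda>s. eV (tr P ?VA V rV s)) ?y"
      by (rule tl_comp[OF tr_mor[OF rV o(1)] eV o(4) y])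
    also have "... = tl (P\<box>?VA) W V (\<lambda>s. rV (?f1 s) \<oplus>\<^bsub>V\<^esub> rV (?f2 s)) ?y"
      by (rule tl_cong) (rule r)
    also have "... = tl (P\<box>?VA) W V (\<lambda>s. rV (?f1 s)) ?y \<oplus>\<^bsub>TT\<^esub> tl (P\<box>?VA) W V (\<lambda>s. rV (?f2 s)) ?y"
      by (rule tm_add[OF mor_comp[OF f1 rV] mor_comp[OF f2 rV] mor_id[OF o(4)] y])
    finally show ?thesis by (simp only: tl_comp[OF f1 rV o(4) y] tl_comp[OF f2 rV o(4) y])
  qed
  have b: "tr V ?PW W eW (B P V W (tr P (?VA\<box>W) TT ?L x)) = ?L ?X3"
    unfolding B_2[OF rV o(1,4) x] by (rule tl_tr[OF rV eW bx, symmetric])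
  let ?b = "B P V ?AW ?x"
  have b': "?b \<in> carrier (V\<box>P\<box>?AW)" using o x' by (intro mor_in[OF B_mor]) auto
  have N: "tr P (?VA\<box>W) TT ?N x = tr P (V\<box>?AW) TT (tr V ?AW W lW) ?x"
    using o x by (intro tr_comp[symmetric] MR lW)
  have c: "tl ?PV W V eV (ai P V W (tr P (?VA\<box>W) TT ?N x)) = ?N ?X1"
  proof -
    let ?z = "tl (P\<box>?VA) W (?PV\<box>A) (ai P V A) ?y"
    have z: "?z \<in> carrier ((?PV\<box>A)\<box>W)" using o by (intro MR y)
    have "as V A W ?X1 = as V A W (tl (?PV\<box>A) W ?VA (tl ?PV A V eV) ?z)"
      using o y by (subst tl_comp[OF ai_mor tl_mor[OF eV]]) auto
    also have "... = tl ?PV ?AW V eV (as ?PV A W ?z)" by (rule as_tl[OF eV o(2,4) z])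
    also have "as ?PV A W ?z = ai P V ?AW ?x" using pentagon_ai[OF o(1,3,2,4) x] by simp
    finally have "?N ?X1 = tr V ?AW W lW (tl ?PV ?AW V eV (ai P V ?AW ?x))" by simp
    also have "... = tl ?PV W V eV (tr ?PV ?AW W lW (ai P V ?AW ?x))"
      using o x' by (intro tl_tr[OF eV lW, symmetric]) auto
    also have "... = tl ?PV W V eV (ai P V W (tr P (?VA\<box>W) TT ?N x))"
      unfolding N using o x' by (subst ai_tr[OF lW]) auto
    finally show ?thesis by simp
  qed
  let ?g1 = "\<lambda>s. tl ?PA W A \<delta> (ai P A W s)" and ?g2 = "\<lambda>s. tr A ?PW W eW (B P A W s)"
  have g1: "mor (P\<box>?AW) ?AW ?g1" by (intro mor_comp[OF ai_mor tl_mor[OF d]] o)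
  have g2: "mor (P\<box>?AW) ?AW ?g2" by (intro mor_comp[OF B_mor tr_mor[OF eW]] o)
  have e: "tr V ?PW W eW (B P V W (tr P (?VA\<box>W) TT ?N x)) = ?N ?X2 \<oplus>\<^bsub>TT\<^esub> ?N ?X3"
  proof -
    have "tr V ?PW W eW (B P V W (tr P (?VA\<box>W) TT ?N x)) = tr V (P\<box>?AW) W (\<lambda>s. eW (tr P ?AW W lW s)) ?b"
      unfolding N B_3[OF lW o(1,3) x'] by (rule tr_comp[OF tr_mor[OF lW o(1)] eW o(3) b'])
    also have "... = tr V (P\<box>?AW) W (\<lambda>s. lW (?g1 s) \<oplus>\<^bsub>W\<^esub> lW (?g2 s)) ?b"
      by (rule tr_cong) (use leibW in "simp add: leib_def")
    also have "... = tr V (P\<box>?AW) W (\<lambda>s. lW (?g1 s)) ?b \<oplus>\<^bsub>TT\<^esub> tr V (P\<box>?AW) W (\<lambda>s. lW (?g2 s)) ?b"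
      by (rule tm_addr[OF mor_id[OF o(3)] mor_comp[OF g1 lW] mor_comp[OF g2 lW] b'])
    also have "... = tr V ?AW W lW (tr V (P\<box>?AW) ?AW ?g1 ?b) \<oplus>\<^bsub>TT\<^esub> tr V ?AW W lW (tr V (P\<box>?AW) ?AW ?g2 ?b)"
      by (simp only: tr_comp[OF g1 lW o(3) b'] tr_comp[OF g2 lW o(3) b'])
    \<comment> \<open>In the first half \<delta> reaches A inside V \<otimes> A, in the second
      inside A \<otimes> W; \<open>B_assoc1\<close> identifies the two routes.\<close>
    also have "tr V (P\<box>?AW) ?AW ?g1 ?b = as V A W ?X2"
    proof -
      let ?z = "tl (P\<box>?VA) W (V\<box>?PA) (B P V A) ?y"
      have z: "?z \<in> carrier ((V\<box>?PA)\<box>W)" by (rule tm_in[OF mB mor_id[OF o(4)] y])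
      have z': "as V ?PA W ?z \<in> carrier (V\<box>?PA\<box>W)" using o z by simp
      have "tr V (P\<box>?AW) (?PA\<box>W) (ai P A W) ?b = as V ?PA W ?z"
        unfolding B_assoc1[OF o(1,3,2,4) x, symmetric] using o z'
        by (subst tr_comp[OF as_mor ai_mor]) (simp_all add: tm_idI ai_as)
      moreover have "tr V (P\<box>?AW) ?AW ?g1 ?b = tr V (?PA\<box>W) ?AW (tl ?PA W A \<delta>) (tr V (P\<box>?AW) (?PA\<box>W) (ai P A W) ?b)"
        using o b' by (intro tr_comp[OF ai_mor tl_mor[OF d], symmetric])
      moreover have "as V A W ?X2 = tr V (?PA\<box>W) ?AW (tl ?PA W A \<delta>) (as V ?PA W ?z)"
        unfolding tl_comp[OF mB tr_mor[OF d o(3)] o(4) y, symmetric] by (rule as_tm[OF d o(3,4) z])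
      ultimately show ?thesis by simp
    qed
    \<comment> \<open>Likewise the operator on W arrives past V \<otimes> A at once or past V and
      then A, which \<open>B_assoc2\<close> identifies.\<close>
    also have "tr V (P\<box>?AW) ?AW ?g2 ?b = as V A W ?X3"
      unfolding as_tr[OF eW o(3,2) bx] B_assoc2[OF o(1,3,2,4) x]
      using o b' by (intro tr_comp[OF B_mor tr_mor[OF eW], symmetric])
    finally show ?thesis .
  qed
  let ?s = "?X1 \<oplus>\<^bsub>?VA\<box>W\<^esub> ?X2 \<oplus>\<^bsub>?VA\<box>W\<^esub> ?X3"
  have MS: "module k (?VA\<box>W)" using o by simp
  note in1 = mor_in[OF mL X1] mor_in[OF mL X2] mor_in[OF mL X3] mor_in[OF mN X1] mor_in[OF mN X2] mor_in[OF mN X3]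
  have kL: "\<kappa> (tr P (?VA\<box>W) TT ?L x) = ?L ?s"
    using MS X1 X2 X3 by (simp add: kap_def a b lin_add[OF mor_lin[OF mL]])
  have kN: "\<kappa> (tr P (?VA\<box>W) TT ?N x) = ?N ?s"
    using MS MT X1 X2 X3 in1 by (simp only: kap_def c e lin_add[OF mor_lin[OF mN]] m_add m_assoc)
  have "\<kappa> (tr P (?VA\<box>W) TT \<rho> x) = \<kappa> (tr P (?VA\<box>W) TT ?L x) \<ominus>\<^bsub>TT\<^esub> \<kappa> (tr P (?VA\<box>W) TT ?N x)"
    unfolding \<rho>_def tm_subr[OF mor_id[OF o(1)] mL mN x]
    using o tm_in[OF mor_id[OF o(1)] mL x] tm_in[OF mor_id[OF o(1)] mN x] by (intro lin_sub[OF _ _ mor_lin[OF km]]) auto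
  then have "\<kappa> (tr P (?VA\<box>W) TT \<rho> x) = \<rho> ?s" unfolding kL kN \<rho>_def .
  moreover have "?s \<in> carrier (?VA\<box>W)" using MS X1 X2 X3 by simp
  ultimately show ?thesis by blast
qed

text \<open>Again three terms. Those at a and at v come from the rule on V. The operator on W
  crosses A \<otimes> V as a block on one side, and A and then V on the other; the pentagon and
  \<open>B_through_tensor\<close> match the terms.\<close>

lemma kap_leib:
  shows "leib P A TT (\<lambda>s. tl (A\<box>V) W V lV (ai A V W s)) \<delta> \<kappa>"
  unfolding leib_def
proof
  let ?VW = "V\<box>W" and ?AV = "A\<box>V" and ?PA = "P\<box>A" and ?PV = "P\<box>V" and ?PW = "P\<box>W"
  let ?l = "\<lambda>s. tl ?AV W V lV (ai A V W s)"
  note MT = obj_module[OF tens_obj[OF o(3,4)]]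
  fix t assume t: "t \<in> carrier (P\<box>A\<box>TT)"
  \<comment> \<open>Rebracketed so that A \<otimes> V, through which A acts on V \<otimes> W,
    becomes a block.\<close>
  let ?x = "tr P (A\<box>TT) (?AV\<box>W) (ai A V W) t"
  have x: "?x \<in> carrier (P\<box>?AV\<box>W)" using o t by (intro MR)
  have xt: "tr P (?AV\<box>W) (A\<box>TT) (as A V W) ?x = t"
    using o t by (subst tr_comp[OF ai_mor as_mor]) (simp_all add: tm_idI as_ai)
  let ?y = "ai P ?AV W ?x" and ?L = "tl ?AV W V lV"
  have y: "?y \<in> carrier ((P\<box>?AV)\<box>W)" using o x by simp
  have bx: "B P ?AV W ?x \<in> carrier (?AV\<box>?PW)" using o x by (intro mor_in[OF B_mor]) auto
  have mL: "mor (?AV\<box>W) TT ?L" by (rule tl_mor[OF lV o(4)])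
  have mB: "mor (P\<box>?AV) (A\<box>?PV) (B P A V)" using o by (intro B_mor)
  have lt: "tr P (A\<box>TT) TT ?l t = tr P (?AV\<box>W) TT ?L ?x"
    using o t by (intro tr_comp[symmetric] mL MR)
  let ?f1 = "\<lambda>s. tl ?PA V A \<delta> (ai P A V s)" and ?f2 = "\<lambda>s. tr A ?PV V eV (B P A V s)"
  have f1: "mor (P\<box>?AV) ?AV ?f1" by (intro mor_comp[OF ai_mor tl_mor[OF d]] o)
  have f2: "mor (P\<box>?AV) ?AV ?f2" by (intro mor_comp[OF mB tr_mor[OF eV]] o)
  let ?X1 = "tl (P\<box>?AV) W ?AV ?f1 ?y" and ?X2 = "tl (P\<box>?AV) W ?AV ?f2 ?y" and ?X3 = "tr ?AV ?PW W eW (B P ?AV W ?x)"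
  have X1: "?X1 \<in> carrier (?AV\<box>W)" by (rule tm_in[OF f1 mor_id[OF o(4)] y])
  have X2: "?X2 \<in> carrier (?AV\<box>W)" by (rule tm_in[OF f2 mor_id[OF o(4)] y])
  have X3: "?X3 \<in> carrier (?AV\<box>W)" by (rule tm_in[OF mor_id eW bx]) (use o in simp)
  have a: "tl ?PV W V eV (ai P V W (tr P (?AV\<box>W) TT ?L ?x)) = ?L ?X1 \<oplus>\<^bsub>TT\<^esub> ?L ?X2"
  proof -
    have "tl ?PV W V eV (ai P V W (tr P (?AV\<box>W) TT ?L ?x)) = tl (P\<box>?AV) W V (\<lambda>s. eV (tr P ?AV V lV s)) ?y"
      unfolding ai_tm[OF lV o(1,4) x] by (rule tl_comp[OF tr_mor[OF lV o(1)] eV o(4) y])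
    also have "... = tl (P\<box>?AV) W V (\<lambda>s. lV (?f1 s) \<oplus>\<^bsub>V\<^esub> lV (?f2 s)) ?y"
      by (rule tl_cong) (use leibV in "simp add: leib_def")
    also have "... = tl (P\<box>?AV) W V (\<lambda>s. lV (?f1 s)) ?y \<oplus>\<^bsub>TT\<^esub> tl (P\<box>?AV) W V (\<lambda>s. lV (?f2 s)) ?y"
      by (rule tm_add[OF mor_comp[OF f1 lV] mor_comp[OF f2 lV] mor_id[OF o(4)] y])
    finally show ?thesis by (simp only: tl_comp[OF f1 lV o(4) y] tl_comp[OF f2 lV o(4) y])
  qed
  have b: "tr V ?PW W eW (B P V W (tr P (?AV\<box>W) TT ?L ?x)) = ?L ?X3"
    unfolding B_2[OF lV o(1,4) x] by (rule tl_tr[OF lV eW bx, symmetric])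
  have l1: "?l (tl ?PA TT A \<delta> (ai P A TT t)) = ?L ?X1"
  proof -
    let ?z = "tl (P\<box>?AV) W (?PA\<box>V) (ai P A V) ?y"
    have z: "?z \<in> carrier ((?PA\<box>V)\<box>W)" using o by (intro MR y)
    have "ai P A TT t = as ?PA V W ?z" using pentagon_ai[OF o(1,2,3,4) x] xt by simp
    then have "ai A V W (tl ?PA TT A \<delta> (ai P A TT t)) = tl (?PA\<box>V) W ?AV (tl ?PA V A \<delta>) ?z"
      using o z by (simp add: ai_tl[OF d] ai_as)
    also have "... = ?X1" using o y by (intro tl_comp[OF ai_mor tl_mor[OF d]])
    finally show ?thesis by simp
  qed
  let ?b = "B P A TT t"
  have b': "?b \<in> carrier (A\<box>P\<box>TT)" using o t by (intro mor_in[OF B_mor]) auto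
  let ?g1 = "\<lambda>s. tl ?PV W V eV (ai P V W s)" and ?g2 = "\<lambda>s. tr V ?PW W eW (B P V W s)"
  have g1: "mor (P\<box>TT) TT ?g1" by (intro mor_comp[OF ai_mor tl_mor[OF eV]] o)
  have g2: "mor (P\<box>TT) TT ?g2" by (intro mor_comp[OF B_mor tr_mor[OF eW]] o)
  have k: "tr A (P\<box>TT) TT \<kappa> ?b = tr A (P\<box>TT) TT ?g1 ?b \<oplus>\<^bsub>A\<box>TT\<^esub> tr A (P\<box>TT) TT ?g2 ?b"
    unfolding kap_def[abs_def] by (rule tm_addr[OF mor_id[OF o(2)] g1 g2 b'])
  have k1: "ai A V W (tr A (P\<box>TT) TT ?g1 ?b) = ?X2"
  proof -
    let ?z = "tl (P\<box>?AV) W (A\<box>?PV) (B P A V) ?y"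
    have z: "?z \<in> carrier ((A\<box>?PV)\<box>W)" by (rule tm_in[OF mB mor_id[OF o(4)] y])
    have z': "as A ?PV W ?z \<in> carrier (A\<box>?PV\<box>W)" using o z by simp
    have "tr A (P\<box>TT) (?PV\<box>W) (ai P V W) ?b = tr A (P\<box>TT) (?PV\<box>W) (ai P V W) (tr A (?PV\<box>W) (P\<box>TT) (as P V W) (as A ?PV W ?z))"
      unfolding B_assoc1[OF o(1,2,3,4) x] xt ..
    also have "... = as A ?PV W ?z" using o z' by (subst tr_comp[OF as_mor ai_mor]) (simp_all add: tm_idI ai_as)
    finally have "tr A (P\<box>TT) TT ?g1 ?b = tr A (?PV\<box>W) TT (tl ?PV W V eV) (as A ?PV W ?z)"
      using o b' tr_comp[OF ai_mor tl_mor[OF eV o(4)] o(2) b'] by simp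
    then have "ai A V W (tr A (P\<box>TT) TT ?g1 ?b) = tl (A\<box>?PV) W ?AV (tr A ?PV V eV) ?z"
      using o z by (simp add: ai_tm[OF eV] ai_as)
    also have "... = ?X2" by (rule tl_comp[OF mB tr_mor[OF eV o(2)] o(4) y])
    finally show ?thesis .
  qed
  have k2: "ai A V W (tr A (P\<box>TT) TT ?g2 ?b) = ?X3"
  proof -
    have "tr A (P\<box>TT) TT ?g2 ?b = tr A (V\<box>?PW) TT (tr V ?PW W eW) (tr A (P\<box>TT) (V\<box>?PW) (B P V W) ?b)"
      using o b' by (intro tr_comp[OF B_mor tr_mor[OF eW], symmetric])
    also have "tr A (P\<box>TT) (V\<box>?PW) (B P V W) ?b = as A V ?PW (B P ?AV W ?x)"
      unfolding B_assoc2[OF o(1,2,3,4) x] xt ..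
    finally show ?thesis using o bx by (simp add: ai_tr[OF eW] ai_as)
  qed
  have gi: "tr A (P\<box>TT) TT ?g1 ?b \<in> carrier (A\<box>TT)" "tr A (P\<box>TT) TT ?g2 ?b \<in> carrier (A\<box>TT)"
    by (intro tm_in[OF mor_id[OF o(2)]] g1 g2 b')+
  have l2: "?l (tr A (P\<box>TT) TT \<kappa> ?b) = ?L ?X2 \<oplus>\<^bsub>TT\<^esub> ?L ?X3"
    unfolding k using o gi X2 X3 by (simp add: lin_add[OF ai_lin] k1 k2 lin_add[OF mor_lin[OF mL]])
  have "\<kappa> (tr P (A\<box>TT) TT ?l t) = ?L ?X1 \<oplus>\<^bsub>TT\<^esub> ?L ?X2 \<oplus>\<^bsub>TT\<^esub> ?L ?X3"
    unfolding lt kap_def a b ..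
  also have "... = ?L ?X1 \<oplus>\<^bsub>TT\<^esub> (?L ?X2 \<oplus>\<^bsub>TT\<^esub> ?L ?X3)"
    using MT mor_in[OF mL X1] mor_in[OF mL X2] mor_in[OF mL X3] by (simp add: m_assoc)
  finally show "\<kappa> (tr P (A\<box>TT) TT ?l t) = ?l (tl ?PA TT A \<delta> (ai P A TT t)) \<oplus>\<^bsub>TT\<^esub> ?l (tr A (P\<box>TT) TT \<kappa> ?b)"
    unfolding l1 l2 .
qed

end

section \<open>The tensor product over the algebra\<close>

lemma pair_mor:
  assumes f: "mor P X f" and g: "mor P Y g"
  shows "mor P (prod_obj X Y) (\<lambda>p. (f p, g p))"
  using mor_obj[OF f] mor_obj[OF g] mor_in[OF f] mor_in[OF g] mor_lin[OF f] mor_lin[OF g]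
  by (auto simp: mor_def mor_gr[OF f] mor_gr[OF g] mor_act[OF f] mor_act[OF g] linear_on_def)

context
  fixes A :: "('k, 'h, 'a) halg" and V :: "('k, 'h, 'a, 'v) hbimod" and W :: "('k, 'h, 'a, 'w) hbimod"
  assumes A: "obj A" and V: "obj V" and W: "obj W"
    and lV: "mor (A\<box>V) V (lact V)" and rV: "mor (V\<box>A) V (ract V)" and lW: "mor (A\<box>W) W (lact W)"
    and bV: "\<forall>t\<in>carrier ((A\<box>V)\<box>A).
        ract V (tl (A\<box>V) A V (lact V) t) = lact V (tr A (V\<box>A) V (ract V) (as A V A t))"
begin

private abbreviation "VW \<equiv> V\<box>W"
private abbreviation "N \<equiv> tensor_A_rel k H A V W"
private abbreviation "pj \<equiv> tensor_A_proj k H A V W"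
private abbreviation "Q \<equiv> tensor_A k H A V W"
private abbreviation "S \<equiv> (V\<box>A)\<box>W"
private abbreviation "lT \<equiv> (\<lambda>s. tl (A\<box>V) W V (lact V) (ai A V W s))"
private abbreviation "\<rho> \<equiv> (\<lambda>s. tl (V\<box>A) W V (ract V) s \<ominus>\<^bsub>VW\<^esub> tr V (A\<box>W) W (lact W) (as V A W s))"

private lemma N_image: "N = \<rho> ` carrier S" by (simp add: tensor_A_rel_def)

private lemma oT: "obj VW" "obj S" using A V W by auto
private lemmas MT = oT[THEN obj_module]

private lemma \<rho>: "mor S VW \<rho>"
  by (intro mor_sub tl_mor[OF rV W] mor_comp[OF as_mor tr_mor[OF lW]] A V W)

private lemma lT: "mor (A\<box>VW) VW lT"
  by (intro mor_comp[OF ai_mor tl_mor[OF lV]] A V W)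

text \<open>The relations are the image of a morphism, so they already form a submodule; stability
  under H and under taking components is inherited in the same way below.\<close>

lemma rel_submod: "submodule N k VW"
  unfolding N_image by (rule submod_image[OF MT(2,1) mor_lin[OF \<rho>]])

lemma rel_in: "n \<in> N ==> n \<in> carrier VW"
  by (rule subsetD[OF conjunct1[OF rel_submod[unfolded submod_iff[OF MT(1)]]]])

lemma rel_act:
  assumes h: "h \<in> carrier H" and n: "n \<in> N"
  shows "act VW h n \<in> N"
proof -
  obtain s where s: "s \<in> carrier S" "n = \<rho> s" using n unfolding N_image by blast
  show ?thesis unfolding s(2) mor_act[OF \<rho> h s(1), symmetric] N_image using oT h s by simp
qed

lemma rel_hcomp:
  assumes n: "n \<in> N"
  shows "hcomp VW n i \<in> N"
proof -
  obtain s where s: "s \<in> carrier S" "n = \<rho> s" using n unfolding N_image by blast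
  show ?thesis unfolding s(2) mor_hcomp[OF \<rho> s(1), symmetric] N_image using lin_closed[OF hcomp_lin[OF oT(2)] s(1)] by simp
qed

text \<open>By the bimodule axiom the left and the right action on V commute up to brackets, so a
  times the relation for v, a', w is the relation for a v, a', w.\<close>

lemma rel_lT:
  assumes a: "a \<in> carrier A" and n: "n \<in> N"
  shows "lT (pt k A VW a n) \<in> N"
proof -
  obtain s where s: "s \<in> carrier S" "n = \<rho> s" using n unfolding N_image by blast
  let ?x = "pt k A S a s" and ?AV = "A\<box>V" and ?VA = "V\<box>A" and ?AW = "A\<box>W"
  have x: "?x \<in> carrier (A\<box>S)" using a s by simp
  let ?y = "ai A ?VA W ?x"
  have y: "?y \<in> carrier ((A\<box>?VA)\<box>W)" using A V W x by simp
  let ?L = "tl ?VA W V (ract V)" and ?N = "\<lambda>s. tr V ?AW W (lact W) (as V A W s)"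
  have mL: "mor S VW ?L" by (rule tl_mor[OF rV W])
  have mN: "mor S VW ?N" by (intro mor_comp[OF as_mor tr_mor[OF lW]] A V W)
  have n': "pt k A VW a n = tr A S VW \<rho> ?x"
    using MT A a s mor_lin[OF \<rho>] by (simp add: tmap_pt lin_id)
  have f: "mor (A\<box>?VA) ?VA (\<lambda>s. tl ?AV A V (lact V) (ai A V A s))"
    by (intro mor_comp[OF ai_mor tl_mor[OF lV]] A V)
  let ?X = "tl (A\<box>?VA) W ?VA (\<lambda>s. tl ?AV A V (lact V) (ai A V A s)) ?y"
  have X: "?X \<in> carrier S" by (rule tm_in[OF f mor_id[OF W] y])
  have "lT (tr A S VW ?L ?x) = tl ?AV W V (lact V) (tl (A\<box>?VA) W ?AV (tr A ?VA V (ract V)) ?y)"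
    using A V W x by (simp add: ai_tm[OF rV])
  also have "... = tl (A\<box>?VA) W V (\<lambda>s. lact V (tr A ?VA V (ract V) s)) ?y"
    by (rule tl_comp[OF tr_mor[OF rV A] lV W y])
  also have "... = tl (A\<box>?VA) W V (\<lambda>s. ract V (tl ?AV A V (lact V) (ai A V A s))) ?y"
    using A V by (intro tl_cong) (simp add: bV as_ai)
  also have "... = ?L ?X" by (rule tl_comp[OF f rV W y, symmetric])
  finally have 1: "lT (tr A S VW ?L ?x) = ?L ?X" .
  let ?x' = "tr A S (V\<box>?AW) (as V A W) ?x" and ?z = "tl (A\<box>?VA) W (?AV\<box>A) (ai A V A) ?y"
  have x': "?x' \<in> carrier (A\<box>V\<box>?AW)" using A V W x by (intro MR)
  have z: "?z \<in> carrier ((?AV\<box>A)\<box>W)" using A V W by (intro MR y)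
  have "lT (tr A S VW ?N ?x) = lT (tr A (V\<box>?AW) VW (tr V ?AW W (lact W)) ?x')"
    using A V W x by (subst tr_comp[OF as_mor tr_mor[OF lW]]) auto
  also have "... = tl ?AV W V (lact V) (tr ?AV ?AW W (lact W) (ai A V ?AW ?x'))"
    using A V x' by (simp add: ai_tr[OF lW])
  also have "... = tr V ?AW W (lact W) (tl ?AV ?AW V (lact V) (ai A V ?AW ?x'))"
    using A V W x' by (intro tl_tr[OF lV lW]) auto
  also have "tl ?AV ?AW V (lact V) (ai A V ?AW ?x') = as V A W (tl (?AV\<box>A) W ?VA (tl ?AV A V (lact V)) ?z)"
    unfolding pentagon_ai[OF A V A W x] by (rule as_tl[OF lV A W z, symmetric])
  also have "tl (?AV\<box>A) W ?VA (tl ?AV A V (lact V)) ?z = ?X"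
    using A V W y by (intro tl_comp[OF ai_mor tl_mor[OF lV]])
  finally have 2: "lT (tr A S VW ?N ?x) = ?N ?X" .
  have "lT (tr A S VW \<rho> ?x) = lT (tr A S VW ?L ?x) \<ominus>\<^bsub>VW\<^esub> lT (tr A S VW ?N ?x)"
    unfolding tm_subr[OF mor_id[OF A] mL mN x]
    using A oT tm_in[OF mor_id[OF A] mL x] tm_in[OF mor_id[OF A] mN x] by (intro lin_sub[OF _ _ mor_lin[OF lT]]) auto
  then have "lT (pt k A VW a n) = \<rho> ?X" unfolding n' 1 2 .
  then show ?thesis using X unfolding N_image by blast
qed

private abbreviation "Q0 \<equiv> quot_mod VW N"

private lemma Q_eqs: "carrier Q = carrier Q0" "add Q = add Q0" "zero Q = zero Q0" "smult Q = smult Q0"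
  by (simp_all add: tensor_A_def Let_def)

private lemma Q_gr: "gr Q n = pj ` gr VW n"
  by (simp add: tensor_A_def Let_def)

lemma Q_carrier: "carrier Q = pj ` carrier VW"
  by (simp add: Q_eqs rcosets_image tensor_A_proj_def image_def)

private lemma pj_N: "n \<in> N ==> pj n = \<zero>\<^bsub>Q\<^esub>"
  using coset_eq_iff[OF MT(1) rel_submod, of n "\<zero>\<^bsub>VW\<^esub>"] quot_zero[OF MT(1) rel_submod] rel_in[of n] MT(1)
  by (simp add: tensor_A_proj_def Q_eqs m_sub_eq)

private lemma linQ: "linear_on k Y Q0 = linear_on k Y Q" "linear_on k Q0 Y = linear_on k Q Y"
  by (intro linear_on_cong; simp add: Q_eqs)+

private lemma desc:
  assumes "module k Y" "lin VW Y g" "\<And>n. n \<in> N ==> g n = \<zero>\<^bsub>Y\<^esub>"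
  shows "lin Q Y (tensor_A_desc k H A V W g)" "t \<in> carrier VW ==> tensor_A_desc k H A V W g (pj t) = g t"
  using quot_map_lin[OF MT(1) rel_submod assms] unfolding linQ tensor_A_desc_def tensor_A_proj_def by auto

lemma tensor_A_props:
  shows tensor_A_obj: "obj Q" and proj_mor: "mor VW Q pj"
proof -
  have p: "lin VW Q0 pj" unfolding tensor_A_proj_def[abs_def] by (rule quot_proj_lin[OF MT(1) rel_submod])
  have M0: "module k Q0" by (rule quot_module[OF MT(1) rel_submod])
  have "act Q h (pj t) = pj (act VW h t)" if h: "h \<in> carrier H" and t: "t \<in> carrier VW" for h t
  proof -
    have "tensor_A_desc k H A V W (\<lambda>t. pj (act VW h t)) (pj t) = pj (act VW h t)"
      by (rule desc(2)[OF M0 lin_comp[OF act_lin p] _ t]) (use oT h rel_act[OF h] in "simp_all add: pj_N Q_eqs")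
    then show ?thesis by (simp add: tensor_A_def Let_def)
  qed
  note q = quotient_obj[OF oT(1) rel_submod rel_act rel_hcomp Q_eqs this[unfolded tensor_A_proj_def] Q_gr[unfolded tensor_A_proj_def[abs_def]]]
  show "obj Q" by (rule q(1))
  show "mor VW Q pj" unfolding tensor_A_proj_def[abs_def] by (rule q(2))
qed

private lemmas MQ = obj_module[OF tensor_A_obj]

text \<open>The projection is onto, so every property is checked on images of elements of V
  \<otimes> W, where it holds for the action on the first factor.\<close>

lemma lact_tensor_A:
  shows lactQ_mor: "mor (A\<box>Q) Q (lact Q)" (is ?g2)
    and lactQ_proj: "s \<in> carrier (A\<box>VW) ==> lact Q (tr A VW Q pj s) = pj (lT s)" (is "PROP ?g1")
proof -
  let ?b = "\<lambda>a. tensor_A_desc k H A V W (\<lambda>t. pj (lT (pt k A VW a t)))"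
  note MA = obj_module[OF A]
  note pl = mor_comp[OF lT proj_mor, THEN mor_lin]
  have b: "lin Q Q (?b a)" "t \<in> carrier VW ==> ?b a (pj t) = pj (lT (pt k A VW a t))" if a: "a \<in> carrier A" for a t
    by (rule desc[OF MQ lin_comp[OF lin_pt2_o[OF MA MT(1) lin_id a] pl]], rule pj_N, rule rel_lT[OF a], assumption+)+
  have bil: "bil A Q Q ?b"
  proof (rule bilI)
    fix q assume "q \<in> carrier Q"
    then obtain t where t: "t \<in> carrier VW" "q = pj t" unfolding Q_carrier by blast
    show "lin A Q (\<lambda>a. ?b a q)"
      by (subst lin_cong[where g = "\<lambda>a. pj (lT (pt k A VW a t))"])
        (use t b MA in "auto intro!: lin_comp[OF lin_pt1_o[OF MA MT(1) lin_id t(1)] pl]")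
  qed (rule b)
  have lQ: "lact Q = bilift k A Q Q ?b"
    by (subst bilift_mod_cong[of A A Q Q0 Q Q0]) (simp_all add: Q_eqs, simp add: tensor_A_def Let_def)
  have l: "lin (A\<box>Q) Q (lact Q)" unfolding lQ by (rule bilift_lin_o[OF MA MQ MQ bil])
  have lp: "lact Q (tr A VW Q pj s) = pj (lT s)" if s: "s \<in> carrier (A\<box>VW)" for s
    by (rule tens_ext_o[OF MA MT(1) lin_comp[OF mor_lin[OF tr_mor[OF proj_mor A]] l] pl _ s])
      (use MA MT MQ mor_lin[OF proj_mor] mor_in[OF proj_mor] bilift_pt[OF MA MQ MQ bil] b in "simp add: tmap_pt lin_id lQ")
  have pure: "pt k A Q a (pj t) = tr A VW Q pj (pt k A VW a t)" if "a \<in> carrier A" "t \<in> carrier VW" for a t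
    using that MA MT MQ mor_lin[OF proj_mor] by (simp add: tmap_pt lin_id)
  have "lact Q (act (A\<box>Q) h u) = act Q h (lact Q u)" if h: "h \<in> carrier H" and u: "u \<in> carrier (A\<box>Q)" for h u
  proof (rule tens_ext_o[OF MA MQ lin_comp[OF act_lin l] lin_comp[OF l act_lin] _ u])
    fix a q assume a: "a \<in> carrier A" and "q \<in> carrier Q"
    then obtain t where t: "t \<in> carrier VW" "q = pj t" unfolding Q_carrier by blast
    let ?u = "pt k A VW a t"
    have u: "?u \<in> carrier (A\<box>VW)" using a t by simp
    show "lact Q (act (A\<box>Q) h (pt k A Q a q)) = act Q h (lact Q (pt k A Q a q))"
      unfolding t(2) pure[OF a t(1)] using u h A oT mor_act[OF mor_comp[OF lT proj_mor] h u]
      by (simp add: mor_act[OF tr_mor[OF proj_mor A] h u, symmetric] lp)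
  qed (use h A tensor_A_obj in auto)
  moreover have "lact Q u \<in> gr Q n" if u: "u \<in> gr (A\<box>Q) n" for u n
  proof (rule tens_gr_lin[OF A tensor_A_obj MQ l gr_submod[OF tensor_A_obj] _ u])
    fix a q i j assume a: "a \<in> gr A i" and q: "q \<in> gr Q j" and ij: "i + j = n"
    obtain t where t: "t \<in> gr VW j" "q = pj t" using q unfolding Q_gr by blast
    have c: "a \<in> carrier A" "t \<in> carrier VW" using gr_in[OF A a] gr_in[OF oT(1) t(1)] by auto
    have "pt k A VW a t \<in> gr (A\<box>VW) n" using tens_gr_pt[OF A oT(1) a t(1)] ij by simp
    then show "lact Q (pt k A Q a q) \<in> gr Q n" unfolding t(2) pure[OF c]
      using lp[of "pt k A VW a t"] c mor_gr[OF mor_comp[OF lT proj_mor]] by simp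
  qed
  ultimately show ?g2 using A tensor_A_obj l by (simp add: mor_def)
  show "PROP ?g1" by (rule lp)
qed

text \<open>The projection is an equivariant surjection that preserves degrees, so it transports
  each ingredient of the internal hom; the descended family inherits linearity, degree and
  equivariance from b.\<close>

lemma desc_mor:
  assumes b: "mor P (hom VW VW) b" and n: "\<And>p n. p \<in> carrier P ==> n \<in> N ==> b p n \<in> N"
  defines "c \<equiv> \<lambda>p. tensor_A_desc k H A V W (\<lambda>t. pj (b p t))"
  shows "mor P (hom Q Q) c" and "p \<in> carrier P ==> t \<in> carrier VW ==> c p (pj t) = pj (b p t)" (is "PROP ?g1")
proof -
  note P = mor_obj(1)[OF b] and oQ = tensor_A_obj
  have bL: "b p \<in> Lin k VW VW" if "p \<in> carrier P" for p using mor_in[OF b that] by simp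
  have c: "lin Q Q (c p)" "t \<in> carrier VW ==> c p (pj t) = pj (b p t)" if p: "p \<in> carrier P" for p t
    unfolding c_def by (rule desc[OF MQ lin_comp[OF Lin_lin[OF bL[OF p]] mor_lin[OF proj_mor]]], rule pj_N, rule n[OF p], assumption+)+
  then show "PROP ?g1" by blast
  \<comment> \<open>\<open>quot_map\<close> is restricted to the set of cosets, which gives the
    extensionality demanded by \<open>Lin\<close>.\<close>
  have cL: "c p \<in> Lin k Q Q" if "p \<in> carrier P" for p
    using c(1)[OF that] unfolding Lin_iff by (simp add: c_def tensor_A_desc_def quot_map_def Q_eqs(1))
  have l: "lin P (hom Q Q) c"
  proof (rule lin_homI[OF MQ MQ cL _ obj_module[OF P]])
    fix q assume "q \<in> carrier Q"
    then obtain t where t: "t \<in> carrier VW" "q = pj t" unfolding Q_carrier by blast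
    show "lin P Q (\<lambda>p. c p q)"
      by (subst lin_cong[where g = "\<lambda>p. pj (b p t)"])
        (use t c P in "auto intro!: lin_comp[OF lin_hom_pt[OF mor_lin[OF b] t(1)] mor_lin[OF proj_mor]]")
  qed
  have "c (act P h p) = act (hom Q Q) h (c p)" if h: "h \<in> carrier H" and p: "p \<in> carrier P" for h p
  proof (rule Lin_eqI[OF cL hom_act_Lin[OF oQ oQ h cL[OF p]]])
    show hp: "act P h p \<in> carrier P" using P h p by simp
    fix q assume q: "q \<in> carrier Q"
    then obtain t where t: "t \<in> carrier VW" "q = pj t" unfolding Q_carrier by blast
    have "c (act P h p) q = pj (act (hom VW VW) h (b p) t)"
      unfolding t(2) c(2)[OF hp t(1)] mor_act[OF b h p] ..
    also have "... = L2 Q (\<lambda>x y. pj (act VW x (b p (act VW (antip H y) t)))) (comul H h)"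
      unfolding hom_act_pt[OF t(1)]
      by (rule L2_push[OF MT(1) MQ hom_act_bil[OF oT(1) oT(1) bL[OF p] t(1)] mor_lin[OF proj_mor]]) (use h in simp)
    also have "... = L2 Q (\<lambda>x y. act Q x (c p (act Q (antip H y) (pj t)))) (comul H h)"
    proof (rule L2_cong)
      fix x y assume xy: "x \<in> carrier H" "y \<in> carrier H"
      let ?u = "act VW (antip H y) t"
      have u: "?u \<in> carrier VW" using oT t xy by simp
      show "pj (act VW x (b p ?u)) = act Q x (c p (act Q (antip H y) (pj t)))"
        unfolding mor_act[OF proj_mor S_in[OF xy(2)] t(1), symmetric] c(2)[OF p u]
        by (rule mor_act[OF proj_mor xy(1) Lin_in[OF bL[OF p] u]])
    qed
    also have "... = act (hom Q Q) h (c p) q" unfolding hom_act_pt[OF q] unfolding t(2) ..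
    finally show "c (act P h p) q = act (hom Q Q) h (c p) q" .
  qed
  moreover have "c p \<in> gr (hom Q Q) n" if p: "p \<in> gr P n" for p n
  proof -
    have pc: "p \<in> carrier P" using gr_in[OF P p] .
    have bg: "t \<in> gr VW m ==> b p t \<in> gr VW (m + n)" for t m using mor_gr[OF b p] by simp
    have "c p q \<in> gr Q (m + n)" if q: "q \<in> gr Q m" for q m
    proof -
      obtain t where t: "t \<in> gr VW m" "q = pj t" using q unfolding Q_gr by blast
      show ?thesis unfolding t(2) c(2)[OF pc gr_in[OF oT(1) t(1)]] by (rule mor_gr[OF proj_mor bg[OF t(1)]])
    qed
    then show ?thesis using cL[OF pc] by simp
  qed
  ultimately show "mor P (hom Q Q) c" using P oQ l by (simp add: mor_def del: hom_simps)
qed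

text \<open>Evaluation is built from actions and one application of the operator, and the projection
  is compatible with both.\<close>

lemma ev_desc:
  assumes b: "mor P (hom VW VW) b" and c: "mor P (hom Q Q) c"
    and cb: "\<And>p t. p \<in> carrier P ==> t \<in> carrier VW ==> c p (pj t) = pj (b p t)"
    and p: "p \<in> carrier P" and t: "t \<in> carrier VW"
  shows "ev' Q Q (pt k (hom Q Q) Q (c p) (pj t)) = pj (ev' VW VW (pt k (hom VW VW) VW (b p) t))"
proof -
  have L: "b p \<in> Lin k VW VW" "c p \<in> Lin k Q Q" using mor_in[OF b p] mor_in[OF c p] by simp_all
  have "pj (eF VW VW (b p) t) = L3 Q (\<lambda>x y z. pj (act VW x (b p (act VW (Sa y z) t)))) (phi H)"
    unfolding eF_def by (rule L3_push[OF MT(1) MQ eF_tril[OF oT(1,1) L(1) t] mor_lin[OF proj_mor]]) simp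
  also have "... = eF Q Q (c p) (pj t)"
    unfolding eF_def
  proof (rule L3_cong)
    fix x y z assume xyz: "x \<in> carrier H" "y \<in> carrier H" "z \<in> carrier H"
    then have u: "Sa y z \<in> carrier H" "act VW (Sa y z) t \<in> carrier VW" using oT t by simp_all
    show "pj (act VW x (b p (act VW (Sa y z) t))) = act Q x (c p (act Q (Sa y z) (pj t)))"
      unfolding mor_act[OF proj_mor u(1) t, symmetric] cb[OF p u(2)]
      by (rule mor_act[OF proj_mor xyz(1) Lin_in[OF L(1) u(2)]])
  qed
  finally show ?thesis
    using ev_pt[OF oT(1,1) L(1) t] ev_pt[OF tensor_A_obj tensor_A_obj L(2) mor_in[OF proj_mor t]] by simp
qed

end

lemma leib_cong: "(\<And>t. t \<in> carrier (P\<box>A) ==> \<delta> t = \<delta>' t) ==> leib P A V l \<delta> e = leib P A V l \<delta>' e"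
  by (simp add: leib_def tl_cong[of "P\<box>A" \<delta> \<delta>'])

section \<open>Sums of connections\<close>

lemma mor_into_sub:
  assumes g: "mor P X g" and o: "obj (sub_obj X U)" and U: "\<And>p. p \<in> carrier P ==> g p \<in> U"
  shows "mor P (sub_obj X U) g"
  using g o U gr_in[OF mor_obj(1)[OF g]] by (simp add: mor_def linear_on_def Pi_def)

context
  fixes A :: "('k, 'h, 'a) halg" and d and V :: "('k, 'h, 'a, 'v) hbimod" and W :: "('k, 'h, 'a, 'w) hbimod"
  assumes A: "obj A" and V: "obj V" and W: "obj W" and d: "mor (unit_obj k H 1) (hom A A) d"
    and lV: "mor (A\<box>V) V (lact V)" and rV: "mor (V\<box>A) V (ract V)" and lW: "mor (A\<box>W) W (lact W)"
    and bV: "\<forall>t\<in>carrier ((A\<box>V)\<box>A).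
        ract V (tl (A\<box>V) A V (lact V) t) = lact V (tr A (V\<box>A) V (ract V) (as A V A t))"
    and sV: "\<forall>t\<in>carrier (V\<box>A). lact V (br V A t) = ract V t"
begin

private abbreviation "VW' \<equiv> V\<box>W"
private abbreviation "N' \<equiv> tensor_A_rel k H A V W"
private abbreviation "pj' \<equiv> tensor_A_proj k H A V W"
private abbreviation "Q' \<equiv> tensor_A k H A V W"
private abbreviation "P \<equiv> con_fibre_prod k H A d V W"
private abbreviation "I \<equiv> unit_obj k H 1"
private abbreviation "bp \<equiv> (\<lambda>p. fst (boxplus k H V W p))"

private lemmas rel = A V W lV rV lW bV
private lemmas con_A = A d

private lemma cobj: "obj (con k H A d V)" "obj (con k H A d W)"
  by (rule con_obj[OF con_A V lV], rule con_obj[OF con_A W lW])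

private lemma cmor: "mor (con k H A d V) (prod_obj (hom V V) I) (\<lambda>x. x)" "mor (con k H A d W) (prod_obj (hom W W) I) (\<lambda>x. x)"
  by (rule con_incl[OF con_A V lV], rule con_incl[OF con_A W lW])

text \<open>The fibre condition is the vanishing of a difference of two morphisms to I[1], so the
  fibred product is a kernel and thereby an object.\<close>

private lemma P_kernel: "P = sub_obj (prod_obj (con k H A d V) (con k H A d W))
   (a_kernel (prod_obj (con k H A d V) (con k H A d W)) I (\<lambda>p. snd (fst p) \<ominus>\<^bsub>I\<^esub> snd (snd p)))"
  and P_obj: "obj P"
  and P_incl: "mor P (prod_obj (con k H A d V) (con k H A d W)) (\<lambda>x. x)"
proof -
  let ?C = "prod_obj (con k H A d V) (con k H A d W)"
  have oK: "obj (prod_obj (hom V V) I)" "obj (prod_obj (hom W W) I)" using V W by auto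
  have m: "mor ?C I (\<lambda>p. snd (fst p))" "mor ?C I (\<lambda>p. snd (snd p))"
    by (rule mor_comp[OF prod_mor(1)[OF cobj] mor_comp[OF cmor(1) prod_mor(2)[OF _ unit_obj_obj]]], use V in simp,
        rule mor_comp[OF prod_mor(2)[OF cobj] mor_comp[OF cmor(2) prod_mor(2)[OF _ unit_obj_obj]]], use W in simp)
  have "snd (fst p) \<ominus>\<^bsub>I\<^esub> snd (snd p) = \<zero>\<^bsub>I\<^esub> \<longleftrightarrow> snd (fst p) = snd (snd p)" if "p \<in> carrier ?C" for p
    by (rule m_sub_zero_iff[OF unit_module mor_in[OF m(1) that] mor_in[OF m(2) that]])
  then have k: "a_kernel ?C I (\<lambda>p. snd (fst p) \<ominus>\<^bsub>I\<^esub> snd (snd p)) = {p \<in> carrier ?C. snd (fst p) = snd (snd p)}"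
    unfolding kernel_eq by blast
  show P: "P = sub_obj ?C (a_kernel ?C I (\<lambda>p. snd (fst p) \<ominus>\<^bsub>I\<^esub> snd (snd p)))"
    unfolding con_fibre_prod_def k ..
  show o: "obj P" unfolding P by (rule kernel_obj[OF mor_sub[OF m]])
  show "mor P ?C (\<lambda>x. x)" unfolding P by (rule sub_incl_mor[OF _ o[unfolded P]]) (use cobj in simp, auto simp: kernel_eq)
qed

private lemma P_snd: "p \<in> carrier P ==> snd (fst p) = snd (snd p)"
  by (simp add: con_fibre_prod_def)

private lemma P_con: "p \<in> carrier P ==> fst p \<in> carrier (con k H A d V)" "p \<in> carrier P ==> snd p \<in> carrier (con k H A d W)"
  by (auto simp: con_fibre_prod_def)

private lemma gV: "mor P (prod_obj (hom V V) I) fst"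
  by (rule mor_comp[OF mor_comp[OF P_incl prod_mor(1)[OF cobj]] cmor(1)])

private lemma gW: "mor P (prod_obj (hom W W) I) snd"
  by (rule mor_comp[OF mor_comp[OF P_incl prod_mor(2)[OF cobj]] cmor(2)])

private lemma pV: "mor P (hom V V) (\<lambda>p. fst (fst p))"
  by (rule mor_comp[OF gV prod_mor(1)]) (use V in auto)

private lemma pW: "mor P (hom W W) (\<lambda>p. fst (snd p))"
  by (rule mor_comp[OF gW prod_mor(1)]) (use W in auto)

private lemma s: "mor P I (\<lambda>p. snd (fst p))"
  by (rule mor_comp[OF gV prod_mor(2)]) (use V in auto)

text \<open>\<open>D\<close> is the derivation with I[1] itself as parameter, and \<delta> is its
  pullback along the projection of P to I[1]. In this factored form \<delta> meets the requirement
  of \<open>swap_derivation\<close>.\<close>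

private definition "D = (\<lambda>t. ev' A A (tl I A (hom A A) d t))"
private definition "\<delta> = (\<lambda>t. D (tl P A I (\<lambda>p. snd (fst p)) t))"
private definition "eV = (\<lambda>t. ev' V V (tl P V (hom V V) (\<lambda>p. fst (fst p)) t))"
private definition "eW = (\<lambda>t. ev' W W (tl P W (hom W W) (\<lambda>p. fst (snd p)) t))"
private abbreviation "\<kappa>' \<equiv> kap P V W eV eW"

private lemma D_mor: "mor (I\<box>A) A D" unfolding D_def by (intro mor_comp[OF tl_mor[OF d] ev_mor] A)
private lemma \<delta>_mor: "mor (P\<box>A) A \<delta>" unfolding \<delta>_def by (intro mor_comp[OF tl_mor[OF s] D_mor] A)
private lemma eV_mor: "mor (P\<box>V) V eV" unfolding eV_def by (intro mor_comp[OF tl_mor[OF pV] ev_mor] V)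
private lemma eW_mor: "mor (P\<box>W) W eW" unfolding eW_def by (intro mor_comp[OF tl_mor[OF pW] ev_mor] W)
private lemmas \<kappa>_mor = kap_mor[OF eV_mor eW_mor P_obj]

private lemma \<delta>_eq:
  assumes g: "\<And>p. p \<in> carrier P ==> g p = snd (fst p)" and t: "t \<in> carrier (P\<box>A)"
  shows "ev' A A (tl P A (hom A A) (\<lambda>p. d (g p)) t) = \<delta> t"
proof -
  have "tl P A (hom A A) (\<lambda>p. d (g p)) t = tl P A (hom A A) (\<lambda>p. d (snd (fst p))) t"
    by (rule tl_cong) (simp add: g)
  then show ?thesis using tl_comp[OF s d A t] by (simp add: \<delta>_def D_def)
qed

private lemma leibV: "leib P A V (lact V) \<delta> eV"
  using con_leib[OF con_A V lV gV] P_con(1) leib_cong[of P A "\<lambda>t. ev' A A (tl P A (hom A A) (\<lambda>p. d (snd (fst p))) t)" \<delta> V "lact V" eV]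
    \<delta>_eq[of "\<lambda>p. snd (fst p)"] by (simp add: eV_def)

text \<open>The component c is read off the first connection; on the fibred product it agrees with
  that of the second, so both rules share one \<delta>.\<close>

private lemma leibW: "leib P A W (lact W) \<delta> eW"
  using con_leib[OF con_A W lW gW] P_con(2) leib_cong[of P A "\<lambda>t. ev' A A (tl P A (hom A A) (\<lambda>p. d (snd (snd p))) t)" \<delta> W "lact W" eW]
    \<delta>_eq[of "\<lambda>p. snd (snd p)"] P_snd by (simp add: eW_def)

private lemma bp_eq: "bp p = itensor k H V V W W (pt k (hom V V) (hom W W) (fst (fst p)) (iunit H W)) \<oplus>\<^bsub>hom VW' VW'\<^esub>
    itensor k H V V W W (pt k (hom V V) (hom W W) (iunit H V) (fst (snd p)))"
  by (simp add: boxplus_def split_beta)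

text \<open>Pairing an operator with the unit is a morphism because the unit is invariant of degree
  0.\<close>

private lemma bp_mor: "mor P (hom VW' VW') bp"
  unfolding bp_eq
  by (intro mor_add mor_comp[OF mor_comp[OF pV pt_inv_mor2] itensor_mor] mor_comp[OF mor_comp[OF pW pt_inv_mor[where p = 0]] itensor_mor]
     iunit_inv hom_obj_obj V W refl)

text \<open>The two unit lemmas for the internal tensor product, rewritten for families over P by
  naturality.\<close>

private lemma ev_bp:
  assumes p: "p \<in> carrier P" and t: "t \<in> carrier VW'"
  shows "ev' VW' VW' (pt k (hom VW' VW') VW' (bp p) t) = \<kappa>' (pt k P VW' p t)"
proof -
  let ?E = "hom V V" and ?F = "hom W W" and ?x = "pt k P VW' p t"
  have oh: "obj ?E" "obj ?F" "obj VW'" "obj (hom VW' VW')" using V W by auto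
  note M = oh[THEN obj_module] obj_module[OF P_obj]
  have x: "?x \<in> carrier (P\<box>VW')" using p t by simp
  have L: "fst (fst p) \<in> carrier ?E" "fst (snd p) \<in> carrier ?F" by (rule mor_in[OF pV p], rule mor_in[OF pW p])
  have u: "iunit H V \<in> carrier ?E" "iunit H W \<in> carrier ?F"
    by (rule inv_el_in[OF oh(1) iunit_inv[OF V]], rule inv_el_in[OF oh(2) iunit_inv[OF W]])
  have in2: "itensor k H V V W W (pt k ?E ?F (fst (fst p)) (iunit H W)) \<in> carrier (hom VW' VW')"
     "itensor k H V V W W (pt k ?E ?F (iunit H V) (fst (snd p))) \<in> carrier (hom VW' VW')"
    by (rule mor_in[OF itensor_mor[OF V W]], use L u in \<open>simp del: hom_simps\<close>)+
  have "ev' VW' VW' (pt k (hom VW' VW') VW' (bp p) t) =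
    tl (?E\<box>V) W V (ev' V V) (ai ?E V W (pt k ?E VW' (fst (fst p)) t)) \<oplus>\<^bsub>VW'\<^esub>
    tr V (?F\<box>W) W (ev' W W) (B ?F V W (pt k ?F VW' (fst (snd p)) t))"
    unfolding bp_eq lin_add[OF lin_comp[OF lin_pt1_o[OF M(4,3) lin_id t] ev_lin[OF oh(3,3)]] in2]
      itensor_iunit_right[OF V W L(1) t] itensor_iunit_left[OF V W L(2) t] ..
  also have "pt k ?E VW' (fst (fst p)) t = tl P VW' ?E (\<lambda>p. fst (fst p)) ?x"
    using M p t mor_lin[OF pV] by (simp add: tmap_pt lin_id)
  also have "ai ?E V W ... = tl (P\<box>V) W (?E\<box>V) (tl P V ?E (\<lambda>p. fst (fst p))) (ai P V W ?x)"
    by (rule ai_tl[OF pV V W x])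
  also have "tl (?E\<box>V) W V (ev' V V) ... = tl (P\<box>V) W V eV (ai P V W ?x)"
    unfolding eV_def by (rule tl_comp[OF tl_mor[OF pV V] ev_mor[OF V V] W]) (use P_obj V W x in simp)
  also have "pt k ?F VW' (fst (snd p)) t = tl P VW' ?F (\<lambda>p. fst (snd p)) ?x"
    using M p t mor_lin[OF pW] by (simp add: tmap_pt lin_id)
  also have "B ?F V W ... = tr V (P\<box>W) (?F\<box>W) (tl P W ?F (\<lambda>p. fst (snd p))) (B P V W ?x)"
    by (rule B_1[OF pW V W x])
  also have "tr V (?F\<box>W) W (ev' W W) ... = tr V (P\<box>W) W eW (B P V W ?x)"
    unfolding eW_def by (rule tr_comp[OF tl_mor[OF pW W] ev_mor[OF W W] V mor_in[OF B_mor[OF P_obj V W] x]])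
  finally show ?thesis unfolding kap_def .
qed

text \<open>Pairing p with a relation is the image of a tensor in P \<otimes> ((V \<otimes> A)
  \<otimes> W), where \<open>kap_rel\<close> applies; the right rule it asks for comes from
  \<open>leib_right\<close> and \<open>swap_derivation\<close>.\<close>

private lemma \<kappa>_rel:
  assumes p: "p \<in> carrier P" and n: "n \<in> N'"
  shows "\<kappa>' (pt k P VW' p n) \<in> N'"
proof -
  let ?S = "(V\<box>A)\<box>W"
  let ?\<rho> = "\<lambda>s. tl (V\<box>A) W V (ract V) s \<ominus>\<^bsub>VW'\<^esub> tr V (A\<box>W) W (lact W) (as V A W s)"
  have \<rho>: "mor ?S VW' ?\<rho>"
    by (intro mor_sub tl_mor[OF rV W] mor_comp[OF as_mor tr_mor[OF lW]] A V W)
  have N: "N' = ?\<rho> ` carrier ?S" by (simp add: tensor_A_rel_def)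
  obtain s where s': "s \<in> carrier ?S" "n = ?\<rho> s" using n unfolding N by blast
  have x: "pt k P ?S p s \<in> carrier (P\<box>?S)" using p s' by simp
  have "pt k P VW' p n = tr P ?S VW' ?\<rho> (pt k P ?S p s)"
    using p s' A V W P_obj mor_lin[OF \<rho>] by (simp add: tmap_pt lin_id)
  moreover have "eV (tr P (V\<box>A) V (ract V) t) = ract V (tl (P\<box>V) A V eV (ai P V A t)) \<oplus>\<^bsub>V\<^esub> ract V (tr V (P\<box>A) A \<delta> (B P V A t))"
    if t: "t \<in> carrier (P\<box>V\<box>A)" for t
    by (rule leib_right[OF leibV eV_mor lV P_obj V A sV _ t \<delta>_mor])
      (simp_all add: \<delta>_def swap_derivation[OF s D_mor V sV])
  ultimately obtain s2 where "s2 \<in> carrier ?S" "\<kappa>' (pt k P VW' p n) = ?\<rho> s2"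
    using kap_rel[OF P_obj A V W lV rV lW \<delta>_mor eV_mor eW_mor leibV leibW _ x] by auto
  then show ?thesis unfolding N by blast
qed

text \<open>Passes from evaluations to values. By \<open>zeta_ev\<close> the value at n is a sum of
  evaluations of translates of the operator at translates of n. The latter are again relations, and
  translates of the operator come from translates of p, which stay in P.\<close>

lemma boxplus_rel:
  assumes p: "p \<in> carrier P" and n: "n \<in> N'"
  shows "fst (boxplus k H V W p) n \<in> N'"
proof -
  have oT: "obj VW'" "obj (hom VW' VW')" using V W by auto
  note Ns = rel_submod[OF rel] and nc = rel_in[OF rel n]
  have L: "bp p \<in> Lin k VW' VW'" using mor_in[OF bp_mor p] by simp
  let ?F = "\<lambda>a b c. ev' VW' VW' (pt k (hom VW' VW') VW' (act (hom VW' VW') a (bp p)) (act VW' (bS b c) n))"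
  \<comment> \<open>Equivariance of the sum moves the action from the operator to p.\<close>
  have eq: "?F a b c = \<kappa>' (pt k P VW' (act P a p) (act VW' (bS b c) n))"
    if "a \<in> carrier H" "b \<in> carrier H" "c \<in> carrier H" for a b c
    using that p nc oT P_obj ev_bp[of "act P a p" "act VW' (bS b c) n"] by (simp add: mor_act[OF bp_mor] del: hom_simps)
  have "L3 VW' ?F \<psi> \<in> N'"
  proof (rule trilift_submod[OF modH modH modH obj_module[OF oT(1)] _ Ns])
    show "tril H H H VW' ?F"
      using oT nc mor_in[OF bp_mor p] by (auto intro!: LR lin_comp[OF _ ev_lin] simp del: hom_simps)
    show "?F a b c \<in> N'" if "a \<in> carrier H" "b \<in> carrier H" "c \<in> carrier H" for a b c
      unfolding eq[OF that] using that p P_obj by (intro \<kappa>_rel rel_act[OF rel] n) auto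
  qed simp
  then show ?thesis using zeta_ev[OF oT(1,1) L nc] by simp
qed

private definition "c p = tensor_A_desc k H A V W (\<lambda>t. pj' (bp p t))"

private lemma c: "mor P (hom Q' Q') c" "p \<in> carrier P ==> t \<in> carrier VW' ==> c p (pj' t) = pj' (bp p t)"
  unfolding c_def[abs_def] by (rule desc_mor[OF rel bp_mor boxplus_rel], assumption+)+

text \<open>Every map in the rule for V \<otimes> W is compatible with the projection, and the
  projection is onto, so the rule descends.\<close>

private lemma leibQ: "leib P A Q' (lact Q') \<delta> (\<lambda>t. ev' Q' Q' (tl P Q' (hom Q' Q') c t))"
  unfolding leib_def
proof
  let ?eQ = "\<lambda>t. ev' Q' Q' (tl P Q' (hom Q' Q') c t)" and ?lT = "\<lambda>s. tl (A\<box>V) W V (lact V) (ai A V W s)"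
  let ?AT = "A\<box>VW'" and ?AQ = "A\<box>Q'"
  note oQ = tensor_A_obj[OF rel] and pm = proj_mor[OF rel] and lQ = lactQ_mor[OF rel]
  note lp = lactQ_proj[OF rel]
  have oT: "obj VW'" using V W by auto
  have eQ: "mor (P\<box>Q') Q' ?eQ" by (intro mor_comp[OF tl_mor[OF c(1)] ev_mor] oQ)
  have lT: "mor ?AT VW' ?lT" by (intro mor_comp[OF ai_mor tl_mor[OF lV]] A V W)
  note M = oQ[THEN obj_module] oT[THEN obj_module] A[THEN obj_module] P_obj[THEN obj_module]
  have ep: "?eQ (tr P VW' Q' pj' x) = pj' (\<kappa>' x)" if x: "x \<in> carrier (P\<box>VW')" for x
  proof (rule tens_ext_o[OF M(4,2) _ _ _ x])
    show "lin (P\<box>VW') Q' (\<lambda>x. ?eQ (tr P VW' Q' pj' x))"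
      by (rule lin_comp[OF mor_lin[OF tr_mor[OF pm P_obj]] mor_lin[OF eQ]])
    show "lin (P\<box>VW') Q' (\<lambda>x. pj' (\<kappa>' x))"
      by (rule lin_comp[OF mor_lin[OF \<kappa>_mor] mor_lin[OF pm]])
    show "?eQ (tr P VW' Q' pj' (pt k P VW' p t)) = pj' (\<kappa>' (pt k P VW' p t))" if p: "p \<in> carrier P" and t: "t \<in> carrier VW'" for p t
      using M p t mor_in[OF pm t] mor_lin[OF pm] mor_lin[OF c(1)] ev_desc[OF rel bp_mor c(1) c(2) p t] ev_bp[OF p t] oQ
      by (simp add: tmap_pt lin_id del: hom_simps)
  qed
  have kl: "leib P A VW' ?lT \<delta> \<kappa>'"
    by (rule kap_leib[OF P_obj A V W lV rV lW \<delta>_mor eV_mor eW_mor leibV leibW])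
  let ?q = "tr P ?AT ?AQ (tr A VW' Q' pj')"
  have qm: "mor (P\<box>?AT) (P\<box>?AQ) ?q" by (intro tr_mor[OF tr_mor[OF pm]] A P_obj)
  let ?R1 = "\<lambda>t. lact Q' (tl (P\<box>A) Q' A \<delta> (ai P A Q' t))" and ?R2 = "\<lambda>t. lact Q' (tr A (P\<box>Q') Q' ?eQ (B P A Q' t))"
  have R1: "mor (P\<box>?AQ) Q' ?R1" by (intro mor_comp[OF mor_comp[OF ai_mor tl_mor[OF \<delta>_mor]] lQ] A oQ P_obj)
  have R2: "mor (P\<box>?AQ) Q' ?R2" by (intro mor_comp[OF mor_comp[OF B_mor tr_mor[OF eQ]] lQ] A oQ P_obj)
  have main: "?eQ (tr P ?AQ Q' (lact Q') (?q x)) = ?R1 (?q x) \<oplus>\<^bsub>Q'\<^esub> ?R2 (?q x)" if x: "x \<in> carrier (P\<box>?AT)" for x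
  proof -
    have "tr P ?AQ Q' (lact Q') (?q x) = tr P ?AT Q' (\<lambda>s. lact Q' (tr A VW' Q' pj' s)) x"
      by (rule tr_comp[OF tr_mor[OF pm A] lQ P_obj x])
    also have "... = tr P ?AT Q' (\<lambda>s. pj' (?lT s)) x" by (rule tr_cong) (rule lp)
    also have "... = tr P VW' Q' pj' (tr P ?AT VW' ?lT x)" by (rule tr_comp[OF lT pm P_obj x, symmetric])
    finally have 0: "?eQ (tr P ?AQ Q' (lact Q') (?q x)) = pj' (\<kappa>' (tr P ?AT VW' ?lT x))"
      using ep[OF tm_in[OF mor_id[OF P_obj] lT x]] by simp
    let ?u = "ai P A VW' x" and ?b = "B P A VW' x"
    have u: "?u \<in> carrier ((P\<box>A)\<box>VW')" using P_obj A oT x by simp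
    have b: "?b \<in> carrier (A\<box>P\<box>VW')" by (rule mor_in[OF B_mor[OF P_obj A oT] x])
    have s1: "tl (P\<box>A) VW' A \<delta> ?u \<in> carrier ?AT" by (rule tm_in[OF \<delta>_mor mor_id[OF oT] u])
    have s2: "tr A (P\<box>VW') VW' \<kappa>' ?b \<in> carrier ?AT" by (rule tm_in[OF mor_id[OF A] \<kappa>_mor b])
    have 1: "?R1 (?q x) = pj' (?lT (tl (P\<box>A) VW' A \<delta> ?u))"
      unfolding ai_tr[OF pm P_obj A x] tl_tr[OF \<delta>_mor pm u] by (rule lp[OF s1])
    have "tr A (P\<box>Q') Q' ?eQ (B P A Q' (?q x)) = tr A (P\<box>VW') Q' (\<lambda>s. ?eQ (tr P VW' Q' pj' s)) ?b"
      unfolding B_3[OF pm P_obj A x] by (rule tr_comp[OF tr_mor[OF pm P_obj] eQ A b])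
    also have "... = tr A (P\<box>VW') Q' (\<lambda>s. pj' (\<kappa>' s)) ?b" by (rule tr_cong) (rule ep)
    also have "... = tr A VW' Q' pj' (tr A (P\<box>VW') VW' \<kappa>' ?b)" by (rule tr_comp[OF \<kappa>_mor pm A b, symmetric])
    finally have 2: "?R2 (?q x) = pj' (?lT (tr A (P\<box>VW') VW' \<kappa>' ?b))" using lp[OF s2] by simp
    have "\<kappa>' (tr P ?AT VW' ?lT x) = ?lT (tl (P\<box>A) VW' A \<delta> ?u) \<oplus>\<^bsub>VW'\<^esub> ?lT (tr A (P\<box>VW') VW' \<kappa>' ?b)"
      using bspec[OF kl[unfolded leib_def] x] .
    then show ?thesis unfolding 0 1 2 by (simp only: lin_add[OF mor_lin[OF pm] mor_in[OF lT s1] mor_in[OF lT s2]])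
  qed
  fix t assume t: "t \<in> carrier (P\<box>A\<box>Q')"
  show "?eQ (tr P ?AQ Q' (lact Q') t) = ?R1 t \<oplus>\<^bsub>Q'\<^esub> ?R2 t"
  proof (rule ext_r[OF P_obj A oQ lin_comp[OF mor_lin[OF tr_mor[OF lQ P_obj]] mor_lin[OF eQ]] lin_addf[OF M(1) mor_lin[OF R1] mor_lin[OF R2]] _ t])
    fix p a q assume pa: "p \<in> carrier P" "a \<in> carrier A" and "q \<in> carrier Q'"
    then obtain t where t: "t \<in> carrier VW'" "q = pj' t" unfolding Q_carrier[OF rel] by blast
    \<comment> \<open>Pure tensors over the quotient are images of pure tensors over V \<otimes> W,
      where \<open>main\<close> applies.\<close>
    have "pt k P ?AQ p (pt k A Q' a q) = ?q (pt k P ?AT p (pt k A VW' a t))"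
      unfolding t(2) using M pa t mor_lin[OF pm] mor_lin[OF tr_mor[OF pm A]] by (simp add: tmap_pt lin_id)
    then show "?eQ (tr P ?AQ Q' (lact Q') (pt k P ?AQ p (pt k A Q' a q))) =
      ?R1 (pt k P ?AQ p (pt k A Q' a q)) \<oplus>\<^bsub>Q'\<^esub> ?R2 (pt k P ?AQ p (pt k A Q' a q))"
      using main[of "pt k P ?AT p (pt k A VW' a t)"] pa t by simp
  qed
qed

text \<open>\<open>con_leib\<close> is read in the other direction: the Leibniz rule on the quotient
  yields membership in con.\<close>

lemma boxplus_con:
  "hm_morphism k H P (con k H A d Q') (\<lambda>p\<in>carrier P. (tensor_A_desc k H A V W (\<lambda>t. pj' (bp p t)), snd (boxplus k H V W p)))"
proof -
  note oQ = tensor_A_obj[OF rel] and lQ = lactQ_mor[OF rel]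
  let ?g = "\<lambda>p. (c p, snd (fst p))"
  have g: "mor P (prod_obj (hom Q' Q') I) ?g" by (rule pair_mor[OF c(1) s])
  have "leib P A Q' (lact Q') (\<lambda>t. ev' A A (tl P A (hom A A) (\<lambda>p. d (snd (?g p))) t)) (\<lambda>t. ev' Q' Q' (tl P Q' (hom Q' Q') (\<lambda>p. fst (?g p)) t))"
    using leibQ leib_cong[of P A "\<lambda>t. ev' A A (tl P A (hom A A) (\<lambda>p. d (snd (fst p))) t)" \<delta> Q' "lact Q'"] \<delta>_eq[of "\<lambda>p. snd (fst p)"] by simp
  then have gc: "?g p \<in> carrier (con k H A d Q')" if "p \<in> carrier P" for p
    using con_leib[OF con_A oQ lQ g] that by blast
  have "mor P (con k H A d Q') ?g"
    using mor_into_sub[OF g con_obj[OF con_A oQ lQ, unfolded con_eq[OF con_A]]] gc by (simp add: con_eq[OF con_A] del: prod_simps hom_simps)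
  \<comment> \<open>The restriction to the carrier supplies the extensionality that
    \<open>hm_morphism\<close> requires.\<close>
  then have "mor P (con k H A d Q') (\<lambda>p\<in>carrier P. (tensor_A_desc k H A V W (\<lambda>t. pj' (bp p t)), snd (boxplus k H V W p)))"
    by (rule mor_cong) (simp add: c_def boxplus_def split_beta)
  then show ?thesis by (simp add: hm_morphism_mor)
qed

end

text \<open>d takes values in der(A), a kernel inside end(A); composing with the inclusion gives the
  morphism into end(A) that is evaluated in the connection condition.\<close>

lemma differential_mor:
  assumes "differential_calculus k H A d"
  shows "obj A" "mor (unit_obj k H 1) (hom A A) d" (is ?g1)
proof -
  show A: "obj A" using assms by (simp add: differential_calculus_def braided_commutative_algebra_def algebra_object_def)
  have "mor (unit_obj k H 1) (der k H A) d" using assms by (simp add: differential_calculus_def hm_morphism_mor)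
  moreover have "mor (der k H A) (hom A A) (\<lambda>x. x)"
    using mor_obj(2)[OF calculation] A unfolding der_def Let_def by (intro sub_incl_mor) (auto simp: kernel_eq)
  ultimately show ?g1 by (rule mor_comp)
qed

lemma symmetric_bimodule_mor:
  assumes "symmetric_bimodule k H A V"
  shows "obj V" "mor (A\<box>V) V (lact V)" "mor (V\<box>A) V (ract V)"
    "\<forall>t\<in>carrier ((A\<box>V)\<box>A). ract V (tl (A\<box>V) A V (lact V) t) = lact V (tr A (V\<box>A) V (ract V) (as A V A t))"
    "\<forall>s\<in>carrier (V\<box>A). lact V (br V A s) = ract V s"
  using assms by (auto simp: symmetric_bimodule_def bimodule_object_def hm_morphism_mor)

end

theorem theorem4p8:
  fixes k :: "'k ring" and H :: "('k, 'h) qqha"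
    and A :: "('k, 'h, 'a) halg" and d :: "'k \<Rightarrow> 'a \<Rightarrow> 'a"
    and V :: "('k, 'h, 'a, 'v) hbimod" and W :: "('k, 'h, 'a, 'w) hbimod"
  assumes "quasitriangular_quasi_Hopf k H"
    and "differential_calculus k H A d"
    and "symmetric_bimodule k H A V"
    and "symmetric_bimodule k H A W"
  shows "(\<forall>p\<in>carrier (con_fibre_prod k H A d V W). \<forall>t\<in>tensor_A_rel k H A V W.
            fst (boxplus k H V W p) t \<in> tensor_A_rel k H A V W) \<and>
         hm_morphism k H (con_fibre_prod k H A d V W) (con k H A d (tensor_A k H A V W))
           (\<lambda>p\<in>carrier (con_fibre_prod k H A d V W).
              (tensor_A_desc k H A V W
                 (\<lambda>t. tensor_A_proj k H A V W (fst (boxplus k H V W p) t)),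
               snd (boxplus k H V W p)))"
proof -
  interpret qtqh k H by unfold_locales (rule assms(1))
  note d = differential_mor[OF assms(2)]
  note V = symmetric_bimodule_mor[OF assms(3)] and W = symmetric_bimodule_mor[OF assms(4)]
  note a = d(1) V(1) W(1) d(2) V(2,3) W(2) V(4,5)
  show ?thesis by (intro conjI ballI boxplus_rel[OF a] boxplus_con[OF a])
qed

end
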